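(* Let $\delta_{opt}(\Gamma)$ denote the optimal horoball packing density of the Coxeter simplex tiling $\mathcal{T}_\Gamma$ of hyperbolic $3$-space. The optimal horoball packing densities of the tilings $\mathcal{T}_{\widehat{AV}_3}$, $\mathcal{T}_{\widehat{BV}_3}$, $\mathcal{T}_{\widehat{HV}_3}$ and $\mathcal{T}_{\widehat{CR}_3}$ are respectively $$\delta_{opt}(\widehat{AV}_3)\approx 0.838825,\quad \delta_{opt}(\widehat{BV}_3)\approx 0.747914,\quad \delta_{opt}(\widehat{HV}_3)\approx 0.655381,\quad \delta_{opt}(\widehat{CR}_3)\approx 0.767195.$$
   Context: $\mathbb{H}^3$ is hyperbolic $3$-space of curvature $-1$ and $\overline{\mathbb{H}}^3=\mathbb{H}^3\cup\partial\mathbb{H}^3$. A Coxeter simplex in $\overline{\mathbb{H}}^3$ is a tetrahedron, possibly with ideal vertices (on $\partial\mathbb{H}^3$), of finite volume, whose dihedral angles are integer submultiples of $\pi$. It is determined up to isometry by its Coxeter diagram: one node per facet; two facets orthogonal if the nodes are not joined, dihedral angle $\pi/3$ if joined by an unlabeled edge (label 3), and dihedral angle $\pi/k$ if joined by an edge labeled $k$. $\Gamma$ is the discrete group generated by reflections in the facets, $\mathcal{F}_\Gamma$ is the simplex (a fundamental domain), and $\mathcal{T}_\Gamma$ is the tiling by the images of $\mathcal{F}_\Gamma$ under $\Gamma$. Diagrams of the groups (each is a $4$-cycle; consecutive edge labels are listed cyclically): - $\widehat{AV}_3=[(3^3,6)]$: labels $3,3,3,6$. - $\widehat{BV}_3=[(3,4,3,6)]$: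 labels $3,4,3,6$. - $\widehat{HV}_3=[(3,5,3,6)]$: labels $3,5,3,6$. - $\widehat{CR}_3=[(3,4^3)]$: labels $3,4,4,4$. Horoball packing associated to $\mathcal{T}_\Gamma$: let $v_1,\dots,v_m$ be the ideal vertices of $\mathcal{F}_\Gamma$. It is a $\Gamma$-invariant collection $\mathcal{B}$ of horoballs which restricts on $\mathcal{F}_\Gamma$ to a set $\{B_1,\dots,B_m\}$ such that (1) $B_i$ is centered at $v_i$; (2) horoballs have pairwise disjoint interiors; (3) each $B_i$ is contained in the half-space (containing $\mathcal{F}_\Gamma$) bounded by the plane of the facet of $\mathcal{F}_\Gamma$ opposite $v_i$. The sizes of horoballs at different ideal vertices may be chosen differently. Its density is $$\delta(\mathcal{B})=\frac{\sum_{i=1}^m \mathrm{vol}_{\mathbb{H}^3}(B_i\cap\mathcal{F}_\Gamma)}{\mathrm{vol}_{\mathbb{H}^3}(\mathcal{F}_\Gamma)},$$ and $\delta_{opt}(\Gamma)$ is the supremum of $\delta(\mathcal{B})$ over all such packings. Convention: $x\approx d$ means that the decimal $d$ approximates $x$ with error less than $10^{-6}$. *)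

theory Defs
  imports "HOL-Analysis.Analysis"
begin

text \<open>
  Hyperbolic 3-space is taken in the hyperboloid model: the upper sheet of the unit hyperboloid
  in Lorentzian 4-space \<open>\<real> \<times> \<real>\<^sup>3\<close> with time coordinate \<open>fst\<close>. The points of its boundary at
  infinity are the rays spanned by future-directed lightlike vectors.
\<close>

type_synonym lorentz4 = "real \<times> (real ^ 3)"

definition lform :: "lorentz4 \<Rightarrow> lorentz4 \<Rightarrow> real" where
  "lform x y = snd x \<bullet> snd y - fst x * fst y"

definition hyp3 :: "lorentz4 set" where
  "hyp3 = {x. lform x x = -1 \<and> fst x > 0}"

definition ideal_point :: "lorentz4 \<Rightarrow> bool" where
  "ideal_point c \<longleftrightarrow> lform c c = 0 \<and> fst c > 0"

text \<open>
  The Riemannian volume. In the global chart \<open>y \<mapsto> (sqrt (1 + |y|\<^sup>2), y)\<close> the metric induced on the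
  hyperboloid by \<open>lform\<close> is \<open>I - y y\<^sup>T / (1 + |y|\<^sup>2)\<close>, of determinant \<open>1 / (1 + |y|\<^sup>2)\<close>.
\<close>

definition hyp_vol :: "lorentz4 measure" where
  "hyp_vol = distr (density lborel (\<lambda>y :: real ^ 3. ennreal (1 / sqrt (1 + (norm y)\<^sup>2)))) borel
     (\<lambda>y. (sqrt (1 + (norm y)\<^sup>2), y))"

text \<open>
  The horoballs centred at the ideal point \<open>[c]\<close> are the sublevel sets of the Busemann function
  \<open>x \<mapsto> ln (- lform x c)\<close>; rescaling \<open>c\<close> only changes the parameter \<open>s\<close>.
\<close>

definition horoball_at :: "lorentz4 \<Rightarrow> lorentz4 set \<Rightarrow> bool" where
  "horoball_at c B \<longleftrightarrow> ideal_point c \<and> (\<exists>s>0. B = {x \<in> hyp3. - lform x c \<le> s})"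

text \<open>Interior relative to hyperbolic space (the interior in the ambient 4-space is empty).\<close>

definition hyp_interior :: "lorentz4 set \<Rightarrow> lorentz4 set" where
  "hyp_interior B = (top_of_set hyp3) interior_of B"

text \<open>
  A tetrahedron is given by its four labelled vertices, each a point of \<open>hyp3\<close> or a representative
  of an ideal point; facet \<open>i\<close> is the one opposite vertex \<open>i\<close>.
\<close>

definition tetrahedron :: "(4 \<Rightarrow> lorentz4) \<Rightarrow> bool" where
  "tetrahedron v \<longleftrightarrow> (\<forall>i. v i \<in> hyp3 \<or> ideal_point (v i)) \<and> inj v \<and> independent (range v)"

definition simplex_of :: "(4 \<Rightarrow> lorentz4) \<Rightarrow> lorentz4 set" where
  "simplex_of v = {x \<in> hyp3. \<exists>c. (\<forall>i. c i \<ge> 0) \<and> x = (\<Sum>i\<in>UNIV. c i *\<^sub>R v i)}"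

definition ideal_vertices :: "(4 \<Rightarrow> lorentz4) \<Rightarrow> 4 set" where
  "ideal_vertices v = {i. ideal_point (v i)}"

definition outward_normal :: "(4 \<Rightarrow> lorentz4) \<Rightarrow> 4 \<Rightarrow> lorentz4" where
  "outward_normal v i =
     (THE n. lform n n = 1 \<and> (\<forall>j. j \<noteq> i \<longrightarrow> lform n (v j) = 0) \<and> lform n (v i) < 0)"

definition facet_halfspace :: "(4 \<Rightarrow> lorentz4) \<Rightarrow> 4 \<Rightarrow> lorentz4 set" where
  "facet_halfspace v i = {x \<in> hyp3. lform x (outward_normal v i) \<le> 0}"

definition dihedral_angle :: "(4 \<Rightarrow> lorentz4) \<Rightarrow> 4 \<Rightarrow> 4 \<Rightarrow> real" where
  "dihedral_angle v i j = arccos (- lform (outward_normal v i) (outward_normal v j))"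

text \<open>
  A Coxeter diagram on four nodes is its matrix of labels, with label 2 for nodes that are not
  joined; diagonal entries are irrelevant. Index arithmetic in the type \<open>4\<close> is modulo 4.
\<close>

type_synonym coxeter_diagram = "4 \<Rightarrow> 4 \<Rightarrow> nat"

definition cycle_diagram :: "nat \<Rightarrow> nat \<Rightarrow> nat \<Rightarrow> nat \<Rightarrow> coxeter_diagram" where
  "cycle_diagram a b c d i j =
     (let k = (\<lambda>l. if l = 0 then a else if l = 1 then b else if l = 2 then c else d)
      in if j = i + 1 then k i else if i = j + 1 then k j else 2)"

definition AV3_diagram :: coxeter_diagram where "AV3_diagram = cycle_diagram 3 3 3 6"
definition BV3_diagram :: coxeter_diagram where "BV3_diagram = cycle_diagram 3 4 3 6"
definition HV3_diagram :: coxeter_diagram where "HV3_diagram = cycle_diagram 3 5 3 6"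
definition CR3_diagram :: coxeter_diagram where "CR3_diagram = cycle_diagram 3 4 4 4"

definition coxeter_simplex :: "coxeter_diagram \<Rightarrow> (4 \<Rightarrow> lorentz4) \<Rightarrow> bool" where
  "coxeter_simplex m v \<longleftrightarrow>
     tetrahedron v \<and> emeasure hyp_vol (simplex_of v) < \<infinity> \<and>
     (\<forall>i j. i \<noteq> j \<longrightarrow> m i j \<ge> 2 \<and> dihedral_angle v i j = pi / real (m i j))"

definition reflection :: "lorentz4 \<Rightarrow> lorentz4 \<Rightarrow> lorentz4" where
  "reflection n x = x - (2 * lform x n) *\<^sub>R n"

text \<open>Reflections are involutions, so the products of facet reflections form a group.\<close>

inductive_set reflection_group :: "(4 \<Rightarrow> lorentz4) \<Rightarrow> (lorentz4 \<Rightarrow> lorentz4) set"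
  for v :: "4 \<Rightarrow> lorentz4" where
  id_in: "id \<in> reflection_group v"
| reflection_in: "g \<in> reflection_group v \<Longrightarrow>
    reflection (outward_normal v i) \<circ> g \<in> reflection_group v"

text \<open>
  \<open>\<B>\<close> is the whole invariant collection and \<open>B i\<close>, for \<open>i\<close> an ideal vertex, its restriction to
  the simplex. A member of \<open>\<B>\<close> counts as belonging to the restriction if its interior meets the
  simplex: a mirror image of \<open>B i\<close> tangent to the opposite facet touches the simplex in one
  point and must not be counted. Values \<open>B i\<close> at non-ideal vertices play no role.
\<close>

definition horoball_packing ::
  "(4 \<Rightarrow> lorentz4) \<Rightarrow> lorentz4 set set \<Rightarrow> (4 \<Rightarrow> lorentz4 set) \<Rightarrow> bool" where
  "horoball_packing v \<B> B \<longleftrightarrow>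
     (\<forall>C\<in>\<B>. \<exists>c. horoball_at c C) \<and>
     (\<forall>g\<in>reflection_group v. \<forall>C\<in>\<B>. g ` C \<in> \<B>) \<and>
     {C \<in> \<B>. hyp_interior C \<inter> simplex_of v \<noteq> {}} = B ` ideal_vertices v \<and>
     (\<forall>i\<in>ideal_vertices v. horoball_at (v i) (B i)) \<and>
     (\<forall>C\<in>\<B>. \<forall>D\<in>\<B>. C \<noteq> D \<longrightarrow> hyp_interior C \<inter> hyp_interior D = {}) \<and>
     (\<forall>i\<in>ideal_vertices v. B i \<subseteq> facet_halfspace v i)"

definition packing_density :: "(4 \<Rightarrow> lorentz4) \<Rightarrow> (4 \<Rightarrow> lorentz4 set) \<Rightarrow> real" where
  "packing_density v B =
     (\<Sum>i\<in>ideal_vertices v. measure hyp_vol (B i \<inter> simplex_of v)) / measure hyp_vol (simplex_of v)"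

definition delta_opt :: "(4 \<Rightarrow> lorentz4) \<Rightarrow> real" where
  "delta_opt v = Sup {packing_density v B | \<B> B. horoball_packing v \<B> B}"

end

theory Submission
  imports Defs
begin

text \<open>
  In the Gram matrix of each of the four simplices the vertices \<open>a\<close> and \<open>p\<close> are ideal and the other two
  are not. Put \<open>v p\<close> at infinity of the upper half-space: the simplex becomes the part of a triangular prism
  above the unit hemisphere, so its volume is a sum of one-dimensional integrals of
  \<open>artanh (\<tau> \<sigma>) / (1 + \<sigma>\<^sup>2)\<close>, and replacing \<open>1 / (1 + \<sigma>\<^sup>2)\<close> by a Chebyshev approximant in \<open>\<sigma>\<^sup>2\<close> gives these in
  closed form up to a certified error. A horoball at an ideal vertex cuts the simplex in a cusp whose volume
  is proportional to the square of its scale. Both scales are at most 1 (the horoball stays on its side of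
  the opposite facet), their product is bounded by tangency, and a convex function on this region is
  maximal at a corner. That the corner extends to an invariant packing is Tits' lemma: every image of the
  simplex lies on one side of each facet plane.
\<close>

text \<open>The four diagrams are instances of one Gram matrix with cosines \<open>k\<close>,
  \<open>s\<close>, \<open>c\<close>, and reversing the cycle exchanges the two ideal vertices
  without changing it. So whatever holds at one cusp is read off at the other, and the four volumes
  differ only in the arguments of the same integrals. These are values of dilogarithm type, whereas
  \<open>artanh\<close> times an even polynomial has an elementary antiderivative; the error of the
  polynomial enters multiplied by the integral of \<open>artanh\<close> itself, which is at most 1.
  Towards the ideal vertex \<open>v a\<close> the integrand is unbounded, so the antiderivative is
  differentiated on the open interval only and is merely continuous at the end. On the packing side
  a horoball is encoded by a lightlike vector, so that disjointness, tangency and containment become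
  inequalities between values of \<open>lform\<close>. Tits' lemma then shows that two horoballs of
  the orbit are never closer than a pair obtained with at most one reflection.\<close>

lemma lform_bilinear:
  "lform (x + y) z = lform x z + lform y z" "lform z (x + y) = lform z x + lform z y"
  "lform (x - y) z = lform x z - lform y z" "lform z (x - y) = lform z x - lform z y"
  "lform (a *\<^sub>R x) z = a * lform x z" "lform z (a *\<^sub>R x) = a * lform z x"
  "lform (- x) z = - lform x z" "lform z (- x) = - lform z x"
  "lform 0 z = 0" "lform z 0 = 0"
  by (simp_all add: lform_def inner_simps algebra_simps)

lemma lform_commute: "lform x y = lform y x"
  by (simp add: lform_def inner_commute)

lemma lform_sum: "lform (\<Sum>i\<in>I. f i) z = (\<Sum>i\<in>I. lform (f i) z)"
  by (induction I rule: infinite_finite_induct) (simp_all add: lform_bilinear)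

lemma lform_nondegenerate:
  assumes "\<And>y. lform x y = 0" shows "x = 0"
  \<comment> \<open>Against the time-reversed vector the form is the squared Euclidean norm of
    \<open>x\<close>.\<close>
  using assms[of "(- fst x, snd x)"]
  by (simp add: lform_def prod_eq_iff power2_eq_square[symmetric])
     (metis add_nonneg_eq_0_iff zero_le_power2 inner_ge_zero inner_eq_zero_iff power_eq_0_iff)

lemma lform_continuous_on [continuous_intros]:
  "continuous_on S f \<Longrightarrow> continuous_on S g \<Longrightarrow> continuous_on S (\<lambda>x. lform (f x) (g x))"
  unfolding lform_def by (intro continuous_intros)

lemma lform_measurable [measurable]:
  assumes "f \<in> M \<rightarrow>\<^sub>M borel" "g \<in> M \<rightarrow>\<^sub>M borel"
  shows "(\<lambda>x. lform (f x) (g x)) \<in> M \<rightarrow>\<^sub>M borel"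
proof -
  have "fst \<in> borel_measurable (borel :: lorentz4 measure)"
       "snd \<in> borel_measurable (borel :: lorentz4 measure)"
    by (auto intro!: borel_measurable_continuous_onI continuous_intros)
  from measurable_compose[OF assms(1) this(1)] measurable_compose[OF assms(1) this(2)]
       measurable_compose[OF assms(2) this(1)] measurable_compose[OF assms(2) this(2)]
  show ?thesis unfolding lform_def by measurable
qed

section \<open>Future-directed causal vectors\<close>

definition causal :: "lorentz4 \<Rightarrow> bool" where
  "causal x \<longleftrightarrow> lform x x \<le> 0 \<and> fst x > 0"

lemma causal_norm: "causal x \<longleftrightarrow> norm (snd x) \<le> fst x \<and> fst x > 0"
proof -
  have "lform x x \<le> 0 \<longleftrightarrow> (norm (snd x))\<^sup>2 \<le> (fst x)\<^sup>2"
    by (simp add: lform_def dot_square_norm power2_eq_square)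
  then show ?thesis
    by (auto simp: causal_def abs_le_square_iff[symmetric])
qed

lemma hyp3_causal: "x \<in> hyp3 \<Longrightarrow> causal x" and ideal_causal: "ideal_point x \<Longrightarrow> causal x"
  by (auto simp: causal_def hyp3_def ideal_point_def)

lemma causal_lform_nonpos:
  assumes "causal x" "causal y" shows "lform x y \<le> 0"
proof -
  have "snd x \<bullet> snd y \<le> norm (snd x) * norm (snd y)" by (rule norm_cauchy_schwarz)
  also have "\<dots> \<le> fst x * fst y" using assms by (intro mult_mono) (auto simp: causal_norm)
  finally show ?thesis by (simp add: lform_def)
qed

text \<open>Equality must hold in every step of the Cauchy-Schwarz estimate behind
  \<open>causal_lform_nonpos\<close>, so both vectors are lightlike with parallel space parts. The
  conclusion is proportionality, written without a division.\<close>

lemma causal_lform_eq_0: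
  assumes "causal x" "causal y" "lform x y = 0" shows "fst y *\<^sub>R x = fst x *\<^sub>R y"
proof -
  have le: "norm (snd x) \<le> fst x" "norm (snd y) \<le> fst y" and pos: "fst x > 0" "fst y > 0"
    using assms by (auto simp: causal_norm)
  have cs: "snd x \<bullet> snd y \<le> norm (snd x) * norm (snd y)" by (rule norm_cauchy_schwarz)
  have m: "norm (snd x) * norm (snd y) \<le> norm (snd x) * fst y" "norm (snd x) * fst y \<le> fst x * fst y"
    using le pos by (auto intro!: mult_mono)
  have e: "snd x \<bullet> snd y = fst x * fst y" using assms(3) by (simp add: lform_def)
  have "norm (snd x) * fst y = fst x * fst y" using m cs e by linarith
  then have 1: "norm (snd x) = fst x" using pos by simp
  have "norm (snd x) * norm (snd y) = norm (snd x) * fst y" using m cs e by linarith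
  then have 2: "norm (snd y) = fst y" using pos 1 by simp
  have "snd x \<bullet> snd y = norm (snd x) * norm (snd y)" using e 1 2 by simp
  then have "norm (snd x) *\<^sub>R snd y = norm (snd y) *\<^sub>R snd x"
    by (simp add: norm_cauchy_schwarz_eq)
  with 1 2 show ?thesis by (simp add: prod_eq_iff)
qed

lemma causal_lform_neg:
  assumes "causal x" "causal y" "lform x x < 0" shows "lform x y < 0"
proof (rule ccontr)
  assume "\<not> lform x y < 0"
  then have "lform x y = 0" using causal_lform_nonpos[OF assms(1,2)] by simp
  from causal_lform_eq_0[OF assms(1,2) this]
  have "lform (fst y *\<^sub>R x) x = fst x * lform y x" by (simp add: lform_bilinear)
  then show False using \<open>lform x y = 0\<close> assms by (simp add: lform_bilinear lform_commute causal_def)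
qed

text \<open>The orthogonal complement of a timelike vector is positive definite, by Cauchy-Schwarz
  on the space parts. This one fact makes the outward normals spacelike, bounds their mutual
  products and decides when two horoballs meet.\<close>

lemma timelike_orthogonal_spacelike:
  assumes "lform z z < 0" "lform n z = 0" "n \<noteq> 0" shows "lform n n > 0"
proof -
  have z: "norm (snd z) ^ 2 < fst z ^ 2" using assms(1) by (simp add: lform_def dot_square_norm power2_eq_square)
  have e: "snd n \<bullet> snd z = fst n * fst z" using assms(2) by (simp add: lform_def)
  have "(fst n * fst z)\<^sup>2 \<le> norm (snd n) ^ 2 * norm (snd z) ^ 2"
    using Cauchy_Schwarz_ineq[of "snd n" "snd z"] e by (simp add: dot_square_norm)
  show ?thesis
  proof (cases "snd n = 0")
    case True
    then have "fst n * fst z = 0" using e by simp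
    moreover have "fst z \<noteq> 0" using z by auto
    ultimately show ?thesis using assms(3) True by (simp add: prod_eq_iff)
  next
    case False
    then have "norm (snd n) ^ 2 * norm (snd z) ^ 2 < norm (snd n) ^ 2 * fst z ^ 2"
      using z by simp
    with \<open>_ \<le> _\<close> have "(fst n)\<^sup>2 * (fst z)\<^sup>2 < norm (snd n) ^ 2 * fst z ^ 2"
      by (simp add: power_mult_distrib)
    then have "(fst n)\<^sup>2 < norm (snd n) ^ 2" using z by (simp add: mult_less_cancel_right)
    then show ?thesis by (simp add: lform_def dot_square_norm power2_eq_square)
  qed
qed

section \<open>Tetrahedra and their outward normals\<close>

lemma ex_other_4: "\<exists>k l :: 4. k \<noteq> l \<and> k \<noteq> i \<and> k \<noteq> j \<and> l \<noteq> i \<and> l \<noteq> j"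
proof -
  have "2 \<le> card (UNIV - {i, j})"
    using card_Diff_subset[of "{i, j}" "UNIV :: 4 set"] card_insert_le_m1[of 2 "{j}" i] by simp
  then obtain T where "T \<subseteq> UNIV - {i, j}" "card T = 2" by (metis obtain_subset_with_card_n)
  then show ?thesis by (auto simp: card_2_iff)
qed

text \<open>Two causal vectors that are not proportional have a strictly negative product. For two
  vertices of a tetrahedron the sum therefore points to a proper point of hyperbolic space on their
  common edge.\<close>

lemma causal_independent_timelike:
  assumes "causal x" "causal y" "x \<noteq> y" "independent {x, y}"
  shows "lform (x + y) (x + y) < 0"
proof -
  have "lform x y \<noteq> 0"
  proof
    assume "lform x y = 0"
    then have "(1 / fst y) *\<^sub>R (fst y *\<^sub>R x) = (1 / fst y) *\<^sub>R (fst x *\<^sub>R y)"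
      using causal_lform_eq_0[OF assms(1,2)] by simp
    then have "x = (fst x / fst y) *\<^sub>R y"
      using assms(2) by (simp add: causal_def)
    then have "x \<in> span {y}" by (metis span_mul span_base singletonI)
    then show False using assms by (simp add: independent_insert)
  qed
  then have "lform x y < 0" using causal_lform_nonpos[OF assms(1,2)] by simp
  then show ?thesis using assms by (simp add: lform_bilinear lform_commute causal_def)
qed

context
  fixes v :: "4 \<Rightarrow> lorentz4"
  assumes tet: "tetrahedron v"
begin

lemma tetrahedron_causal: "causal (v i)"
  using tet hyp3_causal ideal_causal unfolding tetrahedron_def by blast

lemma tetrahedron_edge_timelike:
  assumes "i \<noteq> j" shows "lform (v i + v j) (v i + v j) < 0"
proof (rule causal_independent_timelike)
  show "v i \<noteq> v j" using tet assms by (auto simp: tetrahedron_def inj_eq)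
  show "independent {v i, v j}"
    by (rule independent_mono[of "range v"]) (use tet in \<open>auto simp: tetrahedron_def\<close>)
qed (rule tetrahedron_causal)+

lemma tetrahedron_span: "span (range v) = UNIV"
proof -
  have "card (range v) = DIM(lorentz4)"
    using tet by (simp add: tetrahedron_def card_image)
  then show ?thesis
    using tet dim_eq_full[of "range v"] dim_eq_card_independent[of "range v"]
    by (simp add: tetrahedron_def)
qed

lemma tetrahedron_ext:
  assumes "\<And>j. lform x (v j) = lform y (v j)" shows "x = y"
proof -
  have "lform (x - y) z = 0" for z
  proof -
    have "z \<in> span (range v)" using tetrahedron_span by simp
    then show ?thesis
      by (induction rule: span_induct_alt)
         (use assms in \<open>auto simp: lform_bilinear\<close>)
  qed
  from lform_nondegenerate[OF this] show ?thesis by simp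
qed

text \<open>The functional dual to the vertex \<open>v i\<close> is represented by a vector
  orthogonal to two other vertices, whose sum is timelike; hence it is spacelike and can be scaled
  to norm 1. Two candidates are proportional by a positive factor of square 1.\<close>

lemma ex1_outward_normal:
  "\<exists>!n. lform n n = 1 \<and> (\<forall>j. j \<noteq> i \<longrightarrow> lform n (v j) = 0) \<and> lform n (v i) < 0"
proof (rule ex_ex1I)
  obtain f :: "lorentz4 \<Rightarrow> real" where f: "linear f" "\<forall>x\<in>range v. f x = (if x = v i then -1 else 0)"
    using linear_independent_extend[of "range v" "\<lambda>x. if x = v i then -1 else 0 :: real"] tet
    unfolding tetrahedron_def by metis
  have inj: "v j = v i \<longleftrightarrow> j = i" for j using tet by (auto simp: tetrahedron_def inj_eq)
  \<comment> \<open>\<open>m\<close> represents \<open>f\<close> for the Euclidean inner product;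
    reversing its time component represents \<open>f\<close> for \<open>lform\<close>.\<close>
  define m where "m = adjoint f 1"
  define n where "n = (- fst m, snd m)"
  have fm: "f x = x \<bullet> m" for x
    using adjoint_works[OF f(1), of x 1] by (simp add: m_def)
  have n: "lform n x = f x" for x
    by (simp add: fm lform_def n_def inner_prod_def inner_commute)
  have ni: "lform n (v j) = (if j = i then -1 else 0)" for j using f(2) inj n by auto
  obtain k l where kl: "k \<noteq> l" "k \<noteq> i" "l \<noteq> i" using ex_other_4[of i i] by metis
  have "lform n n > 0"
    by (rule timelike_orthogonal_spacelike[OF tetrahedron_edge_timelike[OF kl(1)]])
       (use ni[of k] ni[of l] ni[of i] kl in \<open>auto simp: lform_bilinear\<close>)
  then show "\<exists>n. lform n n = 1 \<and> (\<forall>j. j \<noteq> i \<longrightarrow> lform n (v j) = 0) \<and> lform n (v i) < 0"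
    using ni by (intro exI[of _ "(1 / sqrt (lform n n)) *\<^sub>R n"]) (simp add: lform_bilinear)
next
  fix n m
  assume n: "lform n n = 1 \<and> (\<forall>j. j \<noteq> i \<longrightarrow> lform n (v j) = 0) \<and> lform n (v i) < 0"
    and m: "lform m m = 1 \<and> (\<forall>j. j \<noteq> i \<longrightarrow> lform m (v j) = 0) \<and> lform m (v i) < 0"
  define r where "r = lform n (v i) / lform m (v i)"
  have r: "r > 0" using n m by (simp add: r_def divide_neg_neg)
  have "n = r *\<^sub>R m"
  proof (rule tetrahedron_ext)
    fix j show "lform n (v j) = lform (r *\<^sub>R m) (v j)"
      using n m by (cases "j = i") (auto simp: lform_bilinear r_def)
  qed
  moreover from this have "r ^ 2 = 1" using n m by (simp add: lform_bilinear power2_eq_square)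
  then have "r = 1" using r by (simp add: power2_eq_1_iff)
  ultimately show "n = m" by simp
qed

lemma outward_normal:
  shows outward_normal_norm: "lform (outward_normal v i) (outward_normal v i) = 1"
    and outward_normal_orth: "j \<noteq> i \<Longrightarrow> lform (outward_normal v i) (v j) = 0"
    and outward_normal_neg: "lform (outward_normal v i) (v i) < 0"
  using theI'[OF ex1_outward_normal[of i]] unfolding outward_normal_def by blast+

lemma outward_normal_eqI:
  assumes "lform n n = 1" "\<And>j. j \<noteq> i \<Longrightarrow> lform n (v j) = 0" "lform n (v i) < 0"
  shows "outward_normal v i = n"
  unfolding outward_normal_def by (rule the1_equality[OF ex1_outward_normal]) (use assms in auto)

text \<open>The function arccos is unspecified outside \<open>[-1,1]\<close>, so a dihedral angle determines the Gram
  matrix of the normals only because of this bound: the edge common to the two facets is timelike.\<close>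

lemma outward_normal_abs_le_1:
  assumes "i \<noteq> j" shows "\<bar>lform (outward_normal v i) (outward_normal v j)\<bar> \<le> 1"
proof -
  obtain k l where kl: "k \<noteq> l" "k \<noteq> i" "l \<noteq> i" "k \<noteq> j" "l \<noteq> j" using ex_other_4[of i j] by metis
  let ?a = "outward_normal v i" and ?b = "outward_normal v j"
  have "lform (?a + t *\<^sub>R ?b) (?a + t *\<^sub>R ?b) \<ge> 0" for t
    using timelike_orthogonal_spacelike[OF tetrahedron_edge_timelike[OF kl(1)], of "?a + t *\<^sub>R ?b"] kl
    by (cases "?a + t *\<^sub>R ?b = 0") (auto simp: lform_bilinear outward_normal_orth)
  from this[of 1] this[of "-1"] show ?thesis
    by (simp add: lform_bilinear outward_normal_norm lform_commute[of ?b])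
qed

lemma outward_normal_gram:
  assumes "i \<noteq> j" "dihedral_angle v i j = t"
  shows "lform (outward_normal v i) (outward_normal v j) = - cos t"
  using outward_normal_abs_le_1[OF assms(1)] assms(2)
  by (auto simp: dihedral_angle_def)

text \<open>Pairing with \<open>outward_normal v j\<close> kills every vertex but
  \<open>v j\<close>, so it reads off one coefficient in the basis of vertices.\<close>

lemma outward_normal_separate:
  assumes "\<And>j. lform x (outward_normal v j) = lform y (outward_normal v j)"
  shows "x = y"
proof -
  have "lform (x - y) z = 0" for z
  proof -
    have 1: "u = 0" if "\<And>j. lform u (outward_normal v j) = 0" for u
    proof -
      have "u \<in> span (range v)" using tetrahedron_span by simp
      then have "u \<in> range (\<lambda>c. \<Sum>i\<in>range v. c i *\<^sub>R i)"
        by (subst (asm) span_finite) auto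
      then obtain c where c: "u = (\<Sum>i\<in>UNIV. c (v i) *\<^sub>R v i)"
        using tet by (auto simp: tetrahedron_def sum.reindex)
      have "c (v j) = 0" for j
      proof -
        have "lform u (outward_normal v j) = (\<Sum>i\<in>UNIV. if i = j then c (v j) * lform (v j) (outward_normal v j) else 0)"
          unfolding c lform_sum
          by (intro sum.cong) (auto simp: lform_bilinear lform_commute[of "v _"] outward_normal_orth)
        also have "\<dots> = c (v j) * lform (v j) (outward_normal v j)" by simp
        finally show ?thesis using that[of j] outward_normal_neg[of j]
          by (simp add: lform_commute[of "v j"])
      qed
      then show ?thesis by (simp add: c)
    qed
    show ?thesis using 1[of "x - y"] assms by (simp add: lform_bilinear)
  qed
  from lform_nondegenerate[OF this] show ?thesis by simp
qed

text \<open>Up to negative factors the outward normals are the basis dual to the vertices, so each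
  half-space inequality is the sign condition on one coefficient. Both the prism in the half-space
  and the chamber of the reflection group start from this description.\<close>

lemma simplex_of_halfspaces:
  "simplex_of v = {x \<in> hyp3. \<forall>j. lform x (outward_normal v j) \<le> 0}"
proof (intro set_eqI iffI)
  fix x assume "x \<in> simplex_of v"
  then obtain c where c: "x \<in> hyp3" "\<And>i. c i \<ge> 0" "x = (\<Sum>i\<in>UNIV. c i *\<^sub>R v i)"
    by (auto simp: simplex_of_def)
  have "lform x (outward_normal v j) \<le> 0" for j
    unfolding c(3) lform_sum
  proof (rule sum_nonpos)
    fix i show "lform (c i *\<^sub>R v i) (outward_normal v j) \<le> 0"
      using c(2)[of i] outward_normal_neg[of j] outward_normal_orth[of i j]
      by (cases "i = j") (auto simp: lform_bilinear lform_commute[of "v _"] mult_nonneg_nonpos)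
  qed
  with c(1) show "x \<in> {x \<in> hyp3. \<forall>j. lform x (outward_normal v j) \<le> 0}" by auto
next
  fix x assume x: "x \<in> {x \<in> hyp3. \<forall>j. lform x (outward_normal v j) \<le> 0}"
  define c where "c i = lform x (outward_normal v i) / lform (v i) (outward_normal v i)" for i
  have neg: "lform (v i) (outward_normal v i) < 0" for i
    using outward_normal_neg[of i] by (simp add: lform_commute)
  have "x = (\<Sum>i\<in>UNIV. c i *\<^sub>R v i)"
  proof (rule outward_normal_separate)
    fix j
    have "lform (\<Sum>i\<in>UNIV. c i *\<^sub>R v i) (outward_normal v j) =
      (\<Sum>i\<in>UNIV. if i = j then c j * lform (v j) (outward_normal v j) else 0)"
      unfolding lform_sum
      by (intro sum.cong) (auto simp: lform_bilinear lform_commute[of "v _"] outward_normal_orth)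
    also have "\<dots> = lform x (outward_normal v j)" using neg[of j] by (simp add: c_def)
    finally show "lform x (outward_normal v j) = lform (\<Sum>i\<in>UNIV. c i *\<^sub>R v i) (outward_normal v j)" ..
  qed
  moreover have "c i \<ge> 0" for i
    using x neg[of i] by (auto simp: c_def divide_nonpos_neg)
  ultimately show "x \<in> simplex_of v" using x by (auto simp: simplex_of_def)
qed

end

section \<open>Lebesgue measure under Lorentz isometries\<close>

lemma nn_integral_lborel_scale:
  fixes f :: "'a::euclidean_space \<Rightarrow> ennreal"
  assumes [measurable]: "f \<in> borel_measurable borel" and t: "t > 0"
  shows "(\<integral>\<^sup>+x. f x \<partial>lborel) = ennreal (t ^ DIM('a)) * (\<integral>\<^sup>+x. f (t *\<^sub>R x) \<partial>lborel)"
  by (subst lborel_affine[of t 0])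
     (use t in \<open>simp_all add: nn_integral_density nn_integral_distr nn_integral_cmult\<close>)

text \<open>Such a map only renames orthonormal coordinates, so it carries boxes to boxes with the
  same side lengths. It moves Lebesgue measure from \<open>real ^ 4\<close>, where determinants
  live, and from nested products, where integrals are iterated, to \<open>lorentz4\<close>.\<close>

lemma distr_lborel_basis:
  fixes f :: "'a::euclidean_space \<Rightarrow> 'b::euclidean_space"
  assumes f: "linear f" "bij_betw f Basis Basis"
  shows "distr lborel borel f = lborel"
proof (rule lborel_eqI[symmetric])
  have cont: "continuous_on UNIV f" using f(1) by (rule linear_continuous_on[OF linear_conv_bounded_linear[THEN iffD1]])
  then have [measurable]: "f \<in> borel_measurable borel" by (rule borel_measurable_continuous_onI)
  fix l u :: 'b assume le: "\<And>b. b \<in> Basis \<Longrightarrow> l \<bullet> b \<le> u \<bullet> b"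
  have ip: "f x \<bullet> f b = x \<bullet> b" if "b \<in> Basis" for x b
  proof -
    have "f x = (\<Sum>i\<in>Basis. (x \<bullet> i) *\<^sub>R f i)"
      by (subst euclidean_representation[of x, symmetric]) (simp only: linear_sum[OF f(1)] linear_scale[OF f(1)])
    moreover have fi: "f i \<bullet> f b = (if i = b then 1 else 0)" if "i \<in> Basis" for i
      using f(2) that \<open>b \<in> Basis\<close> by (subst inner_Basis) (auto simp: bij_betw_def inj_on_eq_iff)
    ultimately have "f x \<bullet> f b = (\<Sum>i\<in>Basis. (x \<bullet> i) * (f i \<bullet> f b))"
      by (simp add: inner_sum_left)
    also have "\<dots> = (\<Sum>i\<in>Basis. if i = b then x \<bullet> b else 0)"
      by (rule sum.cong) (auto simp: fi)
    finally show ?thesis using that by simp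
  qed
  define l' u' where "l' = (\<Sum>b\<in>Basis. (l \<bullet> f b) *\<^sub>R b)" and "u' = (\<Sum>b\<in>Basis. (u \<bullet> f b) *\<^sub>R b)"
  have lu: "l' \<bullet> b = l \<bullet> f b" "u' \<bullet> b = u \<bullet> f b" if "b \<in> Basis" for b
    using that by (simp_all add: l'_def u'_def)
  have B: "Basis = f ` Basis" using f(2) by (simp add: bij_betw_def)
  have fB: "f b \<in> Basis" if "b \<in> Basis" for b using that B by blast
  have "f -` box l u = box l' u'"
    unfolding box_def by (subst B) (auto simp: ip lu)
  then have "emeasure (distr lborel borel f) (box l u) = emeasure lborel (box l' u')"
    by (simp add: emeasure_distr)
  also have "\<dots> = (\<Prod>b\<in>Basis. (u' - l') \<bullet> b)"
    by (subst emeasure_lborel_box) (use le fB lu in auto)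
  also have "\<dots> = (\<Prod>b\<in>Basis. (u - l) \<bullet> f b)"
    by (auto simp: lu inner_diff_left intro!: arg_cong[where f=ennreal] prod.cong)
  also have "\<dots> = (\<Prod>b\<in>Basis. (u - l) \<bullet> b)"
    by (rule arg_cong[where f=ennreal], rule prod.reindex_bij_betw[OF f(2)])
  finally show "emeasure (distr lborel borel f) (box l u) = (\<Prod>b\<in>Basis. (u - l) \<bullet> b)" .
qed simp

text \<open>The preimage of a box is its image under the inverse \<open>g\<close>, and a linear
  image of a box has its volume multiplied by the absolute determinant.\<close>

lemma distr_lborel_unimodular:
  fixes f g :: "real ^ 4 \<Rightarrow> real ^ 4"
  assumes f: "linear f" and g: "linear g" "\<And>x. f (g x) = x" "\<And>x. g (f x) = x" and det: "\<bar>det (matrix g)\<bar> = 1"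
  shows "distr lborel borel f = lborel"
proof (rule lborel_eqI[symmetric])
  have "continuous_on UNIV f" using f by (rule linear_continuous_on[OF linear_conv_bounded_linear[THEN iffD1]])
  then have [measurable]: "f \<in> borel_measurable borel" by (rule borel_measurable_continuous_onI)
  fix l u :: "real ^ 4" assume le: "\<And>b. b \<in> Basis \<Longrightarrow> l \<bullet> b \<le> u \<bullet> b"
  have S: "f -` box l u = g ` box l u" using g by (auto simp: image_iff) metis
  have m: "f -` box l u \<in> sets borel"
    using measurable_sets[of f borel borel "box l u"] by simp
  have "emeasure (distr lborel borel f) (box l u) = emeasure lborel (f -` box l u)"
    by (simp add: emeasure_distr)
  also have "\<dots> = emeasure lebesgue (f -` box l u)"
    using m by simp
  also have "\<dots> = ennreal (measure lebesgue (g ` box l u))"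
    unfolding S using measurable_linear_image[OF g(1), of "box l u"]
    by (simp add: emeasure_eq_measure2)
  also have "\<dots> = ennreal (measure lebesgue (box l u))"
    by (subst measure_linear_image[OF g(1)]) (simp_all add: det)
  also have "\<dots> = (\<Prod>b\<in>Basis. (u - l) \<bullet> b)"
    using le by (simp add: measure_lborel_box_eq)
  finally show "emeasure (distr lborel borel f) (box l u) = (\<Prod>b\<in>Basis. (u - l) \<bullet> b)" .
qed simp

definition lorentz_vec :: "real ^ 4 \<Rightarrow> lorentz4" where
  "lorentz_vec x = (x $ 4, vector [x $ 1, x $ 2, x $ 3])"

definition vec_lorentz :: "lorentz4 \<Rightarrow> real ^ 4" where
  "vec_lorentz y = vector [snd y $ 1, snd y $ 2, snd y $ 3, fst y]"

lemma vec4_nth [simp]: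
  "(vector [x, y, z, w] :: 'a::zero ^ 4) $ 1 = x"
  "(vector [x, y, z, w] :: 'a::zero ^ 4) $ 2 = y"
  "(vector [x, y, z, w] :: 'a::zero ^ 4) $ 3 = z"
  "(vector [x, y, z, w] :: 'a::zero ^ 4) $ 4 = w"
  unfolding vector_def by simp_all

lemma lorentz_vec_inverse [simp]: "lorentz_vec (vec_lorentz y) = y" "vec_lorentz (lorentz_vec x) = x"
  by (simp_all add: lorentz_vec_def vec_lorentz_def prod_eq_iff vec_eq_iff forall_3 forall_4)

lemma linear_lorentz_vec: "linear lorentz_vec" "linear vec_lorentz"
  by (auto intro!: linearI simp: lorentz_vec_def vec_lorentz_def prod_eq_iff vec_eq_iff forall_3 forall_4)

lemma distr_lorentz_vec: "distr lborel borel lorentz_vec = lborel"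
proof (rule distr_lborel_basis[OF linear_lorentz_vec(1)])
  have 1: "lorentz_vec ` Basis \<subseteq> Basis"
  proof
    fix y assume "y \<in> lorentz_vec ` Basis"
    then obtain i :: 4 where y: "y = lorentz_vec (axis i 1)" by (auto simp: Basis_vec_def)
    have "lorentz_vec (axis 1 1) = (0, axis 1 1)" "lorentz_vec (axis 2 1) = (0, axis 2 1)"
       "lorentz_vec (axis 3 1) = (0, axis 3 1)" "lorentz_vec (axis 4 1) = (1, 0)"
      by (simp_all add: lorentz_vec_def axis_def prod_eq_iff vec_eq_iff forall_3)
    then show "y \<in> Basis" unfolding y using exhaust_4[of i]
      by (auto simp: Basis_prod_def Basis_vec_def)
  qed
  have inj: "inj lorentz_vec" by (metis injI lorentz_vec_inverse(2))
  have "card (lorentz_vec ` (Basis :: (real ^ 4) set)) = card (Basis :: lorentz4 set)"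
    using inj by (subst card_image) (auto simp: inj_on_def)
  then have "lorentz_vec ` Basis = Basis" using 1 by (intro card_subset_eq) auto
  then show "bij_betw lorentz_vec Basis Basis" using inj by (auto simp: bij_betw_def inj_on_def)
qed

definition lorentz_gram :: "real ^ 4 ^ 4" where
  "lorentz_gram = (\<chi> i j. if i = j then (if i = 4 then -1 else 1) else 0)"

lemma lform_lorentz_vec: "lform (lorentz_vec x) (lorentz_vec y) = x \<bullet> (lorentz_gram *v y)"
  by (simp add: lform_def lorentz_vec_def inner_vec_def sum_3 sum_4 lorentz_gram_def matrix_vector_mult_def)

lemma det_lorentz_gram: "det lorentz_gram \<noteq> 0"
proof -
  have "lorentz_gram ** lorentz_gram = mat 1"
    by (simp add: vec_eq_iff forall_4 lorentz_gram_def matrix_matrix_mult_def mat_def sum_4)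
  then have "det lorentz_gram * det lorentz_gram = 1" by (metis det_mul det_I)
  then show ?thesis by auto
qed

lemma lorentz_isometry_bij:
  assumes "linear f" "\<And>x y. lform (f x) (f y) = lform x y"
  shows "bij f"
proof -
  have "inj f"
  proof (rule injI)
    fix x y assume "f x = f y"
    then have "lform (x - y) z = 0" for z
      using assms(2)[of x z] assms(2)[of y z] by (simp add: lform_bilinear)
    then show "x = y" using lform_nondegenerate[of "x - y"] by simp
  qed
  then show ?thesis
    using linear_injective_imp_surjective[OF assms(1)] by (simp add: bij_def)
qed

text \<open>Preserving the form means \<open>transpose M ** G ** M = G\<close> for the invertible
  Gram matrix \<open>G\<close>, so the determinant has square 1.\<close>

lemma lorentz_isometry_det:
  fixes g :: "real ^ 4 \<Rightarrow> real ^ 4"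
  assumes g: "linear g"
    and iso: "\<And>x y. lform (lorentz_vec (g x)) (lorentz_vec (g y)) = lform (lorentz_vec x) (lorentz_vec y)"
  shows "\<bar>det (matrix g)\<bar> = 1"
proof -
  let ?M = "matrix g"
  have "x \<bullet> ((transpose ?M ** lorentz_gram ** ?M) *v y) = x \<bullet> (lorentz_gram *v y)" for x y
  proof -
    have "x \<bullet> ((transpose ?M ** lorentz_gram ** ?M) *v y) = x \<bullet> (transpose ?M *v (lorentz_gram *v (?M *v y)))"
      by (simp add: matrix_vector_mul_assoc matrix_mul_assoc)
    also have "\<dots> = (?M *v x) \<bullet> (lorentz_gram *v (?M *v y))"
      by (metis dot_lmul_matrix inner_commute vector_transpose_matrix)
    also have "\<dots> = x \<bullet> (lorentz_gram *v y)"
      using iso[of x y] matrix_works g by (simp add: lform_lorentz_vec)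
    finally show ?thesis .
  qed
  then have "transpose ?M ** lorentz_gram ** ?M = lorentz_gram"
    unfolding matrix_eq by (metis vector_eq_ldot)
  then have "det ?M * det lorentz_gram * det ?M = det lorentz_gram"
    by (metis det_mul det_transpose)
  then have "(det ?M)\<^sup>2 = 1" using det_lorentz_gram by (simp add: power2_eq_square)
  then show ?thesis by (simp add: power2_eq_1_iff abs_if) fastforce
qed

lemma distr_lorentz_isometry:
  assumes f: "linear f" "\<And>x y. lform (f x) (f y) = lform x y"
  shows "distr lborel borel f = (lborel :: lorentz4 measure)"
proof -
  have cont: "h \<in> borel_measurable borel" if "linear h" for h :: "'x::euclidean_space \<Rightarrow> 'y::euclidean_space"
    using that by (intro borel_measurable_continuous_onI)
      (rule linear_continuous_on[OF linear_conv_bounded_linear[THEN iffD1]])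
  note [measurable] = cont[OF f(1)] cont[OF linear_lorentz_vec(1)] cont[OF linear_lorentz_vec(2)]
  have bij: "bij f" by (rule lorentz_isometry_bij[OF f])
  then obtain g where g: "\<And>x. f (g x) = x" "\<And>x. g (f x) = x"
    by (metis bij_inv_eq_iff)
  have ling: "linear g"
    using f(1) g by (intro linearI) (metis linear_add linear_scale)+
  define F where "F = vec_lorentz \<circ> f \<circ> lorentz_vec"
  define G where "G = vec_lorentz \<circ> g \<circ> lorentz_vec"
  have lin: "linear F" "linear G" unfolding F_def G_def
    by (intro linear_compose linear_lorentz_vec f(1) ling)+
  have isog: "lform (g x) (g y) = lform x y" for x y using f(2)[of "g x" "g y"] g by simp
  have "distr lborel borel F = lborel"
    by (rule distr_lborel_unimodular[OF lin], goal_cases)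
       (auto simp: F_def G_def g isog intro!: lorentz_isometry_det[OF lin(2), unfolded G_def])
  note [measurable] = cont[OF lin(1)]
  have "distr lborel borel f = distr (distr lborel borel lorentz_vec) borel f"
    by (simp add: distr_lorentz_vec)
  also have "\<dots> = distr lborel borel (f \<circ> lorentz_vec)" by (subst distr_distr) simp_all
  also have "f \<circ> lorentz_vec = lorentz_vec \<circ> F" by (auto simp: F_def)
  also have "distr lborel borel (lorentz_vec \<circ> F) = distr (distr lborel borel F) borel lorentz_vec"
    by (subst distr_distr) simp_all
  also have "\<dots> = lborel" using \<open>distr lborel borel F = lborel\<close> by (simp add: distr_lorentz_vec)
  finally show ?thesis .
qed

section \<open>Hyperbolic volume as the measure of a cone\<close>

lemma hyp_vol_measurable [measurable]:
  "(\<lambda>y :: real ^ 3. (sqrt (1 + (norm y)\<^sup>2), y)) \<in> borel_measurable borel"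
  by (intro borel_measurable_continuous_onI continuous_intros)

lemma emeasure_hyp_vol:
  assumes [measurable]: "A \<in> sets borel"
  shows "emeasure hyp_vol A =
    (\<integral>\<^sup>+y. ennreal (1 / sqrt (1 + (norm y)\<^sup>2)) * indicator A (sqrt (1 + (norm y)\<^sup>2), y) \<partial>lborel)"
  unfolding hyp_vol_def
  by (subst emeasure_distr)
     (auto simp: indicator_def vimage_def emeasure_density intro!: nn_integral_cong
        measurable_sets[OF hyp_vol_measurable, simplified vimage_def])

text \<open>For \<open>A\<close> on the hyperboloid this is the cone of all \<open>t x\<close> with
  \<open>x\<close> in \<open>A\<close> and \<open>0 < t \<le> 1\<close>, written as a condition on
  the point so that Borel measurability is immediate.\<close>

definition unit_cone :: "lorentz4 set \<Rightarrow> lorentz4 set" where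
  "unit_cone A = {x. lform x x < 0 \<and> - lform x x \<le> 1 \<and> (1 / sqrt (- lform x x)) *\<^sub>R x \<in> A}"

lemma unit_cone_borel [measurable]: assumes [measurable]: "A \<in> sets borel" shows "unit_cone A \<in> sets borel"
proof -
  have "(\<lambda>x. (1 / sqrt (- lform x x)) *\<^sub>R x) \<in> borel_measurable borel" by measurable
  from measurable_sets[OF this, of A] have [measurable]: "{x. (1 / sqrt (- lform x x)) *\<^sub>R x \<in> A} \<in> sets borel"
    by (simp add: vimage_def)
  have "unit_cone A = {x. lform x x < 0 \<and> - lform x x \<le> 1} \<inter> {x. (1 / sqrt (- lform x x)) *\<^sub>R x \<in> A}"
    by (auto simp: unit_cone_def)
  also have "\<dots> \<in> sets borel" by measurable
  finally show ?thesis .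
qed

text \<open>On the line over \<open>y\<close> substitute
  \<open>\<tau> = sqrt (t\<^sup>2 + |y|\<^sup>2)\<close>, where \<open>t\<close> is the Lorentzian
  length of \<open>(\<tau>, y)\<close>. The derivative of \<open>\<tau>\<close> in \<open>t\<close>
  is exactly the density of \<open>hyp_vol\<close> at \<open>y / t\<close>.\<close>

lemma unit_cone_section:
  fixes y :: "real ^ 3"
  assumes [measurable]: "A \<in> sets borel" and A: "A \<subseteq> hyp3" and y: "y \<noteq> 0"
  shows "(\<integral>\<^sup>+\<tau>. indicator (unit_cone A) (\<tau>, y) \<partial>lborel) =
    (\<integral>\<^sup>+t. ennreal (1 / sqrt (1 + (norm ((1 / t) *\<^sub>R y))\<^sup>2)) *
        indicator A (sqrt (1 + (norm ((1 / t) *\<^sub>R y))\<^sup>2), (1 / t) *\<^sub>R y) * indicator {0<..1} t \<partial>lborel)"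
proof -
  define g where "g t = sqrt (t\<^sup>2 + (norm y)\<^sup>2)" for t
  define g' where "g' t = t / sqrt (t\<^sup>2 + (norm y)\<^sup>2)" for t
  define f where "f \<tau> = indicat_real (unit_cone A) (\<tau>, y)" for \<tau>
  have pos: "t\<^sup>2 + (norm y)\<^sup>2 > 0" for t using y by (simp add: add_nonneg_pos)
  have meas [measurable]: "(\<lambda>\<tau> :: real. (\<tau>, y)) \<in> borel_measurable borel"
    by (intro borel_measurable_continuous_onI continuous_intros)
  have fm [measurable]: "f \<in> borel_measurable borel" unfolding f_def by measurable
  have q: "lform (\<tau>, y) (\<tau>, y) = (norm y)\<^sup>2 - \<tau>\<^sup>2" for \<tau>
    by (simp add: lform_def dot_square_norm power2_eq_square)
  have ind: "indicator (unit_cone A) (\<tau>, y) = ennreal (f \<tau> * indicator {g 0..g 1} \<tau>)" for \<tau>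
  proof (cases "(\<tau>, y) \<in> unit_cone A")
    case True
    then have "(norm y)\<^sup>2 < \<tau>\<^sup>2" "\<tau>\<^sup>2 \<le> 1 + (norm y)\<^sup>2" and "(1 / sqrt (\<tau>\<^sup>2 - (norm y)\<^sup>2)) *\<^sub>R (\<tau>, y) \<in> hyp3"
      using A by (auto simp: unit_cone_def q)
    moreover from this have "\<tau> > 0" by (simp add: hyp3_def zero_less_divide_iff)
    ultimately have "\<tau> \<in> {g 0..g 1}"
      using power2_le_imp_le[of "norm y" \<tau>] by (simp add: g_def real_le_rsqrt less_imp_le)
    then show ?thesis using True by (simp add: f_def)
  qed (simp add: f_def)
  have "(\<integral>\<^sup>+\<tau>. indicator (unit_cone A) (\<tau>, y) \<partial>lborel) = (\<integral>\<^sup>+\<tau>. f \<tau> * indicator {g 0..g 1} \<tau> \<partial>lborel)"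
    by (simp add: ind)
  also have "\<dots> = (\<integral>\<^sup>+t. f (g t) * g' t * indicator {0..1} t \<partial>lborel)"
  proof (rule nn_integral_substitution)
    show "set_borel_measurable borel {g 0..g 1} f" unfolding set_borel_measurable_def by measurable
    show "(g has_real_derivative g' x) (at x)" for x
      unfolding g_def g'_def using pos[of x]
      by (auto intro!: derivative_eq_intros simp: field_simps)
    show "continuous_on {0..1} g'" unfolding g'_def by (intro continuous_intros) (use y in auto)
    show "g' x \<ge> 0" if "x \<in> {0..1}" for x using that by (simp add: g'_def)
  qed simp
  also have "\<dots> = (\<integral>\<^sup>+t. ennreal (1 / sqrt (1 + (norm ((1 / t) *\<^sub>R y))\<^sup>2)) *
        indicator A (sqrt (1 + (norm ((1 / t) *\<^sub>R y))\<^sup>2), (1 / t) *\<^sub>R y) * indicator {0<..1} t \<partial>lborel)"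
  proof (rule nn_integral_cong)
    fix t :: real
    show "ennreal (f (g t) * g' t * indicator {0..1} t) = ennreal (1 / sqrt (1 + (norm ((1 / t) *\<^sub>R y))\<^sup>2)) *
        indicator A (sqrt (1 + (norm ((1 / t) *\<^sub>R y))\<^sup>2), (1 / t) *\<^sub>R y) * indicator {0<..1} t"
    proof (cases "0 < t \<and> t \<le> 1")
      case True
      have "(g t)\<^sup>2 = t\<^sup>2 + (norm y)\<^sup>2" using pos[of t] by (simp add: g_def)
      then have "1 + (norm ((1 / t) *\<^sub>R y))\<^sup>2 = (g t / t)\<^sup>2"
        using True by (simp add: power_divide add_divide_distrib)
      moreover have "g t / t \<ge> 0" using True pos[of t] by (simp add: g_def)
      ultimately have s: "sqrt (1 + (norm ((1 / t) *\<^sub>R y))\<^sup>2) = g t / t"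
        by (simp only: real_sqrt_abs abs_of_nonneg)
      have "t\<^sup>2 \<le> 1" using True by (simp add: power_le_one)
      then have "f (g t) = indicator A ((1 / t) *\<^sub>R (g t, y))"
        using True pos[of t] by (auto simp: f_def unit_cone_def q g_def indicator_def)
      moreover have "g' t = 1 / (g t / t)" by (simp add: g'_def g_def)
      ultimately show ?thesis using True unfolding s by (simp add: indicator_def)
    next
      case False
      then show ?thesis by (cases "t = 0") (auto simp: g'_def)
    qed
  qed
  finally show ?thesis .
qed

text \<open>The 4-dimensional Lebesgue measure of a cone is manifestly invariant under Lorentz maps, which
  makes the invariance of the hyperbolic volume a statement about determinants.\<close>

lemma emeasure_hyp_vol_cone:
  assumes [measurable]: "A \<in> sets borel" and A: "A \<subseteq> hyp3"
  shows "emeasure hyp_vol A = 4 * emeasure lborel (unit_cone A)"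
proof -
  let ?K = "\<lambda>t :: real. \<lambda>y :: real ^ 3. ennreal (1 / sqrt (1 + (norm ((1 / t) *\<^sub>R y))\<^sup>2)) *
        indicator A (sqrt (1 + (norm ((1 / t) *\<^sub>R y))\<^sup>2), (1 / t) *\<^sub>R y) * indicator {0<..1} t"
  define V where "V = emeasure hyp_vol A"
  have Km: "(\<lambda>(t, y). ?K t y) \<in> borel_measurable (lborel \<Otimes>\<^sub>M lborel)"
  proof -
    have [measurable]: "(\<lambda>y :: real ^ 3. ennreal (1 / sqrt (1 + (norm y)\<^sup>2)) *
        indicator A (sqrt (1 + (norm y)\<^sup>2), y)) \<in> borel_measurable borel"
      using measurable_compose[OF hyp_vol_measurable borel_measurable_indicator[OF assms(1)]] by measurable
    show ?thesis by measurable
  qed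
  have "emeasure lborel (unit_cone A) = (\<integral>\<^sup>+x. indicator (unit_cone A) x \<partial>(lborel \<Otimes>\<^sub>M lborel))"
    by (simp add: lborel_prod)
  also have "\<dots> = (\<integral>\<^sup>+y. \<integral>\<^sup>+\<tau>. indicator (unit_cone A) (\<tau>, y) \<partial>lborel \<partial>lborel)"
    by (rule lborel_pair.nn_integral_snd[symmetric]) (simp add: lborel_prod)
  also have "\<dots> = (\<integral>\<^sup>+y. \<integral>\<^sup>+t. ?K t y \<partial>lborel \<partial>lborel)"
  proof (rule nn_integral_cong_AE, rule AE_mp[OF AE_lborel_singleton[of 0]], rule AE_I2, intro impI)
    fix y :: "real ^ 3" assume "y \<noteq> 0"
    then show "(\<integral>\<^sup>+\<tau>. indicator (unit_cone A) (\<tau>, y) \<partial>lborel) = (\<integral>\<^sup>+t. ?K t y \<partial>lborel)"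
      by (rule unit_cone_section[OF assms])
  qed
  also have "\<dots> = (\<integral>\<^sup>+t. \<integral>\<^sup>+y. ?K t y \<partial>lborel \<partial>lborel)"
    using lborel_pair.Fubini[OF Km] by simp
  also have "\<dots> = (\<integral>\<^sup>+t. ennreal (t ^ 3) * indicator {0<..1} t * V \<partial>lborel)"
  proof (rule nn_integral_cong)
    fix t :: real
    show "(\<integral>\<^sup>+y. ?K t y \<partial>lborel) = ennreal (t ^ 3) * indicator {0<..1} t * V"
    proof (cases "0 < t \<and> t \<le> 1")
      case True
      have [measurable]: "?K t \<in> borel_measurable borel"
        using measurable_Pair2[OF Km, of t] by simp
      have "(\<integral>\<^sup>+y. ?K t y \<partial>lborel) = ennreal (t ^ 3) * (\<integral>\<^sup>+y. ?K t (t *\<^sub>R y) \<partial>lborel)"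
        using nn_integral_lborel_scale[of "?K t" t] True by simp
      also have "(\<integral>\<^sup>+y. ?K t (t *\<^sub>R y) \<partial>lborel) = V"
        unfolding V_def emeasure_hyp_vol[OF assms(1)] using True by simp
      finally show ?thesis using True by simp
    qed auto
  qed
  also have "\<dots> = (\<integral>\<^sup>+t. ennreal (t ^ 3) * indicator {0..1} t \<partial>lborel) * V"
    by (subst nn_integral_multc[symmetric]) (auto intro!: nn_integral_cong simp: indicator_def le_less)
  \<comment> \<open>The integral of \<open>t ^ 3\<close>, the Jacobian of scaling the space part by
    \<open>t\<close>, is 1/4; this is the origin of the factor 4.\<close>
  also have "(\<integral>\<^sup>+t. ennreal (t ^ 3) * indicator {0..1} t \<partial>lborel) = ennreal (1 ^ 4 / 4 - 0 ^ 4 / 4)"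
    by (rule nn_integral_FTC_Icc) (auto intro!: derivative_eq_intros)
  finally have W: "emeasure lborel (unit_cone A) = ennreal (1 / 4) * V" by simp
  have "4 * ennreal (1 / 4) = ennreal 4 * ennreal (1 / 4)" by (subst ennreal_numeral) (rule refl)
  also have "\<dots> = ennreal (4 * (1 / 4))" by (rule ennreal_mult[symmetric]) auto
  also have "\<dots> = 1" by simp
  finally show ?thesis unfolding W V_def[symmetric] mult.assoc[symmetric] by simp
qed

lemma hyp_vol_isometry:
  assumes f: "linear f" "\<And>x y. lform (f x) (f y) = lform x y" "\<And>x. f x \<in> hyp3 \<longleftrightarrow> x \<in> hyp3"
    and A: "A \<in> sets borel" "A \<subseteq> hyp3"
  shows "emeasure hyp_vol (f -` A) = emeasure hyp_vol A"
proof -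
  have [measurable]: "f \<in> borel_measurable borel"
    using f(1) by (intro borel_measurable_continuous_onI)
      (rule linear_continuous_on[OF linear_conv_bounded_linear[THEN iffD1]])
  have B: "f -` A \<in> sets borel" using measurable_sets[of f borel borel A] A by simp
  have cone: "unit_cone (f -` A) = f -` unit_cone A"
    by (auto simp: unit_cone_def f(2) linear_scale[OF f(1)])
  have sub: "f -` A \<subseteq> hyp3" using f(3) A(2) by blast
  have "emeasure hyp_vol (f -` A) = 4 * emeasure lborel (f -` unit_cone A)"
    by (simp add: emeasure_hyp_vol_cone[OF B sub] cone)
  also have "emeasure lborel (f -` unit_cone A) = emeasure (distr lborel borel f) (unit_cone A)"
    using A by (subst emeasure_distr) auto
  also have "\<dots> = emeasure lborel (unit_cone A)" by (simp add: distr_lorentz_isometry[OF f(1,2)])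
  finally show ?thesis using emeasure_hyp_vol_cone[OF A] by simp
qed

section \<open>Simplices with a cyclic diagram and their volume\<close>

text \<open>The cycle of the diagram is \<open>p\<close>, \<open>a\<close>, \<open>h\<close>,
  \<open>b\<close> with cosines \<open>k\<close>, \<open>s\<close>, \<open>c\<close>,
  \<open>s\<close>. By \<open>s\<^sup>2 + c\<^sup>2 = 1\<close> the facets \<open>a\<close>,
  \<open>b\<close>, \<open>h\<close> have angles of sum pi, which makes \<open>v p\<close> ideal,
  and likewise \<open>p\<close>, \<open>b\<close>, \<open>h\<close> at \<open>v a\<close>. By
  \<open>k < c\<close> the angle sums at the other two vertices exceed pi, so these are not
  ideal.\<close>

locale cycle_simplex =
  fixes v :: "4 \<Rightarrow> lorentz4" and p a b h :: 4 and k s c :: real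
  assumes tet: "tetrahedron v"
    and indices: "distinct [p, a, b, h]"
    and gram:
      "lform (outward_normal v p) (outward_normal v a) = - k"
      "lform (outward_normal v p) (outward_normal v b) = - s"
      "lform (outward_normal v p) (outward_normal v h) = 0"
      "lform (outward_normal v a) (outward_normal v b) = 0"
      "lform (outward_normal v a) (outward_normal v h) = - s"
      "lform (outward_normal v b) (outward_normal v h) = - c"
    and params: "s\<^sup>2 + c\<^sup>2 = 1" "0 < k" "k < c" "0 < s"
begin

text \<open>The reflection of the cycle that exchanges the two ideal vertices: each result at
  \<open>v p\<close> acquires its counterpart at \<open>v a\<close>.\<close>

lemma swap: "cycle_simplex v a p h b k s c"
  using tet indices gram params by unfold_locales (auto simp: lform_commute)

lemma c_pos: "c > 0" using params by simp

lemma indices_UNIV: "UNIV = {p, a, b, h}"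
  using indices by (intro card_subset_eq[symmetric]) auto

lemma all_indices: "(\<forall>i. P i) \<longleftrightarrow> P p \<and> P a \<and> P b \<and> P h"
  using indices_UNIV by (metis UNIV_I empty_iff insert_iff)

abbreviation n where "n \<equiv> outward_normal v"

lemmas n_norm = outward_normal_norm[OF tet]

lemma gram':
  "lform (n a) (n p) = - k" "lform (n b) (n p) = - s" "lform (n h) (n p) = 0"
  "lform (n b) (n a) = 0" "lform (n h) (n a) = - s" "lform (n h) (n b) = - c"
  using gram by (simp_all add: lform_commute)

lemmas gram_simps = gram gram' n_norm

text \<open>In the upper half-space with the ideal vertex \<open>v p\<close> at infinity, the facets \<open>a\<close>, \<open>b\<close>, \<open>h\<close> are
  vertical and the facet \<open>p\<close> is the unit hemisphere over the origin. The vector \<open>cusp\<close> represents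
  \<open>v p\<close>; for \<open>x\<close> with \<open>- lform x x = u w - X\<^sup>2 - Y\<^sup>2\<close> in the lightlike coordinates \<open>u\<close>, \<open>w\<close> and the
  spacelike ones \<open>X\<close>, \<open>Y\<close>, the half-space point is \<open>(X / w, Y / w)\<close> at height \<open>1 / w\<close>.\<close>

definition cusp :: lorentz4 where
  "cusp = (1 / (2 * (k + c) * s)) *\<^sub>R (s *\<^sub>R n a + c *\<^sub>R n b + n h)"

text \<open>The images of the unit vectors are Lorentz orthonormal: as \<open>cusp\<close> is
  lightlike and orthogonal to \<open>n a\<close> and \<open>n b\<close>, adding multiples of it
  removes the products with \<open>n p\<close> and turns \<open>n p\<close> into the timelike
  \<open>2 *\<^sub>R cusp + n p\<close>.\<close>

definition frame :: "lorentz4 \<Rightarrow> lorentz4" where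
  "frame x = fst x *\<^sub>R (2 *\<^sub>R cusp + n p) - (snd x $ 1) *\<^sub>R n p
     + (snd x $ 2) *\<^sub>R ((2 * k) *\<^sub>R cusp - n a) + (snd x $ 3) *\<^sub>R ((2 * s) *\<^sub>R cusp - n b)"

text \<open>Orthogonality to \<open>n h\<close> is the equation
  \<open>s\<^sup>2 + c\<^sup>2 = 1\<close>: the facets through \<open>v p\<close> have a degenerate
  Gram matrix, whose kernel yields a lightlike vector. The value \<open>- 1 / 2\<close> against
  \<open>n p\<close> is the normalisation that puts the facet \<open>p\<close> on the unit
  hemisphere.\<close>

lemma cusp_gram:
  "lform cusp (n p) = - 1 / 2" "lform cusp (n a) = 0" "lform cusp (n b) = 0" "lform cusp (n h) = 0"
  "lform cusp cusp = 0"
proof -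
  show 1: "lform cusp (n p) = - 1 / 2" "lform cusp (n a) = 0" "lform cusp (n b) = 0" "lform cusp (n h) = 0"
  proof -
    have "lform (s *\<^sub>R n a + c *\<^sub>R n b + n h) (n p) = - ((k + c) * s)"
      "lform (s *\<^sub>R n a + c *\<^sub>R n b + n h) (n a) = 0"
      "lform (s *\<^sub>R n a + c *\<^sub>R n b + n h) (n b) = 0"
      "lform (s *\<^sub>R n a + c *\<^sub>R n b + n h) (n h) = 1 - (s\<^sup>2 + c\<^sup>2)"
      by (simp_all add: lform_bilinear gram_simps algebra_simps power2_eq_square)
    moreover have "(k + c) * s \<noteq> 0" using params c_pos by simp
    ultimately show "lform cusp (n p) = - 1 / 2" "lform cusp (n a) = 0" "lform cusp (n b) = 0" "lform cusp (n h) = 0"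
      using params(1) unfolding cusp_def by (simp_all only: lform_bilinear) simp_all
  qed
  show "lform cusp cusp = 0"
    by (subst (2) cusp_def) (simp add: lform_bilinear 1)
qed

lemma cusp_gram':
  "lform (n p) cusp = - 1 / 2" "lform (n a) cusp = 0" "lform (n b) cusp = 0" "lform (n h) cusp = 0"
  using cusp_gram by (simp_all add: lform_commute)

lemma frame_linear: "linear frame"
  by (rule linearI) (simp_all add: frame_def algebra_simps)

lemma frame_lform: "lform (frame x) (frame y) = lform x y"
  unfolding frame_def
  by (simp add: lform_bilinear cusp_gram cusp_gram' gram_simps algebra_simps)
     (simp add: lform_def inner_vec_def sum_3 algebra_simps)

text \<open>The dictionary to the half-space: with \<open>w = fst x - snd x $ 1\<close> the facets
  \<open>a\<close>, \<open>b\<close>, \<open>h\<close> are the vertical walls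
  \<open>X = - k w\<close>, \<open>Y = - s w\<close>, \<open>s X + c Y = 0\<close>, and the facet
  \<open>p\<close> is \<open>u = w\<close>, the unit hemisphere.\<close>

lemma frame_normal:
  "lform (frame x) (n p) = - (snd x $ 1)"
  "lform (frame x) (n a) = - (snd x $ 2) - k * (fst x - snd x $ 1)"
  "lform (frame x) (n b) = - (snd x $ 3) - s * (fst x - snd x $ 1)"
  "lform (frame x) (n h) = s * (snd x $ 2) + c * (snd x $ 3)"
  "lform (frame x) cusp = - (fst x - snd x $ 1) / 2"
  unfolding frame_def
  by (simp_all add: lform_bilinear cusp_gram cusp_gram' gram_simps algebra_simps)

lemma frame_bij: "bij frame"
  by (rule lorentz_isometry_bij[OF frame_linear frame_lform])

text \<open>Both vectors are orthogonal to \<open>n a\<close>, \<open>n b\<close>,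
  \<open>n h\<close> and agree against \<open>n p\<close>. As the factor is positive,
  \<open>cusp\<close> inherits the time orientation of \<open>v p\<close>.\<close>

lemma vertex_p: "v p = (- 2 * lform (v p) (n p)) *\<^sub>R cusp"
proof (rule outward_normal_separate[OF tet])
  have "lform (v p) (n j) = lform ((- 2 * lform (v p) (n p)) *\<^sub>R cusp) (n j)" if "j \<in> {p, a, b, h}" for j
    using that indices outward_normal_orth[OF tet, of p] by (auto simp: lform_bilinear cusp_gram lform_commute[of "v p"])
  then show "lform (v p) (n j) = lform ((- 2 * lform (v p) (n p)) *\<^sub>R cusp) (n j)" for j
    using indices_UNIV by blast
qed

lemma vertex_p_pos: "- 2 * lform (v p) (n p) > 0"
  using outward_normal_neg[OF tet, of p] by (simp add: lform_commute)

lemma cusp_ideal: "ideal_point cusp"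
proof -
  have "fst (v p) = (- 2 * lform (v p) (n p)) * fst cusp" by (subst vertex_p) simp
  then have "fst cusp > 0" using tetrahedron_causal[OF tet, of p] vertex_p_pos
    by (auto simp: causal_def mult_less_0_iff)
  then show ?thesis by (simp add: ideal_point_def cusp_gram)
qed

lemma vertex_p_ideal: "ideal_point (v p)"
  using cusp_ideal vertex_p_pos
  by (subst vertex_p) (auto simp: ideal_point_def lform_bilinear mult_less_0_iff)

text \<open>An isometry preserves the two-sheeted hyperboloid but might exchange its sheets. If it
  did, \<open>- e\<close> would be future-directed and have a positive product with
  \<open>cusp\<close>.\<close>

lemma frame_hyp3: "frame x \<in> hyp3 \<longleftrightarrow> x \<in> hyp3"
proof -
  define e where "e = frame (1, 0)"
  have e: "lform e e = -1" unfolding e_def frame_lform by (simp add: lform_def)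
  have fe: "fst e > 0"
  proof (rule ccontr)
    assume "\<not> fst e > 0"
    moreover have "fst e \<noteq> 0"
    proof
      assume "fst e = 0"
      then have "lform e e \<ge> 0" by (simp add: lform_def)
      then show False using e by simp
    qed
    ultimately have "causal (- e)" using e by (simp add: causal_def lform_bilinear)
    from causal_lform_nonpos[OF this ideal_causal[OF cusp_ideal]]
    show False by (simp add: e_def lform_bilinear frame_normal)
  qed
  have ce: "causal e" using e fe by (simp add: causal_def)
  show ?thesis
  proof (cases "lform x x = -1")
    case True
    have x0: "lform (frame x) e = - fst x" by (simp add: e_def frame_lform) (simp add: lform_def)
    have "fst (frame x) > 0 \<longleftrightarrow> fst x > 0"
    proof
      assume "fst (frame x) > 0"
      then have "causal (frame x)" using True by (simp add: causal_def frame_lform)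
      from causal_lform_neg[OF this ce] True x0 show "fst x > 0" by (simp add: frame_lform)
    next
      assume "fst x > 0"
      show "fst (frame x) > 0"
      proof (rule ccontr)
        assume a: "\<not> ?thesis"
        have "fst (frame x) \<noteq> 0"
        proof
          assume "fst (frame x) = 0"
          then have "lform (frame x) (frame x) \<ge> 0" by (simp add: lform_def)
          then show False using True by (simp add: frame_lform)
        qed
        then have "causal (- frame x)" using True a by (simp add: causal_def frame_lform lform_bilinear)
        from causal_lform_nonpos[OF this ce] x0 \<open>fst x > 0\<close> show False by (simp add: lform_bilinear)
      qed
    qed
    then show ?thesis using True by (simp add: hyp3_def frame_lform)
  qed (simp add: hyp3_def frame_lform)
qed

lemma emeasure_hyp_vol_frame:
  assumes "A \<in> sets borel" "A \<subseteq> hyp3"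
  shows "emeasure hyp_vol A = emeasure hyp_vol (frame -` A)"
  by (rule hyp_vol_isometry[OF frame_linear frame_lform frame_hyp3 assms, symmetric])

lemma simplex_frame:
  "frame -` simplex_of v = {x \<in> hyp3. snd x $ 1 \<ge> 0 \<and> snd x $ 2 \<ge> - k * (fst x - snd x $ 1)
     \<and> snd x $ 3 \<ge> - s * (fst x - snd x $ 1) \<and> s * (snd x $ 2) + c * (snd x $ 3) \<le> 0}"
  unfolding simplex_of_halfspaces[OF tet] vimage_def all_indices
  by (auto simp: frame_hyp3 frame_normal simp del: split_paired_All split_paired_Ex)

lemma vertex_orth: "j \<noteq> i \<Longrightarrow> lform (v j) (n i) = 0"
  using outward_normal_orth[OF tet] by (simp add: lform_commute)

text \<open>In the coordinates of \<open>frame\<close> the three facets through \<open>v b\<close>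
  leave the single parameter \<open>w\<close>, and lightlikeness reads
  \<open>w\<^sup>2 (k\<^sup>2 - c\<^sup>2) = 0\<close>; so \<open>k < c\<close> would force the
  vertex to be 0.\<close>

lemma not_ideal_b: "\<not> ideal_point (v b)"
proof
  assume id: "ideal_point (v b)"
  have k2: "k\<^sup>2 < c\<^sup>2" using params by (intro power_strict_mono) auto
  obtain x where x: "v b = frame x" using frame_bij by (metis bij_pointE)
  define w where "w = fst x - snd x $ 1"
  have o': "snd x $ 1 = 0" "snd x $ 2 = - k * w" "s * (snd x $ 2) + c * (snd x $ 3) = 0"
    using vertex_orth[of b p] vertex_orth[of b a] vertex_orth[of b h] indices
    by (auto simp: x frame_normal w_def)
  have o: "snd x $ 1 = 0" "snd x $ 2 = - k * w" "c * (snd x $ 3) = s * k * w"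
    using o' by (auto simp: algebra_simps)
  have "lform x x = 0" using id unfolding ideal_point_def x frame_lform by simp
  then have "c\<^sup>2 * ((snd x $ 2)\<^sup>2 + (snd x $ 3)\<^sup>2 - w\<^sup>2) = 0"
    using o(1) by (simp add: lform_def inner_vec_def sum_3 w_def power2_eq_square)
  moreover have "c\<^sup>2 * (snd x $ 3)\<^sup>2 = (s * k * w)\<^sup>2" unfolding o(3)[symmetric] by (simp add: power_mult_distrib)
  ultimately have "w\<^sup>2 * ((s\<^sup>2 + c\<^sup>2) * k\<^sup>2 - c\<^sup>2) = 0" using o(2) by (simp add: algebra_simps power2_eq_square)
  then have "w = 0" using k2 params(1) by simp
  then have "x = 0" using o c_pos unfolding w_def by (simp add: prod_eq_iff vec_eq_iff forall_3)
  then have "v b = 0" using x linear_0[OF frame_linear] by simp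
  then show False using id by (simp add: ideal_point_def)
qed

lemma not_ideal_h: "\<not> ideal_point (v h)"
proof
  assume id: "ideal_point (v h)"
  have k2: "k\<^sup>2 < c\<^sup>2" using params by (intro power_strict_mono) auto
  obtain x where x: "v h = frame x" using frame_bij by (metis bij_pointE)
  define w where "w = fst x - snd x $ 1"
  have o: "snd x $ 1 = 0" "snd x $ 2 = - k * w" "snd x $ 3 = - s * w"
    using vertex_orth[of h p] vertex_orth[of h a] vertex_orth[of h b] indices
    by (auto simp: x frame_normal w_def)
  have "lform x x = 0" using id unfolding ideal_point_def x frame_lform by simp
  then have "w\<^sup>2 * (k\<^sup>2 + s\<^sup>2 - 1) = 0"
    using o by (simp add: lform_def inner_vec_def sum_3 w_def algebra_simps power2_eq_square)
  moreover have "k\<^sup>2 + s\<^sup>2 - 1 = k\<^sup>2 - c\<^sup>2" using params(1) by simp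
  ultimately have "w\<^sup>2 * (k\<^sup>2 - c\<^sup>2) = 0" by simp
  then have "w = 0" using k2 by simp
  then have "x = 0" using o unfolding w_def by (simp add: prod_eq_iff vec_eq_iff forall_3)
  then have "v h = 0" using x linear_0[OF frame_linear] by simp
  then show False using id by (simp add: ideal_point_def)
qed

lemma ideal_vertices_eq: "ideal_vertices v = {p, a}"
  using vertex_p_ideal cycle_simplex.vertex_p_ideal[OF swap] not_ideal_b not_ideal_h indices_UNIV
  by (auto simp: ideal_vertices_def)

end

section \<open>Volume in the upper half-space model\<close>

lemma emeasure_lborel_lorentz:
  assumes S: "S \<in> sets (borel :: lorentz4 measure)"
  shows "emeasure lborel S =
    (\<integral>\<^sup>+t. \<integral>\<^sup>+z. \<integral>\<^sup>+q. indicator S (t, vector [z, fst q, snd q]) \<partial>(lborel :: (real \<times> real) measure) \<partial>lborel \<partial>lborel)"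
proof -
  define f :: "real \<times> real \<times> real \<times> real \<Rightarrow> lorentz4" where
    "f = (\<lambda>(t, z, X, Y). (t, vector [z, X, Y]))"
  have lin: "linear f"
    by (rule linearI) (auto simp: f_def vec_eq_iff forall_3)
  have "f ` Basis = Basis"
  proof (rule card_subset_eq)
    have "f (1, 0, 0, 0) = (1, 0)" "f (0, 1, 0, 0) = (0, axis 1 1)" "f (0, 0, 1, 0) = (0, axis 2 1)"
      "f (0, 0, 0, 1) = (0, axis 3 1)"
      by (simp_all add: f_def vec_eq_iff forall_3 axis_def)
    then show "f ` Basis \<subseteq> Basis"
      by (auto simp: Basis_prod_def Basis_vec_def zero_prod_def)
    have "inj f" by (auto simp: inj_def f_def vec_eq_iff forall_3)
    then show "card (f ` Basis) = card (Basis :: lorentz4 set)"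
      by (subst card_image) (auto simp: inj_on_def)
  qed simp
  moreover have "inj f" by (auto simp: inj_def f_def vec_eq_iff forall_3)
  ultimately have "distr lborel borel f = lborel"
    by (intro distr_lborel_basis[OF lin]) (auto simp: bij_betw_def inj_on_def)
  then have "emeasure lborel S = emeasure (distr lborel borel f) S" by simp
  moreover have fm [measurable]: "f \<in> borel_measurable borel"
    using lin by (intro borel_measurable_continuous_onI)
      (rule linear_continuous_on[OF linear_conv_bounded_linear[THEN iffD1]])
  ultimately have "emeasure lborel S = (\<integral>\<^sup>+x. indicator S (f x) \<partial>lborel)"
    using S by (simp add: nn_integral_distr flip: nn_integral_indicator)
  also have "\<dots> = (\<integral>\<^sup>+x. indicator S (f x) \<partial>(lborel \<Otimes>\<^sub>M lborel))"
    by (simp add: lborel_prod)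
  also have "\<dots> = (\<integral>\<^sup>+t. \<integral>\<^sup>+x. indicator S (f (t, x)) \<partial>lborel \<partial>lborel)"
    by (rule lborel.nn_integral_fst[symmetric]) (use S in \<open>simp add: lborel_prod\<close>)
  also have "\<dots> = (\<integral>\<^sup>+t. \<integral>\<^sup>+x. indicator S (f (t, x)) \<partial>(lborel \<Otimes>\<^sub>M lborel) \<partial>lborel)"
    by (simp add: lborel_prod)
  also have "\<dots> = (\<integral>\<^sup>+t. \<integral>\<^sup>+z. \<integral>\<^sup>+q. indicator S (f (t, z, q)) \<partial>lborel \<partial>lborel \<partial>lborel)"
  proof (rule nn_integral_cong)
    fix t :: real
    have "(\<lambda>x. f (t, x)) \<in> borel_measurable borel"
      by (rule measurable_compose[OF _ fm]) (intro borel_measurable_continuous_onI continuous_intros)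
    then have "(\<lambda>x. indicator S (f (t, x)) :: ennreal) \<in> borel_measurable (lborel \<Otimes>\<^sub>M lborel)"
      using S by (simp add: lborel_prod)
    from lborel.nn_integral_fst[OF this]
    show "(\<integral>\<^sup>+x. indicator S (f (t, x)) \<partial>(lborel \<Otimes>\<^sub>M lborel)) = (\<integral>\<^sup>+z. \<integral>\<^sup>+q. indicator S (f (t, z, q)) \<partial>lborel \<partial>lborel)"
      by simp
  qed
  also have "\<dots> = (\<integral>\<^sup>+t. \<integral>\<^sup>+z. \<integral>\<^sup>+q. indicator S (t, vector [z, fst q, snd q]) \<partial>(lborel :: (real \<times> real) measure) \<partial>lborel \<partial>lborel)"
    by (simp add: f_def case_prod_beta)
  finally show ?thesis .
qed

text \<open>New variables \<open>u = t + z\<close> and \<open>w = t - z\<close>, reached by two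
  affine substitutions in one variable; the factor 1/2 is the Jacobian.\<close>

lemma nn_integral_lightlike_coords:
  fixes G :: "real \<Rightarrow> real \<Rightarrow> ennreal"
  assumes [measurable]: "(\<lambda>(t, z). G t z) \<in> borel_measurable (borel \<Otimes>\<^sub>M borel)"
  shows "(\<integral>\<^sup>+t. \<integral>\<^sup>+z. G t z \<partial>lborel \<partial>lborel) =
    ennreal (1 / 2) * (\<integral>\<^sup>+w. \<integral>\<^sup>+u. G ((u + w) / 2) ((u - w) / 2) \<partial>lborel \<partial>lborel)"
proof -
  have "(\<integral>\<^sup>+t. \<integral>\<^sup>+z. G t z \<partial>lborel \<partial>lborel) = (\<integral>\<^sup>+z. \<integral>\<^sup>+t. G t z \<partial>lborel \<partial>lborel)"
    using lborel_pair.Fubini[of "\<lambda>(t, z). G t z"] by simp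
  also have "\<dots> = (\<integral>\<^sup>+z. \<integral>\<^sup>+w. G (z + w) z \<partial>lborel \<partial>lborel)"
  proof (rule nn_integral_cong)
    fix z :: real
    show "(\<integral>\<^sup>+t. G t z \<partial>lborel) = (\<integral>\<^sup>+w. G (z + w) z \<partial>lborel)"
      by (subst nn_integral_real_affine[of _ 1 z]) simp_all
  qed
  also have "\<dots> = (\<integral>\<^sup>+w. \<integral>\<^sup>+z. G (z + w) z \<partial>lborel \<partial>lborel)"
    using lborel_pair.Fubini[of "\<lambda>(w, z). G (z + w) z"] by simp
  also have "\<dots> = (\<integral>\<^sup>+w. ennreal (1 / 2) * (\<integral>\<^sup>+u. G ((u + w) / 2) ((u - w) / 2) \<partial>lborel) \<partial>lborel)"
  proof (rule nn_integral_cong)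
    fix w :: real
    have e: "(\<lambda>u. G (- w / 2 + 1 / 2 * u + w) (- w / 2 + 1 / 2 * u)) = (\<lambda>u. G ((u + w) / 2) ((u - w) / 2))"
      by (intro ext arg_cong2[where f=G]) (simp_all add: field_simps)
    have "(\<integral>\<^sup>+z. G (z + w) z \<partial>lborel) = ennreal \<bar>1 / 2\<bar> * (\<integral>\<^sup>+u. G (- w / 2 + 1 / 2 * u + w) (- w / 2 + 1 / 2 * u) \<partial>lborel)"
      by (rule nn_integral_real_affine) simp_all
    then show "(\<integral>\<^sup>+z. G (z + w) z \<partial>lborel) = ennreal (1 / 2) * (\<integral>\<^sup>+u. G ((u + w) / 2) ((u - w) / 2) \<partial>lborel)"
      unfolding e by simp
  qed
  also have "\<dots> = ennreal (1 / 2) * (\<integral>\<^sup>+w. \<integral>\<^sup>+u. G ((u + w) / 2) ((u - w) / 2) \<partial>lborel \<partial>lborel)"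
    by (rule nn_integral_cmult) measurable
  finally show ?thesis .
qed

lemma nn_integral_power3:
  assumes "0 < r"
  shows "(\<integral>\<^sup>+w. ennreal (w ^ 3) * indicator {w. 0 < w \<and> w\<^sup>2 * r \<le> 1} w \<partial>lborel) = ennreal (1 / (4 * r\<^sup>2))"
proof -
  have "w\<^sup>2 * r \<le> 1 \<longleftrightarrow> w \<le> 1 / sqrt r" if "w > 0" for w
  proof -
    have "w\<^sup>2 * r \<le> 1 \<longleftrightarrow> (w * sqrt r)\<^sup>2 \<le> 1\<^sup>2" using assms by (simp add: power_mult_distrib)
    also have "\<dots> \<longleftrightarrow> w * sqrt r \<le> 1" using that assms by (subst abs_le_square_iff[symmetric]) simp
    finally show ?thesis using assms by (simp add: field_simps)
  qed
  then have "(\<integral>\<^sup>+w. ennreal (w ^ 3) * indicator {w. 0 < w \<and> w\<^sup>2 * r \<le> 1} w \<partial>lborel) =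
    (\<integral>\<^sup>+w. ennreal (w ^ 3) * indicator {0..1 / sqrt r} w \<partial>lborel)"
    by (intro nn_integral_cong) (auto simp: indicator_def le_less)
  also have "\<dots> = ennreal ((1 / sqrt r) ^ 4 / 4 - 0 ^ 4 / 4)"
    using assms by (intro nn_integral_FTC_Icc) (auto intro!: derivative_eq_intros)
  also have "(1 / sqrt r) ^ 4 / 4 - 0 ^ 4 / 4 = 1 / (4 * r\<^sup>2)"
    using assms by (simp add: power_divide power4_eq_xxxx power2_eq_square)
  finally show ?thesis .
qed

text \<open>With \<open>\<zeta> = x\<^sup>2 + y\<^sup>2 + z\<^sup>2\<close>, where \<open>z\<close> is the height, this is the volume element \<open>dx dy dz / z\<^sup>3\<close> of
  the upper half-space model.\<close>

lemma emeasure_hyp_vol_half_space: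
  fixes P :: "real \<Rightarrow> real \<Rightarrow> real \<Rightarrow> bool"
  assumes P [measurable]: "Measurable.pred borel (\<lambda>(\<zeta>, x, y). P \<zeta> x y)"
  defines "A \<equiv> {q \<in> hyp3. P ((fst q + snd q $ 1) / (fst q - snd q $ 1))
     (snd q $ 2 / (fst q - snd q $ 1)) (snd q $ 3 / (fst q - snd q $ 1))}"
  shows "A \<in> sets borel"
    and "emeasure hyp_vol A = ennreal (1 / 2) * (\<integral>\<^sup>+q. \<integral>\<^sup>+\<zeta>. ennreal (1 / (\<zeta> - (fst q)\<^sup>2 - (snd q)\<^sup>2)\<^sup>2) *
      indicator {\<zeta>. \<zeta> > (fst q)\<^sup>2 + (snd q)\<^sup>2 \<and> P \<zeta> (fst q) (snd q)} \<zeta> \<partial>lborel \<partial>lborel)"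
proof -
  have cm: "continuous_on UNIV f \<Longrightarrow> f \<in> borel_measurable borel"
    for f :: "'x::topological_space \<Rightarrow> 'y::topological_space"
    by (rule borel_measurable_continuous_onI)
  have [measurable]: "(\<lambda>q :: lorentz4. fst q) \<in> borel_measurable borel"
     "(\<lambda>q :: lorentz4. snd q $ i) \<in> borel_measurable borel" for i
    by (rule cm, intro continuous_intros)+
  have comp [measurable]: "(\<lambda>q :: lorentz4. ((fst q + snd q $ 1) / (fst q - snd q $ 1), snd q $ 2 / (fst q - snd q $ 1), snd q $ 3 / (fst q - snd q $ 1)))
     \<in> borel_measurable borel"
    by measurable
  have PA: "Measurable.pred borel (\<lambda>q :: lorentz4. P ((fst q + snd q $ 1) / (fst q - snd q $ 1))
     (snd q $ 2 / (fst q - snd q $ 1)) (snd q $ 3 / (fst q - snd q $ 1)))"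
    using measurable_compose[OF comp P] by simp
  have hyp3_borel: "hyp3 \<in> sets borel" unfolding hyp3_def by measurable
  show Am [measurable]: "A \<in> sets borel"
    using PA hyp3_borel unfolding A_def by measurable
  have sub: "A \<subseteq> hyp3" by (auto simp: A_def)
  \<comment> \<open>Membership in the cone over \<open>A\<close> in the coordinates
    \<open>w\<close>, \<open>u\<close>, \<open>q\<close>. The condition \<open>P\<close> sees only
    ratios to \<open>w\<close>, so scaling the other three coordinates by \<open>w\<close> will free
    it from \<open>w\<close>.\<close>
  define K where "K w u q \<longleftrightarrow> 0 < w \<and> 0 < u * w - (fst q)\<^sup>2 - (snd q)\<^sup>2 \<and> u * w - (fst q)\<^sup>2 - (snd q)\<^sup>2 \<le> 1 \<and>
     P (u / w) (fst q / w) (snd q / w)" for w u :: real and q :: "real \<times> real"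
  have cone: "((u + w) / 2, vector [(u - w) / 2, fst q, snd q]) \<in> unit_cone A \<longleftrightarrow> K w u q" for u w q
  proof -
    let ?x = "((u + w) / 2, vector [(u - w) / 2, fst q, snd q]) :: lorentz4"
    have l: "- lform ?x ?x = u * w - (fst q)\<^sup>2 - (snd q)\<^sup>2"
      by (simp add: lform_def inner_vec_def sum_3 field_simps power2_eq_square)
    have nn: "(fst q)\<^sup>2 + (snd q)\<^sup>2 \<ge> 0" by simp
    show ?thesis
    proof (cases "0 < - lform ?x ?x")
      case True
      define d where "d = sqrt (- lform ?x ?x)"
      have d: "d > 0" "d * d = - lform ?x ?x" using True by (simp_all add: d_def)
      have uw: "u * w > 0" using True nn unfolding l by linarith
      then have pos: "(u + w) / 2 > 0 \<longleftrightarrow> w > 0"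
        by (auto simp: zero_less_mult_iff)
      have "lform ((1 / d) *\<^sub>R ?x) ((1 / d) *\<^sub>R ?x) = -1"
      proof -
        have "lform ?x ?x = - (d * d)" using d by simp
        then show ?thesis using d(1) by (simp only: lform_bilinear) simp
      qed
      moreover have "fst ((1 / d) *\<^sub>R ?x) > 0 \<longleftrightarrow> w > 0" using pos d(1) by (simp add: zero_less_divide_iff)
      ultimately have "(1 / d) *\<^sub>R ?x \<in> hyp3 \<longleftrightarrow> w > 0" by (simp add: hyp3_def)
      moreover have "fst ((1 / d) *\<^sub>R ?x) + snd ((1 / d) *\<^sub>R ?x) $ 1 = u / d"
         "fst ((1 / d) *\<^sub>R ?x) - snd ((1 / d) *\<^sub>R ?x) $ 1 = w / d"
         "snd ((1 / d) *\<^sub>R ?x) $ 2 = fst q / d" "snd ((1 / d) *\<^sub>R ?x) $ 3 = snd q / d"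
        using d by (simp_all add: field_simps)
      ultimately have *: "(1 / d) *\<^sub>R ?x \<in> A \<longleftrightarrow> w > 0 \<and> P (u / w) (fst q / w) (snd q / w)"
        using d unfolding A_def by (simp del: fst_scaleR snd_scaleR scaleR_Pair)
      have "?x \<in> unit_cone A \<longleftrightarrow> 0 < - lform ?x ?x \<and> - lform ?x ?x \<le> 1 \<and> (1 / d) *\<^sub>R ?x \<in> A"
        by (simp only: unit_cone_def mem_Collect_eq d_def neg_0_less_iff_less)
      then show ?thesis unfolding * K_def l using True[unfolded l] by blast
    next
      case False
      then show ?thesis using l unfolding unit_cone_def K_def by simp
    qed
  qed
  have Km [measurable]: "Measurable.pred (borel \<Otimes>\<^sub>M borel) (\<lambda>(w, u, q). K w u q)"
  proof -
    have 1: "(\<lambda>(w, u, q). ((u + w) / 2, vector [(u - w) / 2, fst q, snd q]) :: lorentz4) \<in> borel_measurable (borel :: (real \<times> real \<times> real \<times> real) measure)"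
    proof (rule cm)
      have c1: "continuous_on UNIV (\<lambda>x :: real \<times> real \<times> real \<times> real. vector [(fst (snd x) - fst x) / 2, fst (snd (snd x)), snd (snd (snd x))] :: real ^ 3)"
        by (intro linear_continuous_on[OF linear_conv_bounded_linear[THEN iffD1]] linearI)
           (simp_all add: vec_eq_iff forall_3 field_simps)
      show "continuous_on UNIV (\<lambda>(w :: real, u :: real, q :: real \<times> real). ((u + w) / 2, vector [(u - w) / 2, fst q, snd q]) :: lorentz4)"
        unfolding case_prod_beta' by (intro continuous_intros c1) auto
    qed
    have "{x. case x of (w, u, q) \<Rightarrow> K w u q} \<in> sets borel"
      using measurable_sets[OF 1 unit_cone_borel[OF Am]] unfolding cone[symmetric]
      by (simp add: vimage_def case_prod_beta)
    then show ?thesis unfolding borel_prod pred_def by simp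
  qed
  have Fm: "(\<lambda>x. ennreal (1 / (fst x - (fst (snd x))\<^sup>2 - (snd (snd x))\<^sup>2)\<^sup>2) *
      indicator {\<zeta>. \<zeta> > (fst (snd x))\<^sup>2 + (snd (snd x))\<^sup>2 \<and> P \<zeta> (fst (snd x)) (snd (snd x))} (fst x)) \<in> borel_measurable borel"
  proof -
    have [measurable]: "(\<lambda>x :: real \<times> real \<times> real. fst x) \<in> borel_measurable borel"
      "(\<lambda>x :: real \<times> real \<times> real. fst (snd x)) \<in> borel_measurable borel"
      "(\<lambda>x :: real \<times> real \<times> real. snd (snd x)) \<in> borel_measurable borel"
      by (intro cm continuous_intros)+
    have [measurable]: "Measurable.pred borel (\<lambda>x. P (fst x) (fst (snd x)) (snd (snd x)))"
      using P by (simp add: case_prod_beta')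
    show ?thesis unfolding indicator_def mem_Collect_eq by measurable
  qed
  have "emeasure lborel (unit_cone A) =
    (\<integral>\<^sup>+t. \<integral>\<^sup>+z. \<integral>\<^sup>+q. indicator (unit_cone A) (t, vector [z, fst q, snd q]) \<partial>(lborel :: (real \<times> real) measure) \<partial>lborel \<partial>lborel)"
    by (rule emeasure_lborel_lorentz) simp
  also have "\<dots> = ennreal (1 / 2) * (\<integral>\<^sup>+w. \<integral>\<^sup>+u. \<integral>\<^sup>+q. indicator (unit_cone A) ((u + w) / 2, vector [(u - w) / 2, fst q, snd q]) \<partial>(lborel :: (real \<times> real) measure) \<partial>lborel \<partial>lborel)"
  proof (rule nn_integral_lightlike_coords)
    have 1: "(\<lambda>x :: (real \<times> real) \<times> real \<times> real. (fst (fst x), vector [snd (fst x), fst (snd x), snd (snd x)]) :: lorentz4) \<in> borel_measurable borel"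
      by (intro cm linear_continuous_on[OF linear_conv_bounded_linear[THEN iffD1]] linearI)
         (simp_all add: vec_eq_iff forall_3)
    from measurable_compose[OF this borel_measurable_indicator[OF unit_cone_borel[OF Am]]]
    have [measurable]: "(\<lambda>x :: (real \<times> real) \<times> real \<times> real. indicator (unit_cone A) (fst (fst x), vector [snd (fst x), fst (snd x), snd (snd x)]) :: ennreal)
      \<in> borel_measurable (borel \<Otimes>\<^sub>M lborel)"
      by (subst measurable_cong_sets[OF sets_pair_measure_cong[OF refl sets_lborel] refl]) (simp add: borel_prod)
    show "(\<lambda>(t, z). \<integral>\<^sup>+q. indicator (unit_cone A) (t, vector [z, fst q, snd q]) \<partial>(lborel :: (real \<times> real) measure)) \<in> borel_measurable (borel \<Otimes>\<^sub>M borel)"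
      unfolding case_prod_beta' borel_prod by (rule lborel.borel_measurable_nn_integral) (simp add: case_prod_beta')
  qed
  also have "(\<integral>\<^sup>+w. \<integral>\<^sup>+u. \<integral>\<^sup>+q. indicator (unit_cone A) ((u + w) / 2, vector [(u - w) / 2, fst q, snd q]) \<partial>(lborel :: (real \<times> real) measure) \<partial>lborel \<partial>lborel)
    = (\<integral>\<^sup>+w. \<integral>\<^sup>+x. of_bool (K w (fst x) (snd x)) \<partial>lborel \<partial>lborel)"
    (is "_ = (\<integral>\<^sup>+w. \<integral>\<^sup>+x. ?K w x \<partial>lborel \<partial>lborel)")
  proof (rule nn_integral_cong)
    fix w :: real
    have m: "(\<lambda>x. ?K w x :: ennreal) \<in> borel_measurable (lborel \<Otimes>\<^sub>M lborel)"
      using measurable_Pair2[OF Km, of w] by (simp add: lborel_prod case_prod_beta)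
    show "(\<integral>\<^sup>+u. \<integral>\<^sup>+q. indicator (unit_cone A) ((u + w) / 2, vector [(u - w) / 2, fst q, snd q]) \<partial>(lborel :: (real \<times> real) measure) \<partial>lborel)
       = (\<integral>\<^sup>+x. ?K w x \<partial>lborel)"
      using lborel.nn_integral_fst[OF m] by (simp add: lborel_prod indicator_def cone)
  qed
  \<comment> \<open>Scaling \<open>u\<close> and the two spacelike coordinates by \<open>w\<close>
    produces the Jacobian \<open>w ^ 3\<close>; the scaled \<open>u\<close> is
    \<open>\<zeta>\<close>.\<close>
  also have "\<dots> = (\<integral>\<^sup>+w. \<integral>\<^sup>+x. ennreal (w ^ 3) * indicator {0<..} w * ?K w (w *\<^sub>R x) \<partial>lborel \<partial>lborel)"
  proof (rule nn_integral_cong)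
    fix w :: real
    have m1: "(\<lambda>x. ?K w x :: ennreal) \<in> borel_measurable borel"
      using measurable_Pair2[OF Km, of w] by (simp add: case_prod_beta)
    have m2: "(\<lambda>x. ?K w (w *\<^sub>R x) :: ennreal) \<in> borel_measurable lborel"
      using measurable_compose[OF _ m1, of "\<lambda>x. w *\<^sub>R x" borel] by simp
    show "(\<integral>\<^sup>+x. ?K w x \<partial>lborel) = (\<integral>\<^sup>+x. ennreal (w ^ 3) * indicator {0<..} w * ?K w (w *\<^sub>R x) \<partial>lborel)"
    proof (cases "w > 0")
      case True
      have d: "w ^ DIM(real \<times> real \<times> real) = w ^ 3" by (simp add: numeral_3_eq_3)
      have "(\<integral>\<^sup>+x. ?K w x \<partial>lborel) = ennreal (w ^ 3) * (\<integral>\<^sup>+x. ?K w (w *\<^sub>R x) \<partial>lborel)"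
        using nn_integral_lborel_scale[OF m1 True] unfolding d .
      also have "\<dots> = (\<integral>\<^sup>+x. ennreal (w ^ 3) * ?K w (w *\<^sub>R x) \<partial>lborel)"
        by (rule nn_integral_cmult[OF m2, symmetric])
      finally show ?thesis using True by simp
    qed (simp add: K_def)
  qed
  also have "\<dots> = (\<integral>\<^sup>+x. \<integral>\<^sup>+w. ennreal (w ^ 3) * indicator {0<..} w * ?K w (w *\<^sub>R x) \<partial>lborel \<partial>lborel)"
  proof -
    have "(\<lambda>x :: real \<times> real \<times> real \<times> real. (fst x, fst x *\<^sub>R snd x)) \<in> borel_measurable borel"
      by (intro cm continuous_intros)
    then have "(\<lambda>x. ?K (fst x) (fst x *\<^sub>R snd x) :: ennreal) \<in> borel_measurable borel"
      using measurable_compose[of "\<lambda>x. (fst x, fst x *\<^sub>R snd x)" borel borel "\<lambda>x. ?K (fst x) (snd x)"] Km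
      by (simp add: case_prod_beta' borel_prod)
    moreover have "(\<lambda>x :: real \<times> real \<times> real \<times> real. ennreal (fst x ^ 3) * indicator {0<..} (fst x)) \<in> borel_measurable (borel \<Otimes>\<^sub>M borel)"
      by measurable
    ultimately have "(\<lambda>x. ennreal (fst x ^ 3) * indicator {0<..} (fst x) * ?K (fst x) (fst x *\<^sub>R snd x)) \<in> borel_measurable borel"
      unfolding borel_prod by (rule borel_measurable_times_ennreal[rotated])
    then show ?thesis
      by (intro lborel_pair.Fubini'[symmetric]) (simp add: case_prod_beta' lborel_prod)
  qed
  also have "\<dots> = (\<integral>\<^sup>+x. ennreal (1 / 4) * (ennreal (1 / (fst x - (fst (snd x))\<^sup>2 - (snd (snd x))\<^sup>2)\<^sup>2) *
      indicator {\<zeta>. \<zeta> > (fst (snd x))\<^sup>2 + (snd (snd x))\<^sup>2 \<and> P \<zeta> (fst (snd x)) (snd (snd x))} (fst x)) \<partial>lborel)"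
  proof (rule nn_integral_cong)
    fix x :: "real \<times> real \<times> real"
    obtain \<zeta> X Y where x: "x = (\<zeta>, X, Y)" by (cases x) auto
    \<comment> \<open>\<open>r\<close> is the squared height of the half-space point. Of the
      dependence on \<open>w\<close> only the truncation \<open>w\<^sup>2 * r \<le> 1\<close> of the
      cone remains, and \<open>w ^ 3\<close> integrates to \<open>1 / (4 r\<^sup>2)\<close> over
      it.\<close>
    define r where "r = \<zeta> - X\<^sup>2 - Y\<^sup>2"
    have e: "w * \<zeta> * w - (w * X)\<^sup>2 - (w * Y)\<^sup>2 = w\<^sup>2 * r" for w
      by (simp add: r_def power2_eq_square algebra_simps)
    have KK: "0 < w \<Longrightarrow> K w (w * \<zeta>) (w * X, w * Y) \<longleftrightarrow> 0 < r \<and> w\<^sup>2 * r \<le> 1 \<and> P \<zeta> X Y" for w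
      unfolding K_def fst_conv snd_conv e by (simp add: zero_less_mult_iff)
    have "(\<integral>\<^sup>+w. ennreal (w ^ 3) * indicator {0<..} w * of_bool (K w (fst (w *\<^sub>R x)) (snd (w *\<^sub>R x))) \<partial>lborel)
      = (\<integral>\<^sup>+w. of_bool (0 < r \<and> P \<zeta> X Y) * (ennreal (w ^ 3) * indicator {w. 0 < w \<and> w\<^sup>2 * r \<le> 1} w) \<partial>lborel)"
      by (intro nn_integral_cong) (auto simp: x KK indicator_def)
    also have "\<dots> = ennreal (1 / 4) * (ennreal (1 / r\<^sup>2) * indicator {\<zeta>. \<zeta> > X\<^sup>2 + Y\<^sup>2 \<and> P \<zeta> X Y} \<zeta>)"
    proof (cases "0 < r \<and> P \<zeta> X Y")
      case True
      then show ?thesis using nn_integral_power3[of r] by (simp add: r_def ennreal_mult[symmetric])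
    next
      case False
      then have "\<not> (\<zeta> > X\<^sup>2 + Y\<^sup>2 \<and> P \<zeta> X Y)" by (auto simp: r_def)
      then show ?thesis using False by (auto simp: indicator_def)
    qed
    finally show "(\<integral>\<^sup>+w. ennreal (w ^ 3) * indicator {0<..} w * of_bool (K w (fst (w *\<^sub>R x)) (snd (w *\<^sub>R x))) \<partial>lborel)
      = ennreal (1 / 4) * (ennreal (1 / (fst x - (fst (snd x))\<^sup>2 - (snd (snd x))\<^sup>2)\<^sup>2) *
      indicator {\<zeta>. \<zeta> > (fst (snd x))\<^sup>2 + (snd (snd x))\<^sup>2 \<and> P \<zeta> (fst (snd x)) (snd (snd x))} (fst x))"
      by (simp add: x r_def)
  qed
  also have "\<dots> = ennreal (1 / 4) * (\<integral>\<^sup>+x. (ennreal (1 / (fst x - (fst (snd x))\<^sup>2 - (snd (snd x))\<^sup>2)\<^sup>2) *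
      indicator {\<zeta>. \<zeta> > (fst (snd x))\<^sup>2 + (snd (snd x))\<^sup>2 \<and> P \<zeta> (fst (snd x)) (snd (snd x))} (fst x)) \<partial>lborel)"
    (is "_ = _ * integral\<^sup>N _ ?F")
  proof (rule nn_integral_cmult)
    show "?F \<in> borel_measurable lborel" by (simp add: Fm)
  qed
  also have "integral\<^sup>N lborel ?F = (\<integral>\<^sup>+q. \<integral>\<^sup>+\<zeta>. ?F (\<zeta>, q) \<partial>lborel \<partial>lborel)"
  proof -
    have "?F \<in> borel_measurable (lborel \<Otimes>\<^sub>M lborel)" by (simp add: Fm lborel_prod)
    from lborel_pair.nn_integral_snd[OF this] show ?thesis by (simp add: lborel_prod)
  qed
  finally have "emeasure hyp_vol A = 4 * (ennreal (1 / 2) * (ennreal (1 / 4) * (\<integral>\<^sup>+q. \<integral>\<^sup>+\<zeta>. ?F (\<zeta>, q) \<partial>lborel \<partial>lborel)))"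
    using emeasure_hyp_vol_cone[OF Am sub] by simp
  \<comment> \<open>The factor 4 comes from the cone, 1/2 from the lightlike coordinates and 1/4
    from the integral in \<open>w\<close>. The resulting 1/2 matches
    \<open>d\<zeta> = 2 z dz\<close>.\<close>
  also have "\<dots> = (4 * ennreal (1 / 2) * ennreal (1 / 4)) * (\<integral>\<^sup>+q. \<integral>\<^sup>+\<zeta>. ?F (\<zeta>, q) \<partial>lborel \<partial>lborel)"
    by (simp only: mult.assoc)
  also have "4 * ennreal (1 / 2) * ennreal (1 / 4) = ennreal 4 * ennreal (1 / 2) * ennreal (1 / 4)"
    by (subst ennreal_numeral) (rule refl)
  also have "\<dots> = ennreal (4 * (1 / 2) * (1 / 4))" by (simp only: ennreal_mult[symmetric])
  finally show "emeasure hyp_vol A = ennreal (1 / 2) * (\<integral>\<^sup>+q. \<integral>\<^sup>+\<zeta>. ennreal (1 / (\<zeta> - (fst q)\<^sup>2 - (snd q)\<^sup>2)\<^sup>2) *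
      indicator {\<zeta>. \<zeta> > (fst q)\<^sup>2 + (snd q)\<^sup>2 \<and> P \<zeta> (fst q) (snd q)} \<zeta> \<partial>lborel \<partial>lborel)"
    by simp
qed

section \<open>Integrals over the base of the prism\<close>

lemma nn_integral_inverse_square_tail:
  assumes "r < (a::real)"
  shows "(\<integral>\<^sup>+\<zeta>. ennreal (1 / (\<zeta> - r)\<^sup>2) * indicator {a..} \<zeta> \<partial>lborel) = ennreal (1 / (a - r))"
proof -
  have "((\<lambda>\<zeta>. - (1 / (\<zeta> - r))) \<longlongrightarrow> - 0) at_top"
    by (intro tendsto_minus tendsto_divide_0[OF tendsto_const] filterlim_at_top_imp_at_infinity
        filterlim_tendsto_add_at_top[OF tendsto_const filterlim_ident, of "- r", simplified add.commute[of "- r"], simplified])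
  then have "(\<integral>\<^sup>+\<zeta>. ennreal (1 / (\<zeta> - r)\<^sup>2) * indicator {a..} \<zeta> \<partial>lborel) = ennreal (- 0 - (- (1 / (a - r))))"
    using assms by (intro nn_integral_FTC_atLeast)
      (auto intro!: derivative_eq_intros simp: power2_eq_square divide_simps)
  then show ?thesis by simp
qed

text \<open>A right triangle with its right angle at \<open>(- k, - s)\<close>, below
  \<open>v h\<close>. The corner \<open>(- k, s k / c)\<close> lies below \<open>v b\<close>, the
  corner \<open>(c, - s)\<close> on the unit circle is the ideal vertex \<open>v a\<close> itself,
  and the origin lies on the hypotenuse.\<close>

definition cusp_triangle :: "real \<Rightarrow> real \<Rightarrow> real \<Rightarrow> (real \<times> real) set" where
  "cusp_triangle k s c = {q. - k \<le> fst q \<and> - s \<le> snd q \<and> s * fst q + c * snd q \<le> 0}"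

lemma cusp_triangle_borel [measurable]: "cusp_triangle k s c \<in> sets borel"
proof -
  have "closed (cusp_triangle k s c)"
    unfolding cusp_triangle_def by (intro closed_Collect_conj closed_Collect_le continuous_intros)
  then show ?thesis by simp
qed

text \<open>Twice the volume above the unit hemisphere over a right triangle with a corner at the
  origin: \<open>\<tau>\<close> is the tangent of the angle there, and
  \<open>S = h / sqrt (1 - h\<^sup>2)\<close> for the adjacent leg \<open>h\<close>.\<close>

definition wedge_integral :: "real \<Rightarrow> real \<Rightarrow> ennreal" where
  "wedge_integral S \<tau> = (\<integral>\<^sup>+\<sigma>. ennreal (artanh (\<tau> * \<sigma>) / (1 + \<sigma>\<^sup>2)) * indicator {0..S} \<sigma> \<partial>lborel)"

text \<open>The strict bound keeps the slice inside the open unit disc, so the integrand is the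
  derivative of a scaled \<open>artanh\<close> up to the end point.\<close>

lemma wedge_slice:
  fixes \<eta> \<tau> :: real
  assumes "0 < \<eta>" "0 \<le> \<tau>" "\<eta>\<^sup>2 * (1 + \<tau>\<^sup>2) < 1"
  shows "ennreal \<eta> * (\<integral>\<^sup>+t. ennreal (1 / (1 - \<eta>\<^sup>2 * (1 + t\<^sup>2))) * indicator {0..\<tau>} t \<partial>lborel)
    = ennreal (artanh (\<tau> * (\<eta> / sqrt (1 - \<eta>\<^sup>2))) / sqrt (1 - \<eta>\<^sup>2))"
proof -
  have "\<eta>\<^sup>2 * 1 \<le> \<eta>\<^sup>2 * (1 + \<tau>\<^sup>2)" by (intro mult_left_mono) auto
  then have e1: "\<eta>\<^sup>2 < 1" using assms by linarith
  define d where "d = sqrt (1 - \<eta>\<^sup>2)"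
  have d: "d > 0" "d\<^sup>2 = 1 - \<eta>\<^sup>2" using e1 by (simp_all add: d_def)
  have lt: "(\<eta> / d * t)\<^sup>2 < 1" and nz: "1 - \<eta>\<^sup>2 * (1 + t\<^sup>2) > 0" if "t \<in> {0..\<tau>}" for t
  proof -
    have "t\<^sup>2 \<le> \<tau>\<^sup>2" using that by (intro power_mono) auto
    then have "\<eta>\<^sup>2 * (1 + t\<^sup>2) \<le> \<eta>\<^sup>2 * (1 + \<tau>\<^sup>2)" by (intro mult_left_mono) auto
    then show "1 - \<eta>\<^sup>2 * (1 + t\<^sup>2) > 0" using assms(3) by linarith
    then have "\<eta>\<^sup>2 * t\<^sup>2 < d\<^sup>2" unfolding d by (simp add: algebra_simps)
    then show "(\<eta> / d * t)\<^sup>2 < 1" using d(1) by (simp add: power_mult_distrib power_divide)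
  qed
  have "(\<integral>\<^sup>+t. ennreal (1 / (1 - \<eta>\<^sup>2 * (1 + t\<^sup>2))) * indicator {0..\<tau>} t \<partial>lborel)
     = ennreal (artanh (\<eta> / d * \<tau>) / (\<eta> * d) - artanh (\<eta> / d * 0) / (\<eta> * d))"
  proof (rule nn_integral_FTC_Icc[where F = "\<lambda>t. artanh (\<eta> / d * t) / (\<eta> * d)"])
    fix t assume t: "t \<in> {0..\<tau>}"
    have a: "\<bar>\<eta> / d * t\<bar> < 1" using lt[of t] t by (simp add: abs_square_less_1)
    have "((\<lambda>t. \<eta> / d * t) has_real_derivative \<eta> / d) (at t)"
      using d(1) by (auto intro!: derivative_eq_intros)
    from DERIV_cdivide[OF DERIV_chain2[OF artanh_real_has_field_derivative[OF a, where A = UNIV] this], of "\<eta> * d"]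
    have "((\<lambda>t. artanh (\<eta> / d * t) / (\<eta> * d)) has_real_derivative (\<eta> / d) * (1 / (1 - (\<eta> / d * t)\<^sup>2)) / (\<eta> * d)) (at t)"
      by (simp add: mult.commute)
    moreover have "(\<eta> / d) * (1 / (1 - (\<eta> / d * t)\<^sup>2)) / (\<eta> * d) = 1 / (d\<^sup>2 * (1 - (\<eta> / d * t)\<^sup>2))"
      using d(1) assms(1) by (simp add: power2_eq_square)
    moreover have "d\<^sup>2 * (1 - (\<eta> / d * t)\<^sup>2) = d\<^sup>2 - \<eta>\<^sup>2 * t\<^sup>2"
      using d(1) by (simp add: power_mult_distrib power_divide right_diff_distrib)
    moreover have "d\<^sup>2 - \<eta>\<^sup>2 * t\<^sup>2 = 1 - \<eta>\<^sup>2 * (1 + t\<^sup>2)" by (simp add: d algebra_simps)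
    ultimately show "((\<lambda>t. artanh (\<eta> / d * t) / (\<eta> * d)) has_real_derivative 1 / (1 - \<eta>\<^sup>2 * (1 + t\<^sup>2))) (at t)"
      by simp
  qed (use nz assms in \<open>auto simp: less_imp_le\<close>)
  then have "ennreal \<eta> * (\<integral>\<^sup>+t. ennreal (1 / (1 - \<eta>\<^sup>2 * (1 + t\<^sup>2))) * indicator {0..\<tau>} t \<partial>lborel)
    = ennreal \<eta> * ennreal (artanh (\<eta> / d * \<tau>) / (\<eta> * d))" by simp
  also have "\<dots> = ennreal (\<eta> * (artanh (\<eta> / d * \<tau>) / (\<eta> * d)))"
    by (rule ennreal_mult'[symmetric]) (use assms(1) in simp)
  also have "\<eta> * (artanh (\<eta> / d * \<tau>) / (\<eta> * d)) = artanh (\<tau> * (\<eta> / d)) / d"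
    using assms(1) by (simp add: mult.commute)
  finally show ?thesis by (simp add: d_def)
qed

text \<open>Substitution \<open>\<eta> = \<sigma> / sqrt (1 + \<sigma>\<^sup>2)\<close>, which turns
  \<open>\<eta> / sqrt (1 - \<eta>\<^sup>2)\<close> into \<open>\<sigma>\<close>. Equality in the
  last hypothesis is the case of a triangle whose far corner is an ideal vertex.\<close>

lemma wedge_integral_eq:
  assumes h: "0 < h" "h < 1" and \<tau>: "0 \<le> \<tau>" and le: "h\<^sup>2 * (1 + \<tau>\<^sup>2) \<le> 1"
  shows "(\<integral>\<^sup>+\<eta>. ennreal \<eta> * (\<integral>\<^sup>+t. ennreal (1 / (1 - \<eta>\<^sup>2 * (1 + t\<^sup>2))) * indicator {0..\<tau>} t \<partial>lborel) * indicator {0<..h} \<eta> \<partial>lborel)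
    = wedge_integral (h / sqrt (1 - h\<^sup>2)) \<tau>"
proof -
  define S where "S = h / sqrt (1 - h\<^sup>2)"
  define f where "f \<eta> = artanh (\<tau> * (\<eta> / sqrt (1 - \<eta>\<^sup>2))) / sqrt (1 - \<eta>\<^sup>2)" for \<eta> :: real
  define g where "g \<sigma> = \<sigma> / sqrt (1 + \<sigma>\<^sup>2)" for \<sigma> :: real
  define g' where "g' \<sigma> = 1 / ((1 + \<sigma>\<^sup>2) * sqrt (1 + \<sigma>\<^sup>2))" for \<sigma> :: real
  have pos: "1 + \<sigma>\<^sup>2 > 0" for \<sigma> :: real by (simp add: add_pos_nonneg)
  have h2: "h\<^sup>2 < 1" using h by (simp add: power_less_one_iff abs_square_less_1)
  have gg: "1 - (g \<sigma>)\<^sup>2 = 1 / (1 + \<sigma>\<^sup>2)" for \<sigma>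
    using pos[of \<sigma>] by (simp add: g_def power_divide field_simps)
  have gs: "sqrt (1 - (g \<sigma>)\<^sup>2) = 1 / sqrt (1 + \<sigma>\<^sup>2)" for \<sigma>
    unfolding gg by (simp add: real_sqrt_divide)
  have gS: "g S = h"
  proof -
    have "1 + S\<^sup>2 = 1 / (1 - h\<^sup>2)" using h2 by (simp add: S_def power_divide field_simps)
    then show ?thesis using h2 by (simp add: g_def real_sqrt_divide) (simp add: S_def)
  qed
  have g0: "g 0 = 0" by (simp add: g_def)
  have fg: "f (g \<sigma>) * g' \<sigma> = artanh (\<tau> * \<sigma>) / (1 + \<sigma>\<^sup>2)" for \<sigma>
    using pos[of \<sigma>] unfolding f_def gs by (simp add: g_def g'_def)
  have "(\<integral>\<^sup>+\<eta>. ennreal \<eta> * (\<integral>\<^sup>+t. ennreal (1 / (1 - \<eta>\<^sup>2 * (1 + t\<^sup>2))) * indicator {0..\<tau>} t \<partial>lborel) * indicator {0<..h} \<eta> \<partial>lborel)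
    = (\<integral>\<^sup>+\<eta>. ennreal (f \<eta> * indicator {g 0..g S} \<eta>) \<partial>lborel)"
  \<comment> \<open>At \<open>\<eta> = h\<close> the slice may reach the unit circle, where
    \<open>wedge_slice\<close> does not apply; this point is a null set.\<close>
  proof (rule nn_integral_cong_AE, rule AE_mp[OF AE_lborel_singleton[of h]], rule AE_mp[OF AE_lborel_singleton[of 0]], rule AE_I2, intro impI)
    fix \<eta> :: real assume ne: "\<eta> \<noteq> 0" "\<eta> \<noteq> h"
    show "ennreal \<eta> * (\<integral>\<^sup>+t. ennreal (1 / (1 - \<eta>\<^sup>2 * (1 + t\<^sup>2))) * indicator {0..\<tau>} t \<partial>lborel) * indicator {0<..h} \<eta>
      = ennreal (f \<eta> * indicator {g 0..g S} \<eta>)"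
    proof (cases "0 < \<eta> \<and> \<eta> < h")
      case True
      have "\<eta>\<^sup>2 < h\<^sup>2" using True by (intro power_strict_mono) auto
      then have "\<eta>\<^sup>2 * (1 + \<tau>\<^sup>2) < h\<^sup>2 * (1 + \<tau>\<^sup>2)" using pos[of \<tau>] by (intro mult_strict_right_mono)
      then have "\<eta>\<^sup>2 * (1 + \<tau>\<^sup>2) < 1" using le by simp
      from wedge_slice[OF _ \<tau> this] True show ?thesis by (simp add: f_def gS g0)
    next
      case False
      then show ?thesis using ne by (auto simp: gS g0 indicator_def)
    qed
  qed
  also have "\<dots> = (\<integral>\<^sup>+\<sigma>. ennreal (f (g \<sigma>) * g' \<sigma> * indicator {0..S} \<sigma>) \<partial>lborel)"
  proof (rule nn_integral_substitution)
    show "set_borel_measurable borel {g 0..g S} f"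
      unfolding set_borel_measurable_def f_def artanh_def by measurable
    show "(g has_real_derivative g' x) (at x)" for x
    proof -
      have "(g has_real_derivative (sqrt (1 + x\<^sup>2) - x * (inverse (sqrt (1 + x\<^sup>2)) / 2 * (2 * x))) / (sqrt (1 + x\<^sup>2))\<^sup>2) (at x)"
        unfolding g_def using pos[of x]
        by (auto intro!: derivative_eq_intros simp: power2_eq_square)
      also have "(sqrt (1 + x\<^sup>2) - x * (inverse (sqrt (1 + x\<^sup>2)) / 2 * (2 * x))) = 1 / sqrt (1 + x\<^sup>2)"
        using pos[of x] by (simp add: field_simps power2_eq_square[symmetric])
      finally show ?thesis using pos[of x] by (simp add: g'_def mult.commute)
    qed
    show "continuous_on {0..S} g'"
      unfolding g'_def by (intro continuous_intros) (use pos in \<open>auto simp: less_imp_neq[THEN not_sym]\<close>)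
    show "g' x \<ge> 0" for x using pos[of x] by (simp add: g'_def)
    show "0 \<le> S" using h h2 by (simp add: S_def)
  qed
  also have "\<dots> = wedge_integral S \<tau>"
    unfolding wedge_integral_def fg by (intro nn_integral_cong) (auto simp: indicator_def)
  finally show ?thesis by (simp add: S_def)
qed

text \<open>A triangle with apex at the origin and base on the line \<open>y = - h\<close>: the
  perpendicular from the apex cuts it into right triangles with tangents \<open>\<tau>1\<close> and
  \<open>\<tau>2\<close>, and \<open>x = - y t\<close> makes each slice an interval in
  \<open>t\<close>. The exception \<open>t \<noteq> - \<tau>1\<close> admits half-open triangles, so
  that neighbours need not overlap.\<close>

lemma nn_integral_wedge:
  fixes U :: "real \<Rightarrow> real set"
  assumes h: "0 < h" "h < 1" and \<tau>: "0 \<le> \<tau>1" "h\<^sup>2 * (1 + \<tau>1\<^sup>2) \<le> 1" "0 \<le> \<tau>2" "h\<^sup>2 * (1 + \<tau>2\<^sup>2) \<le> 1"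
    and U [measurable]: "\<And>y. U y \<in> sets borel"
    and UI: "\<And>y t. - h \<le> y \<Longrightarrow> y < 0 \<Longrightarrow> t \<noteq> - \<tau>1 \<Longrightarrow> - y * t \<in> U y \<longleftrightarrow> - \<tau>1 \<le> t \<and> t \<le> \<tau>2"
  shows "(\<integral>\<^sup>+y. (\<integral>\<^sup>+x. ennreal (1 / (1 - x\<^sup>2 - y\<^sup>2)) * indicator (U y) x \<partial>lborel) * indicator {- h..<0} y \<partial>lborel)
    = wedge_integral (h / sqrt (1 - h\<^sup>2)) \<tau>1 + wedge_integral (h / sqrt (1 - h\<^sup>2)) \<tau>2"
proof -
  define I where "I \<eta> \<tau> = (\<integral>\<^sup>+t. ennreal (1 / (1 - \<eta>\<^sup>2 * (1 + t\<^sup>2))) * indicator {0..\<tau>} t \<partial>lborel)" for \<eta> \<tau> :: real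
  have Im [measurable]: "(\<lambda>\<eta>. I \<eta> \<tau>) \<in> borel_measurable borel" for \<tau>
    unfolding I_def by measurable
  have Ineg: "I (- \<eta>) \<tau> = I \<eta> \<tau>" for \<eta> \<tau> by (simp add: I_def)
  have split: "(\<integral>\<^sup>+t. ennreal (1 / (1 - \<eta>\<^sup>2 * (1 + t\<^sup>2))) * indicator {-\<tau>1..\<tau>2} t \<partial>lborel) = I \<eta> \<tau>1 + I \<eta> \<tau>2" for \<eta>
  proof -
    have "(\<integral>\<^sup>+t. ennreal (1 / (1 - \<eta>\<^sup>2 * (1 + t\<^sup>2))) * indicator {-\<tau>1..\<tau>2} t \<partial>lborel)
      = (\<integral>\<^sup>+t. ennreal (1 / (1 - \<eta>\<^sup>2 * (1 + t\<^sup>2))) * indicator {-\<tau>1..0} t +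
          ennreal (1 / (1 - \<eta>\<^sup>2 * (1 + t\<^sup>2))) * indicator {0..\<tau>2} t \<partial>lborel)"
      by (rule nn_integral_cong_AE, rule AE_mp[OF AE_lborel_singleton[of 0]], rule AE_I2)
         (use \<tau> in \<open>auto simp: indicator_def\<close>)
    also have "\<dots> = (\<integral>\<^sup>+t. ennreal (1 / (1 - \<eta>\<^sup>2 * (1 + t\<^sup>2))) * indicator {-\<tau>1..0} t \<partial>lborel) + I \<eta> \<tau>2"
      unfolding I_def by (rule nn_integral_add) measurable
    also have "(\<integral>\<^sup>+t. ennreal (1 / (1 - \<eta>\<^sup>2 * (1 + t\<^sup>2))) * indicator {-\<tau>1..0} t \<partial>lborel) = I \<eta> \<tau>1"
      unfolding I_def by (subst nn_integral_real_affine[of _ "-1" 0])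
        (auto intro!: nn_integral_cong simp: indicator_def)
    finally show ?thesis .
  qed
  have "(\<integral>\<^sup>+y. (\<integral>\<^sup>+x. ennreal (1 / (1 - x\<^sup>2 - y\<^sup>2)) * indicator (U y) x \<partial>lborel) * indicator {- h..<0} y \<partial>lborel)
     = (\<integral>\<^sup>+y. ennreal (- y) * (I y \<tau>1 + I y \<tau>2) * indicator {- h..<0} y \<partial>lborel)"
  proof (rule nn_integral_cong)
    fix y :: real
    show "(\<integral>\<^sup>+x. ennreal (1 / (1 - x\<^sup>2 - y\<^sup>2)) * indicator (U y) x \<partial>lborel) * indicator {- h..<0} y
      = ennreal (- y) * (I y \<tau>1 + I y \<tau>2) * indicator {- h..<0} y"
    proof (cases "y \<in> {- h..<0}")
      case True
      have "(\<integral>\<^sup>+x. ennreal (1 / (1 - x\<^sup>2 - y\<^sup>2)) * indicator (U y) x \<partial>lborel)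
        = ennreal (- y) * (\<integral>\<^sup>+t. ennreal (1 / (1 - (0 + - y * t)\<^sup>2 - y\<^sup>2)) * indicator (U y) (0 + - y * t) \<partial>lborel)"
        using True by (subst nn_integral_real_affine[of _ "- y" 0]) auto
      also have "(\<integral>\<^sup>+t. ennreal (1 / (1 - (0 + - y * t)\<^sup>2 - y\<^sup>2)) * indicator (U y) (0 + - y * t) \<partial>lborel)
        = (\<integral>\<^sup>+t. ennreal (1 / (1 - y\<^sup>2 * (1 + t\<^sup>2))) * indicator {-\<tau>1..\<tau>2} t \<partial>lborel)"
      proof (rule nn_integral_cong_AE, rule AE_mp[OF AE_lborel_singleton[of "- \<tau>1"]], rule AE_I2, intro impI)
        fix t :: real assume "t \<noteq> - \<tau>1"
        then have "- y * t \<in> U y \<longleftrightarrow> t \<in> {- \<tau>1..\<tau>2}" using UI[of y t] True by auto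
        moreover have "1 - (0 + - y * t)\<^sup>2 - y\<^sup>2 = 1 - y\<^sup>2 * (1 + t\<^sup>2)" by (simp add: power_mult_distrib algebra_simps)
        ultimately show "ennreal (1 / (1 - (0 + - y * t)\<^sup>2 - y\<^sup>2)) * indicator (U y) (0 + - y * t)
          = ennreal (1 / (1 - y\<^sup>2 * (1 + t\<^sup>2))) * indicator {-\<tau>1..\<tau>2} t"
          by (simp only: add_0_left indicator_def)
      qed
      finally show ?thesis using True by (simp add: split)
    qed simp
  qed
  also have "\<dots> = (\<integral>\<^sup>+\<eta>. ennreal \<eta> * (I \<eta> \<tau>1 + I \<eta> \<tau>2) * indicator {0<..h} \<eta> \<partial>lborel)"
    by (subst nn_integral_real_affine[of _ "-1" 0])
       (auto intro!: nn_integral_cong simp: Ineg indicator_def)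
  also have "\<dots> = (\<integral>\<^sup>+\<eta>. ennreal \<eta> * I \<eta> \<tau>1 * indicator {0<..h} \<eta> + ennreal \<eta> * I \<eta> \<tau>2 * indicator {0<..h} \<eta> \<partial>lborel)"
    by (intro nn_integral_cong) (simp add: algebra_simps)
  also have "\<dots> = wedge_integral (h / sqrt (1 - h\<^sup>2)) \<tau>1 + wedge_integral (h / sqrt (1 - h\<^sup>2)) \<tau>2"
    unfolding wedge_integral_eq[OF h \<tau>(1,2), folded I_def, symmetric] wedge_integral_eq[OF h \<tau>(3,4), folded I_def, symmetric]
    by (rule nn_integral_add) measurable
  finally show ?thesis .
qed

text \<open>Half the product of the legs \<open>k + c\<close> and
  \<open>s (k + c) / c\<close>.\<close>

lemma emeasure_cusp_triangle:
  assumes "0 < s" "0 < c" "0 < k"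
  shows "emeasure lborel (cusp_triangle k s c) = ennreal (s * (k + c)\<^sup>2 / (2 * c))"
proof -
  have "emeasure lborel (cusp_triangle k s c) = (\<integral>\<^sup>+q. indicator (cusp_triangle k s c) q \<partial>(lborel \<Otimes>\<^sub>M lborel))"
    by (simp add: lborel_prod)
  also have "\<dots> = (\<integral>\<^sup>+x. \<integral>\<^sup>+y. indicator (cusp_triangle k s c) (x, y) \<partial>lborel \<partial>lborel)"
    by (rule lborel.nn_integral_fst[symmetric]) (simp add: lborel_prod)
  also have "\<dots> = (\<integral>\<^sup>+x. ennreal (s * (c - x) / c) * indicator {- k..c} x \<partial>lborel)"
  proof (rule nn_integral_cong)
    fix x :: real
    have "(\<integral>\<^sup>+y. indicator (cusp_triangle k s c) (x, y) \<partial>lborel) = (\<integral>\<^sup>+y. indicator {- k..} x * indicator {- s..- s * x / c} y \<partial>lborel)"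
      using assms by (intro nn_integral_cong) (auto simp: indicator_def cusp_triangle_def field_simps)
    also have "\<dots> = indicator {- k..} x * emeasure lborel {- s..- s * x / c}"
      by (subst nn_integral_cmult) simp_all
    also have "\<dots> = ennreal (s * (c - x) / c) * indicator {- k..c} x"
    proof (cases "x \<le> c")
      case True
      then have "- s \<le> - s * x / c" using assms by (simp add: field_simps)
      moreover have "- s * x / c - - s = s * (c - x) / c" using assms by (simp add: field_simps)
      ultimately show ?thesis using True by (simp add: indicator_def)
    next
      case False
      then have "\<not> - s \<le> - s * x / c" using assms by (simp add: field_simps)
      then show ?thesis using False by (simp add: indicator_def)
    qed
    finally show "(\<integral>\<^sup>+y. indicator (cusp_triangle k s c) (x, y) \<partial>lborel) = ennreal (s * (c - x) / c) * indicator {- k..c} x" .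
  qed
  also have "\<dots> = ennreal (- (s / (2 * c)) * (c - c)\<^sup>2 - (- (s / (2 * c)) * (c - - k)\<^sup>2))"
    using assms by (intro nn_integral_FTC_Icc) (auto intro!: derivative_eq_intros simp: field_simps)
  also have "- (s / (2 * c)) * (c - c)\<^sup>2 - (- (s / (2 * c)) * (c - - k)\<^sup>2) = s * (k + c)\<^sup>2 / (2 * c)"
    by (simp add: add.commute)
  finally show ?thesis .
qed

text \<open>The segment from the origin to the right angle cuts the triangle into \<open>TA\<close>,
  based on the side \<open>x = - k\<close>, and \<open>TB\<close>, based on \<open>y = - s\<close>.
  Each contributes two tangents, hence four integrals; the one with tangent \<open>c / s\<close>
  reaches the ideal vertex.\<close>

lemma nn_integral_cusp_triangle:
  assumes p: "s\<^sup>2 + c\<^sup>2 = 1" "0 < k" "k < c" "0 < s"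
  shows "(\<integral>\<^sup>+q. ennreal (1 / (1 - (fst q)\<^sup>2 - (snd q)\<^sup>2)) * indicator (cusp_triangle k s c) q \<partial>lborel)
    = wedge_integral (s / c) (k / s) + wedge_integral (s / c) (c / s) +
      (wedge_integral (k / sqrt (1 - k\<^sup>2)) (s / k) + wedge_integral (k / sqrt (1 - k\<^sup>2)) (s / c))"
proof -
  have c: "c > 0" using p by simp
  have kc: "k\<^sup>2 < c\<^sup>2" using p by (intro power_strict_mono) auto
  have s1: "s < 1" using p c by (smt (verit) power2_less_imp_less one_power2 zero_less_power2 zero_le_one)
  have c1: "c < 1" using p c by (smt (verit) power2_less_imp_less one_power2 zero_less_power2 zero_le_one)
  have sc: "sqrt (1 - s\<^sup>2) = c" using p c by (smt (verit) real_sqrt_unique)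
  define f where "f q = ennreal (1 / (1 - (fst q)\<^sup>2 - (snd q)\<^sup>2))" for q :: "real \<times> real"
  define TA where "TA = {q :: real \<times> real. - k \<le> fst q \<and> fst q < 0 \<and> s * fst q < k * snd q \<and> s * fst q + c * snd q \<le> 0}"
  define TB where "TB = {q :: real \<times> real. - s \<le> snd q \<and> snd q < 0 \<and> k * snd q \<le> s * fst q \<and> s * fst q + c * snd q \<le> 0}"
  have m0: "continuous_on UNIV g \<Longrightarrow> g \<in> borel_measurable borel" for g :: "real \<times> real \<Rightarrow> real"
    by (rule borel_measurable_continuous_onI)
  have [measurable]: "(\<lambda>q :: real \<times> real. fst q) \<in> borel_measurable borel" "(\<lambda>q :: real \<times> real. snd q) \<in> borel_measurable borel"
    by (intro m0 continuous_intros)+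
  have fm [measurable]: "f \<in> borel_measurable borel" unfolding f_def by measurable
  have Tm [measurable]: "TA \<in> sets borel" "TB \<in> sets borel" unfolding TA_def TB_def by measurable
  have "(\<integral>\<^sup>+q. f q * indicator (cusp_triangle k s c) q \<partial>lborel) = (\<integral>\<^sup>+q. f q * indicator TA q + f q * indicator TB q \<partial>lborel)"
  proof (rule nn_integral_cong_AE, rule AE_mp[OF AE_lborel_singleton[of 0]], rule AE_I2, intro impI)
    fix q :: "real \<times> real" assume q: "q \<noteq> 0"
    obtain x y where xy: "q = (x, y)" by (cases q)
    have "q \<in> cusp_triangle k s c \<longleftrightarrow> q \<in> TA \<or> q \<in> TB"
    proof
      assume "q \<in> cusp_triangle k s c"
      then have t: "- k \<le> x" "- s \<le> y" "s * x + c * y \<le> 0" by (auto simp: cusp_triangle_def xy)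
      show "q \<in> TA \<or> q \<in> TB"
      proof (cases "k * y \<le> s * x")
        case True
        have "y < 0"
        proof (rule ccontr)
          assume "\<not> y < 0"
          then have "k * y \<ge> 0" "c * y \<ge> 0" using p c by auto
          then have "s * x \<ge> 0" "c * y = 0" "s * x = 0" using True t by linarith+
          then show False using q p c by (simp add: xy zero_prod_def)
        qed
        then show ?thesis using True t by (auto simp: TB_def xy)
      next
        case False
        have "x < 0"
        proof (rule ccontr)
          assume "\<not> x < 0"
          then have "s * x \<ge> 0" using p by auto
          then have "k * y > 0" using False by linarith
          then have "c * y > 0" using p c by (simp add: zero_less_mult_iff)
          then show False using \<open>s * x \<ge> 0\<close> t by linarith
        qed
        then show ?thesis using False t by (auto simp: TA_def xy)
      qed
    next
      assume "q \<in> TA \<or> q \<in> TB"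
      then show "q \<in> cusp_triangle k s c"
      proof
        assume "q \<in> TA"
        then have t: "- k \<le> x" "x < 0" "s * x < k * y" "s * x + c * y \<le> 0" by (auto simp: TA_def xy)
        have "k * - s \<le> s * x" using mult_left_mono[OF t(1), of s] p by (simp add: mult.commute)
        then have "k * - s < k * y" using t by linarith
        then have "- s < y" by (rule mult_left_less_imp_less) (use p in simp)
        then show ?thesis using t p by (simp add: cusp_triangle_def xy)
      next
        assume "q \<in> TB"
        then have t: "- s \<le> y" "y < 0" "k * y \<le> s * x" "s * x + c * y \<le> 0" by (auto simp: TB_def xy)
        have "s * - k \<le> k * y" using mult_left_mono[OF t(1), of k] p by (simp add: mult.commute)
        then have "s * - k \<le> s * x" using t by linarith
        then have "- k \<le> x" by (rule mult_left_le_imp_le) (use p in simp)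
        then show ?thesis using t p by (simp add: cusp_triangle_def xy)
      qed
    qed
    moreover have "\<not> (q \<in> TA \<and> q \<in> TB)" by (auto simp: TA_def TB_def)
    ultimately show "f q * indicator (cusp_triangle k s c) q = f q * indicator TA q + f q * indicator TB q"
      by (auto simp: indicator_def)
  qed
  also have "\<dots> = (\<integral>\<^sup>+q. f q * indicator TA q \<partial>lborel) + (\<integral>\<^sup>+q. f q * indicator TB q \<partial>lborel)"
    by (rule nn_integral_add) simp_all
  also have "(\<integral>\<^sup>+q. f q * indicator TB q \<partial>lborel) = wedge_integral (s / c) (k / s) + wedge_integral (s / c) (c / s)"
  proof -
    have "(\<lambda>q. f q * indicator TB q) \<in> borel_measurable (lborel \<Otimes>\<^sub>M lborel)" by (simp add: lborel_prod)
    from lborel_pair.nn_integral_snd[OF this]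
    have "(\<integral>\<^sup>+q. f q * indicator TB q \<partial>lborel) = (\<integral>\<^sup>+y. \<integral>\<^sup>+x. f (x, y) * indicator TB (x, y) \<partial>lborel \<partial>lborel)"
      by (simp add: lborel_prod)
    also have "\<dots> = (\<integral>\<^sup>+y. (\<integral>\<^sup>+x. ennreal (1 / (1 - x\<^sup>2 - y\<^sup>2)) * indicator {x. k * y \<le> s * x \<and> s * x + c * y \<le> 0} x \<partial>lborel) * indicator {- s..<0} y \<partial>lborel)"
    proof (rule nn_integral_cong)
      fix y :: real
      show "(\<integral>\<^sup>+x. f (x, y) * indicator TB (x, y) \<partial>lborel) = (\<integral>\<^sup>+x. ennreal (1 / (1 - x\<^sup>2 - y\<^sup>2)) * indicator {x. k * y \<le> s * x \<and> s * x + c * y \<le> 0} x \<partial>lborel) * indicator {- s..<0} y"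
        by (cases "y \<in> {- s..<0}") (auto intro!: nn_integral_cong simp: f_def TB_def indicator_def)
    qed
    also have "\<dots> = wedge_integral (s / sqrt (1 - s\<^sup>2)) (k / s) + wedge_integral (s / sqrt (1 - s\<^sup>2)) (c / s)"
    proof (rule nn_integral_wedge)
      show "- y * t \<in> {x. k * y \<le> s * x \<and> s * x + c * y \<le> 0} \<longleftrightarrow> - (k / s) \<le> t \<and> t \<le> c / s" if "y < 0" for y t
      proof -
        have "k * y \<le> s * (- y * t) \<longleftrightarrow> - (k / s) \<le> t"
        proof -
          have "k * y \<le> s * (- y * t) \<longleftrightarrow> y * (k + s * t) \<le> 0"
            unfolding diff_le_0_iff_le[of "k * y", symmetric] by (intro arg_cong2[where f="(\<le>)"]) (simp_all add: algebra_simps)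
          also have "\<dots> \<longleftrightarrow> k + s * t \<ge> 0" using that by (simp add: mult_le_0_iff)
          also have "\<dots> \<longleftrightarrow> - (k / s) \<le> t" using p by (auto simp: field_simps)
          finally show ?thesis .
        qed
        moreover have "s * (- y * t) + c * y \<le> 0 \<longleftrightarrow> t \<le> c / s"
        proof -
          have "s * (- y * t) + c * y \<le> 0 \<longleftrightarrow> y * (c - s * t) \<le> 0" by (simp add: algebra_simps)
          also have "\<dots> \<longleftrightarrow> c - s * t \<ge> 0" using that by (simp add: mult_le_0_iff)
          also have "\<dots> \<longleftrightarrow> t \<le> c / s" using p by (auto simp: field_simps)
          finally show ?thesis .
        qed
        ultimately show ?thesis by simp
      qed
    qed (use p c s1 kc in \<open>auto simp: power_divide distrib_left\<close>)
    finally show ?thesis by (simp add: sc)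
  qed
  also have "(\<integral>\<^sup>+q. f q * indicator TA q \<partial>lborel) = wedge_integral (k / sqrt (1 - k\<^sup>2)) (s / k) + wedge_integral (k / sqrt (1 - k\<^sup>2)) (s / c)"
  proof -
    have "(\<lambda>q. f q * indicator TA q) \<in> borel_measurable (lborel \<Otimes>\<^sub>M lborel)" by (simp add: lborel_prod)
    from lborel.nn_integral_fst[OF this]
    have "(\<integral>\<^sup>+q. f q * indicator TA q \<partial>lborel) = (\<integral>\<^sup>+x. \<integral>\<^sup>+y. f (x, y) * indicator TA (x, y) \<partial>lborel \<partial>lborel)"
      by (simp add: lborel_prod)
    also have "\<dots> = (\<integral>\<^sup>+x. (\<integral>\<^sup>+y. ennreal (1 / (1 - y\<^sup>2 - x\<^sup>2)) * indicator {y. s * x < k * y \<and> s * x + c * y \<le> 0} y \<partial>lborel) * indicator {- k..<0} x \<partial>lborel)"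
    proof (rule nn_integral_cong)
      fix x :: real
      have e: "1 - x\<^sup>2 - y\<^sup>2 = 1 - y\<^sup>2 - x\<^sup>2" for y by simp
      show "(\<integral>\<^sup>+y. f (x, y) * indicator TA (x, y) \<partial>lborel) = (\<integral>\<^sup>+y. ennreal (1 / (1 - y\<^sup>2 - x\<^sup>2)) * indicator {y. s * x < k * y \<and> s * x + c * y \<le> 0} y \<partial>lborel) * indicator {- k..<0} x"
        by (cases "x \<in> {- k..<0}") (auto intro!: nn_integral_cong simp: f_def TA_def indicator_def e)
    qed
    also have "\<dots> = wedge_integral (k / sqrt (1 - k\<^sup>2)) (s / k) + wedge_integral (k / sqrt (1 - k\<^sup>2)) (s / c)"
    proof (rule nn_integral_wedge)
      show "- x * t \<in> {y. s * x < k * y \<and> s * x + c * y \<le> 0} \<longleftrightarrow> - (s / k) \<le> t \<and> t \<le> s / c" if "x < 0" "t \<noteq> - (s / k)" for x t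
      proof -
        have "s * x < k * (- x * t) \<longleftrightarrow> - (s / k) \<le> t"
        proof -
          have "s * x < k * (- x * t) \<longleftrightarrow> x * (s + k * t) < 0"
            unfolding diff_less_0_iff_less[of "s * x", symmetric] by (intro arg_cong2[where f="(<)"]) (simp_all add: algebra_simps)
          also have "\<dots> \<longleftrightarrow> s + k * t > 0" using that by (simp add: mult_less_0_iff)
          also have "\<dots> \<longleftrightarrow> - (s / k) < t" using p by (auto simp: field_simps)
          finally show ?thesis using that by auto
        qed
        moreover have "s * x + c * (- x * t) \<le> 0 \<longleftrightarrow> t \<le> s / c"
        proof -
          have "s * x + c * (- x * t) \<le> 0 \<longleftrightarrow> x * (s - c * t) \<le> 0" by (simp add: algebra_simps)
          also have "\<dots> \<longleftrightarrow> s - c * t \<ge> 0" using that by (simp add: mult_le_0_iff)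
          also have "\<dots> \<longleftrightarrow> t \<le> s / c" using c by (auto simp: field_simps)
          finally show ?thesis .
        qed
        ultimately show ?thesis by simp
      qed
      show "k\<^sup>2 * (1 + (s / c)\<^sup>2) \<le> 1"
      proof -
        have "1 + (s / c)\<^sup>2 = 1 / c\<^sup>2" using p c by (simp add: power_divide field_simps)
        then show ?thesis using kc c by simp
      qed
    qed (use p c c1 kc in \<open>auto simp: power_divide distrib_left\<close>)
    finally show ?thesis .
  qed
  finally show ?thesis by (simp add: f_def add.commute)
qed

lemma hyp3_borel [measurable]: "hyp3 \<in> sets borel"
  unfolding hyp3_def
proof -
  have [measurable]: "(\<lambda>x :: lorentz4. fst x) \<in> borel_measurable borel"
    by (intro borel_measurable_continuous_onI continuous_intros)
  show "{x. lform x x = - 1 \<and> 0 < fst x} \<in> sets borel" by measurable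
qed

lemma hyp3_lightlike:
  assumes "q \<in> hyp3"
  shows "fst q - snd q $ 1 > 0"
    and "(fst q + snd q $ 1) * (fst q - snd q $ 1) = 1 + (snd q $ 2)\<^sup>2 + (snd q $ 3)\<^sup>2"
proof -
  show e: "(fst q + snd q $ 1) * (fst q - snd q $ 1) = 1 + (snd q $ 2)\<^sup>2 + (snd q $ 3)\<^sup>2"
    using assms by (simp add: hyp3_def lform_def inner_vec_def sum_3 algebra_simps power2_eq_square)
  have "(fst q + snd q $ 1) * (fst q - snd q $ 1) > 0" unfolding e by (simp add: add_pos_nonneg)
  then show "fst q - snd q $ 1 > 0" using assms by (auto simp: hyp3_def zero_less_mult_iff)
qed

text \<open>The distance from the origin is largest at a corner: its square is
  \<open>k\<^sup>2 + s\<^sup>2 < 1\<close> at the right angle, it is \<open>k / c < 1\<close> at the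
  corner below \<open>v b\<close>, and 1 only at the excluded corner. The cases on signs compare
  with these corners.\<close>

lemma cusp_triangle_disc:
  assumes p: "s\<^sup>2 + c\<^sup>2 = 1" "0 < k" "k < c" "0 < s" and q: "(x, y) \<in> cusp_triangle k s c" "(x, y) \<noteq> (c, - s)"
  shows "x\<^sup>2 + y\<^sup>2 < 1"
proof -
  have c: "c > 0" using p by simp
  have t: "- k \<le> x" "- s \<le> y" "s * x + c * y \<le> 0" using q by (auto simp: cusp_triangle_def)
  have x2: "x\<^sup>2 \<le> c\<^sup>2" if "x > 0"
  proof -
    have "s * x \<le> c * s" using t mult_left_mono[OF t(2), of c] c by simp
    then have "x \<le> c" using p by (simp add: mult.commute)
    then show ?thesis using that by (intro power_mono) auto
  qed
  have kc: "k\<^sup>2 < c\<^sup>2" using p by (intro power_strict_mono) auto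
  show ?thesis
  proof (cases "x > 0")
    case True
    have "c * y < 0" using True p t by (smt (verit) mult_pos_pos)
    then have y0: "y < 0" using c by (simp add: mult_less_0_iff)
    have "y\<^sup>2 \<le> s\<^sup>2" using t(2) y0 by (simp add: abs_le_square_iff[symmetric])
    moreover have "x\<^sup>2 < c\<^sup>2 \<or> y\<^sup>2 < s\<^sup>2"
    proof (rule ccontr)
      assume "\<not> ?thesis"
      then have "x\<^sup>2 = c\<^sup>2" "y\<^sup>2 = s\<^sup>2" using x2[OF True] \<open>y\<^sup>2 \<le> s\<^sup>2\<close> by auto
      then have "x = c" "y = - s" using True c y0 p by (auto simp: power2_eq_iff)
      then show False using q(2) by simp
    qed
    ultimately show ?thesis using x2[OF True] p(1) by linarith
  next
    case False
    then have xk: "x\<^sup>2 \<le> k\<^sup>2" using t(1) by (simp add: abs_le_square_iff[symmetric])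
    show ?thesis
    proof (cases "y \<le> 0")
      case True
      then have "y\<^sup>2 \<le> s\<^sup>2" using t(2) by (simp add: abs_le_square_iff[symmetric])
      then show ?thesis using xk kc p(1) by linarith
    next
      case False
      have "c * y \<le> s * - x" using t by simp
      then have "(c * y)\<^sup>2 \<le> (s * - x)\<^sup>2" using False c by (intro power_mono) auto
      then have "c\<^sup>2 * (x\<^sup>2 + y\<^sup>2) \<le> (s\<^sup>2 + c\<^sup>2) * x\<^sup>2" by (simp add: power_mult_distrib algebra_simps)
      also have "\<dots> \<le> k\<^sup>2" using xk p(1) by simp
      also have "\<dots> < c\<^sup>2 * 1" using kc by simp
      finally show ?thesis using c by (simp add: mult_less_cancel_left_pos)
    qed
  qed
qed

section \<open>Volumes of the simplex and of its cusps\<close>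

context cycle_simplex
begin

lemma simplex_borel [measurable]: "simplex_of v \<in> sets borel"
proof -
  have "simplex_of v = hyp3 \<inter> {x. lform x (n p) \<le> 0 \<and> lform x (n a) \<le> 0 \<and> lform x (n b) \<le> 0 \<and> lform x (n h) \<le> 0}"
    unfolding simplex_of_halfspaces[OF tet] all_indices by auto
  also have "\<dots> \<in> sets borel" by measurable
  finally show ?thesis .
qed

lemma simplex_subset: "simplex_of v \<subseteq> hyp3"
  by (auto simp: simplex_of_def)

text \<open>The first ratio is \<open>\<zeta>\<close>, so its bound means lying on or outside the
  unit hemisphere; the vertical walls become conditions on the base point alone.\<close>

lemma frame_simplex_ratio:
  assumes "q \<in> hyp3"
  shows "frame q \<in> simplex_of v \<longleftrightarrow> 1 \<le> (fst q + snd q $ 1) / (fst q - snd q $ 1) \<and>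
     (snd q $ 2 / (fst q - snd q $ 1), snd q $ 3 / (fst q - snd q $ 1)) \<in> cusp_triangle k s c"
proof -
  let ?w = "fst q - snd q $ 1"
  have w: "?w > 0" by (rule hyp3_lightlike[OF assms])
  have "frame q \<in> simplex_of v \<longleftrightarrow> snd q $ 1 \<ge> 0 \<and> snd q $ 2 \<ge> - k * ?w
     \<and> snd q $ 3 \<ge> - s * ?w \<and> s * (snd q $ 2) + c * (snd q $ 3) \<le> 0"
    using simplex_frame assms by blast
  moreover have "snd q $ 1 \<ge> 0 \<longleftrightarrow> 1 \<le> (fst q + snd q $ 1) / ?w" using w by (simp add: le_divide_eq)
  moreover have "snd q $ 2 \<ge> - k * ?w \<longleftrightarrow> - k \<le> snd q $ 2 / ?w" "snd q $ 3 \<ge> - s * ?w \<longleftrightarrow> - s \<le> snd q $ 3 / ?w"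
    by (simp_all only: pos_le_divide_eq[OF w])
  moreover have "s * (snd q $ 2) + c * (snd q $ 3) \<le> 0 \<longleftrightarrow> s * (snd q $ 2 / ?w) + c * (snd q $ 3 / ?w) \<le> 0"
  proof -
    have "s * (snd q $ 2 / ?w) + c * (snd q $ 3 / ?w) = (s * (snd q $ 2) + c * (snd q $ 3)) / ?w"
      by (simp add: add_divide_distrib)
    then show ?thesis using w by (simp add: divide_le_0_iff)
  qed
  ultimately show ?thesis by (simp add: cusp_triangle_def)
qed

lemma triangle_pred [measurable]: "Measurable.pred borel (\<lambda>(\<zeta> :: real, x, y). (x, y) \<in> cusp_triangle k s c)"
proof -
  have 1: "(\<lambda>x :: real \<times> real \<times> real. (fst (snd x), snd (snd x))) \<in> borel_measurable borel"
    by (intro borel_measurable_continuous_onI continuous_intros)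
  from measurable_sets[OF this cusp_triangle_borel[of k s c]]
  show ?thesis by (simp add: pred_def vimage_def case_prod_beta')
qed

lemma emeasure_simplex:
  "emeasure hyp_vol (simplex_of v) = ennreal (1 / 2) *
    (wedge_integral (s / c) (k / s) + wedge_integral (s / c) (c / s) +
      (wedge_integral (k / sqrt (1 - k\<^sup>2)) (s / k) + wedge_integral (k / sqrt (1 - k\<^sup>2)) (s / c)))"
proof -
  let ?P = "\<lambda>(\<zeta> :: real) x y. 1 \<le> \<zeta> \<and> (x, y) \<in> cusp_triangle k s c"
  have P: "Measurable.pred borel (\<lambda>(\<zeta>, x, y). ?P \<zeta> x y)"
  proof -
    have "Measurable.pred borel (\<lambda>x :: real \<times> real \<times> real. 1 \<le> fst x)"
      unfolding pred_def by (intro borel_closed) (simp add: closed_Collect_le continuous_on_fst continuous_on_const)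
    with triangle_pred show ?thesis unfolding case_prod_beta' pred_def by (intro sets.sets_Collect_conj)
  qed
  have "emeasure hyp_vol (simplex_of v) = emeasure hyp_vol (frame -` simplex_of v)"
    by (rule emeasure_hyp_vol_frame) (use simplex_subset in auto)
  also have "frame -` simplex_of v = {q \<in> hyp3. ?P ((fst q + snd q $ 1) / (fst q - snd q $ 1))
     (snd q $ 2 / (fst q - snd q $ 1)) (snd q $ 3 / (fst q - snd q $ 1))}"
    using frame_simplex_ratio frame_hyp3 simplex_subset by blast
  also have "emeasure hyp_vol \<dots> = ennreal (1 / 2) * (\<integral>\<^sup>+q. \<integral>\<^sup>+\<zeta>. ennreal (1 / (\<zeta> - (fst q)\<^sup>2 - (snd q)\<^sup>2)\<^sup>2) *
      indicator {\<zeta>. \<zeta> > (fst q)\<^sup>2 + (snd q)\<^sup>2 \<and> ?P \<zeta> (fst q) (snd q)} \<zeta> \<partial>lborel \<partial>lborel)"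
    by (rule emeasure_hyp_vol_half_space(2)[OF P])
  also have "(\<integral>\<^sup>+q. \<integral>\<^sup>+\<zeta>. ennreal (1 / (\<zeta> - (fst q)\<^sup>2 - (snd q)\<^sup>2)\<^sup>2) *
      indicator {\<zeta>. \<zeta> > (fst q)\<^sup>2 + (snd q)\<^sup>2 \<and> ?P \<zeta> (fst q) (snd q)} \<zeta> \<partial>lborel \<partial>lborel)
    = (\<integral>\<^sup>+q. ennreal (1 / (1 - (fst q)\<^sup>2 - (snd q)\<^sup>2)) * indicator (cusp_triangle k s c) q \<partial>lborel)"
  \<comment> \<open>Over \<open>(c, - s)\<close>, the ideal vertex, the integral in
    \<open>\<zeta>\<close> diverges; this base point is a null set.\<close>
  proof (rule nn_integral_cong_AE, rule AE_mp[OF AE_lborel_singleton[of "(c, - s)"]], rule AE_I2, intro impI)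
    fix q :: "real \<times> real" assume ne: "q \<noteq> (c, - s)"
    obtain x y where q: "q = (x, y)" by (cases q)
    show "(\<integral>\<^sup>+\<zeta>. ennreal (1 / (\<zeta> - (fst q)\<^sup>2 - (snd q)\<^sup>2)\<^sup>2) * indicator {\<zeta>. \<zeta> > (fst q)\<^sup>2 + (snd q)\<^sup>2 \<and> ?P \<zeta> (fst q) (snd q)} \<zeta> \<partial>lborel)
      = ennreal (1 / (1 - (fst q)\<^sup>2 - (snd q)\<^sup>2)) * indicator (cusp_triangle k s c) q"
    proof (cases "q \<in> cusp_triangle k s c")
      case True
      have lt: "x\<^sup>2 + y\<^sup>2 < 1" using cusp_triangle_disc[OF params] True ne q by auto
      have "(\<integral>\<^sup>+\<zeta>. ennreal (1 / (\<zeta> - (fst q)\<^sup>2 - (snd q)\<^sup>2)\<^sup>2) * indicator {\<zeta>. \<zeta> > (fst q)\<^sup>2 + (snd q)\<^sup>2 \<and> ?P \<zeta> (fst q) (snd q)} \<zeta> \<partial>lborel)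
        = (\<integral>\<^sup>+\<zeta>. ennreal (1 / (\<zeta> - (x\<^sup>2 + y\<^sup>2))\<^sup>2) * indicator {1..} \<zeta> \<partial>lborel)"
        using True lt by (intro nn_integral_cong) (auto simp: q indicator_def diff_diff_eq)
      also have "\<dots> = ennreal (1 / (1 - (x\<^sup>2 + y\<^sup>2)))"
        by (rule nn_integral_inverse_square_tail[OF lt])
      finally show ?thesis using True by (simp add: q diff_diff_eq)
    qed (simp add: q)
  qed
  finally show ?thesis unfolding nn_integral_cusp_triangle[OF params] .
qed

text \<open>In the half-space the horoball is everything of height at least
  \<open>1 / \<sigma>\<close>. By \<open>\<sigma> \<le> 1\<close> this lies above the unit
  hemisphere, so the cusp is a full vertical prism over the triangle, of volume area times
  \<open>\<sigma>\<^sup>2 / 2\<close>.\<close>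

lemma emeasure_horoball:
  assumes \<sigma>: "0 < \<sigma>" "\<sigma> \<le> 1"
  shows "emeasure hyp_vol ({x \<in> hyp3. - lform x cusp \<le> \<sigma> / 2} \<inter> simplex_of v) = ennreal (\<sigma>\<^sup>2 * (s * (k + c)\<^sup>2 / (4 * c)))"
proof -
  let ?B = "{x \<in> hyp3. - lform x cusp \<le> \<sigma> / 2} \<inter> simplex_of v"
  let ?P = "\<lambda>\<zeta> x y. 1 / \<sigma>\<^sup>2 \<le> \<zeta> - x\<^sup>2 - y\<^sup>2 \<and> (x, y) \<in> cusp_triangle k s c"
  have P: "Measurable.pred borel (\<lambda>(\<zeta>, x, y). ?P \<zeta> x y)"
  proof -
    have "Measurable.pred borel (\<lambda>x :: real \<times> real \<times> real. 1 / \<sigma>\<^sup>2 \<le> fst x - (fst (snd x))\<^sup>2 - (snd (snd x))\<^sup>2)"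
      unfolding pred_def space_borel by (intro borel_closed) (simp, intro closed_Collect_le continuous_intros)
    with triangle_pred show ?thesis unfolding case_prod_beta' pred_def by (intro sets.sets_Collect_conj)
  qed
  have \<sigma>2: "1 / \<sigma>\<^sup>2 \<ge> 1" using \<sigma> by (simp add: power_le_one)
  have "emeasure hyp_vol ?B = emeasure hyp_vol (frame -` ?B)"
    by (rule emeasure_hyp_vol_frame) (use simplex_subset in auto)
  also have "frame -` ?B = {q \<in> hyp3. ?P ((fst q + snd q $ 1) / (fst q - snd q $ 1))
     (snd q $ 2 / (fst q - snd q $ 1)) (snd q $ 3 / (fst q - snd q $ 1))}"
  proof -
    have "frame q \<in> ?B \<longleftrightarrow> ?P ((fst q + snd q $ 1) / (fst q - snd q $ 1))
     (snd q $ 2 / (fst q - snd q $ 1)) (snd q $ 3 / (fst q - snd q $ 1))" if q: "q \<in> hyp3" for q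
    proof -
      define w where "w = fst q - snd q $ 1"
      define x y where "x = snd q $ 2 / w" and "y = snd q $ 3 / w"
      have w: "w > 0" using hyp3_lightlike(1)[OF q] by (simp add: w_def)
      have "(fst q + snd q $ 1) * w = 1 + (w * x)\<^sup>2 + (w * y)\<^sup>2"
        using hyp3_lightlike(2)[OF q] w by (simp add: w_def[symmetric] x_def y_def)
      then have z: "(fst q + snd q $ 1) / w = 1 / w\<^sup>2 + x\<^sup>2 + y\<^sup>2"
        using w by (simp add: field_simps power2_eq_square)
      have "w \<le> \<sigma> \<longleftrightarrow> 1 / \<sigma>\<^sup>2 \<le> 1 / w\<^sup>2"
        using w \<sigma> by (simp add: field_simps abs_le_square_iff[symmetric])
      then have B: "- lform (frame q) cusp \<le> \<sigma> / 2 \<longleftrightarrow> 1 / \<sigma>\<^sup>2 \<le> (fst q + snd q $ 1) / w - x\<^sup>2 - y\<^sup>2"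
        unfolding z frame_normal w_def[symmetric] by simp
      moreover have "1 \<le> (fst q + snd q $ 1) / w" if "1 / \<sigma>\<^sup>2 \<le> (fst q + snd q $ 1) / w - x\<^sup>2 - y\<^sup>2"
        using that \<sigma>2 zero_le_power2[of x] zero_le_power2[of y] by linarith
      moreover have "frame q \<in> simplex_of v \<longleftrightarrow> 1 \<le> (fst q + snd q $ 1) / w \<and> (x, y) \<in> cusp_triangle k s c"
        unfolding x_def y_def w_def by (rule frame_simplex_ratio[OF q])
      ultimately show ?thesis
        using q unfolding w_def[symmetric] x_def[symmetric] y_def[symmetric] by (auto simp: frame_hyp3)
    qed
    moreover have "frame q \<notin> ?B" if "q \<notin> hyp3" for q using that frame_hyp3 by auto
    ultimately show ?thesis by blast
  qed
  also have "emeasure hyp_vol \<dots> = ennreal (1 / 2) * (\<integral>\<^sup>+q. \<integral>\<^sup>+\<zeta>. ennreal (1 / (\<zeta> - (fst q)\<^sup>2 - (snd q)\<^sup>2)\<^sup>2) *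
      indicator {\<zeta>. \<zeta> > (fst q)\<^sup>2 + (snd q)\<^sup>2 \<and> ?P \<zeta> (fst q) (snd q)} \<zeta> \<partial>lborel \<partial>lborel)"
    by (rule emeasure_hyp_vol_half_space(2)[OF P])
  also have "(\<integral>\<^sup>+q. \<integral>\<^sup>+\<zeta>. ennreal (1 / (\<zeta> - (fst q)\<^sup>2 - (snd q)\<^sup>2)\<^sup>2) *
      indicator {\<zeta>. \<zeta> > (fst q)\<^sup>2 + (snd q)\<^sup>2 \<and> ?P \<zeta> (fst q) (snd q)} \<zeta> \<partial>lborel \<partial>lborel)
    = (\<integral>\<^sup>+q. ennreal (\<sigma>\<^sup>2) * indicator (cusp_triangle k s c) q \<partial>lborel)"
  proof (rule nn_integral_cong)
    fix q :: "real \<times> real"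
    obtain x y where q: "q = (x, y)" by (cases q)
    show "(\<integral>\<^sup>+\<zeta>. ennreal (1 / (\<zeta> - (fst q)\<^sup>2 - (snd q)\<^sup>2)\<^sup>2) * indicator {\<zeta>. \<zeta> > (fst q)\<^sup>2 + (snd q)\<^sup>2 \<and> ?P \<zeta> (fst q) (snd q)} \<zeta> \<partial>lborel)
      = ennreal (\<sigma>\<^sup>2) * indicator (cusp_triangle k s c) q"
    proof (cases "q \<in> cusp_triangle k s c")
      case True
      have pos: "1 / \<sigma>\<^sup>2 > 0" using \<sigma> by simp
      have "(\<integral>\<^sup>+\<zeta>. ennreal (1 / (\<zeta> - (fst q)\<^sup>2 - (snd q)\<^sup>2)\<^sup>2) * indicator {\<zeta>. \<zeta> > (fst q)\<^sup>2 + (snd q)\<^sup>2 \<and> ?P \<zeta> (fst q) (snd q)} \<zeta> \<partial>lborel)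
        = (\<integral>\<^sup>+\<zeta>. ennreal (1 / (\<zeta> - (x\<^sup>2 + y\<^sup>2))\<^sup>2) * indicator {x\<^sup>2 + y\<^sup>2 + 1 / \<sigma>\<^sup>2..} \<zeta> \<partial>lborel)"
      proof (rule nn_integral_cong)
        fix \<zeta> :: real
        have "\<zeta> > x\<^sup>2 + y\<^sup>2 \<and> 1 / \<sigma>\<^sup>2 \<le> \<zeta> - x\<^sup>2 - y\<^sup>2 \<longleftrightarrow> x\<^sup>2 + y\<^sup>2 + 1 / \<sigma>\<^sup>2 \<le> \<zeta>" using pos by linarith
        then have "\<zeta> \<in> {\<zeta>. \<zeta> > (fst q)\<^sup>2 + (snd q)\<^sup>2 \<and> ?P \<zeta> (fst q) (snd q)} \<longleftrightarrow> \<zeta> \<in> {x\<^sup>2 + y\<^sup>2 + 1 / \<sigma>\<^sup>2..}"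
          using True unfolding q by auto
        then show "ennreal (1 / (\<zeta> - (fst q)\<^sup>2 - (snd q)\<^sup>2)\<^sup>2) * indicator {\<zeta>. \<zeta> > (fst q)\<^sup>2 + (snd q)\<^sup>2 \<and> ?P \<zeta> (fst q) (snd q)} \<zeta>
          = ennreal (1 / (\<zeta> - (x\<^sup>2 + y\<^sup>2))\<^sup>2) * indicator {x\<^sup>2 + y\<^sup>2 + 1 / \<sigma>\<^sup>2..} \<zeta>"
          by (simp only: indicator_def q fst_conv snd_conv diff_diff_eq)
      qed
      also have "\<dots> = ennreal (1 / (x\<^sup>2 + y\<^sup>2 + 1 / \<sigma>\<^sup>2 - (x\<^sup>2 + y\<^sup>2)))"
        by (rule nn_integral_inverse_square_tail) (use pos in simp)
      finally show ?thesis using True by simp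
    qed (simp add: q)
  qed
  also have "\<dots> = ennreal (\<sigma>\<^sup>2) * emeasure lborel (cusp_triangle k s c)"
    by (subst nn_integral_cmult) simp_all
  also have "\<dots> = ennreal (\<sigma>\<^sup>2) * ennreal (s * (k + c)\<^sup>2 / (2 * c))"
    using params c_pos by (subst emeasure_cusp_triangle) auto
  also have "ennreal (1 / 2) * \<dots> = ennreal (1 / 2 * (\<sigma>\<^sup>2 * (s * (k + c)\<^sup>2 / (2 * c))))"
    using params c_pos by (subst ennreal_mult[symmetric], simp, simp)+ simp
  also have "1 / 2 * (\<sigma>\<^sup>2 * (s * (k + c)\<^sup>2 / (2 * c))) = \<sigma>\<^sup>2 * (s * (k + c)\<^sup>2 / (4 * c))" by simp
  finally show ?thesis .
qed

end

section \<open>Reflections and alternating words\<close>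

lemma reflection_lform: "lform n n = 1 \<Longrightarrow> lform (reflection n x) (reflection n y) = lform x y"
  by (simp add: reflection_def lform_bilinear lform_commute[of n y] algebra_simps)

lemma reflection_involution: "lform n n = 1 \<Longrightarrow> reflection n (reflection n x) = x"
  by (simp add: reflection_def lform_bilinear algebra_simps)

lemma reflection_adjoint: "lform (reflection n x) y = lform x (reflection n y)"
  by (simp add: reflection_def lform_bilinear lform_commute[of n y])

lemma fst_pos_of_lform_neg:
  assumes "lform z z \<le> 0" "x \<in> hyp3" "lform z x < 0" shows "fst z > 0"
proof (rule ccontr)
  assume a: "\<not> fst z > 0"
  have "fst z \<noteq> 0"
  proof
    assume "fst z = 0"
    then have "snd z \<bullet> snd z = 0" using assms(1) inner_ge_zero[of "snd z"] by (simp add: lform_def)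
    then have "z = 0" using \<open>fst z = 0\<close> by (simp add: prod_eq_iff)
    then show False using assms(3) by (simp add: lform_bilinear)
  qed
  then have "causal (- z)" using assms(1) a by (simp add: causal_def lform_bilinear)
  from causal_lform_nonpos[OF this hyp3_causal[OF assms(2)]] assms(3) show False by (simp add: lform_bilinear)
qed

text \<open>The product of \<open>x\<close> and its mirror image is
  \<open>- 1 - 2 (lform x n)\<^sup>2\<close>, which is negative, so the image stays on the same
  sheet.\<close>

lemma reflection_hyp3:
  assumes "lform n n = 1" "x \<in> hyp3" shows "reflection n x \<in> hyp3"
proof -
  have "lform (reflection n x) (reflection n x) = -1"
    using assms by (simp add: reflection_lform hyp3_def)
  moreover have "lform (reflection n x) x < 0"
  proof -
    have "lform (reflection n x) x = - 1 - 2 * (lform x n)\<^sup>2"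
      using assms(2) by (simp add: reflection_def lform_bilinear lform_commute[of n] hyp3_def power2_eq_square)
    then show ?thesis using zero_le_power2[of "lform x n"] by linarith
  qed
  ultimately show ?thesis using fst_pos_of_lform_neg[of "reflection n x" x] assms(2) by (simp add: hyp3_def)
qed

primrec alternating :: "'i \<Rightarrow> 'i \<Rightarrow> nat \<Rightarrow> 'i list" where
  "alternating s t 0 = []"
| "alternating s t (Suc k) = s # alternating t s k"

lemma length_alternating [simp]: "length (alternating s t k) = k"
  by (induction k arbitrary: s t) auto

lemma alternating_add:
  "alternating s t (i + j) = alternating s t i @ (if even i then alternating s t j else alternating t s j)"
  by (induction i arbitrary: s t) auto

section \<open>Tits' lemma\<close>

text \<open>All labels are finite, so any two generators span a finite dihedral group. The
  \<open>chamber\<close> is a cone in the whole Lorentzian space: besides the simplex it contains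
  the lightlike vectors that represent its cusps.\<close>

locale coxeter_system =
  fixes n :: "'i \<Rightarrow> lorentz4"
  assumes norm: "lform (n i) (n i) = 1"
    and angles: "i \<noteq> j \<Longrightarrow> \<exists>m :: nat. 2 \<le> m \<and> lform (n i) (n j) = - cos (pi / real m)"
begin

abbreviation r where "r i \<equiv> reflection (n i)"

abbreviation act :: "'i list \<Rightarrow> lorentz4 \<Rightarrow> lorentz4" where "act \<equiv> foldr r"

abbreviation chamber :: "lorentz4 set" where "chamber \<equiv> {x. \<forall>j. lform x (n j) \<le> 0}"

lemma r_r [simp]: "r i (r i x) = x"
  by (rule reflection_involution[OF norm])

text \<open>Word length as a function of the transformation, meaningful for maps of the form
  \<open>act ws\<close>; different words for one map thus need no comparison.\<close>

definition len :: "(lorentz4 \<Rightarrow> lorentz4) \<Rightarrow> nat" where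
  "len g = (LEAST k. \<exists>ws. length ws = k \<and> act ws = g)"

lemma len_le: "len (act ws) \<le> length ws"
  unfolding len_def by (rule Least_le) auto

lemma reduced_word: "\<exists>ws. length ws = len (act us) \<and> act ws = act us"
  unfolding len_def by (rule LeastI_ex) auto

lemma len_le_add: "len (act us \<circ> act ws) \<le> length us + len (act ws)"
proof -
  obtain w' where w': "length w' = len (act ws)" "act w' = act ws" using reduced_word by blast
  have "act us \<circ> act ws = act (us @ w')" by (auto simp: w')
  then show ?thesis using len_le[of "us @ w'"] w'(1) by simp
qed

text \<open>The components along the two roots of a point moved by an alternating word obey the Chebyshev
  recursion.\<close>

lemma alternating_components:
  assumes "lform (n s) (n t) = - cos \<theta>"
  shows "sin \<theta> * lform (act (alternating t s k) y) (n s) =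
      sin (real (k + 1) * \<theta>) * lform y (n (if even k then s else t)) + sin (real k * \<theta>) * lform y (n (if even k then t else s))
    \<and> sin \<theta> * lform (act (alternating t s k) y) (n t) =
      - (sin (real k * \<theta>) * lform y (n (if even k then s else t)) + sin ((real k - 1) * \<theta>) * lform y (n (if even k then t else s)))"
  using assms
proof (induction k arbitrary: s t)
  case 0
  then show ?case by simp
next
  case (Suc k)
  let ?z = "act (alternating s t k) y"
  define p q where "p = lform y (n (if even k then s else t))" and "q = lform y (n (if even k then t else s))"
  have IH: "sin \<theta> * lform ?z (n t) = sin (real (k + 1) * \<theta>) * q + sin (real k * \<theta>) * p"
    "sin \<theta> * lform ?z (n s) = - (sin (real k * \<theta>) * q + sin ((real k - 1) * \<theta>) * p)"
    using Suc.IH[of t s] Suc.prems unfolding p_def q_def by (auto simp: lform_commute)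
  have rec: "sin ((a + 1) * \<theta>) = 2 * cos \<theta> * sin (a * \<theta>) - sin ((a - 1) * \<theta>)" for a
    by (simp add: distrib_right left_diff_distrib sin_add sin_diff)
  have a2: "sin (real (Suc k) * \<theta>) = 2 * cos \<theta> * sin (real k * \<theta>) - sin ((real k - 1) * \<theta>)"
    using rec[of "real k"] by (simp add: add.commute)
  have a3: "sin (real (Suc k + 1) * \<theta>) = 2 * cos \<theta> * sin (real (k + 1) * \<theta>) - sin (real k * \<theta>)"
    using rec[of "real k + 1"] by (simp add: algebra_simps)
  have 1: "lform (r t ?z) (n t) = - lform ?z (n t)"
    by (simp add: reflection_def lform_bilinear norm)
  have 2: "lform (r t ?z) (n s) = lform ?z (n s) + 2 * cos \<theta> * lform ?z (n t)"
    using Suc.prems by (simp add: reflection_def lform_bilinear lform_commute[of "n t"])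
  have "sin \<theta> * lform (r t ?z) (n s) = sin \<theta> * lform ?z (n s) + 2 * cos \<theta> * (sin \<theta> * lform ?z (n t))"
    unfolding 2 by (simp add: algebra_simps)
  also have "\<dots> = sin (real (Suc k + 1) * \<theta>) * q + sin (real (Suc k) * \<theta>) * p"
    unfolding IH a3 a2 by algebra
  finally have "sin \<theta> * lform (r t ?z) (n s) = sin (real (Suc k + 1) * \<theta>) * q + sin (real (Suc k) * \<theta>) * p" .
  moreover have "sin \<theta> * lform (r t ?z) (n t) = - (sin (real (Suc k) * \<theta>) * q + sin ((real (Suc k) - 1) * \<theta>) * p)"
    unfolding 1 using IH(1) by (simp add: algebra_simps)
  ultimately show ?case unfolding p_def q_def by auto
qed

lemma dihedral_displacement:
  "set ws \<subseteq> {s, t} \<Longrightarrow> \<exists>\<alpha> \<beta>. act ws y = y + \<alpha> *\<^sub>R n s + \<beta> *\<^sub>R n t"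
proof (induction ws)
  case Nil
  show ?case by (rule exI[of _ 0], rule exI[of _ 0]) simp
next
  case (Cons u ws)
  then obtain \<alpha> \<beta> where e: "act ws y = y + \<alpha> *\<^sub>R n s + \<beta> *\<^sub>R n t" by auto
  define l where "l = 2 * lform (act ws y) (n u)"
  have "act (u # ws) y = y + \<alpha> *\<^sub>R n s + \<beta> *\<^sub>R n t - l *\<^sub>R n u"
    by (simp add: reflection_def l_def) (simp add: e)
  moreover have "u = s \<or> u = t" using Cons.prems by auto
  ultimately have "act (u # ws) y = y + (\<alpha> - l) *\<^sub>R n s + \<beta> *\<^sub>R n t \<or> act (u # ws) y = y + \<alpha> *\<^sub>R n s + (\<beta> - l) *\<^sub>R n t"
    by (auto simp: algebra_simps)
  then show ?case by blast
qed

lemma set_alternating: "set (alternating s t k) \<subseteq> {s, t}"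
  by (induction k arbitrary: s t) auto

text \<open>Both sides move \<open>y\<close> within the span of \<open>n s\<close> and
  \<open>n t\<close>, and by \<open>m \<theta> = pi\<close> the Chebyshev coefficients give them the
  same products with both roots. The Gram determinant of the roots is the square of
  \<open>sin \<theta>\<close>, hence nonzero, and the displacements agree.\<close>

lemma braid:
  assumes m: "2 \<le> m" "lform (n s) (n t) = - cos (pi / real m)"
  shows "act (alternating s t m) = act (alternating t s m)"
proof
  fix y
  define \<theta> where "\<theta> = pi / real m"
  have sin: "sin \<theta> > 0" using m(1) by (intro sin_gt_zero) (auto simp: \<theta>_def field_simps)
  have mt: "real m * \<theta> = pi" using m(1) by (simp add: \<theta>_def)
  have s3: "sin (real m * \<theta>) = 0" "sin (real (m + 1) * \<theta>) = - sin \<theta>" "sin ((real m - 1) * \<theta>) = sin \<theta>"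
    using mt by (simp_all add: distrib_right left_diff_distrib sin_add sin_diff)
  have e: "lform (n s) (n t) = - cos \<theta>" "lform (n t) (n s) = - cos \<theta>" using m(2) by (simp_all add: \<theta>_def lform_commute)
  note c1 = alternating_components[OF e(1), of m y, unfolded s3]
  note c2 = alternating_components[OF e(2), of m y, unfolded s3]
  have "sin \<theta> * lform (act (alternating s t m) y) (n s) = sin \<theta> * lform (act (alternating t s m) y) (n s)"
    using conjunct1[OF c1] conjunct2[OF c2] by linarith
  moreover have "sin \<theta> * lform (act (alternating s t m) y) (n t) = sin \<theta> * lform (act (alternating t s m) y) (n t)"
    using conjunct2[OF c1] conjunct1[OF c2] by linarith
  ultimately have "sin \<theta> * lform (act (alternating s t m) y) (n u) = sin \<theta> * lform (act (alternating t s m) y) (n u)" if "u \<in> {s, t}" for u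
    using that by blast
  then have eq: "lform (act (alternating s t m) y) (n u) = lform (act (alternating t s m) y) (n u)" if "u \<in> {s, t}" for u
    using that sin by simp
  obtain \<alpha> \<beta> where ab: "act (alternating s t m) y = y + \<alpha> *\<^sub>R n s + \<beta> *\<^sub>R n t"
    using dihedral_displacement[OF set_alternating] by blast
  obtain \<alpha>' \<beta>' where ab': "act (alternating t s m) y = y + \<alpha>' *\<^sub>R n s + \<beta>' *\<^sub>R n t"
    using dihedral_displacement[of "alternating t s m" s t y] set_alternating[of t s m] by (auto simp: insert_commute)
  have 1: "(\<alpha> - \<alpha>') = (\<beta> - \<beta>') * cos \<theta>" using eq[of s] unfolding ab ab'
    by (simp add: lform_bilinear norm e algebra_simps)
  have 2: "(\<beta> - \<beta>') = (\<alpha> - \<alpha>') * cos \<theta>" using eq[of t] unfolding ab ab'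
    by (simp add: lform_bilinear norm e algebra_simps)
  have "(\<alpha> - \<alpha>') * (1 - (cos \<theta>)\<^sup>2) = 0" using 1 2 by (simp add: power2_eq_square algebra_simps)
  then have "\<alpha> = \<alpha>'" using sin by (simp add: sin_squared_eq[symmetric])
  then have "\<beta> = \<beta>'" using 2 by simp
  show "act (alternating s t m) y = act (alternating t s m) y"
    unfolding ab ab' using \<open>\<alpha> = \<alpha>'\<close> \<open>\<beta> = \<beta>'\<close> by simp
qed

text \<open>A new first letter either extends an alternating word or cancels its first
  letter.\<close>

lemma dihedral_normal_form:
  "set ws \<subseteq> {s, t} \<Longrightarrow> \<exists>k \<le> length ws. act ws = act (alternating s t k) \<or> act ws = act (alternating t s k)"
proof (induction ws)
  case Nil
  show ?case by (intro exI[of _ 0]) simp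
next
  case (Cons u ws)
  have step: "\<exists>k \<le> Suc l. act (a # us) = act (alternating a b k) \<or> act (a # us) = act (alternating b a k)"
    if "act us = act (alternating a b l) \<or> act us = act (alternating b a l)" for a b l us
    using that
  proof
    assume e: "act us = act (alternating a b l)"
    show ?thesis
    proof (cases l)
      case 0
      then show ?thesis using e by (intro exI[of _ 1]) auto
    next
      case (Suc i)
      then have "act (a # us) = act (alternating b a i)" by (auto simp: e)
      then show ?thesis using Suc by (intro exI[of _ i]) auto
    qed
  next
    assume e: "act us = act (alternating b a l)"
    then have "act (a # us) = act (alternating a b (Suc l))" by auto
    then show ?thesis by blast
  qed
  from Cons obtain l where l: "l \<le> length ws" "act ws = act (alternating s t l) \<or> act ws = act (alternating t s l)" by auto
  have "u = s \<or> u = t" using Cons.prems by auto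
  then obtain k where "k \<le> Suc l" "act (u # ws) = act (alternating s t k) \<or> act (u # ws) = act (alternating t s k)"
    using step[of ws s t l] step[of ws t s l] l(2) by blast
  moreover from this have "k \<le> length (u # ws)" using l(1) by simp
  ultimately show ?case by blast
qed

text \<open>Tits' lemma, by induction on the length: split off from \<open>g\<close> on the left as long a word in \<open>s\<close>
  and some second generator \<open>t\<close> as possible, apply the induction hypothesis to what remains, and
  compute in the dihedral group generated by \<open>s\<close> and \<open>t\<close>.\<close>

lemma chamber_side:
  assumes "len (r s \<circ> act ws) \<ge> len (act ws)" "x \<in> chamber"
  shows "lform (act ws x) (n s) \<le> 0"
  using assms(1)
proof (induction "len (act ws)" arbitrary: ws s rule: less_induct)
  case less
  obtain us where us: "length us = len (act ws)" "act us = act ws" using reduced_word by blast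
  define N where "N = len (act ws)"
  show ?case
  proof (cases us)
    case Nil
    then have "act ws = act []" using us by simp
    then show ?thesis using assms(2) by simp
  next
    case (Cons t us')
    have lt: "len (r t \<circ> act ws) < N"
    proof -
      have "r t \<circ> act ws = act us'" by (auto simp: us(2)[symmetric] Cons)
      then show ?thesis using len_le[of us'] us(1) Cons by (simp add: N_def)
    qed
    then have st: "t \<noteq> s" using less.prems by (auto simp: N_def)
    \<comment> \<open>\<open>Q k\<close>: a word of length \<open>k\<close> in \<open>s\<close> and
      \<open>t\<close> splits off on the left without loss of length. A reduced word starting with
      \<open>t\<close> gives \<open>Q 1\<close>; below, \<open>k\<close> is the largest such number,
      and \<open>1 \<le> k\<close> makes the remainder shorter.\<close>
    define Q where "Q k \<longleftrightarrow> (\<exists>ds vs. set ds \<subseteq> {s, t} \<and> length ds = k \<and> act ws = act ds \<circ> act vs \<and> k + len (act vs) = N)" for k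
    have "Q 1"
    proof -
      have "act ws = act [t] \<circ> act us'" by (auto simp: us(2)[symmetric] Cons)
      moreover from this have "len (act ws) \<le> 1 + len (act us')" using len_le_add[of "[t]" us'] by simp
      moreover have "len (act us') \<le> length us'" by (rule len_le)
      ultimately show ?thesis unfolding Q_def N_def using us(1) Cons
        by (intro exI[of _ "[t]"] exI[of _ us']) auto
    qed
    moreover have bound: "\<forall>k. Q k \<longrightarrow> k \<le> N" by (auto simp: Q_def)
    ultimately obtain k where k: "Q k" "1 \<le> k" "\<And>j. Q j \<Longrightarrow> j \<le> k"
      by (metis GreatestI_nat Greatest_le_nat)
    then obtain ds vs where ds: "set ds \<subseteq> {s, t}" "length ds = k" "act ws = act ds \<circ> act vs" "k + len (act vs) = N"
      by (auto simp: Q_def)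
    \<comment> \<open>If \<open>u\<close> shortened the remainder, moving it over to
      \<open>ds\<close> would give \<open>Q (k + 1)\<close>, against the choice of
      \<open>k\<close>.\<close>
    have up: "len (r u \<circ> act vs) \<ge> len (act vs)" if u: "u \<in> {s, t}" for u
    proof (rule ccontr)
      assume a: "\<not> ?thesis"
      have e: "r u \<circ> act vs = act (u # vs)" by auto
      have "act ws = act (ds @ [u]) \<circ> act (u # vs)" by (auto simp: ds(3))
      moreover from this have "N \<le> k + 1 + len (act (u # vs))"
        using len_le_add[of "ds @ [u]" "u # vs"] ds(2) by (simp add: N_def)
      ultimately have "Q (k + 1)" unfolding Q_def using a ds u e
        by (intro exI[of _ "ds @ [u]"] exI[of _ "u # vs"]) (auto simp del: foldr.simps)
      then show False using k(3) by fastforce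
    qed
    have neg: "lform (act vs x) (n u) \<le> 0" if "u \<in> {s, t}" for u
      by (rule less.hyps) (use up[OF that] ds(4) k(2) in \<open>auto simp: N_def\<close>)
    have red: "k \<le> length ds'" if "act ds' = act ds" for ds'
      using len_le_add[of ds' vs] that ds by (simp add: N_def)
    \<comment> \<open>No expression of \<open>act ds\<close> of length at most \<open>k\<close>
      begins with \<open>s\<close>: cancelling that letter would make
      \<open>r s \<circ> act ws\<close> shorter than \<open>act ws\<close>.\<close>
    have nots: False if e: "act ds = act (s # es)" "length es < k" for es
    proof -
      have "r s \<circ> act ws = act es \<circ> act vs" by (auto simp: ds(3) e(1))
      then have "len (r s \<circ> act ws) \<le> length es + len (act vs)" using len_le_add by simp
      then show False using less.prems ds(4) e(2) by (simp add: N_def)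
    qed
    obtain j where j: "j \<le> k" "act ds = act (alternating s t j) \<or> act ds = act (alternating t s j)"
      using dihedral_normal_form[OF ds(1)] ds(2) by auto
    then have jk: "j = k" using red[of "alternating s t j"] red[of "alternating t s j"] by auto
    obtain k' where k': "k = Suc k'" using k(2) by (cases k) auto
    have alt: "act ds = act (alternating t s k)"
      using j(2) nots[of "alternating t s k'"] unfolding jk k' by auto
    obtain m :: nat where m: "2 \<le> m" "lform (n s) (n t) = - cos (pi / real m)" using angles st by metis
    \<comment> \<open>From length \<open>m\<close> on, the braid relation would rewrite
      \<open>ds\<close> so that it begins with \<open>s\<close>.\<close>
    have km: "k < m"
    proof (rule ccontr)
      assume "\<not> k < m"
      then obtain d where d: "k = m + d" using le_Suc_ex by (metis not_less)
      obtain m' where m': "m = Suc m'" using m(1) by (cases m) auto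
      define rest where "rest = (if even m then alternating t s d else alternating s t d)"
      have "act ds = act (alternating t s m @ rest)" using alt unfolding d alternating_add rest_def .
      also have "\<dots> = act (alternating s t m @ rest)" using braid[OF m] by auto
      also have "\<dots> = act (s # (alternating t s m' @ rest))" by (simp add: m')
      finally have "act ds = act (s # (alternating t s m' @ rest))" .
      moreover have "length rest = d" by (simp add: rest_def)
      then have "length (alternating t s m' @ rest) < k" by (simp add: d m')
      ultimately show False by (rule nots)
    qed
    define \<theta> where "\<theta> = pi / real m"
    have \<theta>: "0 < \<theta>" "real m * \<theta> = pi" using m(1) by (auto simp: \<theta>_def)
    have sin: "sin \<theta> > 0" using m(1) by (intro sin_gt_zero) (auto simp: \<theta>_def field_simps)
    \<comment> \<open>By \<open>k < m\<close> both multiples of \<open>\<theta>\<close> stay between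
      0 and \<open>pi\<close>, so the product with \<open>n s\<close> is a combination, with
      nonnegative coefficients, of the two nonpositive products from the induction
      hypothesis.\<close>
    have "real (k + 1) * \<theta> \<le> real m * \<theta>" using km \<theta>(1) by (intro mult_right_mono) auto
    then have s1: "sin (real (k + 1) * \<theta>) \<ge> 0" using \<theta> by (intro sin_ge_zero) auto
    have "real k * \<theta> \<le> real m * \<theta>" using km \<theta>(1) by (intro mult_right_mono) auto
    then have s2: "sin (real k * \<theta>) \<ge> 0" using \<theta> by (intro sin_ge_zero) auto
    have "sin \<theta> * lform (act ws x) (n s) =
      sin (real (k + 1) * \<theta>) * lform (act vs x) (n (if even k then s else t)) + sin (real k * \<theta>) * lform (act vs x) (n (if even k then t else s))"
      using alternating_components[of s t \<theta> k "act vs x"] m(2) unfolding ds(3) alt \<theta>_def by simp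
    also have "\<dots> \<le> 0"
      using neg s1 s2 by (intro add_nonpos_nonpos mult_nonneg_nonpos) auto
    finally show ?thesis using sin by (simp add: mult_le_0_iff)
  qed
qed

text \<open>All generators but \<open>r i\<close> fix \<open>e\<close>, as for the vector of the
  vertex opposite facet \<open>i\<close>. By \<open>chamber_side\<close> every further letter of a
  reduced word reflects the vector away from the chamber, which only lowers its products with
  chamber vectors; so the closest image other than \<open>e\<close> is \<open>r i e\<close>.\<close>

lemma orbit_dichotomy:
  assumes e: "\<And>j. j \<noteq> i \<Longrightarrow> lform e (n j) = 0" "lform e (n i) \<le> 0"
  shows "act ws e = e \<or> (\<forall>x\<in>chamber. lform x (act ws e) \<le> lform x (r i e))"
proof (induction "len (act ws)" arbitrary: ws rule: less_induct)
  case less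
  obtain us where us: "length us = len (act ws)" "act us = act ws" using reduced_word by blast
  have "lform e (n j) \<le> 0" for j using e(1)[of j] e(2) by (cases "j = i") auto
  then have ec: "e \<in> chamber" by simp
  show ?case
  proof (cases us)
    case Nil
    then have "act ws = act []" using us by simp
    then show ?thesis by simp
  next
    case (Cons t us')
    have w: "act ws = r t \<circ> act us'" by (auto simp: us(2)[symmetric] Cons)
    have lt: "len (act us') < len (act ws)" using len_le[of us'] us(1) Cons by simp
    then have "lform (act us' e) (n t) \<le> 0"
      by (intro chamber_side) (use w ec in auto)
    then have le: "lform x (act ws e) \<le> lform x (act us' e)" if "x \<in> chamber" for x
      using that by (simp add: w reflection_def lform_bilinear mult_nonpos_nonpos)
    from less.hyps[OF lt] show ?thesis
    proof
      assume "act us' e = e"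
      then have "act ws e = r t e" by (simp add: w)
      moreover have "r t e = e" if "t \<noteq> i" using e(1)[OF that] by (simp add: reflection_def)
      ultimately show ?thesis by (cases "t = i") auto
    next
      assume "\<forall>x\<in>chamber. lform x (act us' e) \<le> lform x (r i e)"
      then show ?thesis using le by force
    qed
  qed
qed

end

section \<open>Horoballs encoded by lightlike vectors\<close>

definition unit_horoball :: "lorentz4 \<Rightarrow> lorentz4 set" where
  "unit_horoball c = {x \<in> hyp3. - lform x c \<le> 1}"

lemma horoball_at_unit: "ideal_point c \<Longrightarrow> horoball_at c (unit_horoball c)"
  unfolding horoball_at_def unit_horoball_def by (auto intro: exI[of _ 1])

lemma unit_horoball_scale: "t > 0 \<Longrightarrow> unit_horoball (t *\<^sub>R c) = {x \<in> hyp3. - lform x c \<le> 1 / t}"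
  by (simp add: unit_horoball_def lform_bilinear field_simps)

text \<open>For the harder inclusion a point of the horosphere is moved slightly away from the ideal
  point, which takes it out of the horoball.\<close>

lemma horoball_interior:
  assumes c: "ideal_point c"
  shows "hyp_interior (unit_horoball c) = {x \<in> hyp3. - lform x c < 1}"
proof
  show "{x \<in> hyp3. - lform x c < 1} \<subseteq> hyp_interior (unit_horoball c)"
    unfolding hyp_interior_def
  proof (rule interior_of_maximal)
    have "open {x. - lform x c < 1}"
      by (intro open_Collect_less continuous_intros)
    then show "openin (top_of_set hyp3) {x \<in> hyp3. - lform x c < 1}"
      by (auto simp: openin_open intro!: exI[of _ "{x. - lform x c < 1}"])
  qed (auto simp: unit_horoball_def)
next
  show "hyp_interior (unit_horoball c) \<subseteq> {x \<in> hyp3. - lform x c < 1}"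
  proof
    fix x assume "x \<in> hyp_interior (unit_horoball c)"
    then obtain T where T: "openin (top_of_set hyp3) T" "x \<in> T" "T \<subseteq> unit_horoball c"
      by (auto simp: hyp_interior_def interior_of_def)
    then obtain U where U: "open U" "T = hyp3 \<inter> U" by (auto simp: openin_open)
    have x: "x \<in> hyp3" "- lform x c \<le> 1" using T by (auto simp: unit_horoball_def)
    have "- lform x c \<noteq> 1"
    proof
      assume e: "- lform x c = 1"
      \<comment> \<open>By \<open>lform x c = - 1\<close> the vector \<open>x - t c\<close> has
        square \<open>- (1 - 2 t)\<close>, so \<open>y t\<close> is its projection to the
        hyperboloid. Its product with \<open>c\<close> is \<open>- 1 / sqrt (1 - 2 t)\<close>,
        beyond the horosphere for small positive \<open>t\<close>.\<close>
      define y where "y t = (1 / sqrt (1 - 2 * t)) *\<^sub>R (x - t *\<^sub>R c)" for t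
      have "isCont y 0" unfolding y_def by (intro continuous_intros) simp_all
      then have "(y \<longlongrightarrow> x) (at 0)" by (simp add: isCont_def y_def)
      then have "eventually (\<lambda>t. y t \<in> U) (at_right 0)"
        using U T by (metis IntD2 filterlim_at_split topological_tendstoD)
      moreover have "eventually (\<lambda>t. t \<in> {0<..<1/2}) (at_right (0::real))"
        by (rule eventually_at_right_real) simp
      ultimately have "eventually (\<lambda>t. y t \<in> U \<and> t \<in> {0<..<1/2}) (at_right 0)"
        by (rule eventually_conj)
      then obtain t where t: "y t \<in> U" "0 < t" "t < 1 / 2"
        using eventually_happens'[OF trivial_limit_at_right_real] by fastforce
      define d where "d = sqrt (1 - 2 * t)"
      have d: "d > 0" "d * d = 1 - 2 * t" using t by (simp_all add: d_def)
      have q: "lform (x - t *\<^sub>R c) (x - t *\<^sub>R c) = - (d * d)"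
        using x(1) e c by (simp add: lform_bilinear lform_commute[of c x] hyp3_def ideal_point_def d)
      have yy: "lform (y t) (y t) = -1"
        unfolding y_def d_def[symmetric] using d(1) by (simp only: lform_bilinear(5,6) q) simp
      have yc: "lform (y t) c = - 1 / d"
        unfolding y_def d_def[symmetric] using e c by (simp add: lform_bilinear ideal_point_def)
      have "lform (y t) x = (t - 1) / d"
        unfolding y_def d_def[symmetric] using x(1) e by (simp add: lform_bilinear lform_commute[of c x] hyp3_def)
      then have "lform (y t) x < 0" using d t by (simp add: divide_neg_pos)
      then have "y t \<in> hyp3" using fst_pos_of_lform_neg[of "y t" x] x(1) yy by (simp add: hyp3_def)
      then have "y t \<in> unit_horoball c" using t(1) U(2) T(3) by blast
      then have "1 / d \<le> 1" by (simp add: unit_horoball_def yc)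
      then have "1 \<le> d" using d(1) by simp
      then have "1 * 1 \<le> d * d" by (intro mult_mono) auto
      then show False using d(2) t by simp
    qed
    then show "x \<in> {x \<in> hyp3. - lform x c < 1}" using x by simp
  qed
qed

text \<open>Reversed Cauchy-Schwarz for \<open>x\<close> and \<open>z = c + d\<close>: the square of
  \<open>lform x z\<close> is at least \<open>- lform z z\<close>, hence at least 4, whereas a
  common interior point would have \<open>- lform x z < 2\<close>.\<close>

lemma disjoint_horoballs:
  assumes c: "ideal_point c" and d: "ideal_point d" and le: "lform c d \<le> - 2"
  shows "hyp_interior (unit_horoball c) \<inter> hyp_interior (unit_horoball d) = {}"
proof (rule ccontr)
  assume "\<not> ?thesis"
  then obtain x where x: "x \<in> hyp3" "- lform x c < 1" "- lform x d < 1"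
    unfolding horoball_interior[OF c] horoball_interior[OF d] by auto
  have xx: "lform x x = -1" using x(1) by (simp add: hyp3_def)
  define z where "z = c + d"
  define a where "a = - lform x z"
  have zz: "lform z z = 2 * lform c d"
    using c d by (simp add: z_def lform_bilinear ideal_point_def lform_commute[of d c])
  have a: "a < 2" "a \<ge> 0"
    using x(2,3) causal_lform_nonpos[OF hyp3_causal[OF x(1)] ideal_causal[OF c]]
      causal_lform_nonpos[OF hyp3_causal[OF x(1)] ideal_causal[OF d]]
    by (auto simp: a_def z_def lform_bilinear)
  have "lform (z - a *\<^sub>R x) x = 0" using xx by (simp add: lform_bilinear a_def lform_commute[of z x])
  then have "lform (z - a *\<^sub>R x) (z - a *\<^sub>R x) \<ge> 0"
    using timelike_orthogonal_spacelike[of x "z - a *\<^sub>R x"] xx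
    by (cases "z - a *\<^sub>R x = 0") (auto simp: lform_bilinear less_imp_le)
  moreover have "lform (z - a *\<^sub>R x) (z - a *\<^sub>R x) = lform z z + a * a"
    using xx by (simp add: lform_bilinear a_def lform_commute[of z x] algebra_simps)
  ultimately have "a * a \<ge> 4" using zz le by simp
  moreover have "a * a < 2 * 2" using a by (intro mult_strict_mono') auto
  ultimately show False by simp
qed

text \<open>If \<open>- lform c d < 2\<close>, the normalised sum of \<open>c\<close> and
  \<open>d\<close> is interior to both. It is the point of the geodesic between the two ideal points
  that is level with respect to both horoballs.\<close>

lemma disjoint_horoballs_D:
  assumes c: "ideal_point c" and d: "ideal_point d" and neg: "lform c d < 0"
    and dis: "hyp_interior (unit_horoball c) \<inter> hyp_interior (unit_horoball d) = {}"
  shows "lform c d \<le> - 2"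
proof (rule ccontr)
  assume "\<not> ?thesis"
  define l where "l = - lform c d"
  have l: "0 < l" "l < 2" using neg \<open>\<not> lform c d \<le> - 2\<close> by (auto simp: l_def)
  define e where "e = 1 / sqrt (2 * l)"
  have e: "e > 0" "e * e * (2 * l) = 1" using l by (auto simp: e_def)
  define x where "x = e *\<^sub>R (c + d)"
  have cc: "lform c c = 0" "lform d d = 0" "fst c > 0" "fst d > 0" using c d by (auto simp: ideal_point_def)
  have "lform x x = - (e * e * (2 * l))"
    using cc by (simp add: x_def lform_bilinear l_def lform_commute[of d c])
  then have x: "x \<in> hyp3" using cc e by (simp add: hyp3_def x_def)
  have "e * l < 1"
  proof -
    have "(e * l)\<^sup>2 = l / 2" using e(2) by (simp add: power2_eq_square algebra_simps)
    then have "(e * l)\<^sup>2 < 1\<^sup>2" using l by simp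
    then show ?thesis by (rule power2_less_imp_less) simp
  qed
  then have "- lform x c < 1" "- lform x d < 1"
    using cc by (simp_all add: x_def lform_bilinear l_def lform_commute[of d c])
  then show False using x dis unfolding horoball_interior[OF c] horoball_interior[OF d] by blast
qed

section \<open>Horoball packings\<close>

context cycle_simplex
begin

text \<open>The point of the upper half-space over \<open>(x, y)\<close> at height \<open>1 / w\<close>.\<close>

definition upper_point :: "real \<Rightarrow> real \<Rightarrow> real \<Rightarrow> lorentz4" where
  "upper_point w x y = frame (((1 + (w * x)\<^sup>2 + (w * y)\<^sup>2) / w + w) / 2,
     vector [((1 + (w * x)\<^sup>2 + (w * y)\<^sup>2) / w - w) / 2, w * x, w * y])"

lemma upper_point:
  assumes w: "w > 0"
  shows "upper_point w x y \<in> hyp3"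
    and "lform (upper_point w x y) cusp = - w / 2"
    and "lform (upper_point w x y) (n a) = - w * (x + k)"
    and "lform (upper_point w x y) (n p) = (w - (1 + (w * x)\<^sup>2 + (w * y)\<^sup>2) / w) / 2"
    and "w \<le> 1 \<Longrightarrow> (x, y) \<in> cusp_triangle k s c \<Longrightarrow> upper_point w x y \<in> simplex_of v"
proof -
  define u where "u = (1 + (w * x)\<^sup>2 + (w * y)\<^sup>2) / w"
  define q :: lorentz4 where "q = ((u + w) / 2, vector [(u - w) / 2, w * x, w * y])"
  have up: "upper_point w x y = frame q" by (simp add: upper_point_def q_def u_def)
  have uw: "u * w = 1 + (w * x)\<^sup>2 + (w * y)\<^sup>2" using w by (simp add: u_def)
  have u0: "u > 0" unfolding u_def using w by (intro divide_pos_pos add_pos_nonneg) auto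
  have "lform q q = -1"
    using uw by (simp add: q_def lform_def inner_vec_def sum_3 field_simps power2_eq_square)
  then have q: "q \<in> hyp3" using u0 w by (simp add: hyp3_def q_def)
  have coord: "fst q - snd q $ 1 = w" "fst q + snd q $ 1 = u" "snd q $ 1 = (u - w) / 2" "snd q $ 2 = w * x" "snd q $ 3 = w * y"
    by (simp_all add: q_def field_simps)
  show "upper_point w x y \<in> hyp3" unfolding up frame_hyp3 by (rule q)
  have "lform (frame q) cusp = - w / 2" "lform (frame q) (n a) = - (w * x) - k * w" "lform (frame q) (n p) = - ((u - w) / 2)"
    unfolding frame_normal coord(1) by (simp_all only: coord)
  then  show "lform (upper_point w x y) cusp = - w / 2" "lform (upper_point w x y) (n a) = - w * (x + k)"
    "lform (upper_point w x y) (n p) = (w - (1 + (w * x)\<^sup>2 + (w * y)\<^sup>2) / w) / 2"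
    unfolding up by (simp_all add: u_def algebra_simps diff_divide_distrib)
  assume "w \<le> 1" "(x, y) \<in> cusp_triangle k s c"
  moreover have "1 \<le> u / w"
  proof -
    have "w * w \<le> 1" using w \<open>w \<le> 1\<close> by (simp add: mult_le_one)
    then have "w * w \<le> u * w" using uw zero_le_power2[of "w * x"] zero_le_power2[of "w * y"] by linarith
    then show ?thesis using w by simp
  qed
  ultimately show "upper_point w x y \<in> simplex_of v"
    unfolding up frame_simplex_ratio[OF q] coord(1,2) coord(4,5) using w by simp
qed

text \<open>On and inside the unit hemisphere the height \<open>1 / w\<close> is at most 1, and
  \<open>- lform y cusp\<close> is \<open>w / 2\<close>.\<close>

lemma horoball_below_facet:
  assumes y: "y \<in> hyp3" "lform y (n p) \<ge> 0" shows "- lform y cusp \<ge> 1 / 2"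
proof -
  obtain q where q: "y = frame q" using frame_bij by (metis bij_pointE)
  have qh: "q \<in> hyp3" using y(1) unfolding q frame_hyp3 .
  define w u where "w = fst q - snd q $ 1" and "u = fst q + snd q $ 1"
  have w: "w > 0" using hyp3_lightlike(1)[OF qh] by (simp add: w_def)
  have uw: "u * w \<ge> 1" using hyp3_lightlike(2)[OF qh] by (simp add: w_def u_def)
  have "u \<le> w" using y(2) unfolding q frame_normal by (simp add: w_def u_def)
  then have "u * w \<le> w * w" using w by (intro mult_right_mono) auto
  then have "1\<^sup>2 \<le> w\<^sup>2" using uw by (simp add: power2_eq_square)
  then have "1 \<le> w" by (rule power2_le_imp_le) (use w in simp)
  then show ?thesis unfolding q frame_normal by (simp add: w_def)
qed

text \<open>The horosphere at height \<open>1 / \<sigma>\<close> touches the unit hemisphere at its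
  summit when \<open>\<sigma> = 1\<close>. For \<open>\<sigma> > 1\<close> its point over the origin
  lies inside the hemisphere, which is the witness for necessity.\<close>

lemma facet_halfspace_horoball:
  assumes "0 < \<sigma>"
  shows "{x \<in> hyp3. - lform x cusp \<le> \<sigma> / 2} \<subseteq> facet_halfspace v p \<longleftrightarrow> \<sigma> \<le> 1"
proof
  assume sub: "{x \<in> hyp3. - lform x cusp \<le> \<sigma> / 2} \<subseteq> facet_halfspace v p"
  have "upper_point \<sigma> 0 0 \<in> {x \<in> hyp3. - lform x cusp \<le> \<sigma> / 2}"
    using upper_point[OF assms] by simp
  then have "upper_point \<sigma> 0 0 \<in> facet_halfspace v p" using sub by blast
  then have "\<sigma> \<le> 1 / \<sigma>" using upper_point(4)[OF assms, of 0 0] by (simp add: facet_halfspace_def)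
  then have "\<sigma>\<^sup>2 \<le> 1\<^sup>2" using assms by (simp add: field_simps power2_eq_square)
  then show "\<sigma> \<le> 1" by (rule power2_le_imp_le) simp
next
  assume \<sigma>: "\<sigma> \<le> 1"
  show "{x \<in> hyp3. - lform x cusp \<le> \<sigma> / 2} \<subseteq> facet_halfspace v p"
  proof
    fix x assume "x \<in> {x \<in> hyp3. - lform x cusp \<le> \<sigma> / 2}"
    then have x: "x \<in> hyp3" "- lform x cusp \<le> \<sigma> / 2" by auto
    obtain q where q: "x = frame q" using frame_bij by (metis bij_pointE)
    have qh: "q \<in> hyp3" using x(1) unfolding q frame_hyp3 .
    define w u where "w = fst q - snd q $ 1" and "u = fst q + snd q $ 1"
    have w: "w > 0" using hyp3_lightlike(1)[OF qh] by (simp add: w_def)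
    have uw: "u * w \<ge> 1" using hyp3_lightlike(2)[OF qh] by (simp add: w_def u_def)
    have w1: "w \<le> 1" using x(2) \<sigma> unfolding q frame_normal w_def[symmetric] by simp
    then have "w * w \<le> u * w" using uw w by (smt (verit) mult_le_one)
    then have "w \<le> u" using w by simp
    then show "x \<in> facet_halfspace v p"
      using x(1) unfolding facet_halfspace_def q by (simp add: frame_normal w_def u_def)
  qed
qed

text \<open>A horoball centred at infinity crosses every vertical wall: over
  \<open>x = - 2 k\<close> it has points beyond the wall \<open>x = - k\<close>. This is how the
  horoballs at the two vertices are told apart.\<close>

lemma horoball_not_in_other_halfspace:
  assumes "0 < \<sigma>"
  shows "\<not> {x \<in> hyp3. - lform x cusp \<le> \<sigma> / 2} \<subseteq> facet_halfspace v a"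
proof
  assume sub: "{x \<in> hyp3. - lform x cusp \<le> \<sigma> / 2} \<subseteq> facet_halfspace v a"
  have "upper_point \<sigma> (- 2 * k) 0 \<in> {x \<in> hyp3. - lform x cusp \<le> \<sigma> / 2}"
    using upper_point[OF assms] by simp
  then have "upper_point \<sigma> (- 2 * k) 0 \<in> facet_halfspace v a" using sub by blast
  then have "\<sigma> * k \<le> 0" using upper_point(3)[OF assms, of "- 2 * k" 0] by (simp add: facet_halfspace_def)
  then show False using assms params by (simp add: mult_le_0_iff)
qed

lemma horoball_at_vertex:
  assumes "horoball_at (v p) B"
  shows "\<exists>\<sigma>>0. B = {x \<in> hyp3. - lform x cusp \<le> \<sigma> / 2}"
proof -
  define l where "l = - 2 * lform (v p) (n p)"
  have l: "l > 0" "v p = l *\<^sub>R cusp" using vertex_p_pos vertex_p by (simp_all add: l_def)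
  obtain t where t: "t > 0" "B = {x \<in> hyp3. - lform x (v p) \<le> t}"
    using assms unfolding horoball_at_def by blast
  have "B = {x \<in> hyp3. - lform x cusp \<le> (2 * t / l) / 2}"
    unfolding t(2) l(2) using l(1) by (simp add: lform_bilinear field_simps)
  then show ?thesis using t(1) l(1) by (intro exI[of _ "2 * t / l"]) simp
qed

lemma vertex_horoball_at:
  assumes "0 < \<sigma>" shows "horoball_at (v p) {x \<in> hyp3. - lform x cusp \<le> \<sigma> / 2}"
proof -
  define l where "l = - 2 * lform (v p) (n p)"
  have l: "l > 0" "v p = l *\<^sub>R cusp" using vertex_p_pos vertex_p by (simp_all add: l_def)
  have "{x \<in> hyp3. - lform x cusp \<le> \<sigma> / 2} = {x \<in> hyp3. - lform x (v p) \<le> l * \<sigma> / 2}"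
  proof -
    have "- lform x (v p) = l * - lform x cusp" "l * \<sigma> / 2 = l * (\<sigma> / 2)" for x
      unfolding l(2) by (simp_all add: lform_bilinear)
    then show ?thesis using l(1) by (simp only: mult_le_cancel_left_pos)
  qed
  then show ?thesis unfolding horoball_at_def using vertex_p_ideal l(1) assms by (intro conjI exI[of _ "l * \<sigma> / 2"]) auto
qed

text \<open>The vector whose \<open>unit_horoball\<close> has height \<open>1 / \<sigma>\<close>; at
  \<open>\<sigma> = 1\<close> the horoball touches the opposite facet plane.\<close>

definition scaled_cusp :: "real \<Rightarrow> lorentz4" where "scaled_cusp \<sigma> = (2 / \<sigma>) *\<^sub>R cusp"

lemma unit_horoball_scaled_cusp: "\<sigma> > 0 \<Longrightarrow> unit_horoball (scaled_cusp \<sigma>) = {x \<in> hyp3. - lform x cusp \<le> \<sigma> / 2}"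
  unfolding scaled_cusp_def by (subst unit_horoball_scale) simp_all

lemma scaled_cusp_ideal: "\<sigma> > 0 \<Longrightarrow> ideal_point (scaled_cusp \<sigma>)"
  using cusp_ideal by (simp add: scaled_cusp_def ideal_point_def lform_bilinear)

end

text \<open>\<open>Q\<close> is the same simplex seen from the other ideal vertex:
  \<open>Q.cusp\<close> belongs to \<open>v a\<close>, and \<open>Q.frame\<close> puts it at
  infinity.\<close>

sublocale cycle_simplex \<subseteq> Q: cycle_simplex v a p h b k s c
  by (rule swap)

context cycle_simplex
begin

text \<open>Of the three normals in \<open>Q.cusp\<close> only \<open>n p\<close> is not orthogonal
  to \<open>cusp\<close>. This number makes \<open>2 * (k + c) * (\<sigma> * \<sigma>') = 1\<close>
  the condition of tangency.\<close>

lemma cusp_cusp: "lform cusp Q.cusp = - (1 / 4) / (k + c)"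
proof -
  have "k + c > 0" using params c_pos by simp
  moreover have "lform cusp Q.cusp = (1 / (2 * (k + c) * s)) * (s * (- 1 / 2))"
    unfolding Q.cusp_def by (simp add: lform_bilinear cusp_gram)
  ultimately show ?thesis using params(4) by (simp add: divide_simps)
qed

lemma scaled_cusps: "\<sigma> > 0 \<Longrightarrow> \<sigma>' > 0 \<Longrightarrow> lform (scaled_cusp \<sigma>) (Q.scaled_cusp \<sigma>') = - 1 / ((k + c) * (\<sigma> * \<sigma>'))"
proof -
  have "(2 / \<sigma>') * ((2 / \<sigma>) * (- (1 / 4) / L)) = - 1 / (L * (\<sigma> * \<sigma>'))" for L
    by (simp add: field_simps)
  then show ?thesis by (simp only: scaled_cusp_def Q.scaled_cusp_def lform_bilinear(5,6) cusp_cusp)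
qed

lemma packing_cusps:
  assumes "horoball_packing v \<B> B"
  obtains \<sigma> \<sigma>' where "0 < \<sigma>" "\<sigma> \<le> 1" "0 < \<sigma>'" "\<sigma>' \<le> 1" "2 * (k + c) * (\<sigma> * \<sigma>') \<le> 1"
    "B p = {x \<in> hyp3. - lform x cusp \<le> \<sigma> / 2}" "B a = {x \<in> hyp3. - lform x Q.cusp \<le> \<sigma>' / 2}"
proof -
  note D = assms[unfolded horoball_packing_def ideal_vertices_eq]
  have "\<forall>i\<in>{p, a}. horoball_at (v i) (B i)" using D by (elim conjE)
  moreover have "\<forall>i\<in>{p, a}. B i \<subseteq> facet_halfspace v i" using D by (elim conjE)
  moreover have "{C \<in> \<B>. hyp_interior C \<inter> simplex_of v \<noteq> {}} = B ` {p, a}" using D by (elim conjE)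
  moreover have dis: "\<forall>C\<in>\<B>. \<forall>D\<in>\<B>. C \<noteq> D \<longrightarrow> hyp_interior C \<inter> hyp_interior D = {}" using D by (elim conjE)
  ultimately have P: "horoball_at (v p) (B p)" "horoball_at (v a) (B a)"
     "B p \<subseteq> facet_halfspace v p" "B a \<subseteq> facet_halfspace v a" "B p \<in> \<B>" "B a \<in> \<B>"
    by auto
  obtain \<sigma> where \<sigma>: "\<sigma> > 0" "B p = {x \<in> hyp3. - lform x cusp \<le> \<sigma> / 2}"
    using horoball_at_vertex[OF P(1)] by blast
  obtain \<sigma>' where \<sigma>': "\<sigma>' > 0" "B a = {x \<in> hyp3. - lform x Q.cusp \<le> \<sigma>' / 2}"
    using Q.horoball_at_vertex[OF P(2)] by blast
  have 1: "\<sigma> \<le> 1" using P(3) facet_halfspace_horoball[OF \<sigma>(1)] \<sigma>(2) by simp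
  have 2: "\<sigma>' \<le> 1" using P(4) Q.facet_halfspace_horoball[OF \<sigma>'(1)] \<sigma>'(2) by simp
  \<comment> \<open>Disjoint interiors are demanded of distinct members only, so the two horoballs
    must first be told apart.\<close>
  have "B p \<noteq> B a" using horoball_not_in_other_halfspace[OF \<sigma>(1)] P(4) \<sigma>(2) by auto
  then have dis: "hyp_interior (unit_horoball (scaled_cusp \<sigma>)) \<inter> hyp_interior (unit_horoball (Q.scaled_cusp \<sigma>')) = {}"
    using dis P(5,6) unfolding \<sigma> \<sigma>' unit_horoball_scaled_cusp[OF \<sigma>(1)] Q.unit_horoball_scaled_cusp[OF \<sigma>'(1)] by simp
  have L: "k + c > 0" using params c_pos by simp
  have pos: "(k + c) * (\<sigma> * \<sigma>') > 0" using L \<sigma> \<sigma>' by simp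
  then have "lform (scaled_cusp \<sigma>) (Q.scaled_cusp \<sigma>') < 0"
    unfolding scaled_cusps[OF \<sigma>(1) \<sigma>'(1)] by (simp add: divide_neg_pos)
  from disjoint_horoballs_D[OF scaled_cusp_ideal[OF \<sigma>(1)] Q.scaled_cusp_ideal[OF \<sigma>'(1)] this dis]
  have "- 1 / ((k + c) * (\<sigma> * \<sigma>')) \<le> - 2" unfolding scaled_cusps[OF \<sigma>(1) \<sigma>'(1)] .
  then have "2 * ((k + c) * (\<sigma> * \<sigma>')) \<le> 1" using pos by (simp add: divide_simps)
  then have "2 * (k + c) * (\<sigma> * \<sigma>') \<le> 1" by (simp only: mult.assoc)
  then show thesis using that 1 2 \<sigma> \<sigma>' by blast
qed

end

section \<open>The orbit packing and the optimal density\<close>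

lemma isometry_image_horoball:
  assumes f: "\<And>x y. lform (f x) (f y) = lform x y" "\<And>x. x \<in> hyp3 \<Longrightarrow> f x \<in> hyp3"
    and g: "\<And>x. x \<in> hyp3 \<Longrightarrow> g x \<in> hyp3" "\<And>x. f (g x) = x"
  shows "f ` unit_horoball c = unit_horoball (f c)"
proof
  show "f ` unit_horoball c \<subseteq> unit_horoball (f c)"
    by (rule image_subsetI) (simp add: unit_horoball_def f)
  show "unit_horoball (f c) \<subseteq> f ` unit_horoball c"
  proof
    fix y assume y: "y \<in> unit_horoball (f c)"
    have "lform (g y) c = lform y (f c)" using f(1)[of "g y" c] g(2) by simp
    then have "g y \<in> unit_horoball c" using y g by (auto simp: unit_horoball_def)
    then show "y \<in> f ` unit_horoball c" using g(2) by (metis imageI)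
  qed
qed

context coxeter_system
begin

lemma act_lform: "lform (act ws x) (act ws y) = lform x y"
  by (induction ws) (simp_all add: reflection_lform[OF norm])

lemma act_hyp3: "x \<in> hyp3 \<Longrightarrow> act ws x \<in> hyp3"
  by (induction ws) (simp_all add: reflection_hyp3[OF norm])

lemma act_rev: "act (rev ws) (act ws x) = x" "act ws (act (rev ws) x) = x"
proof -
  show 1: "act (rev us) (act us x) = x" for us by (induction us arbitrary: x) simp_all
  show "act ws (act (rev ws) x) = x" using 1[of "rev ws"] by simp
qed

lemma act_ideal:
  assumes c: "ideal_point c" shows "ideal_point (act ws c)"
proof -
  define x :: lorentz4 where "x = (1, 0)"
  have x: "x \<in> hyp3" by (simp add: x_def hyp3_def lform_def)
  have "lform x c < 0"
    by (rule causal_lform_neg[OF hyp3_causal[OF x] ideal_causal[OF c]]) (simp add: x_def lform_def)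
  then have 1: "lform (act ws c) (act ws x) < 0" by (simp add: act_lform lform_commute)
  have "fst (act ws c) > 0"
    by (rule fst_pos_of_lform_neg[OF _ act_hyp3[OF x] 1]) (use c in \<open>simp add: act_lform ideal_point_def\<close>)
  then show ?thesis using c by (simp add: ideal_point_def act_lform)
qed

lemma act_horoball: "act ws ` unit_horoball c = unit_horoball (act ws c)"
  by (rule isometry_image_horoball[where g = "act (rev ws)"]) (simp_all add: act_lform act_hyp3 act_rev)

end

context cycle_simplex
begin

lemma reflection_group_eq:
  assumes "coxeter_system n"
  shows "reflection_group v = range (foldr (\<lambda>i. reflection (n i)))"
proof
  show "reflection_group v \<subseteq> range (foldr (\<lambda>i. reflection (n i)))"
  proof
    fix g assume "g \<in> reflection_group v"
    then show "g \<in> range (foldr (\<lambda>i. reflection (n i)))"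
    proof induction
      case id_in
      show ?case by (rule range_eqI[of _ _ "[]"]) simp
    next
      case (reflection_in g i)
      then obtain ws where "g = foldr (\<lambda>i. reflection (n i)) ws" by blast
      then show ?case by (intro range_eqI[of _ _ "i # ws"]) simp
    qed
  qed
  have "foldr (\<lambda>i. reflection (n i)) ws \<in> reflection_group v" for ws
  proof (induction ws)
    case Nil
    show ?case using reflection_group.id_in[of v] by (simp add: id_def)
  next
    case (Cons i ws)
    have st: "foldr (\<lambda>i. reflection (n i)) (i # ws) = reflection (n i) \<circ> foldr (\<lambda>i. reflection (n i)) ws" by simp
    show ?case unfolding st by (rule reflection_group.reflection_in[OF Cons])
  qed
  then show "range (foldr (\<lambda>i. reflection (n i))) \<subseteq> reflection_group v" by blast
qed

text \<open>The collection is the orbit of the two horoballs. Any pair of members is moved so that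
  one of them is \<open>e p\<close> or \<open>e a\<close>, which lies in the chamber;
  \<open>orbit_dichotomy\<close> then leaves a single reflection to be examined.\<close>

lemma exists_packing:
  assumes cox: "coxeter_system n" and \<sigma>: "0 < \<sigma>" "\<sigma> \<le> 1" "0 < \<sigma>'" "\<sigma>' \<le> 1" "2 * (k + c) * (\<sigma> * \<sigma>') \<le> 1"
  shows "\<exists>\<B> B. horoball_packing v \<B> B \<and> B p = {x \<in> hyp3. - lform x cusp \<le> \<sigma> / 2} \<and> B a = {x \<in> hyp3. - lform x Q.cusp \<le> \<sigma>' / 2}"
proof -
  interpret W: coxeter_system n by (rule cox)
  define e where "e i = (if i = p then scaled_cusp \<sigma> else Q.scaled_cusp \<sigma>')" for i
  have pa: "p \<noteq> a" using indices by auto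
  have e: "e p = scaled_cusp \<sigma>" "e a = Q.scaled_cusp \<sigma>'" using pa by (auto simp: e_def)
  have id: "ideal_point (e i)" if "i \<in> {p, a}" for i
    using that e scaled_cusp_ideal[OF \<sigma>(1)] Q.scaled_cusp_ideal[OF \<sigma>(3)] by auto
  have L: "k + c > 0" using params c_pos by simp
  have cross: "lform (e p) (e a) \<le> - 2"
  proof -
    have "0 < (k + c) * (\<sigma> * \<sigma>')" using L \<sigma> by simp
    moreover have "2 * ((k + c) * (\<sigma> * \<sigma>')) \<le> 1" using \<sigma>(5) by (simp only: mult.assoc)
    ultimately have "- 1 / ((k + c) * (\<sigma> * \<sigma>')) \<le> - 2" by (simp add: divide_simps)
    then show ?thesis unfolding e scaled_cusps[OF \<sigma>(1,3)] .
  qed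
  have orth: "lform (e i) (n j) = 0" if "i \<in> {p, a}" "j \<noteq> i" for i j
  proof -
    have "j \<in> {p, a, b, h}" using indices_UNIV by blast
    then show ?thesis using that e by (auto simp: scaled_cusp_def Q.scaled_cusp_def lform_bilinear cusp_gram Q.cusp_gram)
  qed
  have own: "lform (e i) (n i) \<le> - 1" if "i \<in> {p, a}" for i
    using that e \<sigma> by (auto simp: scaled_cusp_def Q.scaled_cusp_def lform_bilinear cusp_gram Q.cusp_gram)
  have chamber: "e i \<in> W.chamber" if "i \<in> {p, a}" for i
  proof -
    have "lform (e i) (n j) \<le> 0" for j
      using orth[OF that, of j] own[OF that] by (cases "j = i") auto
    then show ?thesis by simp
  qed
  have simplex_chamber: "x \<in> W.chamber" if "x \<in> simplex_of v" for x
    using that unfolding simplex_of_halfspaces[OF tet] by blast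
  \<comment> \<open>No point beyond the facet opposite \<open>v i\<close> is interior to the
    horoball at \<open>v i\<close>; this uses that both scales are at most 1.\<close>
  have far: "lform y (e i) \<le> - 1" if i: "i \<in> {p, a}" and y: "y \<in> hyp3" "lform y (n i) \<ge> 0" for i y
  proof -
    have t: "(2 / \<tau>) * t \<le> - 1" if "1 / 2 \<le> - t" "0 < \<tau>" "\<tau> \<le> 1" for t \<tau> :: real
      using that by (simp add: divide_simps)
    show ?thesis
    proof (cases "i = p")
      case True
      then show ?thesis unfolding True e scaled_cusp_def lform_bilinear(6)
        by (intro t horoball_below_facet \<sigma>) (use y True in auto)
    next
      case False
      then have "i = a" using i by simp
      then show ?thesis unfolding \<open>i = a\<close> e Q.scaled_cusp_def lform_bilinear(6)
        by (intro t Q.horoball_below_facet \<sigma>) (use y \<open>i = a\<close> in auto)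
    qed
  qed
  have dich: "W.act ws (e i) = e i \<or> (\<forall>x\<in>W.chamber. lform x (W.act ws (e i)) \<le> lform x (reflection (n i) (e i)))"
    if i: "i \<in> {p, a}" for i ws
  proof (rule W.orbit_dichotomy)
    show "lform (e i) (n i) \<le> 0" using own[OF i] by simp
  qed (rule orth[OF i])
  define B where "B i = unit_horoball (e i)" for i
  define \<B> where "\<B> = {W.act ws ` B i | ws i. i \<in> {p, a}}"
  have member: "C \<in> \<B> \<longleftrightarrow> (\<exists>ws. \<exists>i\<in>{p, a}. C = unit_horoball (W.act ws (e i)))" for C
    unfolding \<B>_def B_def W.act_horoball by blast
  have Bp: "B p = {x \<in> hyp3. - lform x cusp \<le> \<sigma> / 2}" and Ba: "B a = {x \<in> hyp3. - lform x Q.cusp \<le> \<sigma>' / 2}"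
    unfolding B_def e using unit_horoball_scaled_cusp[OF \<sigma>(1)] Q.unit_horoball_scaled_cusp[OF \<sigma>(3)] by auto
  have "horoball_packing v \<B> B"
    unfolding horoball_packing_def ideal_vertices_eq
  proof (intro conjI)
    show "\<forall>C\<in>\<B>. \<exists>c. horoball_at c C"
    proof
      fix C assume "C \<in> \<B>"
      then obtain ws i where "i \<in> {p, a}" "C = unit_horoball (W.act ws (e i))" unfolding member by blast
      then show "\<exists>c. horoball_at c C" using horoball_at_unit[OF W.act_ideal[OF id]] by metis
    qed
    show "\<forall>g\<in>reflection_group v. \<forall>C\<in>\<B>. g ` C \<in> \<B>"
    proof (intro ballI)
      fix g C assume "g \<in> reflection_group v" "C \<in> \<B>"
      then obtain us ws i where "g = W.act us" "i \<in> {p, a}" "C = W.act ws ` B i"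
        unfolding reflection_group_eq[OF cox] \<B>_def by blast
      then have "g ` C = W.act (us @ ws) ` B i" by (simp add: image_image)
      then show "g ` C \<in> \<B>" unfolding \<B>_def using \<open>i \<in> {p, a}\<close> by blast
    qed
    show "{C \<in> \<B>. hyp_interior C \<inter> simplex_of v \<noteq> {}} = B ` {p, a}"
    proof
      show "{C \<in> \<B>. hyp_interior C \<inter> simplex_of v \<noteq> {}} \<subseteq> B ` {p, a}"
      proof
        fix C assume C: "C \<in> {C \<in> \<B>. hyp_interior C \<inter> simplex_of v \<noteq> {}}"
        then obtain ws i where i: "i \<in> {p, a}" "C = unit_horoball (W.act ws (e i))" unfolding mem_Collect_eq member by blast
        obtain x where x: "x \<in> simplex_of v" "- lform x (W.act ws (e i)) < 1"
        proof -
          have "hyp_interior C = {x \<in> hyp3. - lform x (W.act ws (e i)) < 1}"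
            unfolding i(2) by (rule horoball_interior[OF W.act_ideal[OF id[OF i(1)]]])
          moreover have "hyp_interior C \<inter> simplex_of v \<noteq> {}" using C by simp
          ultimately show thesis using that by blast
        qed
        have "W.act ws (e i) = e i"
        proof (rule ccontr)
          assume "W.act ws (e i) \<noteq> e i"
          then have "lform x (W.act ws (e i)) \<le> lform x (reflection (n i) (e i))"
            using dich[OF i(1), of ws] simplex_chamber[OF x(1)] by blast
          \<comment> \<open>The reflection is moved onto \<open>x\<close>: the mirror image of a
            point of the simplex lies on or beyond the facet \<open>i\<close>, where
            \<open>far\<close> applies.\<close>
          also have "\<dots> = lform (reflection (n i) x) (e i)" by (simp add: reflection_adjoint)
          also have "\<dots> \<le> - 1"
          proof (rule far[OF i(1)])
            have x3: "x \<in> hyp3" using x(1) simplex_subset by blast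
            show "reflection (n i) x \<in> hyp3" by (rule reflection_hyp3[OF n_norm x3])
            show "0 \<le> lform (reflection (n i) x) (n i)"
              using simplex_chamber[OF x(1)] by (simp add: reflection_def lform_bilinear n_norm)
          qed
          finally show False using x(2) by simp
        qed
        then show "C \<in> B ` {p, a}" using i by (auto simp: B_def)
      qed
      have "B i \<in> \<B>" if "i \<in> {p, a}" for i
      proof -
        have "B i = unit_horoball (W.act [] (e i))" by (simp add: B_def)
        then show ?thesis unfolding member using that by blast
      qed
      moreover have "hyp_interior (B p) \<inter> simplex_of v \<noteq> {}"
      proof -
        \<comment> \<open>The origin lies on the hypotenuse, so the vertical line over it stays in
          the simplex above the hemisphere; height \<open>2 / \<sigma>\<close> is strictly inside
          the horoball.\<close>
        have "(0, 0) \<in> cusp_triangle k s c" using params by (simp add: cusp_triangle_def)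
        then have "upper_point (\<sigma> / 2) 0 0 \<in> simplex_of v" using \<sigma> by (intro upper_point(5)) auto
        moreover have "upper_point (\<sigma> / 2) 0 0 \<in> hyp_interior (B p)"
          unfolding B_def e(1) horoball_interior[OF scaled_cusp_ideal[OF \<sigma>(1)]]
          using upper_point(1,2)[of "\<sigma> / 2" 0 0] \<sigma> by (simp add: scaled_cusp_def lform_bilinear)
        ultimately show ?thesis by blast
      qed
      moreover have "hyp_interior (B a) \<inter> simplex_of v \<noteq> {}"
      proof -
        have "(0, 0) \<in> cusp_triangle k s c" using params by (simp add: cusp_triangle_def)
        then have "Q.upper_point (\<sigma>' / 2) 0 0 \<in> simplex_of v" using \<sigma> by (intro Q.upper_point(5)) auto
        moreover have "Q.upper_point (\<sigma>' / 2) 0 0 \<in> hyp_interior (B a)"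
          unfolding B_def e(2) horoball_interior[OF Q.scaled_cusp_ideal[OF \<sigma>(3)]]
          using Q.upper_point(1,2)[of "\<sigma>' / 2" 0 0] \<sigma> by (simp add: Q.scaled_cusp_def lform_bilinear)
        ultimately show ?thesis by blast
      qed
      ultimately show "B ` {p, a} \<subseteq> {C \<in> \<B>. hyp_interior C \<inter> simplex_of v \<noteq> {}}" by blast
    qed
    show "\<forall>i\<in>{p, a}. horoball_at (v i) (B i)"
    proof -
      have "horoball_at (v p) (B p)" unfolding Bp by (rule vertex_horoball_at[OF \<sigma>(1)])
      moreover have "horoball_at (v a) (B a)" unfolding Ba by (rule Q.vertex_horoball_at[OF \<sigma>(3)])
      ultimately show ?thesis by blast
    qed
    show "\<forall>C\<in>\<B>. \<forall>D\<in>\<B>. C \<noteq> D \<longrightarrow> hyp_interior C \<inter> hyp_interior D = {}"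
    proof (intro ballI impI)
      fix C D assume C: "C \<in> \<B>" and D: "D \<in> \<B>" and ne: "C \<noteq> D"
      obtain ws i where i: "i \<in> {p, a}" "C = unit_horoball (W.act ws (e i))" using C unfolding member by blast
      obtain us j where j: "j \<in> {p, a}" "D = unit_horoball (W.act us (e j))" using D unfolding member by blast
      have cross': "lform (e i') (e j') \<le> - 2" if "i' \<in> {p, a}" "j' \<in> {p, a}" "i' \<noteq> j'" for i' j'
        using that cross lform_commute[of "e p" "e a"] by auto
      \<comment> \<open>The inverse of \<open>us\<close> turns the pair into \<open>e j\<close>,
        which lies in the chamber, and an image of \<open>e i\<close>.\<close>
      let ?g = "rev us @ ws"
      have lf: "lform (W.act ws (e i)) (W.act us (e j)) = lform (e j) (W.act ?g (e i))"
      proof -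
        have "lform (W.act us (e j)) (W.act ws (e i)) = lform (W.act (rev us) (W.act us (e j))) (W.act (rev us) (W.act ws (e i)))"
          by (simp only: W.act_lform)
        also have "\<dots> = lform (e j) (W.act ?g (e i))" by (simp add: W.act_rev)
        finally show ?thesis by (subst lform_commute)
      qed
      have "lform (e j) (W.act ?g (e i)) \<le> - 2"
      proof (cases "W.act ?g (e i) = e i")
        case True
        have "i \<noteq> j"
        proof
          assume "i = j"
          have "W.act us (W.act (rev us) (W.act ws (e i))) = W.act us (e i)" using True by simp
          then have "W.act ws (e i) = W.act us (e j)" using \<open>i = j\<close> by (simp add: W.act_rev)
          then show False using ne i j by simp
        qed
        then show ?thesis unfolding True using cross'[OF j(1) i(1)] by simp
      next
        case False
        then have "lform (e j) (W.act ?g (e i)) \<le> lform (e j) (reflection (n i) (e i))"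
          using dich[OF i(1), of ?g] chamber[OF j(1)] by blast
        also have "\<dots> = lform (e j) (e i) - 2 * lform (e i) (n i) * lform (e j) (n i)"
          by (simp add: reflection_def lform_bilinear)
        also have "\<dots> \<le> - 2"
        \<comment> \<open>Within one orbit the bound is
          \<open>- 2 (lform (e i) (n i))\<^sup>2 \<le> - 2\<close>, again because scales are at most
          1. For different orbits \<open>e j\<close> lies on the mirror of \<open>n i\<close>, so
          the product is that of the two original vectors.\<close>
        proof (cases "i = j")
          case True
          have "1 * 1 \<le> (- lform (e i) (n i)) * (- lform (e i) (n i))"
            using own[OF i(1)] by (intro mult_mono) auto
          moreover have "lform (e i) (e i) = 0" using id[OF i(1)] by (simp add: ideal_point_def)
          ultimately show ?thesis using True by simp
        next
          case False
          then show ?thesis using orth[OF j(1) False] cross'[OF j(1) i(1)] by simp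
        qed
        finally show ?thesis .
      qed
      then show "hyp_interior C \<inter> hyp_interior D = {}"
        unfolding i(2) j(2) by (intro disjoint_horoballs W.act_ideal id i(1) j(1)) (simp only: lf)
    qed
    show "\<forall>i\<in>{p, a}. B i \<subseteq> facet_halfspace v i"
    proof -
      have "B p \<subseteq> facet_halfspace v p" unfolding Bp using facet_halfspace_horoball[OF \<sigma>(1)] \<sigma>(2) by blast
      moreover have "B a \<subseteq> facet_halfspace v a" unfolding Ba using Q.facet_halfspace_horoball[OF \<sigma>(3)] \<sigma>(4) by blast
      ultimately show ?thesis by blast
    qed
  qed
  then show ?thesis using Bp Ba by blast
qed

lemma packing_density_eq:
  assumes "0 < \<sigma>" "\<sigma> \<le> 1" "0 < \<sigma>'" "\<sigma>' \<le> 1"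
    "B p = {x \<in> hyp3. - lform x cusp \<le> \<sigma> / 2}" "B a = {x \<in> hyp3. - lform x Q.cusp \<le> \<sigma>' / 2}"
  shows "packing_density v B = (\<sigma>\<^sup>2 + \<sigma>'\<^sup>2) * (s * (k + c)\<^sup>2 / (4 * c)) / measure hyp_vol (simplex_of v)"
proof -
  have "p \<noteq> a" using indices by auto
  have pos: "s * (k + c)\<^sup>2 / (4 * c) \<ge> 0" using params c_pos by simp
  have "measure hyp_vol (B p \<inter> simplex_of v) = \<sigma>\<^sup>2 * (s * (k + c)\<^sup>2 / (4 * c))"
    unfolding measure_def assms(5) emeasure_horoball[OF assms(1,2)] by (rule enn2real_ennreal, rule mult_nonneg_nonneg[OF zero_le_power2 pos])
  moreover have "measure hyp_vol (B a \<inter> simplex_of v) = \<sigma>'\<^sup>2 * (s * (k + c)\<^sup>2 / (4 * c))"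
    unfolding measure_def assms(6) Q.emeasure_horoball[OF assms(3,4)] by (rule enn2real_ennreal, rule mult_nonneg_nonneg[OF zero_le_power2 pos])
  ultimately show ?thesis
    unfolding packing_density_def ideal_vertices_eq using \<open>p \<noteq> a\<close> by (simp add: distrib_right add_divide_distrib)
qed

text \<open>The density is proportional to \<open>\<sigma>\<^sup>2 + \<sigma>'\<^sup>2\<close> with \<open>\<sigma>, \<sigma>' \<le> 1\<close> and \<open>\<sigma> \<sigma>'\<close> bounded by tangency of the
  two horoballs, so it is largest when one of them is as large as its facet permits.\<close>

lemma delta_opt_eq:
  assumes cox: "coxeter_system n" and L: "1 \<le> 2 * (k + c)"
  shows "delta_opt v = ((k + c)\<^sup>2 + 1 / 4) * s / (4 * c) / measure hyp_vol (simplex_of v)"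
proof -
  define A where "A = s * (k + c)\<^sup>2 / (4 * c) / measure hyp_vol (simplex_of v)"
  define l where "l = 1 / (2 * (k + c))"
  have A: "A \<ge> 0" using params c_pos by (simp add: A_def)
  have L0: "k + c > 0" using params c_pos by simp
  \<comment> \<open>\<open>l\<close> is the scale that tangency leaves when the other horoball has
    scale 1; \<open>L\<close> keeps it at most 1, so that this corner is admissible.\<close>
  have l: "0 < l" "l \<le> 1" "2 * (k + c) * (1 * l) = 1" using L L0 by (simp_all add: l_def)
  have val: "packing_density v B = (\<sigma>\<^sup>2 + \<sigma>'\<^sup>2) * A"
    if "0 < \<sigma>" "\<sigma> \<le> 1" "0 < \<sigma>'" "\<sigma>' \<le> 1" "B p = {x \<in> hyp3. - lform x cusp \<le> \<sigma> / 2}" "B a = {x \<in> hyp3. - lform x Q.cusp \<le> \<sigma>' / 2}"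
    for \<sigma> \<sigma>' B
    unfolding packing_density_eq[OF that] A_def by simp
  have "delta_opt v = (1 + l\<^sup>2) * A"
    unfolding delta_opt_def
  proof (rule cSup_eq_maximum)
    obtain \<B> B where B: "horoball_packing v \<B> B" "B p = {x \<in> hyp3. - lform x cusp \<le> 1 / 2}" "B a = {x \<in> hyp3. - lform x Q.cusp \<le> l / 2}"
      using exists_packing[OF cox, of 1 l] l by auto
    then have "(1 + l\<^sup>2) * A = packing_density v B"
      using val[of 1 l B] l by simp
    then show "(1 + l\<^sup>2) * A \<in> {packing_density v B | \<B> B. horoball_packing v \<B> B}"
      using B(1) by blast
  next
    fix x assume "x \<in> {packing_density v B | \<B> B. horoball_packing v \<B> B}"
    then obtain \<B> B where x: "x = packing_density v B" "horoball_packing v \<B> B" by blast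
    from packing_cusps[OF x(2)] obtain \<sigma> \<sigma>' where \<sigma>: "0 < \<sigma>" "\<sigma> \<le> 1" "0 < \<sigma>'" "\<sigma>' \<le> 1" "2 * (k + c) * (\<sigma> * \<sigma>') \<le> 1"
      "B p = {x \<in> hyp3. - lform x cusp \<le> \<sigma> / 2}" "B a = {x \<in> hyp3. - lform x Q.cusp \<le> \<sigma>' / 2}" by blast
    have "\<sigma> * \<sigma>' \<le> l" using \<sigma>(5) L0 by (simp add: l_def field_simps)
    then have "(\<sigma> * \<sigma>')\<^sup>2 \<le> l\<^sup>2" using \<sigma> by (intro power_mono) auto
    \<comment> \<open>Expanded, this is \<open>\<sigma>\<^sup>2 + \<sigma>'\<^sup>2 \<le> 1 +
      (\<sigma> * \<sigma>')\<^sup>2\<close>, which reduces the maximisation to the bound on the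
      product.\<close>
    moreover have "0 \<le> (1 - \<sigma>\<^sup>2) * (1 - \<sigma>'\<^sup>2)" using \<sigma> by (simp add: power_le_one)
    ultimately have "\<sigma>\<^sup>2 + \<sigma>'\<^sup>2 \<le> 1 + l\<^sup>2" by (simp add: algebra_simps power_mult_distrib)
    then show "x \<le> (1 + l\<^sup>2) * A" unfolding x(1) val[OF \<sigma>(1-4,6,7)] using A by (rule mult_right_mono)
  qed
  also have "\<dots> = ((1 + l\<^sup>2) * (k + c)\<^sup>2) * s / (4 * c) / measure hyp_vol (simplex_of v)"
    unfolding A_def by (simp only: times_divide_eq_right mult.commute mult.left_commute mult.assoc)
  also have "(1 + l\<^sup>2) * (k + c)\<^sup>2 = (k + c)\<^sup>2 + 1 / 4"
  proof -
    have "l * (k + c) = 1 / 2" using L0 by (simp add: l_def)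
    then have "(l * (k + c))\<^sup>2 = (1 / 2)\<^sup>2" by simp
    moreover have "(1 + l\<^sup>2) * (k + c)\<^sup>2 = (k + c)\<^sup>2 + (l * (k + c))\<^sup>2"
      by (simp only: power_mult_distrib distrib_right mult_1_left)
    ultimately show ?thesis by (simp add: power2_eq_square)
  qed
  finally show ?thesis .
qed

end

section \<open>Existence of the simplices and translation of the diagrams\<close>

lemma tetrahedron_from_normals:
  assumes v: "\<And>i. v i \<in> hyp3 \<or> ideal_point (v i)"
    and orth: "\<And>i j. i \<noteq> j \<Longrightarrow> lform (v i) (N j) = 0" and neg: "\<And>i. lform (v i) (N i) < 0"
  shows "tetrahedron v"
  unfolding tetrahedron_def
proof (intro conjI allI v)
  show inj: "inj v"
  proof (rule injI, rule ccontr)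
    fix i j assume "v i = v j" "i \<noteq> j"
    then show False using orth[of i j] neg[of j] by simp
  qed
  show "independent (range v)"
  proof (rule independent_if_scalars_zero)
    fix f x assume s: "(\<Sum>x\<in>range v. f x *\<^sub>R x) = 0" and x: "x \<in> range v"
    then obtain j where j: "x = v j" by blast
    have "0 = lform (\<Sum>i\<in>UNIV. f (v i) *\<^sub>R v i) (N j)"
      using s inj by (simp add: sum.reindex lform_bilinear)
    also have "\<dots> = (\<Sum>i\<in>UNIV. if i = j then f (v j) * lform (v j) (N j) else 0)"
      unfolding lform_sum by (intro sum.cong) (auto simp: lform_bilinear orth)
    also have "\<dots> = f (v j) * lform (v j) (N j)" by simp
    finally show "f x = 0" using neg[of j] j by simp
  qed simp
qed

text \<open>The vertices and normals are those of the half-space picture, with the identity in the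
  place of \<open>frame\<close>.\<close>

lemma exists_cycle_simplex:
  assumes ind: "distinct [p, a, b, h :: 4]"
    and params: "s\<^sup>2 + c\<^sup>2 = 1" "0 < k" "k < c" "0 < s"
  shows "\<exists>v. cycle_simplex v p a b h k s c"
proof -
  have c: "c > 0" using params by simp
  have k2: "k\<^sup>2 < c\<^sup>2" using params by (intro power_strict_mono) auto
  have UN: "UNIV = {p, a, b, h}"
    using ind by (intro card_subset_eq[symmetric]) auto
  \<comment> \<open>\<open>w\<close> and \<open>w'\<close> scale \<open>v b\<close> and
    \<open>v h\<close> onto the hyperboloid; \<open>k < c\<close> makes both radicands
    positive.\<close>
  define w where "w = 1 / sqrt (1 - k\<^sup>2 / c\<^sup>2)"
  define w' where "w' = 1 / sqrt (1 - k\<^sup>2 - s\<^sup>2)"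
  have w: "w > 0" "w\<^sup>2 * (1 - k\<^sup>2 / c\<^sup>2) = 1"
    using k2 c by (simp_all add: w_def power_divide)
  have w': "w' > 0" "w'\<^sup>2 * (1 - k\<^sup>2 - s\<^sup>2) = 1"
  proof -
    have "1 - k\<^sup>2 - s\<^sup>2 > 0" using k2 params(1) by simp
    then show "w' > 0" "w'\<^sup>2 * (1 - k\<^sup>2 - s\<^sup>2) = 1" by (simp_all add: w'_def power_divide)
  qed
  define v :: "4 \<Rightarrow> lorentz4" where
    "v = (\<lambda>i. if i = p then (1 / 2, vector [1 / 2, 0, 0]) else if i = a then (1, vector [0, c, - s])
      else if i = b then (w, vector [0, - k * w, s * k * w / c]) else (w', vector [0, - k * w', - s * w']))"
  define N :: "4 \<Rightarrow> lorentz4" where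
    "N = (\<lambda>i. if i = p then (0, vector [- 1, 0, 0]) else if i = a then (k, vector [k, - 1, 0])
      else if i = b then (s, vector [s, 0, - 1]) else (0, vector [0, s, c]))"
  have vs: "v p = (1 / 2, vector [1 / 2, 0, 0])" "v a = (1, vector [0, c, - s])"
     "v b = (w, vector [0, - k * w, s * k * w / c])" "v h = (w', vector [0, - k * w', - s * w'])"
    using ind by (auto simp: v_def)
  have Ns: "N p = (0, vector [- 1, 0, 0])" "N a = (k, vector [k, - 1, 0])" "N b = (s, vector [s, 0, - 1])" "N h = (0, vector [0, s, c])"
    using ind by (auto simp: N_def)
  have lf: "lform (t, vector [z, x, y]) (t', vector [z', x', y']) = z * z' + x * x' + y * y' - t * t'" for t z x y t' z' x' y' :: real
    by (simp add: lform_def inner_vec_def sum_3)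
  have all: "P i" if "P p" "P a" "P b" "P h" for P i
    using that UN by (metis UNIV_I empty_iff insert_iff)
  have orth: "lform (v i) (N j) = 0" if "i \<noteq> j" for i j
  proof -
    have "\<forall>j. i \<noteq> j \<longrightarrow> lform (v i) (N j) = 0"
      by (rule all[of "\<lambda>i. \<forall>j. i \<noteq> j \<longrightarrow> lform (v i) (N j) = 0"]; intro allI;
          rule_tac P = "\<lambda>j. _ j \<longrightarrow> _ j" in all)
         (use c in \<open>simp_all add: vs Ns lf algebra_simps\<close>)
    then show ?thesis using that by blast
  qed
  have neg: "lform (v i) (N i) < 0" for i
  proof (rule all)
    show "lform (v b) (N b) < 0"
    proof -
      have "0 < s * k * w / c" "0 < s * w" using params c w by auto
      moreover have "lform (v b) (N b) = - (s * k * w / c) - s * w" by (simp add: vs Ns lf)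
      ultimately show ?thesis by linarith
    qed
    show "lform (v h) (N h) < 0"
    proof -
      have "0 < s * (k * w')" "0 < c * (s * w')" using params c w' by auto
      moreover have "lform (v h) (N h) = - (s * (k * w')) - c * (s * w')" by (simp add: vs Ns lf)
      ultimately show ?thesis by linarith
    qed
  qed (use params c in \<open>simp_all add: vs Ns lf\<close>)
  have vert: "v i \<in> hyp3 \<or> ideal_point (v i)" for i
  proof (rule all)
    show "v p \<in> hyp3 \<or> ideal_point (v p)" "v a \<in> hyp3 \<or> ideal_point (v a)"
      using params(1) by (simp_all add: vs lf ideal_point_def power2_eq_square add.commute)
    have "(s * k * w / c)\<^sup>2 + (k * w)\<^sup>2 - w\<^sup>2 = - (w\<^sup>2 * (1 - k\<^sup>2 / c\<^sup>2))"
    proof -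
      have "(s * k * w / c)\<^sup>2 + (k * w)\<^sup>2 = k\<^sup>2 * w\<^sup>2 * ((s\<^sup>2 + c\<^sup>2) / c\<^sup>2)"
        using c by (simp add: field_simps power2_eq_square)
      then show ?thesis unfolding params(1) by (simp add: algebra_simps)
    qed
    then show "v b \<in> hyp3 \<or> ideal_point (v b)"
      using w by (simp add: vs lf hyp3_def power2_eq_square algebra_simps)
    show "v h \<in> hyp3 \<or> ideal_point (v h)"
      using w' by (simp add: vs lf hyp3_def power2_eq_square algebra_simps)
  qed
  have tet: "tetrahedron v" by (rule tetrahedron_from_normals[OF vert orth neg])
  have Nn: "lform (N i) (N i) = 1" for i
    by (rule all[of "\<lambda>i. lform (N i) (N i) = 1"]) (use params(1) in \<open>simp_all add: Ns lf power2_eq_square\<close>)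
  have out: "outward_normal v i = N i" for i
  proof (rule outward_normal_eqI[OF tet Nn])
    show "lform (N i) (v j) = 0" if "j \<noteq> i" for j
      using orth[OF that] by (subst lform_commute)
    show "lform (N i) (v i) < 0" using neg[of i] by (subst lform_commute)
  qed
  show ?thesis
    by (intro exI[of _ v] cycle_simplex.intro tet ind params) (simp_all add: out Ns lf)
qed

lemma dihedral_angle_iff:
  assumes "tetrahedron v" "i \<noteq> j" "0 \<le> t" "t \<le> pi"
  shows "dihedral_angle v i j = t \<longleftrightarrow> lform (outward_normal v i) (outward_normal v j) = - cos t"
  using outward_normal_gram[OF assms(1,2)] assms(3,4)
  by (auto simp: dihedral_angle_def arccos_cos)

text \<open>In the type \<open>4\<close> the numeral 4 equals 0, which turns the list of
  \<open>forall_4\<close> into the indices of the diagrams.\<close>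

lemma all_4: "(\<forall>i :: 4. P i) \<longleftrightarrow> P 0 \<and> P 1 \<and> P 2 \<and> P 3"
proof -
  have "(4 :: 4) = 0" by simp
  then show ?thesis unfolding forall_4 by metis
qed

lemma coxeter_simplex_iff_gram:
  assumes m: "\<And>i j. i \<noteq> j \<Longrightarrow> m i j \<ge> 2"
  shows "coxeter_simplex m v \<longleftrightarrow> tetrahedron v \<and> emeasure hyp_vol (simplex_of v) < \<infinity> \<and>
    (\<forall>i j. i \<noteq> j \<longrightarrow> lform (outward_normal v i) (outward_normal v j) = - cos (pi / real (m i j)))"
proof -
  have "pi / real (m i j) \<le> pi" if "i \<noteq> j" for i j using m[OF that] by (simp add: field_simps)
  then have "dihedral_angle v i j = pi / real (m i j) \<longleftrightarrow> lform (outward_normal v i) (outward_normal v j) = - cos (pi / real (m i j))"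
    if "tetrahedron v" "i \<noteq> j" for i j
    using dihedral_angle_iff[OF that, of "pi / real (m i j)"] that by simp
  then show ?thesis unfolding coxeter_simplex_def using m by blast
qed

lemma cycle_diagram_values:
  "cycle_diagram l0 l1 l2 l3 0 1 = l0" "cycle_diagram l0 l1 l2 l3 1 0 = l0"
  "cycle_diagram l0 l1 l2 l3 1 2 = l1" "cycle_diagram l0 l1 l2 l3 2 1 = l1"
  "cycle_diagram l0 l1 l2 l3 2 3 = l2" "cycle_diagram l0 l1 l2 l3 3 2 = l2"
  "cycle_diagram l0 l1 l2 l3 3 0 = l3" "cycle_diagram l0 l1 l2 l3 0 3 = l3"
  "cycle_diagram l0 l1 l2 l3 0 2 = 2" "cycle_diagram l0 l1 l2 l3 2 0 = 2"
  "cycle_diagram l0 l1 l2 l3 1 3 = 2" "cycle_diagram l0 l1 l2 l3 3 1 = 2"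
  by (simp_all add: cycle_diagram_def Let_def)

lemma cycle_diagram_ge_2:
  assumes "2 \<le> l0" "2 \<le> l1" "2 \<le> l2" "2 \<le> l3"
  shows "cycle_diagram l0 l1 l2 l3 i j \<ge> 2"
  using assms by (simp add: cycle_diagram_def Let_def)

lemma coxeter_cycle_iff:
  assumes "2 \<le> l0" "2 \<le> l1" "2 \<le> l2" "2 \<le> l3"
  shows "coxeter_simplex (cycle_diagram l0 l1 l2 l3) v \<longleftrightarrow> tetrahedron v \<and> emeasure hyp_vol (simplex_of v) < \<infinity> \<and>
    lform (outward_normal v 0) (outward_normal v 1) = - cos (pi / real l0) \<and>
    lform (outward_normal v 1) (outward_normal v 2) = - cos (pi / real l1) \<and>
    lform (outward_normal v 2) (outward_normal v 3) = - cos (pi / real l2) \<and>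
    lform (outward_normal v 3) (outward_normal v 0) = - cos (pi / real l3) \<and>
    lform (outward_normal v 0) (outward_normal v 2) = 0 \<and>
    lform (outward_normal v 1) (outward_normal v 3) = 0"
  by (subst coxeter_simplex_iff_gram[OF cycle_diagram_ge_2[OF assms]])
     (auto simp: all_4 cycle_diagram_values lform_commute)

lemma coxeter_simplex_system:
  assumes "coxeter_simplex m v"
  shows "coxeter_system (outward_normal v)"
proof
  have tet: "tetrahedron v" using assms by (simp add: coxeter_simplex_def)
  show "lform (outward_normal v i) (outward_normal v i) = 1" for i by (rule outward_normal_norm[OF tet])
  fix i j :: 4 assume ij: "i \<noteq> j"
  then have "2 \<le> m i j" "dihedral_angle v i j = pi / real (m i j)"
    using assms by (auto simp: coxeter_simplex_def)
  then show "\<exists>m. 2 \<le> m \<and> lform (outward_normal v i) (outward_normal v j) = - cos (pi / real m)"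
    using outward_normal_gram[OF tet ij] by blast
qed

text \<open>The edge labelled \<open>l\<close> joins the facets 1 and 2, which become
  \<open>p\<close> and \<open>a\<close>; the opposite edge, labelled 6, gives
  \<open>c = cos (pi / 6)\<close>. The bound \<open>l \<le> 5\<close> yields
  \<open>k < c\<close>.\<close>

lemma coxeter_cycle_36:
  assumes l: "3 \<le> l" "l \<le> 5"
  shows "coxeter_simplex (cycle_diagram 3 l 3 6) v \<longleftrightarrow>
    cycle_simplex v 1 2 0 3 (cos (pi / real l)) (1 / 2) (sqrt 3 / 2) \<and> emeasure hyp_vol (simplex_of v) < \<infinity>"
proof -
  have "cos (pi / real l) < cos (pi / 6)" using l by (intro cos_monotone_0_pi) (auto simp: field_simps)
  moreover have "0 < cos (pi / real l)" using l by (intro cos_gt_zero) (auto simp: field_simps)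
  ultimately show ?thesis
    using l by (subst coxeter_cycle_iff)
      (auto simp: cycle_simplex_def cos_30 cos_60 power_divide lform_commute[of _ "outward_normal v 0"] lform_commute[of "outward_normal v 2" "outward_normal v 1"])
qed

text \<open>Now the edge labelled 3 supplies \<open>k\<close>, and the three edges labelled 4 make
  \<open>s = c\<close>.\<close>

lemma coxeter_cycle_44:
  "coxeter_simplex (cycle_diagram 3 4 4 4) v \<longleftrightarrow>
    cycle_simplex v 1 0 2 3 (1 / 2) (sqrt 2 / 2) (sqrt 2 / 2) \<and> emeasure hyp_vol (simplex_of v) < \<infinity>"
proof -
  have "1 / 2 < sqrt 2 / 2" by simp
  then show ?thesis
    by (subst coxeter_cycle_iff)
      (auto simp: cycle_simplex_def cos_45 cos_60 power_divide lform_commute[of "outward_normal v 1" "outward_normal v 0"]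
        lform_commute[of "outward_normal v 2" "outward_normal v 0"] lform_commute[of "outward_normal v 3" "outward_normal v 0"])
qed

section \<open>Certified values of the volume integrals\<close>

primrec horner :: "real list \<Rightarrow> real \<Rightarrow> real" where
  "horner [] w = 0"
| "horner (a # as) w = a + w * horner as w"

text \<open>The sum of \<open>a_j * y ^ j / (2 * (i + j) + 1)\<close>, that is, the integral of an
  even polynomial up to a power of its end point.\<close>

primrec odd_horner :: "nat \<Rightarrow> real list \<Rightarrow> real \<Rightarrow> real" where
  "odd_horner i [] y = 0"
| "odd_horner i (a # as) y = a / real (2 * i + 1) + y * odd_horner (i + 1) as y"

text \<open>The sum of \<open>odd_horner\<close> with each term multiplied by a truncated logarithm
  series: \<open>H\<close> carries the partial sum of \<open>q ^ j / j\<close> up to the current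
  index.\<close>

primrec log_horner :: "nat \<Rightarrow> real \<Rightarrow> real list \<Rightarrow> real \<Rightarrow> real \<Rightarrow> real" where
  "log_horner i H [] u q = 0"
| "log_horner i H (a # as) u q = a / real (2 * i + 1) * H + u * log_horner (i + 1) (H + q ^ (i + 1) / real (i + 1)) as u q"

text \<open>The antiderivative of \<open>artanh z * z ^ (2 * i)\<close> that vanishes at 0, by
  integration by parts. In this arrangement the factor \<open>1 - z ^ (2 * i + 1)\<close> cancels
  the singularity of \<open>ln (1 - z)\<close> at 1.\<close>

definition artanh_moment :: "nat \<Rightarrow> real \<Rightarrow> real" where
  "artanh_moment i z = ((1 + z ^ (2 * i + 1)) * ln (1 + z) + (1 - z ^ (2 * i + 1)) * ln (1 - z) + (\<Sum>j=1..i. z ^ (2 * j) / real j)) / (2 * real (2 * i + 1))"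

lemma artanh_moment_deriv:
  assumes z: "\<bar>z\<bar> < 1"
  shows "(artanh_moment i has_real_derivative artanh z * z ^ (2 * i)) (at z)"
proof -
  have pos: "1 + z > 0" "1 - z > 0" using z by auto
  define S where "S = (\<Sum>j=1..i. 2 * z ^ (2 * j - 1))"
  \<comment> \<open>The rational remainder of the derivative is a geometric sum, which telescopes to
    0.\<close>
  have geo: "(1 + z ^ (2 * i + 1)) / (1 + z) - (1 - z ^ (2 * i + 1)) / (1 - z) + S = 0"
    unfolding S_def
  proof (induction i)
    case 0
    show ?case using pos by simp
  next
    case (Suc i)
    have "(1 + z ^ (2 * Suc i + 1)) / (1 + z) - (1 - z ^ (2 * Suc i + 1)) / (1 - z)
      = (1 + z ^ (2 * i + 1)) / (1 + z) - (1 - z ^ (2 * i + 1)) / (1 - z) - 2 * z ^ (2 * i + 1)"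
    proof -
      define P where "P = z ^ (2 * i + 1)"
      have zP: "z ^ (2 * Suc i + 1) = P * z\<^sup>2" by (simp add: P_def power2_eq_square)
      have e1: "(1 + P * z\<^sup>2) / (1 + z) = (1 + P) / (1 + z) + P * (z - 1)"
        using pos by (simp add: field_simps power2_eq_square)
      have e2: "(1 - P * z\<^sup>2) / (1 - z) = (1 - P) / (1 - z) + P * (1 + z)"
        using pos by (simp add: field_simps power2_eq_square)
      show ?thesis unfolding zP P_def[symmetric] e1 e2 by (simp add: right_diff_distrib distrib_left)
    qed
    then show ?case using Suc.IH by simp
  qed
  have "((\<lambda>z. \<Sum>j=1..i. z ^ (2 * j) / real j) has_real_derivative S) (at z)"
    unfolding S_def
  proof (rule DERIV_sum)
    fix j assume "j \<in> {1..i}"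
    then show "((\<lambda>z. z ^ (2 * j) / real j) has_real_derivative 2 * z ^ (2 * j - 1)) (at z)"
      by (auto intro!: derivative_eq_intros)
  qed
  note dS = this
  have dp: "((\<lambda>z. z ^ (2 * i + 1)) has_real_derivative real (2 * i + 1) * z ^ (2 * i)) (at z)"
    using DERIV_pow[of "2 * i + 1" z] by simp
  have dl: "((\<lambda>z. ln (1 + z)) has_real_derivative 1 / (1 + z)) (at z)"
    "((\<lambda>z. ln (1 - z)) has_real_derivative - 1 / (1 - z)) (at z)"
    using pos by (auto intro!: derivative_eq_intros simp: divide_simps)
  note d1 = DERIV_mult[OF DERIV_add[OF DERIV_const[of 1] dp] dl(1)]
  note d2 = DERIV_mult[OF DERIV_diff[OF DERIV_const[of 1] dp] dl(2)]
  have "(artanh_moment i has_real_derivative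
    (real (2 * i + 1) * z ^ (2 * i) * (ln (1 + z) - ln (1 - z)) +
      ((1 + z ^ (2 * i + 1)) / (1 + z) - (1 - z ^ (2 * i + 1)) / (1 - z) + S)) / (2 * real (2 * i + 1))) (at z)"
    unfolding artanh_moment_def
    by (rule DERIV_cong[OF DERIV_cdivide[OF DERIV_add[OF DERIV_add[OF d1 d2] dS]]])
       (simp add: algebra_simps add_divide_distrib diff_divide_distrib)
  then have d: "(artanh_moment i has_real_derivative (real (2 * i + 1) * z ^ (2 * i) * (ln (1 + z) - ln (1 - z)) + 0) / (2 * real (2 * i + 1))) (at z)"
    unfolding geo .
  have art: "artanh z = (ln (1 + z) - ln (1 - z)) / 2" using pos by (simp add: artanh_def ln_div)
  have e: "(N * X * D + 0) / (2 * N) = D / 2 * X" if "N \<noteq> 0" for N X D :: real using that by simp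
  show ?thesis unfolding art by (rule DERIV_cong[OF d], rule e) simp
qed

text \<open>The end point 1 is reached when \<open>\<tau> * S = 1\<close>, at the ideal vertex.
  Continuity there rests on the limit 0 of \<open>(1 - z) * ln (1 - z)\<close>.\<close>

lemma artanh_moment_continuous: "continuous_on {0..1} (artanh_moment i)"
proof -
  define f :: "real \<Rightarrow> real" where "f z = (1 - z) * ln (1 - z)" for z
  have f: "continuous_on {0..1} f"
    unfolding continuous_on_def
  proof
    fix x :: real assume x: "x \<in> {0..1}"
    show "(f \<longlongrightarrow> f x) (at x within {0..1})"
    proof (cases "x = 1")
      case True
      have "filterlim (\<lambda>z::real. 1 - z) (at_right 0) (at_left 1)"
        by (auto simp: filterlim_at eventually_at_filter intro!: tendsto_eq_intros)
      then have "((\<lambda>z. ln (inverse (1 - z)) / inverse (1 - z)) \<longlongrightarrow> 0) (at_left (1::real))"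
        by (intro filterlim_compose[OF ln_x_over_x_tendsto_0] filterlim_compose[OF filterlim_inverse_at_top_right])
      then have "((\<lambda>z. - ((1 - z) * ln (1 - z))) \<longlongrightarrow> 0) (at_left (1::real))"
        by (rule Lim_transform_eventually) (auto simp: eventually_at_filter ln_inverse divide_inverse)
      then have "((\<lambda>z. (1 - z) * ln (1 - z)) \<longlongrightarrow> 0) (at_left (1::real))"
        by (subst (asm) tendsto_minus_cancel_left[symmetric]) simp
      moreover have "at (1::real) within {0..1} \<le> at_left 1"
        by (simp add: at_within_Icc_at_left)
      ultimately show ?thesis unfolding True f_def by (auto intro: tendsto_mono)
    next
      case False
      then have "isCont f x" unfolding f_def using x by (intro continuous_intros) auto
      then show ?thesis using continuous_at_imp_continuous_at_within continuous_within by blast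
    qed
  qed
  have geo: "1 - z ^ (2 * i + 1) = (\<Sum>j<2 * i + 1. z ^ j) * (1 - z)" for z :: real
    using one_diff_power_eq[of z "2 * i + 1"] by (simp add: mult.commute)
  have "artanh_moment i = (\<lambda>z. ((1 + z ^ (2 * i + 1)) * ln (1 + z) + (\<Sum>j<2 * i + 1. z ^ j) * f z + (\<Sum>j=1..i. z ^ (2 * j) / real j)) / (2 * real (2 * i + 1)))"
    by (rule ext) (simp only: artanh_moment_def geo f_def mult.assoc)
  then show ?thesis by (simp only:) (intro continuous_intros f; simp)
qed

text \<open>The closed form of the integral of \<open>artanh (\<tau> * \<sigma>)\<close> times the
  polynomial in \<open>\<sigma>\<^sup>2\<close>, where \<open>S\<^sup>2 = x\<close> and
  \<open>\<tau>\<^sup>2 = T\<close>. For rational \<open>x\<close> and \<open>T\<close> the Horner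
  sums are rational, and only square roots and two logarithms need enclosures.\<close>

definition wedge_value :: "real list \<Rightarrow> real \<Rightarrow> real \<Rightarrow> real" where
  "wedge_value ps x T = (let z = sqrt (x * T); l = ln (1 + z); m = ln (1 - z) in
     ((odd_horner 0 ps (1 / T) * (l + m) + log_horner 0 0 ps (1 / T) (x * T)) * sqrt (1 / T) + odd_horner 0 ps x * (l - m) * sqrt x) / 2)"

text \<open>One moment per coefficient, with the running offset \<open>i\<close> carried through the
  induction. The derivative is used on the open interval only, as \<open>artanh\<close> is unbounded
  near \<open>S\<close> when \<open>\<tau> * S = 1\<close>.\<close>

lemma artanh_has_integral:
  assumes \<tau>: "0 < \<tau>" and S: "0 < S" "\<tau> * S \<le> 1"
  shows "((\<lambda>\<sigma>. artanh (\<tau> * \<sigma>) * (\<sigma> ^ (2 * i) * horner ps (\<sigma>\<^sup>2))) has_integral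
    ((odd_horner i ps (1 / \<tau>\<^sup>2) * (ln (1 + \<tau> * S) + ln (1 - \<tau> * S)) + log_horner i (\<Sum>j=1..i. (\<tau> * S) ^ (2 * j) / real j) ps (1 / \<tau>\<^sup>2) ((\<tau> * S)\<^sup>2)) / \<tau> ^ (2 * i + 1)
     + odd_horner i ps (S\<^sup>2) * (ln (1 + \<tau> * S) - ln (1 - \<tau> * S)) * S ^ (2 * i + 1)) / 2) {0..S}"
proof (induction ps arbitrary: i)
  case Nil
  show ?case by simp
next
  case (Cons a ps)
  define z l m where "z = \<tau> * S" and "l = ln (1 + z)" and "m = ln (1 - z)"
  have one: "((\<lambda>\<sigma>. artanh (\<tau> * \<sigma>) * \<sigma> ^ (2 * i)) has_integral (artanh_moment i (\<tau> * S) / \<tau> ^ (2 * i + 1) - artanh_moment i (\<tau> * 0) / \<tau> ^ (2 * i + 1))) {0..S}"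
  proof (rule fundamental_theorem_of_calculus_interior)
    show "continuous_on {0..S} (\<lambda>\<sigma>. artanh_moment i (\<tau> * \<sigma>) / \<tau> ^ (2 * i + 1))"
    proof (intro continuous_intros continuous_on_compose2[OF artanh_moment_continuous])
      show "times \<tau> ` {0..S} \<subseteq> {0..1}" using \<tau> S
        by (auto simp: mult_le_one intro: order_trans[OF mult_left_mono S(2)])
    qed (use \<tau> in auto)
    fix \<sigma> assume \<sigma>: "\<sigma> \<in> {0<..<S}"
    have "\<tau> * \<sigma> < \<tau> * S" using \<sigma> \<tau> by simp
    moreover have "0 < \<tau> * \<sigma>" using \<sigma> \<tau> by simp
    ultimately have lt: "\<bar>\<tau> * \<sigma>\<bar> < 1" using S by linarith
    have "((\<lambda>\<sigma>. \<tau> * \<sigma>) has_real_derivative \<tau>) (at \<sigma>)" by (auto intro!: derivative_eq_intros)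
    from DERIV_cdivide[OF DERIV_chain2[OF artanh_moment_deriv[OF lt] this], of i "\<tau> ^ (2 * i + 1)"]
    have "((\<lambda>\<sigma>. artanh_moment i (\<tau> * \<sigma>) / \<tau> ^ (2 * i + 1)) has_real_derivative artanh (\<tau> * \<sigma>) * \<sigma> ^ (2 * i)) (at \<sigma>)"
      using \<tau> by (simp add: power_mult_distrib)
    then show "((\<lambda>\<sigma>. artanh_moment i (\<tau> * \<sigma>) / \<tau> ^ (2 * i + 1)) has_vector_derivative artanh (\<tau> * \<sigma>) * \<sigma> ^ (2 * i)) (at \<sigma>)"
      by (simp add: has_real_derivative_iff_has_vector_derivative)
  qed (use S in auto)
  have "(\<Sum>j=1..i. (\<tau> * 0) ^ (2 * j) / real j) = 0" by (intro sum.neutral) auto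
  then have z0: "artanh_moment i (\<tau> * 0) = 0" by (simp add: artanh_moment_def)
  have "((\<lambda>\<sigma>. a * (artanh (\<tau> * \<sigma>) * \<sigma> ^ (2 * i)) + artanh (\<tau> * \<sigma>) * (\<sigma> ^ (2 * (i + 1)) * horner ps (\<sigma>\<^sup>2))) has_integral
     (a * (artanh_moment i z / \<tau> ^ (2 * i + 1)) +
     ((odd_horner (i + 1) ps (1 / \<tau>\<^sup>2) * (l + m) + log_horner (i + 1) (\<Sum>j=1..i + 1. z ^ (2 * j) / real j) ps (1 / \<tau>\<^sup>2) (z\<^sup>2)) / \<tau> ^ (2 * (i + 1) + 1)
     + odd_horner (i + 1) ps (S\<^sup>2) * (l - m) * S ^ (2 * (i + 1) + 1)) / 2)) {0..S}"
    using has_integral_add[OF has_integral_mult_right[OF one, of a] Cons.IH[of "i + 1"]]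
    unfolding z0 z_def l_def m_def by simp
  also have "(\<lambda>\<sigma>. a * (artanh (\<tau> * \<sigma>) * \<sigma> ^ (2 * i)) + artanh (\<tau> * \<sigma>) * (\<sigma> ^ (2 * (i + 1)) * horner ps (\<sigma>\<^sup>2)))
     = (\<lambda>\<sigma>. artanh (\<tau> * \<sigma>) * (\<sigma> ^ (2 * i) * horner (a # ps) (\<sigma>\<^sup>2)))"
    by (simp add: fun_eq_iff algebra_simps power2_eq_square)
  also have "a * (artanh_moment i z / \<tau> ^ (2 * i + 1)) +
     ((odd_horner (i + 1) ps (1 / \<tau>\<^sup>2) * (l + m) + log_horner (i + 1) (\<Sum>j=1..i + 1. z ^ (2 * j) / real j) ps (1 / \<tau>\<^sup>2) (z\<^sup>2)) / \<tau> ^ (2 * (i + 1) + 1)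
     + odd_horner (i + 1) ps (S\<^sup>2) * (l - m) * S ^ (2 * (i + 1) + 1)) / 2
   = ((odd_horner i (a # ps) (1 / \<tau>\<^sup>2) * (l + m) + log_horner i (\<Sum>j=1..i. z ^ (2 * j) / real j) (a # ps) (1 / \<tau>\<^sup>2) (z\<^sup>2)) / \<tau> ^ (2 * i + 1)
     + odd_horner i (a # ps) (S\<^sup>2) * (l - m) * S ^ (2 * i + 1)) / 2"
  proof -
    define n where "n = real (2 * i + 1)"
    define H where "H = (\<Sum>j=1..i. z ^ (2 * j) / real j)"
    define t where "t = \<tau> ^ (2 * i + 1)"
    define r where "r = S ^ (2 * i + 1)"
    have H': "(\<Sum>j=1..i + 1. z ^ (2 * j) / real j) = H + (z\<^sup>2) ^ (i + 1) / real (i + 1)"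
    proof -
      have "(z\<^sup>2) ^ (i + 1) = z ^ (2 * (i + 1))" by (rule power_mult[symmetric])
      then show ?thesis unfolding H_def by simp
    qed
    have tz: "t > 0" "n > 0" using \<tau> by (simp_all add: t_def n_def)
    have pw: "\<tau> ^ (2 * (i + 1) + 1) = \<tau>\<^sup>2 * t" "S ^ (2 * (i + 1) + 1) = S\<^sup>2 * r" "z ^ (2 * i + 1) = t * r"
      by (simp_all add: t_def r_def z_def power2_eq_square power_mult_distrib)
    have mom: "artanh_moment i z = ((1 + t * r) * l + (1 - t * r) * m + H) / (2 * n)"
      unfolding artanh_moment_def pw H_def n_def l_def m_def ..
    show ?thesis
      unfolding mom H' pw odd_horner.simps log_horner.simps n_def[symmetric] t_def[symmetric] r_def[symmetric] H_def[symmetric]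
      using tz \<tau> by (simp add: field_simps)
  qed
  finally show ?case unfolding z_def l_def m_def .
qed

text \<open>For \<open>w \<le> 2\<close> the reciprocal is at least 1/3, so
  \<open>\<delta> \<le> 1 / 6\<close> keeps \<open>horner ps w - \<delta>\<close> nonnegative, as
  integration in \<open>ennreal\<close> requires. The last assumption bounds the integral of
  \<open>artanh\<close> by 1, which leaves a total error of at most \<open>\<delta>\<close>.\<close>

lemma wedge_integral_approx:
  assumes xT: "0 < x" "x \<le> 2" "0 < T" "x * T \<le> 1"
    and approx: "\<And>w. 0 \<le> w \<Longrightarrow> w \<le> x \<Longrightarrow> \<bar>1 / (1 + w) - horner ps w\<bar> \<le> \<delta>" and \<delta>: "\<delta> \<le> 1 / 6"
    and one: "wedge_value [1] x T \<le> 1"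
  shows "ennreal (wedge_value ps x T - \<delta>) \<le> wedge_integral (sqrt x) (sqrt T)"
    and "wedge_integral (sqrt x) (sqrt T) \<le> ennreal (wedge_value ps x T + \<delta>)"
proof -
  define S \<tau> where "S = sqrt x" and "\<tau> = sqrt T"
  have S: "S > 0" "S\<^sup>2 = x" and \<tau>: "\<tau> > 0" "\<tau>\<^sup>2 = T" using xT by (simp_all add: S_def \<tau>_def)
  have z: "\<tau> * S = sqrt (x * T)" by (simp add: S_def \<tau>_def real_sqrt_mult mult.commute)
  have le1: "\<tau> * S \<le> 1" unfolding z using xT by simp
  have int: "((\<lambda>\<sigma>. artanh (\<tau> * \<sigma>) * horner qs (\<sigma>\<^sup>2)) has_integral wedge_value qs x T) {0..S}" for qs
  proof -
    have "(\<tau> * S)\<^sup>2 = x * T" unfolding z using xT by simp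
    then show ?thesis
      using artanh_has_integral[OF \<tau>(1) S(1) le1, of 0 qs] xT unfolding z \<tau>(2) S(2)
      by (simp add: wedge_value_def Let_def z real_sqrt_divide \<tau>_def[symmetric] S_def[symmetric])
  qed
  have \<delta>0: "0 \<le> \<delta>" using approx[of 0] xT by auto
  have art: "0 \<le> artanh (\<tau> * \<sigma>)" if "\<sigma> \<in> {0..S}" for \<sigma>
  proof (cases "\<tau> * \<sigma> < 1")
    case True
    moreover have "0 \<le> \<tau> * \<sigma>" using that \<tau> by simp
    ultimately show ?thesis by (simp add: artanh_def)
  next
    \<comment> \<open>Here \<open>\<tau> * \<sigma> = 1\<close>, and division by 0 together with
      \<open>ln 0 = 0\<close> makes the value of \<open>artanh\<close> 0.\<close>
    case False
    have "\<tau> * \<sigma> \<le> \<tau> * S" using that \<tau> by simp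
    then have "\<tau> * \<sigma> = 1" using False le1 by simp
    then show ?thesis by (simp add: artanh_def)
  qed
  have sq: "0 \<le> \<sigma>\<^sup>2 \<and> \<sigma>\<^sup>2 \<le> x" if "\<sigma> \<in> {0..S}" for \<sigma>
    using that S(2) power_mono[of \<sigma> S 2] by auto
  have I1: "((\<lambda>\<sigma>. artanh (\<tau> * \<sigma>)) has_integral wedge_value [1] x T) {0..S}" using int[of "[1]"] by simp
  have up: "((\<lambda>\<sigma>. artanh (\<tau> * \<sigma>) * (horner ps (\<sigma>\<^sup>2) + \<delta>)) has_integral wedge_value ps x T + \<delta> * wedge_value [1] x T) {0..S}"
    using has_integral_add[OF int[of ps] has_integral_mult_right[OF I1, of \<delta>]] by (simp add: algebra_simps)
  have lo: "((\<lambda>\<sigma>. artanh (\<tau> * \<sigma>) * (horner ps (\<sigma>\<^sup>2) - \<delta>)) has_integral wedge_value ps x T - \<delta> * wedge_value [1] x T) {0..S}"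
    using has_integral_diff[OF int[of ps] has_integral_mult_right[OF I1, of \<delta>]] by (simp add: algebra_simps)
  have hor: "0 \<le> horner ps (\<sigma>\<^sup>2) - \<delta>" "horner ps (\<sigma>\<^sup>2) - \<delta> \<le> 1 / (1 + \<sigma>\<^sup>2)" "1 / (1 + \<sigma>\<^sup>2) \<le> horner ps (\<sigma>\<^sup>2) + \<delta>" if "\<sigma> \<in> {0..S}" for \<sigma>
  proof -
    have "1 + \<sigma>\<^sup>2 \<le> 3" using sq[OF that] xT by simp
    then have "1 / 3 \<le> 1 / (1 + \<sigma>\<^sup>2)" by (intro divide_left_mono) (auto simp: add_pos_nonneg)
    then show "0 \<le> horner ps (\<sigma>\<^sup>2) - \<delta>" "horner ps (\<sigma>\<^sup>2) - \<delta> \<le> 1 / (1 + \<sigma>\<^sup>2)" "1 / (1 + \<sigma>\<^sup>2) \<le> horner ps (\<sigma>\<^sup>2) + \<delta>"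
      using approx[of "\<sigma>\<^sup>2"] sq[OF that] \<delta> unfolding abs_le_iff by linarith+
  qed
  have "\<delta> * wedge_value [1] x T \<le> \<delta> * 1" using one \<delta>0 by (intro mult_left_mono)
  then have \<delta>1: "\<delta> * wedge_value [1] x T \<le> \<delta>" by simp
  have "ennreal (wedge_value ps x T - \<delta>) \<le> ennreal (wedge_value ps x T - \<delta> * wedge_value [1] x T)"
    using \<delta>1 by (intro ennreal_leI) simp
  also have "\<dots> = (\<integral>\<^sup>+\<sigma>. ennreal (artanh (\<tau> * \<sigma>) * (horner ps (\<sigma>\<^sup>2) - \<delta>)) * indicator {0..S} \<sigma> \<partial>lborel)"
    using art hor by (intro nn_integral_has_integral_lebesgue'[OF _ lo, symmetric]) simp
  also have "\<dots> \<le> wedge_integral S \<tau>"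
    unfolding wedge_integral_def
  proof (rule nn_integral_mono)
    fix \<sigma>
    have "artanh (\<tau> * \<sigma>) * (horner ps (\<sigma>\<^sup>2) - \<delta>) \<le> artanh (\<tau> * \<sigma>) * (1 / (1 + \<sigma>\<^sup>2))" if "\<sigma> \<in> {0..S}"
      using art[OF that] hor[OF that] by (intro mult_left_mono)
    then show "ennreal (artanh (\<tau> * \<sigma>) * (horner ps (\<sigma>\<^sup>2) - \<delta>)) * indicator {0..S} \<sigma> \<le> ennreal (artanh (\<tau> * \<sigma>) / (1 + \<sigma>\<^sup>2)) * indicator {0..S} \<sigma>"
      by (auto simp: indicator_def intro: ennreal_leI)
  qed
  finally show "ennreal (wedge_value ps x T - \<delta>) \<le> wedge_integral (sqrt x) (sqrt T)" unfolding S_def \<tau>_def .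
  have "wedge_integral S \<tau> \<le> (\<integral>\<^sup>+\<sigma>. ennreal (artanh (\<tau> * \<sigma>) * (horner ps (\<sigma>\<^sup>2) + \<delta>)) * indicator {0..S} \<sigma> \<partial>lborel)"
    unfolding wedge_integral_def
  proof (rule nn_integral_mono)
    fix \<sigma>
    have "artanh (\<tau> * \<sigma>) * (1 / (1 + \<sigma>\<^sup>2)) \<le> artanh (\<tau> * \<sigma>) * (horner ps (\<sigma>\<^sup>2) + \<delta>)" if "\<sigma> \<in> {0..S}"
      using art[OF that] hor[OF that] by (intro mult_left_mono)
    then show "ennreal (artanh (\<tau> * \<sigma>) / (1 + \<sigma>\<^sup>2)) * indicator {0..S} \<sigma> \<le> ennreal (artanh (\<tau> * \<sigma>) * (horner ps (\<sigma>\<^sup>2) + \<delta>)) * indicator {0..S} \<sigma>"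
      by (auto simp: indicator_def intro: ennreal_leI)
  qed
  also have "\<dots> = ennreal (wedge_value ps x T + \<delta> * wedge_value [1] x T)"
  proof (rule nn_integral_has_integral_lebesgue'[OF _ up])
    fix \<sigma> assume s: "\<sigma> \<in> {0..S}"
    have "0 \<le> horner ps (\<sigma>\<^sup>2) + \<delta>" using hor(1)[OF s] \<delta>0 by linarith
    then show "0 \<le> artanh (\<tau> * \<sigma>) * (horner ps (\<sigma>\<^sup>2) + \<delta>)" using art[OF s] by simp
  qed
  also have "\<dots> \<le> ennreal (wedge_value ps x T + \<delta>)" using \<delta>1 by (intro ennreal_leI) simp
  finally show "wedge_integral (sqrt x) (sqrt T) \<le> ennreal (wedge_value ps x T + \<delta>)" unfolding S_def \<tau>_def .
qed

text \<open>In \<open>HV3_diagram\<close> the squared arguments are irrational and get bracketed by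
  rationals. The strict bound keeps \<open>artanh\<close> below its singularity, where it is
  increasing.\<close>

lemma wedge_integral_mono:
  assumes "0 \<le> \<tau>" "\<tau> \<le> \<tau>'" "S \<le> S'" "\<tau>' * S' < 1"
  shows "wedge_integral S \<tau> \<le> wedge_integral S' \<tau>'"
  unfolding wedge_integral_def
proof (rule nn_integral_mono)
  fix \<sigma>
  show "ennreal (artanh (\<tau> * \<sigma>) / (1 + \<sigma>\<^sup>2)) * indicator {0..S} \<sigma> \<le> ennreal (artanh (\<tau>' * \<sigma>) / (1 + \<sigma>\<^sup>2)) * indicator {0..S'} \<sigma>"
  proof (cases "\<sigma> \<in> {0..S}")
    case True
    have 1: "\<tau> * \<sigma> \<le> \<tau>' * \<sigma>" using True assms by (intro mult_right_mono) auto
    have 2: "\<tau>' * \<sigma> \<le> \<tau>' * S'" using True assms by (intro mult_left_mono) auto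
    have 3: "0 \<le> \<tau> * \<sigma>" using True assms by simp
    have "(1 + \<tau> * \<sigma>) / (1 - \<tau> * \<sigma>) \<le> (1 + \<tau>' * \<sigma>) / (1 - \<tau>' * \<sigma>)"
      using 1 2 3 assms by (intro frac_le) auto
    then have "artanh (\<tau> * \<sigma>) \<le> artanh (\<tau>' * \<sigma>)"
      unfolding artanh_def using 1 2 3 assms by (intro divide_right_mono ln_mono) auto
    then have "artanh (\<tau> * \<sigma>) / (1 + \<sigma>\<^sup>2) \<le> artanh (\<tau>' * \<sigma>) / (1 + \<sigma>\<^sup>2)"
      by (intro divide_right_mono) auto
    then show ?thesis using True assms by (auto simp: indicator_def intro: ennreal_leI)
  qed simp
qed

section \<open>Error bounds for logarithms, square roots and products\<close>

lemma ln_lipschitz: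
  fixes r r' a :: real
  assumes "0 < a" "a \<le> r" "a \<le> r'" shows "\<bar>ln r - ln r'\<bar> \<le> \<bar>r - r'\<bar> / a"
proof -
  have le: "ln x - ln y \<le> \<bar>x - y\<bar> / a" if "a \<le> x" "a \<le> y" for x y :: real
  proof -
    have "ln x - ln y = ln (x / y)" using that assms(1) by (simp add: ln_div)
    also have "\<dots> \<le> x / y - 1" using that assms(1) by (intro ln_le_minus_one) simp
    also have "\<dots> = (x - y) / y" using that assms(1) by (simp add: diff_divide_distrib)
    also have "\<dots> \<le> \<bar>x - y\<bar> / y" using that assms(1) by (intro divide_right_mono) auto
    also have "\<dots> \<le> \<bar>x - y\<bar> / a" using that assms(1) by (intro divide_left_mono) auto
    finally show ?thesis .
  qed
  from le[OF assms(2,3)] le[OF assms(3,2)] show ?thesis by (simp add: abs_minus_commute abs_le_iff)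
qed

text \<open>\<open>ln x\<close> is twice \<open>artanh y\<close>; the first \<open>n\<close> terms
  of the power series form a Horner sum in \<open>y\<^sup>2\<close>, and the second summand of the
  error bounds the tail.\<close>

lemma ln_near:
  fixes x y v e :: real
  assumes x: "1 < x" and y: "y = (x - 1) / (x + 1)"
    and e: "\<bar>2 * y * odd_horner 0 (replicate n 1) (y\<^sup>2) - v\<bar> + 2 * y ^ (2 * n + 1) / ((1 - y\<^sup>2) * real (2 * n + 1)) \<le> e"
  shows "\<bar>ln x - v\<bar> \<le> e"
proof -
  have oh: "(\<Sum>k<n. 2 * y ^ (2 * (k + i) + 1) / real (2 * (k + i) + 1)) = 2 * y ^ (2 * i + 1) * odd_horner i (replicate n 1) (y\<^sup>2)" for i
  proof (induction n arbitrary: i)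
    case (Suc n)
    have "(\<Sum>k<Suc n. 2 * y ^ (2 * (k + i) + 1) / real (2 * (k + i) + 1)) =
      2 * y ^ (2 * i + 1) / real (2 * i + 1) + (\<Sum>k<n. 2 * y ^ (2 * (k + (i + 1)) + 1) / real (2 * (k + (i + 1)) + 1))"
      by (subst sum.lessThan_Suc_shift) simp
    then show ?case unfolding Suc.IH by (simp add: algebra_simps power2_eq_square)
  qed simp
  define d where "d = y ^ (2 * n + 1) / (1 - y\<^sup>2) / real (2 * n + 1)"
  have "ln x \<in> {2 * y * odd_horner 0 (replicate n 1) (y\<^sup>2)..2 * y * odd_horner 0 (replicate n 1) (y\<^sup>2) + 2 * d}"
    using ln_approx_bounds[OF x, of n] oh[of 0] unfolding y[symmetric] d_def by simp
  moreover have "2 * d = 2 * y ^ (2 * n + 1) / ((1 - y\<^sup>2) * real (2 * n + 1))" by (simp add: d_def)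
  ultimately show ?thesis using e by (auto simp: abs_le_iff)
qed

lemma sqrt_near: "0 \<le> z - d \<Longrightarrow> (z - d)\<^sup>2 \<le> q \<Longrightarrow> q \<le> (z + d)\<^sup>2 \<Longrightarrow> 0 \<le> d \<Longrightarrow> \<bar>sqrt q - z\<bar> \<le> d"
  using real_le_rsqrt[of "z - d" q] real_le_lsqrt[of "z + d" q] by (auto simp: abs_le_iff)

lemma ln_one_plus_sqrt_near:
  assumes z: "\<bar>sqrt q - z\<bar> \<le> d" "0 \<le> z" "0 \<le> q" and v: "\<bar>ln (1 + z) - v\<bar> \<le> e"
  shows "\<bar>ln (1 + sqrt q) - v\<bar> \<le> e + d"
proof -
  have "\<bar>ln (1 + sqrt q) - ln (1 + z)\<bar> \<le> \<bar>sqrt q - z\<bar>"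
    using ln_lipschitz[of 1 "1 + sqrt q" "1 + z"] z by simp
  then show ?thesis using z v by linarith
qed

lemma ln_one_minus_sqrt_near:
  assumes z: "\<bar>sqrt q - z\<bar> \<le> d" "0 < a" "a \<le> 1 - z - d" "0 \<le> d" and v: "\<bar>ln (1 - z) - v\<bar> \<le> e"
  shows "\<bar>ln (1 - sqrt q) - v\<bar> \<le> e + d / a"
proof -
  have le: "a \<le> 1 - sqrt q" "a \<le> 1 - z" using z by auto
  have "\<bar>ln (1 - sqrt q) - ln (1 - z)\<bar> \<le> \<bar>sqrt q - z\<bar> / a"
    using ln_lipschitz[OF z(2) le] by (simp add: abs_minus_commute)
  also have "\<dots> \<le> d / a" using z by (intro divide_right_mono) auto
  finally show ?thesis using v by linarith
qed

text \<open>A power of two moves the argument near 1, where the series converges fast. At most four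
  factors 2 occur, hence the error \<open>e + 4 * e\<close>.\<close>

lemma ln_mult_pow2_near:
  assumes "\<bar>ln r - v\<bar> \<le> e" "\<bar>ln 2 - v2\<bar> \<le> e" "0 < r" "x * 2 ^ i = r * 2 ^ j" "i + j \<le> 4"
  shows "\<bar>ln x - (v + (real j - real i) * v2)\<bar> \<le> 5 * e"
proof -
  have x: "x = r * 2 ^ j / 2 ^ i" using assms(4) by (simp add: field_simps)
  have "ln x = ln r + (real j - real i) * ln 2"
    using assms(3) by (simp add: x ln_div ln_mult ln_realpow algebra_simps)
  then have e: "ln x - (v + (real j - real i) * v2) = (ln r - v) + (real j - real i) * (ln 2 - v2)"
    by (simp add: algebra_simps)
  have "\<bar>real j - real i\<bar> \<le> 4" using assms(5) by linarith
  then have "\<bar>(real j - real i) * (ln 2 - v2)\<bar> \<le> 4 * e"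
    unfolding abs_mult using assms(2) by (intro mult_mono) auto
  then show ?thesis unfolding e using assms(1) by linarith
qed

lemma ln_inverse_near:
  fixes x y v e :: real
  assumes "\<bar>ln x - v\<bar> \<le> e" "0 < x" "y = 1 / x"
  shows "\<bar>ln y - (- v)\<bar> \<le> e"
proof -
  have "ln y = - ln x" using assms(2,3) by (simp add: ln_inverse flip: inverse_eq_divide)
  then show ?thesis using assms(1) by linarith
qed

lemma mult_near:
  fixes x y x' y' :: real
  assumes "\<bar>x - x'\<bar> \<le> d" "\<bar>y - y'\<bar> \<le> e" "\<bar>x'\<bar> \<le> X" "\<bar>y'\<bar> \<le> Y"
  shows "\<bar>x * y - x' * y'\<bar> \<le> d * Y + X * e + d * e"
proof -
  have "x * y - x' * y' = (x - x') * y' + x' * (y - y') + (x - x') * (y - y')" by (simp add: algebra_simps)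
  then have "\<bar>x * y - x' * y'\<bar> \<le> \<bar>x - x'\<bar> * \<bar>y'\<bar> + \<bar>x'\<bar> * \<bar>y - y'\<bar> + \<bar>x - x'\<bar> * \<bar>y - y'\<bar>"
    unfolding abs_mult[symmetric] by linarith
  also have "\<dots> \<le> d * Y + X * e + d * e"
    using assms by (intro add_mono mult_mono) auto
  finally show ?thesis .
qed

text \<open>The errors add up to \<open>(176 + 27) / 2 + 1\<close> times \<open>e\<close>, rounded
  up to 105. The bounds on the approximations are coarse, common to all evaluations below.\<close>

lemma wedge_value_near:
  assumes l: "\<bar>ln (1 + sqrt (x * T)) - l\<bar> \<le> e" and m: "\<bar>ln (1 - sqrt (x * T)) - m\<bar> \<le> e"
    and t: "\<bar>sqrt (1 / T) - t\<bar> \<le> e" and s: "\<bar>sqrt x - s\<bar> \<le> e"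
    and A: "\<bar>odd_horner 0 ps (1 / T) - A\<bar> \<le> e" and B: "\<bar>odd_horner 0 ps x - B\<bar> \<le> e"
    and C: "\<bar>log_horner 0 0 ps (1 / T) (x * T) - C\<bar> \<le> e"
    and bounds: "\<bar>l + m\<bar> \<le> 4" "\<bar>l - m\<bar> \<le> 4" "\<bar>A\<bar> \<le> 20" "\<bar>B\<bar> \<le> 2" "\<bar>C\<bar> \<le> 3" "\<bar>t\<bar> \<le> 2" "\<bar>s\<bar> \<le> 2" "e \<le> 1 / 100"
    and v: "\<bar>((A * (l + m) + C) * t + B * (l - m) * s) / 2 - v\<bar> \<le> e"
  shows "\<bar>wedge_value ps x T - v\<bar> \<le> 105 * e"
proof -
  define l' m' where "l' = ln (1 + sqrt (x * T))" and "m' = ln (1 - sqrt (x * T))"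
  define A' B' C' where "A' = odd_horner 0 ps (1 / T)" and "B' = odd_horner 0 ps x" and "C' = log_horner 0 0 ps (1 / T) (x * T)"
  have e0: "0 \<le> e" using l by linarith
  then have ee: "e * e \<le> e / 100" using bounds(8) mult_left_mono[of e "1 / 100" e] by simp
  have 1: "\<bar>A' * (l' + m') - A * (l + m)\<bar> \<le> 45 * e"
  proof -
    have "\<bar>(l' + m') - (l + m)\<bar> \<le> 2 * e" using l m unfolding l'_def m'_def by linarith
    from mult_near[OF A this bounds(3,1)] show ?thesis unfolding A'_def using ee by (simp add: mult.left_commute)
  qed
  have 2: "\<bar>A' * (l' + m') + C' - (A * (l + m) + C)\<bar> \<le> 46 * e"
    using 1 C unfolding C'_def by linarith
  have "\<bar>A * (l + m)\<bar> \<le> 20 * 4" unfolding abs_mult using bounds by (intro mult_mono) auto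
  then have "\<bar>A * (l + m) + C\<bar> \<le> 83" using bounds(5) by linarith
  from mult_near[OF 2 t this bounds(6)] have 3: "\<bar>(A' * (l' + m') + C') * sqrt (1 / T) - (A * (l + m) + C) * t\<bar> \<le> 176 * e"
    using ee by simp
  have 4: "\<bar>B' * (l' - m') - B * (l - m)\<bar> \<le> 9 * e"
  proof -
    have "\<bar>(l' - m') - (l - m)\<bar> \<le> 2 * e" using l m unfolding l'_def m'_def by linarith
    from mult_near[OF B this bounds(4,2)] show ?thesis unfolding B'_def using ee by (simp add: mult.left_commute)
  qed
  have "\<bar>B * (l - m)\<bar> \<le> 2 * 4" unfolding abs_mult using bounds by (intro mult_mono) auto
  from mult_near[OF 4 s this bounds(7)] have 5: "\<bar>B' * (l' - m') * sqrt x - B * (l - m) * s\<bar> \<le> 27 * e"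
    using ee by simp
  have "wedge_value ps x T = ((A' * (l' + m') + C') * sqrt (1 / T) + B' * (l' - m') * sqrt x) / 2"
    unfolding wedge_value_def Let_def A'_def B'_def C'_def l'_def m'_def ..
  moreover have "\<bar>W - v\<bar> \<le> 105 * e"
    if W: "W = (P + Q) / 2" and P: "\<bar>P - P0\<bar> \<le> 176 * e" and Q: "\<bar>Q - Q0\<bar> \<le> 27 * e" and PQ: "\<bar>(P0 + Q0) / 2 - v\<bar> \<le> e" for W P Q P0 Q0
  proof -
    show ?thesis using W P Q PQ e0 unfolding add_divide_distrib by linarith
  qed
  ultimately show ?thesis using 3 5 v by blast
qed

section \<open>Chebyshev approximants of the reciprocal\<close>

definition cheb2 :: "real \<Rightarrow> real" where "cheb2 x = 2 * x\<^sup>2 - 1"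

definition cheb3 :: "real \<Rightarrow> real" where "cheb3 x = 4 * x ^ 3 - 3 * x"

text \<open>Degrees multiply when Chebyshev polynomials are composed, so the degrees 8, 9 and 12
  come from degrees 2 and 3 alone, and the bound 1 passes through every stage.\<close>

lemma abs_cheb2_le: "\<bar>x\<bar> \<le> 1 \<Longrightarrow> \<bar>cheb2 x\<bar> \<le> 1"
  using abs_square_le_1[of x] by (simp add: cheb2_def abs_le_iff)

lemma abs_cheb3_le:
  assumes "\<bar>x\<bar> \<le> 1" shows "\<bar>cheb3 x\<bar> \<le> 1"
proof -
  have "1 - cheb3 x = (1 - x) * (1 + 2 * x)\<^sup>2" "1 + cheb3 x = (1 + x) * (1 - 2 * x)\<^sup>2"
    by (simp_all add: cheb3_def power2_eq_square power3_eq_cube algebra_simps)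
  moreover have "0 \<le> (1 - x) * (1 + 2 * x)\<^sup>2" "0 \<le> (1 + x) * (1 - 2 * x)\<^sup>2" using assms by auto
  ultimately show ?thesis by (simp add: abs_le_iff)
qed

lemma recip_error:
  fixes w P t d D :: real
  assumes "0 \<le> w" "(1 + w) * P = 1 - t / d" "\<bar>t\<bar> \<le> 1" "\<bar>d\<bar> = D" "1 \<le> D"
  shows "\<bar>1 / (1 + w) - P\<bar> \<le> 1 / D"
proof -
  have "P = (1 - t / d) / (1 + w)" using assms(1,2) by (simp add: nonzero_eq_divide_eq mult.commute)
  then have "1 / (1 + w) - P = t / d / (1 + w)" by (simp add: diff_divide_distrib)
  then have "\<bar>1 / (1 + w) - P\<bar> = \<bar>t\<bar> / D / (1 + w)" using assms(1,4) by (auto simp add: abs_divide abs_mult abs_of_nonneg)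
  also have "\<dots> \<le> 1 / D / 1" using assms by (intro frac_le divide_right_mono) auto
  finally show ?thesis by simp
qed

lemma replicate_7: "replicate 7 (x :: real) = [x, x, x, x, x, x, x]"
  by (simp add: numeral_eq_Suc)

lemma replicate_11: "replicate 11 (x :: real) = [x, x, x, x, x, x, x, x, x, x, x]"
  by (simp add: numeral_eq_Suc)

lemma ln_2_near: "\<bar>ln 2 - (0.6931471805599 :: real)\<bar> \<le> 1 / 10 ^ 11"
  by (rule ln_near[where y = "1 / 3" and n = 11]) (simp_all add: replicate_11 power_divide)

text \<open>
  The coefficients below are those of \<open>(1 - T (2 * w / r - 1) / T (- 2 / r - 1)) / (1 + w)\<close>, where \<open>T\<close> is the
  Chebyshev polynomial of degree 8, 9 or 12 and \<open>{0..r}\<close> is the range of \<open>w\<close>.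
\<close>

definition recip_poly_third :: "real list" where
  "recip_poly_third = [708158976 / 708158977, - (708158592 / 708158977), 708134400 / 708158977, - (707553792 / 708158977), 700710912 / 708158977, - (656916480 / 708158977), 501645312 / 708158977, - (214990848 / 708158977)]"

text \<open>The map \<open>6 * w - 1\<close> sends the range to the interval from -1 to 1 and
  \<open>w = - 1\<close> to -7, where the Chebyshev polynomial of degree 8 has the value 708158977;
  hence the numerator is divisible by \<open>1 + w\<close>.\<close>

lemma recip_poly_third:
  assumes "0 \<le> w" "w \<le> 1 / 3"
  shows "\<bar>1 / (1 + w) - horner recip_poly_third w\<bar> \<le> 1 / 708158977"
proof -
  let ?t = "(cheb2 (cheb2 (cheb2 (6 * w - 1))))"
  have "(1 + w) * horner recip_poly_third w = 1 - ?t / (708158977)"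
    by (simp add: recip_poly_third_def cheb2_def cheb3_def power2_eq_square power3_eq_cube) algebra
  moreover have "\<bar>?t\<bar> \<le> 1"
    using assms by (intro abs_cheb2_le abs_cheb3_le) (simp add: abs_le_iff)
  ultimately show ?thesis using assms(1) by (intro recip_error[where t = ?t and d = "708158977"]) simp_all
qed

definition recip_poly_one :: "real list" where
  "recip_poly_one = [3880898 / 3880899, - (3880736 / 3880899), 3876416 / 3880899, - (3832064 / 3880899), 3603968 / 3880899, - (2945024 / 3880899), 1826816 / 3880899, - (65536 / 352809), 131072 / 3880899]"

text \<open>Here \<open>w = - 1\<close> goes to -3, where the polynomial of degree 9 has the value
  -3880899; the odd degree accounts for the sign.\<close>

lemma recip_poly_one:
  assumes "0 \<le> w" "w \<le> 1"
  shows "\<bar>1 / (1 + w) - horner recip_poly_one w\<bar> \<le> 1 / 3880899"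
proof -
  let ?t = "(cheb3 (cheb3 (2 * w - 1)))"
  have "(1 + w) * horner recip_poly_one w = 1 - ?t / (- 3880899)"
    by (simp add: recip_poly_one_def cheb2_def cheb3_def power2_eq_square power3_eq_cube) algebra
  moreover have "\<bar>?t\<bar> \<le> 1"
    using assms by (intro abs_cheb2_le abs_cheb3_le) (simp add: abs_le_iff)
  ultimately show ?thesis using assms(1) by (intro recip_error[where t = ?t and d = "- 3880899"]) simp_all
qed

definition recip_poly_two :: "real list" where
  "recip_poly_two = [3650400 / 3650401, - (3650256 / 3650401), 3646824 / 3650401, - (3614792 / 3650401), 3460352 / 3650401, - (3021056 / 3650401), 2228992 / 3650401, - (1288960 / 3650401), 544768 / 3650401, - (155648 / 3650401), 26624 / 3650401, - (2048 / 3650401)]"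

text \<open>Here \<open>w = - 1\<close> goes to -2, where the polynomial of degree 12 has the value
  3650401.\<close>

lemma recip_poly_two:
  assumes "0 \<le> w" "w \<le> 2"
  shows "\<bar>1 / (1 + w) - horner recip_poly_two w\<bar> \<le> 1 / 3650401"
proof -
  let ?t = "(cheb2 (cheb2 (cheb3 (1 * w - 1))))"
  have "(1 + w) * horner recip_poly_two w = 1 - ?t / (3650401)"
    by (simp add: recip_poly_two_def cheb2_def cheb3_def power2_eq_square power3_eq_cube) algebra
  moreover have "\<bar>?t\<bar> \<le> 1"
    using assms by (intro abs_cheb2_le abs_cheb3_le) (simp add: abs_le_iff)
  ultimately show ?thesis using assms(1) by (intro recip_error[where t = ?t and d = "3650401"]) simp_all
qed

section \<open>Numerical enclosures of the wedge integrals\<close>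

lemma ln_sqrt_near_1:
  "\<bar>ln (1 + sqrt (1 / 3)) - (0.4557463944081)\<bar> \<le> 1 / 10 ^ 10"
  "\<bar>ln (1 - sqrt (1 / 3)) - (- 0.8612115025157)\<bar> \<le> 1 / 10 ^ 10"
proof -
  \<comment> \<open>A solution of Pell's equation,
    \<open>3 * 564719\<^sup>2 + 1 = 978122\<^sup>2\<close>, hence the small error.\<close>
  have z: "\<bar>sqrt (1 / 3) - 564719 / 978122\<bar> \<le> 1 / 10 ^ 12"
    by (rule sqrt_near) (simp_all add: power2_eq_square)
  \<comment> \<open>\<open>1 + z\<close> is halved to come near 1 and then inverted to exceed 1, as
    \<open>ln_near\<close> requires.\<close>
  have "\<bar>ln (1956244 / 1542841) - (0.2374007861518 :: real)\<bar> \<le> 1 / 10 ^ 11"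
    by (rule ln_near[where y = "413403 / 3499085" and n = 7]) (simp_all add: replicate_7 power_divide)
  then have "\<bar>ln (1542841 / 1956244) - (- 0.2374007861518 :: real)\<bar> \<le> 1 / 10 ^ 11"
    by (rule ln_inverse_near) simp_all
  from ln_mult_pow2_near[OF this ln_2_near, of "1542841 / 978122" 0 1]
  have "\<bar>ln (1542841 / 978122) - (0.4557463944081 :: real)\<bar> \<le> 5 / 10 ^ 11" by simp
  then have "\<bar>ln (1 + 564719 / 978122) - (0.4557463944081 :: real)\<bar> \<le> 5 / 10 ^ 11" by simp
  from ln_one_plus_sqrt_near[OF z _ _ this]
  show "\<bar>ln (1 + sqrt (1 / 3)) - (0.4557463944081)\<bar> \<le> 1 / 10 ^ 10" by simp
  have "\<bar>ln (489061 / 413403) - (0.1680643219558 :: real)\<bar> \<le> 1 / 10 ^ 11"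
    by (rule ln_near[where y = "37829 / 451232" and n = 7]) (simp_all add: replicate_7 power_divide)
  then have "\<bar>ln (413403 / 489061) - (- 0.1680643219558 :: real)\<bar> \<le> 1 / 10 ^ 11"
    by (rule ln_inverse_near) simp_all
  from ln_mult_pow2_near[OF this ln_2_near, of "413403 / 978122" 1 0]
  have "\<bar>ln (413403 / 978122) - (- 0.8612115025157 :: real)\<bar> \<le> 5 / 10 ^ 11" by simp
  then have "\<bar>ln (1 - 564719 / 978122) - (- 0.8612115025157 :: real)\<bar> \<le> 5 / 10 ^ 11" by simp
  \<comment> \<open>0.380 is a convenient lower bound for \<open>1 - z\<close>, which is about 0.42;
    its inverse is the Lipschitz constant of the logarithm.\<close>
  from ln_one_minus_sqrt_near[OF z _ _ _ this, of "0.380"]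
  show "\<bar>ln (1 - sqrt (1 / 3)) - (- 0.8612115025157)\<bar> \<le> 1 / 10 ^ 10" by simp
qed

text \<open>The decimals inside are rounded values of the rational sums and of the irrational parts.
  The half-width of the interval just exceeds \<open>105 / 10 ^ 10 + 1 / 708158977\<close>, the
  evaluation error plus the error of the approximant.\<close>

lemma wedge_bounds_1:
  "ennreal 0.1526609203 \<le> wedge_integral (sqrt (1 / 3)) (sqrt (1))"
  "wedge_integral (sqrt (1 / 3)) (sqrt (1)) \<le> ennreal 0.1526609445"
proof -
  have l: "\<bar>ln (1 + sqrt (1 / 3 * (1))) - (0.4557463944081)\<bar> \<le> 1 / 10 ^ 10" using ln_sqrt_near_1(1) by simp
  have m: "\<bar>ln (1 - sqrt (1 / 3 * (1))) - (- 0.8612115025157)\<bar> \<le> 1 / 10 ^ 10" using ln_sqrt_near_1(2) by simp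
  have t: "\<bar>sqrt (1 / (1)) - 1.000000000000\<bar> \<le> 1 / 10 ^ 10" and s: "\<bar>sqrt (1 / 3) - 0.577350269190\<bar> \<le> 1 / 10 ^ 10"
    by (rule sqrt_near; simp add: power2_eq_square)+
  have A: "\<bar>odd_horner 0 recip_poly_third (1 / (1)) - (0.783787768859)\<bar> \<le> 1 / 10 ^ 10"
    by (simp add: recip_poly_third_def)
  have B: "\<bar>odd_horner 0 recip_poly_third (1 / 3) - 0.906899682121\<bar> \<le> 1 / 10 ^ 10"
    by (simp add: recip_poly_third_def)
  have C: "\<bar>log_horner 0 0 recip_poly_third (1 / (1)) (1 / 3 * (1)) - (- 0.066437085181)\<bar> \<le> 1 / 10 ^ 10"
    by (simp add: recip_poly_third_def power_divide)
  have v: "\<bar>wedge_value recip_poly_third (1 / 3) (1) - 0.152660932366\<bar> \<le> 105 * (1 / 10 ^ 10)"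
    by (rule wedge_value_near[OF l m t s A B C]) simp_all
  \<comment> \<open>The constant polynomial gives the integral of \<open>artanh\<close> itself,
    which has to be at most 1.\<close>
  have one: "\<bar>wedge_value [1] (1 / 3) (1) - 0.177440444097\<bar> \<le> 105 * (1 / 10 ^ 10)"
    by (rule wedge_value_near[OF l m t s, of "[1]" 1 1 0]) simp_all
  note W = wedge_integral_approx[of "1 / 3" "1" recip_poly_third "1 / 708158977", OF _ _ _ _ recip_poly_third]
  have "ennreal 0.1526609203 \<le> ennreal (wedge_value recip_poly_third (1 / 3) (1) - 1 / 708158977)"
    using v unfolding abs_le_iff by (intro ennreal_leI) simp
  also have "\<dots> \<le> wedge_integral (sqrt (1 / 3)) (sqrt (1))"
    using one unfolding abs_le_iff by (intro W) simp_all
  finally show "ennreal 0.1526609203 \<le> wedge_integral (sqrt (1 / 3)) (sqrt (1))" .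
  have "wedge_integral (sqrt (1 / 3)) (sqrt (1)) \<le> ennreal (wedge_value recip_poly_third (1 / 3) (1) + 1 / 708158977)"
    using one unfolding abs_le_iff by (intro W) simp_all
  also have "\<dots> \<le> ennreal 0.1526609445"
    using v unfolding abs_le_iff by (intro ennreal_leI) simp
  finally show "wedge_integral (sqrt (1 / 3)) (sqrt (1)) \<le> ennreal 0.1526609445" .
qed

lemma wedge_bounds_2:
  "ennreal 0.3383138567 \<le> wedge_integral (sqrt (1 / 3)) (sqrt (3))"
  "wedge_integral (sqrt (1 / 3)) (sqrt (3)) \<le> ennreal 0.3383138809"
proof -
  have l: "\<bar>ln (1 + sqrt (1 / 3 * (3))) - (0.6931471805599)\<bar> \<le> 1 / 10 ^ 10" using ln_2_near by simp
  \<comment> \<open>Now \<open>x * T = 1\<close>, the corner at the ideal vertex, and the argument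
    is 0 with \<open>ln 0 = 0\<close>. The two contributions of this logarithm to
    \<open>wedge_value\<close> have opposite coefficients and cancel.\<close>
  have m: "\<bar>ln (1 - sqrt (1 / 3 * (3))) - (0)\<bar> \<le> 1 / 10 ^ 10" by simp
  have t: "\<bar>sqrt (1 / (3)) - 0.577350269190\<bar> \<le> 1 / 10 ^ 10" and s: "\<bar>sqrt (1 / 3) - 0.577350269190\<bar> \<le> 1 / 10 ^ 10"
    by (rule sqrt_near; simp add: power2_eq_square)+
  have A: "\<bar>odd_horner 0 recip_poly_third (1 / (3)) - (0.906899682121)\<bar> \<le> 1 / 10 ^ 10"
    by (simp add: recip_poly_third_def)
  have B: "\<bar>odd_horner 0 recip_poly_third (1 / 3) - 0.906899682121\<bar> \<le> 1 / 10 ^ 10"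
    by (simp add: recip_poly_third_def)
  have C: "\<bar>log_horner 0 0 recip_poly_third (1 / (3)) (1 / 3 * (3)) - (- 0.085276296045)\<bar> \<le> 1 / 10 ^ 10"
    by (simp add: recip_poly_third_def power_divide)
  have v: "\<bar>wedge_value recip_poly_third (1 / 3) (3) - 0.338313868814\<bar> \<le> 105 * (1 / 10 ^ 10)"
    by (rule wedge_value_near[OF l m t s A B C]) simp_all
  have one: "\<bar>wedge_value [1] (1 / 3) (3) - 0.400188711285\<bar> \<le> 105 * (1 / 10 ^ 10)"
    by (rule wedge_value_near[OF l m t s, of "[1]" 1 1 0]) simp_all
  note W = wedge_integral_approx[of "1 / 3" "3" recip_poly_third "1 / 708158977", OF _ _ _ _ recip_poly_third]
  have "ennreal 0.3383138567 \<le> ennreal (wedge_value recip_poly_third (1 / 3) (3) - 1 / 708158977)"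
    using v unfolding abs_le_iff by (intro ennreal_leI) simp
  also have "\<dots> \<le> wedge_integral (sqrt (1 / 3)) (sqrt (3))"
    using one unfolding abs_le_iff by (intro W) simp_all
  finally show "ennreal 0.3383138567 \<le> wedge_integral (sqrt (1 / 3)) (sqrt (3))" .
  have "wedge_integral (sqrt (1 / 3)) (sqrt (3)) \<le> ennreal (wedge_value recip_poly_third (1 / 3) (3) + 1 / 708158977)"
    using one unfolding abs_le_iff by (intro W) simp_all
  also have "\<dots> \<le> ennreal 0.3383138809"
    using v unfolding abs_le_iff by (intro ennreal_leI) simp
  finally show "wedge_integral (sqrt (1 / 3)) (sqrt (3)) \<le> ennreal 0.3383138809" .
qed

lemma ln_sqrt_near_2:
  "\<bar>ln (1 + sqrt (1 / 9)) - (0.2876820724518)\<bar> \<le> 1 / 10 ^ 10"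
  "\<bar>ln (1 - sqrt (1 / 9)) - (- 0.4054651081081)\<bar> \<le> 1 / 10 ^ 10"
proof -
  have z: "\<bar>sqrt (1 / 9) - 1 / 3\<bar> \<le> 1 / 10 ^ 12"
    by (rule sqrt_near) (simp_all add: power2_eq_square)
  have "\<bar>ln (4 / 3) - (0.2876820724518 :: real)\<bar> \<le> 1 / 10 ^ 11"
    by (rule ln_near[where y = "1 / 7" and n = 7]) (simp_all add: replicate_7 power_divide)
  from ln_mult_pow2_near[OF this ln_2_near, of "4 / 3" 0 0]
  have "\<bar>ln (4 / 3) - (0.2876820724518 :: real)\<bar> \<le> 5 / 10 ^ 11" by simp
  then have "\<bar>ln (1 + 1 / 3) - (0.2876820724518 :: real)\<bar> \<le> 5 / 10 ^ 11" by simp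
  from ln_one_plus_sqrt_near[OF z _ _ this]
  show "\<bar>ln (1 + sqrt (1 / 9)) - (0.2876820724518)\<bar> \<le> 1 / 10 ^ 10" by simp
  have "\<bar>ln (4 / 3) - (0.2876820724518 :: real)\<bar> \<le> 1 / 10 ^ 11"
    by (rule ln_near[where y = "1 / 7" and n = 7]) (simp_all add: replicate_7 power_divide)
  from ln_mult_pow2_near[OF this ln_2_near, of "2 / 3" 1 0]
  have "\<bar>ln (2 / 3) - (- 0.4054651081081 :: real)\<bar> \<le> 5 / 10 ^ 11" by simp
  then have "\<bar>ln (1 - 1 / 3) - (- 0.4054651081081 :: real)\<bar> \<le> 5 / 10 ^ 11" by simp
  from ln_one_minus_sqrt_near[OF z _ _ _ this, of "0.600"]
  show "\<bar>ln (1 - sqrt (1 / 9)) - (- 0.4054651081081)\<bar> \<le> 1 / 10 ^ 10" by simp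
qed

lemma wedge_bounds_3:
  "ennreal 0.0845784551 \<le> wedge_integral (sqrt (1 / 3)) (sqrt (1 / 3))"
  "wedge_integral (sqrt (1 / 3)) (sqrt (1 / 3)) \<le> ennreal 0.0845784793"
proof -
  have l: "\<bar>ln (1 + sqrt (1 / 3 * (1 / 3))) - (0.2876820724518)\<bar> \<le> 1 / 10 ^ 10" using ln_sqrt_near_2(1) by simp
  have m: "\<bar>ln (1 - sqrt (1 / 3 * (1 / 3))) - (- 0.4054651081081)\<bar> \<le> 1 / 10 ^ 10" using ln_sqrt_near_2(2) by simp
  have t: "\<bar>sqrt (1 / (1 / 3)) - 1.732050807569\<bar> \<le> 1 / 10 ^ 10" and s: "\<bar>sqrt (1 / 3) - 0.577350269190\<bar> \<le> 1 / 10 ^ 10"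
    by (rule sqrt_near; simp add: power2_eq_square)+
  \<comment> \<open>\<open>1 / T = 3\<close> is outside the range on which the polynomial
    approximates the reciprocal; the sum is just one term of an exact antiderivative. Its size
    accounts for the bound 20 in \<open>wedge_value_near\<close>.\<close>
  have A: "\<bar>odd_horner 0 recip_poly_third (1 / (1 / 3)) - (- 18.180829822813)\<bar> \<le> 1 / 10 ^ 10"
    by (simp add: recip_poly_third_def)
  have B: "\<bar>odd_horner 0 recip_poly_third (1 / 3) - 0.906899682121\<bar> \<le> 1 / 10 ^ 10"
    by (simp add: recip_poly_third_def)
  have C: "\<bar>log_horner 0 0 recip_poly_third (1 / (1 / 3)) (1 / 3 * (1 / 3)) - (- 2.253268844906)\<bar> \<le> 1 / 10 ^ 10"
    by (simp add: recip_poly_third_def power_divide)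
  have v: "\<bar>wedge_value recip_poly_third (1 / 3) (1 / 3) - 0.084578467202\<bar> \<le> 105 * (1 / 10 ^ 10)"
    by (rule wedge_value_near[OF l m t s A B C]) simp_all
  have one: "\<bar>wedge_value [1] (1 / 3) (1 / 3) - 0.098091254629\<bar> \<le> 105 * (1 / 10 ^ 10)"
    by (rule wedge_value_near[OF l m t s, of "[1]" 1 1 0]) simp_all
  note W = wedge_integral_approx[of "1 / 3" "1 / 3" recip_poly_third "1 / 708158977", OF _ _ _ _ recip_poly_third]
  have "ennreal 0.0845784551 \<le> ennreal (wedge_value recip_poly_third (1 / 3) (1 / 3) - 1 / 708158977)"
    using v unfolding abs_le_iff by (intro ennreal_leI) simp
  also have "\<dots> \<le> wedge_integral (sqrt (1 / 3)) (sqrt (1 / 3))"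
    using one unfolding abs_le_iff by (intro W) simp_all
  finally show "ennreal 0.0845784551 \<le> wedge_integral (sqrt (1 / 3)) (sqrt (1 / 3))" .
  have "wedge_integral (sqrt (1 / 3)) (sqrt (1 / 3)) \<le> ennreal (wedge_value recip_poly_third (1 / 3) (1 / 3) + 1 / 708158977)"
    using one unfolding abs_le_iff by (intro W) simp_all
  also have "\<dots> \<le> ennreal 0.0845784793"
    using v unfolding abs_le_iff by (intro ennreal_leI) simp
  finally show "wedge_integral (sqrt (1 / 3)) (sqrt (1 / 3)) \<le> ennreal 0.0845784793" .
qed

lemma ln_sqrt_near_3:
  "\<bar>ln (1 + sqrt (2 / 3)) - (0.5969096904464)\<bar> \<le> 1 / 10 ^ 10"
  "\<bar>ln (1 - sqrt (2 / 3)) - (- 1.6955219791135)\<bar> \<le> 1 / 10 ^ 10"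
proof -
  have z: "\<bar>sqrt (2 / 3) - 2093258 / 2563707\<bar> \<le> 1 / 10 ^ 12"
    by (rule sqrt_near) (simp_all add: power2_eq_square)
  have "\<bar>ln (5127414 / 4656965) - (0.0962374901135 :: real)\<bar> \<le> 1 / 10 ^ 11"
    by (rule ln_near[where y = "470449 / 9784379" and n = 7]) (simp_all add: replicate_7 power_divide)
  then have "\<bar>ln (4656965 / 5127414) - (- 0.0962374901135 :: real)\<bar> \<le> 1 / 10 ^ 11"
    by (rule ln_inverse_near) simp_all
  from ln_mult_pow2_near[OF this ln_2_near, of "4656965 / 2563707" 0 1]
  have "\<bar>ln (4656965 / 2563707) - (0.5969096904464 :: real)\<bar> \<le> 5 / 10 ^ 11" by simp
  then have "\<bar>ln (1 + 2093258 / 2563707) - (0.5969096904464 :: real)\<bar> \<le> 5 / 10 ^ 11" by simp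
  from ln_one_plus_sqrt_near[OF z _ _ this]
  show "\<bar>ln (1 + sqrt (2 / 3)) - (0.5969096904464)\<bar> \<le> 1 / 10 ^ 10" by simp
  have "\<bar>ln (2563707 / 1881796) - (0.3092276179937 :: real)\<bar> \<le> 1 / 10 ^ 11"
    by (rule ln_near[where y = "681911 / 4445503" and n = 7]) (simp_all add: replicate_7 power_divide)
  then have "\<bar>ln (1881796 / 2563707) - (- 0.3092276179937 :: real)\<bar> \<le> 1 / 10 ^ 11"
    by (rule ln_inverse_near) simp_all
  from ln_mult_pow2_near[OF this ln_2_near, of "470449 / 2563707" 2 0]
  have "\<bar>ln (470449 / 2563707) - (- 1.6955219791135 :: real)\<bar> \<le> 5 / 10 ^ 11" by simp
  then have "\<bar>ln (1 - 2093258 / 2563707) - (- 1.6955219791135 :: real)\<bar> \<le> 5 / 10 ^ 11" by simp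
  from ln_one_minus_sqrt_near[OF z _ _ _ this, of "0.165"]
  show "\<bar>ln (1 - sqrt (2 / 3)) - (- 1.6955219791135)\<bar> \<le> 1 / 10 ^ 10" by simp
qed

lemma wedge_bounds_4:
  "ennreal 0.2340620820 \<le> wedge_integral (sqrt (1 / 3)) (sqrt (2))"
  "wedge_integral (sqrt (1 / 3)) (sqrt (2)) \<le> ennreal 0.2340621063"
proof -
  have l: "\<bar>ln (1 + sqrt (1 / 3 * (2))) - (0.5969096904464)\<bar> \<le> 1 / 10 ^ 10" using ln_sqrt_near_3(1) by simp
  have m: "\<bar>ln (1 - sqrt (1 / 3 * (2))) - (- 1.6955219791135)\<bar> \<le> 1 / 10 ^ 10" using ln_sqrt_near_3(2) by simp
  have t: "\<bar>sqrt (1 / (2)) - 0.707106781187\<bar> \<le> 1 / 10 ^ 10" and s: "\<bar>sqrt (1 / 3) - 0.577350269190\<bar> \<le> 1 / 10 ^ 10"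
    by (rule sqrt_near; simp add: power2_eq_square)+
  have A: "\<bar>odd_horner 0 recip_poly_third (1 / (2)) - (0.870419167946)\<bar> \<le> 1 / 10 ^ 10"
    by (simp add: recip_poly_third_def)
  have B: "\<bar>odd_horner 0 recip_poly_third (1 / 3) - 0.906899682121\<bar> \<le> 1 / 10 ^ 10"
    by (simp add: recip_poly_third_def)
  have C: "\<bar>log_horner 0 0 recip_poly_third (1 / (2)) (1 / 3 * (2)) - (- 0.079220155139)\<bar> \<le> 1 / 10 ^ 10"
    by (simp add: recip_poly_third_def power_divide)
  have v: "\<bar>wedge_value recip_poly_third (1 / 3) (2) - 0.234062094138\<bar> \<le> 105 * (1 / 10 ^ 10)"
    by (rule wedge_value_near[OF l m t s A B C]) simp_all
  have one: "\<bar>wedge_value [1] (1 / 3) (2) - 0.273349921154\<bar> \<le> 105 * (1 / 10 ^ 10)"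
    by (rule wedge_value_near[OF l m t s, of "[1]" 1 1 0]) simp_all
  note W = wedge_integral_approx[of "1 / 3" "2" recip_poly_third "1 / 708158977", OF _ _ _ _ recip_poly_third]
  have "ennreal 0.2340620820 \<le> ennreal (wedge_value recip_poly_third (1 / 3) (2) - 1 / 708158977)"
    using v unfolding abs_le_iff by (intro ennreal_leI) simp
  also have "\<dots> \<le> wedge_integral (sqrt (1 / 3)) (sqrt (2))"
    using one unfolding abs_le_iff by (intro W) simp_all
  finally show "ennreal 0.2340620820 \<le> wedge_integral (sqrt (1 / 3)) (sqrt (2))" .
  have "wedge_integral (sqrt (1 / 3)) (sqrt (2)) \<le> ennreal (wedge_value recip_poly_third (1 / 3) (2) + 1 / 708158977)"
    using one unfolding abs_le_iff by (intro W) simp_all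
  also have "\<dots> \<le> ennreal 0.2340621063"
    using v unfolding abs_le_iff by (intro ennreal_leI) simp
  finally show "wedge_integral (sqrt (1 / 3)) (sqrt (2)) \<le> ennreal 0.2340621063" .
qed

lemma ln_sqrt_near_4:
  "\<bar>ln (1 + sqrt (4181 / 4791)) - (0.6596794973417)\<bar> \<le> 1 / 10 ^ 10"
  "\<bar>ln (1 - sqrt (4181 / 4791)) - (- 2.7207149770512)\<bar> \<le> 1 / 10 ^ 10"
proof -
  have z: "\<bar>sqrt (4181 / 4791) - 580178 / 621061\<bar> \<le> 1 / 10 ^ 12"
    by (rule sqrt_near) (simp_all add: power2_eq_square)
  have "\<bar>ln (1242122 / 1201239) - (0.0334676832182 :: real)\<bar> \<le> 1 / 10 ^ 11"
    by (rule ln_near[where y = "40883 / 2443361" and n = 7]) (simp_all add: replicate_7 power_divide)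
  then have "\<bar>ln (1201239 / 1242122) - (- 0.0334676832182 :: real)\<bar> \<le> 1 / 10 ^ 11"
    by (rule ln_inverse_near) simp_all
  from ln_mult_pow2_near[OF this ln_2_near, of "1201239 / 621061" 0 1]
  have "\<bar>ln (1201239 / 621061) - (0.6596794973417 :: real)\<bar> \<le> 5 / 10 ^ 11" by simp
  then have "\<bar>ln (1 + 580178 / 621061) - (0.6596794973417 :: real)\<bar> \<le> 5 / 10 ^ 11" by simp
  from ln_one_plus_sqrt_near[OF z _ _ this]
  show "\<bar>ln (1 + sqrt (4181 / 4791)) - (0.6596794973417)\<bar> \<le> 1 / 10 ^ 10" by simp
  have "\<bar>ln (654128 / 621061) - (0.0518737451884 :: real)\<bar> \<le> 1 / 10 ^ 11"
    by (rule ln_near[where y = "33067 / 1275189" and n = 7]) (simp_all add: replicate_7 power_divide)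
  from ln_mult_pow2_near[OF this ln_2_near, of "40883 / 621061" 4 0]
  have "\<bar>ln (40883 / 621061) - (- 2.7207149770512 :: real)\<bar> \<le> 5 / 10 ^ 11" by simp
  then have "\<bar>ln (1 - 580178 / 621061) - (- 2.7207149770512 :: real)\<bar> \<le> 5 / 10 ^ 11" by simp
  from ln_one_minus_sqrt_near[OF z _ _ _ this, of "0.059"]
  show "\<bar>ln (1 - sqrt (4181 / 4791)) - (- 2.7207149770512)\<bar> \<le> 1 / 10 ^ 10" by simp
qed

text \<open>\<open>4181 / 1597\<close> lies just below the squared golden ratio, and
  \<open>6765 / 2584\<close> in the next enclosure just above it; monotonicity will place the
  integral with the irrational argument between them.\<close>

lemma wedge_bounds_5:
  "ennreal 0.2887452443 \<le> wedge_integral (sqrt (1 / 3)) (sqrt (4181 / 1597))"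
  "wedge_integral (sqrt (1 / 3)) (sqrt (4181 / 1597)) \<le> ennreal 0.2887452685"
proof -
  have l: "\<bar>ln (1 + sqrt (1 / 3 * (4181 / 1597))) - (0.6596794973417)\<bar> \<le> 1 / 10 ^ 10" using ln_sqrt_near_4(1) by simp
  have m: "\<bar>ln (1 - sqrt (1 / 3 * (4181 / 1597))) - (- 2.7207149770512)\<bar> \<le> 1 / 10 ^ 10" using ln_sqrt_near_4(2) by simp
  have t: "\<bar>sqrt (1 / (4181 / 1597)) - 0.618034009447\<bar> \<le> 1 / 10 ^ 10" and s: "\<bar>sqrt (1 / 3) - 0.577350269190\<bar> \<le> 1 / 10 ^ 10"
    by (rule sqrt_near; simp add: power2_eq_square)+
  have A: "\<bar>odd_horner 0 recip_poly_third (1 / (4181 / 1597)) - (0.895702118500)\<bar> \<le> 1 / 10 ^ 10"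
    by (simp add: recip_poly_third_def)
  have B: "\<bar>odd_horner 0 recip_poly_third (1 / 3) - 0.906899682121\<bar> \<le> 1 / 10 ^ 10"
    by (simp add: recip_poly_third_def)
  have C: "\<bar>log_horner 0 0 recip_poly_third (1 / (4181 / 1597)) (1 / 3 * (4181 / 1597)) - (- 0.083399091048)\<bar> \<le> 1 / 10 ^ 10"
    by (simp add: recip_poly_third_def power_divide)
  have v: "\<bar>wedge_value recip_poly_third (1 / 3) (4181 / 1597) - 0.288745256379\<bar> \<le> 105 * (1 / 10 ^ 10)"
    by (rule wedge_value_near[OF l m t s A B C]) simp_all
  have one: "\<bar>wedge_value [1] (1 / 3) (4181 / 1597) - 0.338940819311\<bar> \<le> 105 * (1 / 10 ^ 10)"
    by (rule wedge_value_near[OF l m t s, of "[1]" 1 1 0]) simp_all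
  note W = wedge_integral_approx[of "1 / 3" "4181 / 1597" recip_poly_third "1 / 708158977", OF _ _ _ _ recip_poly_third]
  have "ennreal 0.2887452443 \<le> ennreal (wedge_value recip_poly_third (1 / 3) (4181 / 1597) - 1 / 708158977)"
    using v unfolding abs_le_iff by (intro ennreal_leI) simp
  also have "\<dots> \<le> wedge_integral (sqrt (1 / 3)) (sqrt (4181 / 1597))"
    using one unfolding abs_le_iff by (intro W) simp_all
  finally show "ennreal 0.2887452443 \<le> wedge_integral (sqrt (1 / 3)) (sqrt (4181 / 1597))" .
  have "wedge_integral (sqrt (1 / 3)) (sqrt (4181 / 1597)) \<le> ennreal (wedge_value recip_poly_third (1 / 3) (4181 / 1597) + 1 / 708158977)"
    using one unfolding abs_le_iff by (intro W) simp_all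
  also have "\<dots> \<le> ennreal 0.2887452685"
    using v unfolding abs_le_iff by (intro ennreal_leI) simp
  finally show "wedge_integral (sqrt (1 / 3)) (sqrt (4181 / 1597)) \<le> ennreal 0.2887452685" .
qed

lemma ln_sqrt_near_5:
  "\<bar>ln (1 + sqrt (2255 / 2584)) - (0.6596795196943)\<bar> \<le> 1 / 10 ^ 10"
  "\<bar>ln (1 - sqrt (2255 / 2584)) - (- 2.7207156338222)\<bar> \<le> 1 / 10 ^ 10"
proof -
  have z: "\<bar>sqrt (2255 / 2584) - 679091 / 726944\<bar> \<le> 1 / 10 ^ 12"
    by (rule sqrt_near) (simp_all add: power2_eq_square)
  have "\<bar>ln (1453888 / 1406035) - (0.0334676608656 :: real)\<bar> \<le> 1 / 10 ^ 11"
    by (rule ln_near[where y = "47853 / 2859923" and n = 7]) (simp_all add: replicate_7 power_divide)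
  then have "\<bar>ln (1406035 / 1453888) - (- 0.0334676608656 :: real)\<bar> \<le> 1 / 10 ^ 11"
    by (rule ln_inverse_near) simp_all
  from ln_mult_pow2_near[OF this ln_2_near, of "1406035 / 726944" 0 1]
  have "\<bar>ln (1406035 / 726944) - (0.6596795196943 :: real)\<bar> \<le> 5 / 10 ^ 11" by simp
  then have "\<bar>ln (1 + 679091 / 726944) - (0.6596795196943 :: real)\<bar> \<le> 5 / 10 ^ 11" by simp
  from ln_one_plus_sqrt_near[OF z _ _ this]
  show "\<bar>ln (1 + sqrt (2255 / 2584)) - (0.6596795196943)\<bar> \<le> 1 / 10 ^ 10" by simp
  have "\<bar>ln (47853 / 45434) - (0.0518730884174 :: real)\<bar> \<le> 1 / 10 ^ 11"
    by (rule ln_near[where y = "2419 / 93287" and n = 7]) (simp_all add: replicate_7 power_divide)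
  from ln_mult_pow2_near[OF this ln_2_near, of "47853 / 726944" 4 0]
  have "\<bar>ln (47853 / 726944) - (- 2.7207156338222 :: real)\<bar> \<le> 5 / 10 ^ 11" by simp
  then have "\<bar>ln (1 - 679091 / 726944) - (- 2.7207156338222 :: real)\<bar> \<le> 5 / 10 ^ 11" by simp
  from ln_one_minus_sqrt_near[OF z _ _ _ this, of "0.059"]
  show "\<bar>ln (1 - sqrt (2255 / 2584)) - (- 2.7207156338222)\<bar> \<le> 1 / 10 ^ 10" by simp
qed

lemma wedge_bounds_6:
  "ennreal 0.2887452686 \<le> wedge_integral (sqrt (1 / 3)) (sqrt (6765 / 2584))"
  "wedge_integral (sqrt (1 / 3)) (sqrt (6765 / 2584)) \<le> ennreal 0.2887452928"
proof -
  have l: "\<bar>ln (1 + sqrt (1 / 3 * (6765 / 2584))) - (0.6596795196943)\<bar> \<le> 1 / 10 ^ 10" using ln_sqrt_near_5(1) by simp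
  have m: "\<bar>ln (1 - sqrt (1 / 3 * (6765 / 2584))) - (- 2.7207156338222)\<bar> \<le> 1 / 10 ^ 10" using ln_sqrt_near_5(2) by simp
  have t: "\<bar>sqrt (1 / (6765 / 2584)) - 0.618033980844\<bar> \<le> 1 / 10 ^ 10" and s: "\<bar>sqrt (1 / 3) - 0.577350269190\<bar> \<le> 1 / 10 ^ 10"
    by (rule sqrt_near; simp add: power2_eq_square)+
  have A: "\<bar>odd_horner 0 recip_poly_third (1 / (6765 / 2584)) - (0.895702126465)\<bar> \<le> 1 / 10 ^ 10"
    by (simp add: recip_poly_third_def)
  have B: "\<bar>odd_horner 0 recip_poly_third (1 / 3) - 0.906899682121\<bar> \<le> 1 / 10 ^ 10"
    by (simp add: recip_poly_third_def)
  have C: "\<bar>log_horner 0 0 recip_poly_third (1 / (6765 / 2584)) (1 / 3 * (6765 / 2584)) - (- 0.083399092377)\<bar> \<le> 1 / 10 ^ 10"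
    by (simp add: recip_poly_third_def power_divide)
  have v: "\<bar>wedge_value recip_poly_third (1 / 3) (6765 / 2584) - 0.288745280685\<bar> \<le> 105 * (1 / 10 ^ 10)"
    by (rule wedge_value_near[OF l m t s A B C]) simp_all
  have one: "\<bar>wedge_value [1] (1 / 3) (6765 / 2584) - 0.338940848787\<bar> \<le> 105 * (1 / 10 ^ 10)"
    by (rule wedge_value_near[OF l m t s, of "[1]" 1 1 0]) simp_all
  note W = wedge_integral_approx[of "1 / 3" "6765 / 2584" recip_poly_third "1 / 708158977", OF _ _ _ _ recip_poly_third]
  have "ennreal 0.2887452686 \<le> ennreal (wedge_value recip_poly_third (1 / 3) (6765 / 2584) - 1 / 708158977)"
    using v unfolding abs_le_iff by (intro ennreal_leI) simp
  also have "\<dots> \<le> wedge_integral (sqrt (1 / 3)) (sqrt (6765 / 2584))"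
    using one unfolding abs_le_iff by (intro W) simp_all
  finally show "ennreal 0.2887452686 \<le> wedge_integral (sqrt (1 / 3)) (sqrt (6765 / 2584))" .
  have "wedge_integral (sqrt (1 / 3)) (sqrt (6765 / 2584)) \<le> ennreal (wedge_value recip_poly_third (1 / 3) (6765 / 2584) + 1 / 708158977)"
    using one unfolding abs_le_iff by (intro W) simp_all
  also have "\<dots> \<le> ennreal 0.2887452928"
    using v unfolding abs_le_iff by (intro ennreal_leI) simp
  finally show "wedge_integral (sqrt (1 / 3)) (sqrt (6765 / 2584)) \<le> ennreal 0.2887452928" .
qed

lemma ln_sqrt_near_6:
  "\<bar>ln (1 + sqrt (1 / 2)) - (0.5347999967391)\<bar> \<le> 1 / 10 ^ 10"
  "\<bar>ln (1 - sqrt (1 / 2)) - (- 1.2279471772967)\<bar> \<le> 1 / 10 ^ 10"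
proof -
  have z: "\<bar>sqrt (1 / 2) - 470832 / 665857\<bar> \<le> 1 / 10 ^ 12"
    by (rule sqrt_near) (simp_all add: power2_eq_square)
  have "\<bar>ln (1331714 / 1136689) - (0.1583471838208 :: real)\<bar> \<le> 1 / 10 ^ 11"
    by (rule ln_near[where y = "195025 / 2468403" and n = 7]) (simp_all add: replicate_7 power_divide)
  then have "\<bar>ln (1136689 / 1331714) - (- 0.1583471838208 :: real)\<bar> \<le> 1 / 10 ^ 11"
    by (rule ln_inverse_near) simp_all
  from ln_mult_pow2_near[OF this ln_2_near, of "1136689 / 665857" 0 1]
  have "\<bar>ln (1136689 / 665857) - (0.5347999967391 :: real)\<bar> \<le> 5 / 10 ^ 11" by simp
  then have "\<bar>ln (1 + 470832 / 665857) - (0.5347999967391 :: real)\<bar> \<le> 5 / 10 ^ 11" by simp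
  from ln_one_plus_sqrt_near[OF z _ _ this]
  show "\<bar>ln (1 + sqrt (1 / 2)) - (0.5347999967391)\<bar> \<le> 1 / 10 ^ 10" by simp
  have "\<bar>ln (780100 / 665857) - (0.1583471838231 :: real)\<bar> \<le> 1 / 10 ^ 11"
    by (rule ln_near[where y = "114243 / 1445957" and n = 7]) (simp_all add: replicate_7 power_divide)
  from ln_mult_pow2_near[OF this ln_2_near, of "195025 / 665857" 2 0]
  have "\<bar>ln (195025 / 665857) - (- 1.2279471772967 :: real)\<bar> \<le> 5 / 10 ^ 11" by simp
  then have "\<bar>ln (1 - 470832 / 665857) - (- 1.2279471772967 :: real)\<bar> \<le> 5 / 10 ^ 11" by simp
  from ln_one_minus_sqrt_near[OF z _ _ _ this, of "0.264"]
  show "\<bar>ln (1 - sqrt (1 / 2)) - (- 1.2279471772967)\<bar> \<le> 1 / 10 ^ 10" by simp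
qed

text \<open>Shared by two simplices: a wedge at the side \<open>x = - k\<close> for
  \<open>k = sqrt 2 / 2\<close>, and one at the side \<open>y = - s\<close> for
  \<open>s = c\<close>.\<close>

lemma wedge_bounds_7:
  "ennreal 0.2678581394 \<le> wedge_integral (sqrt (1)) (sqrt (1 / 2))"
  "wedge_integral (sqrt (1)) (sqrt (1 / 2)) \<le> ennreal 0.2678586761"
proof -
  have l: "\<bar>ln (1 + sqrt (1 * (1 / 2))) - (0.5347999967391)\<bar> \<le> 1 / 10 ^ 10" using ln_sqrt_near_6(1) by simp
  have m: "\<bar>ln (1 - sqrt (1 * (1 / 2))) - (- 1.2279471772967)\<bar> \<le> 1 / 10 ^ 10" using ln_sqrt_near_6(2) by simp
  have t: "\<bar>sqrt (1 / (1 / 2)) - 1.414213562373\<bar> \<le> 1 / 10 ^ 10" and s: "\<bar>sqrt (1) - 1.000000000000\<bar> \<le> 1 / 10 ^ 10"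
    by (rule sqrt_near; simp add: power2_eq_square)+
  have A: "\<bar>odd_horner 0 recip_poly_one (1 / (1 / 2)) - (0.688186776424)\<bar> \<le> 1 / 10 ^ 10"
    by (simp add: recip_poly_one_def)
  have B: "\<bar>odd_horner 0 recip_poly_one (1) - 0.785398163002\<bar> \<le> 1 / 10 ^ 10"
    by (simp add: recip_poly_one_def)
  have C: "\<bar>log_horner 0 0 recip_poly_one (1 / (1 / 2)) (1 * (1 / 2)) - (- 0.123136200653)\<bar> \<le> 1 / 10 ^ 10"
    by (simp add: recip_poly_one_def power_divide)
  have v: "\<bar>wedge_value recip_poly_one (1) (1 / 2) - 0.267858407764\<bar> \<le> 105 * (1 / 10 ^ 10)"
    by (rule wedge_value_near[OF l m t s A B C]) simp_all
  have one: "\<bar>wedge_value [1] (1) (1 / 2) - 0.391244515285\<bar> \<le> 105 * (1 / 10 ^ 10)"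
    by (rule wedge_value_near[OF l m t s, of "[1]" 1 1 0]) simp_all
  note W = wedge_integral_approx[of "1" "1 / 2" recip_poly_one "1 / 3880899", OF _ _ _ _ recip_poly_one]
  have "ennreal 0.2678581394 \<le> ennreal (wedge_value recip_poly_one (1) (1 / 2) - 1 / 3880899)"
    using v unfolding abs_le_iff by (intro ennreal_leI) simp
  also have "\<dots> \<le> wedge_integral (sqrt (1)) (sqrt (1 / 2))"
    using one unfolding abs_le_iff by (intro W) simp_all
  finally show "ennreal 0.2678581394 \<le> wedge_integral (sqrt (1)) (sqrt (1 / 2))" .
  have "wedge_integral (sqrt (1)) (sqrt (1 / 2)) \<le> ennreal (wedge_value recip_poly_one (1) (1 / 2) + 1 / 3880899)"
    using one unfolding abs_le_iff by (intro W) simp_all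
  also have "\<dots> \<le> ennreal 0.2678586761"
    using v unfolding abs_le_iff by (intro ennreal_leI) simp
  finally show "wedge_integral (sqrt (1)) (sqrt (1 / 2)) \<le> ennreal 0.2678586761" .
qed

lemma wedge_bounds_8:
  "ennreal 0.2114458998 \<le> wedge_integral (sqrt (1)) (sqrt (1 / 3))"
  "wedge_integral (sqrt (1)) (sqrt (1 / 3)) \<le> ennreal 0.2114464366"
proof -
  have l: "\<bar>ln (1 + sqrt (1 * (1 / 3))) - (0.4557463944081)\<bar> \<le> 1 / 10 ^ 10" using ln_sqrt_near_1(1) by simp
  have m: "\<bar>ln (1 - sqrt (1 * (1 / 3))) - (- 0.8612115025157)\<bar> \<le> 1 / 10 ^ 10" using ln_sqrt_near_1(2) by simp
  have t: "\<bar>sqrt (1 / (1 / 3)) - 1.732050807569\<bar> \<le> 1 / 10 ^ 10" and s: "\<bar>sqrt (1) - 1.000000000000\<bar> \<le> 1 / 10 ^ 10"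
    by (rule sqrt_near; simp add: power2_eq_square)+
  have A: "\<bar>odd_horner 0 recip_poly_one (1 / (1 / 3)) - (1.931514437708)\<bar> \<le> 1 / 10 ^ 10"
    by (simp add: recip_poly_one_def)
  have B: "\<bar>odd_horner 0 recip_poly_one (1) - 0.785398163002\<bar> \<le> 1 / 10 ^ 10"
    by (simp add: recip_poly_one_def)
  have C: "\<bar>log_horner 0 0 recip_poly_one (1 / (1 / 3)) (1 * (1 / 3)) - (0.430144365830)\<bar> \<le> 1 / 10 ^ 10"
    by (simp add: recip_poly_one_def power_divide)
  have v: "\<bar>wedge_value recip_poly_one (1) (1 / 3) - 0.211446168213\<bar> \<le> 105 * (1 / 10 ^ 10)"
    by (rule wedge_value_near[OF l m t s A B C]) simp_all
  have one: "\<bar>wedge_value [1] (1) (1 / 3) - 0.307335864492\<bar> \<le> 105 * (1 / 10 ^ 10)"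
    by (rule wedge_value_near[OF l m t s, of "[1]" 1 1 0]) simp_all
  note W = wedge_integral_approx[of "1" "1 / 3" recip_poly_one "1 / 3880899", OF _ _ _ _ recip_poly_one]
  have "ennreal 0.2114458998 \<le> ennreal (wedge_value recip_poly_one (1) (1 / 3) - 1 / 3880899)"
    using v unfolding abs_le_iff by (intro ennreal_leI) simp
  also have "\<dots> \<le> wedge_integral (sqrt (1)) (sqrt (1 / 3))"
    using one unfolding abs_le_iff by (intro W) simp_all
  finally show "ennreal 0.2114458998 \<le> wedge_integral (sqrt (1)) (sqrt (1 / 3))" .
  have "wedge_integral (sqrt (1)) (sqrt (1 / 3)) \<le> ennreal (wedge_value recip_poly_one (1) (1 / 3) + 1 / 3880899)"
    using one unfolding abs_le_iff by (intro W) simp_all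
  also have "\<dots> \<le> ennreal 0.2114464366"
    using v unfolding abs_le_iff by (intro ennreal_leI) simp
  finally show "wedge_integral (sqrt (1)) (sqrt (1 / 3)) \<le> ennreal 0.2114464366" .
qed

lemma wedge_bounds_9:
  "ennreal 0.4579825283 \<le> wedge_integral (sqrt (1)) (sqrt (1))"
  "wedge_integral (sqrt (1)) (sqrt (1)) \<le> ennreal 0.4579830650"
proof -
  have l: "\<bar>ln (1 + sqrt (1 * (1))) - (0.6931471805599)\<bar> \<le> 1 / 10 ^ 10" using ln_2_near by simp
  have m: "\<bar>ln (1 - sqrt (1 * (1))) - (0)\<bar> \<le> 1 / 10 ^ 10" by simp
  have t: "\<bar>sqrt (1 / (1)) - 1.000000000000\<bar> \<le> 1 / 10 ^ 10" and s: "\<bar>sqrt (1) - 1.000000000000\<bar> \<le> 1 / 10 ^ 10"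
    by (rule sqrt_near; simp add: power2_eq_square)+
  have A: "\<bar>odd_horner 0 recip_poly_one (1 / (1)) - (0.785398163002)\<bar> \<le> 1 / 10 ^ 10"
    by (simp add: recip_poly_one_def)
  have B: "\<bar>odd_horner 0 recip_poly_one (1) - 0.785398163002\<bar> \<le> 1 / 10 ^ 10"
    by (simp add: recip_poly_one_def)
  have C: "\<bar>log_horner 0 0 recip_poly_one (1 / (1)) (1 * (1)) - (- 0.172827451296)\<bar> \<le> 1 / 10 ^ 10"
    by (simp add: recip_poly_one_def power_divide)
  have v: "\<bar>wedge_value recip_poly_one (1) (1) - 0.457982796654\<bar> \<le> 105 * (1 / 10 ^ 10)"
    by (rule wedge_value_near[OF l m t s A B C]) simp_all
  have one: "\<bar>wedge_value [1] (1) (1) - 0.693147180560\<bar> \<le> 105 * (1 / 10 ^ 10)"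
    by (rule wedge_value_near[OF l m t s, of "[1]" 1 1 0]) simp_all
  note W = wedge_integral_approx[of "1" "1" recip_poly_one "1 / 3880899", OF _ _ _ _ recip_poly_one]
  have "ennreal 0.4579825283 \<le> ennreal (wedge_value recip_poly_one (1) (1) - 1 / 3880899)"
    using v unfolding abs_le_iff by (intro ennreal_leI) simp
  also have "\<dots> \<le> wedge_integral (sqrt (1)) (sqrt (1))"
    using one unfolding abs_le_iff by (intro W) simp_all
  finally show "ennreal 0.4579825283 \<le> wedge_integral (sqrt (1)) (sqrt (1))" .
  have "wedge_integral (sqrt (1)) (sqrt (1)) \<le> ennreal (wedge_value recip_poly_one (1) (1) + 1 / 3880899)"
    using one unfolding abs_le_iff by (intro W) simp_all
  also have "\<dots> \<le> ennreal 0.4579830650"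
    using v unfolding abs_le_iff by (intro ennreal_leI) simp
  finally show "wedge_integral (sqrt (1)) (sqrt (1)) \<le> ennreal 0.4579830650" .
qed

lemma ln_sqrt_near_7:
  "\<bar>ln (1 + sqrt (1039414 / 1436435)) - (0.6155373366649)\<bar> \<le> 1 / 10 ^ 10"
  "\<bar>ln (1 - sqrt (1039414 / 1436435)) - (- 1.9014677891771)\<bar> \<le> 1 / 10 ^ 10"
proof -
  have z: "\<bar>sqrt (1039414 / 1436435) - 625418 / 735223\<bar> \<le> 1 / 10 ^ 12"
    by (rule sqrt_near) (simp_all add: power2_eq_square)
  have "\<bar>ln (1470446 / 1360641) - (0.0776098438950 :: real)\<bar> \<le> 1 / 10 ^ 11"
    by (rule ln_near[where y = "109805 / 2831087" and n = 7]) (simp_all add: replicate_7 power_divide)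
  then have "\<bar>ln (1360641 / 1470446) - (- 0.0776098438950 :: real)\<bar> \<le> 1 / 10 ^ 11"
    by (rule ln_inverse_near) simp_all
  from ln_mult_pow2_near[OF this ln_2_near, of "1360641 / 735223" 0 1]
  have "\<bar>ln (1360641 / 735223) - (0.6155373366649 :: real)\<bar> \<le> 5 / 10 ^ 11" by simp
  then have "\<bar>ln (1 + 625418 / 735223) - (0.6155373366649 :: real)\<bar> \<le> 5 / 10 ^ 11" by simp
  from ln_one_plus_sqrt_near[OF z _ _ this]
  show "\<bar>ln (1 + sqrt (1039414 / 1436435)) - (0.6155373366649)\<bar> \<le> 1 / 10 ^ 10" by simp
  have "\<bar>ln (878440 / 735223) - (0.1779737525026 :: real)\<bar> \<le> 1 / 10 ^ 11"
    by (rule ln_near[where y = "143217 / 1613663" and n = 7]) (simp_all add: replicate_7 power_divide)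
  from ln_mult_pow2_near[OF this ln_2_near, of "109805 / 735223" 3 0]
  have "\<bar>ln (109805 / 735223) - (- 1.9014677891771 :: real)\<bar> \<le> 5 / 10 ^ 11" by simp
  then have "\<bar>ln (1 - 625418 / 735223) - (- 1.9014677891771 :: real)\<bar> \<le> 5 / 10 ^ 11" by simp
  from ln_one_minus_sqrt_near[OF z _ _ _ this, of "0.134"]
  show "\<bar>ln (1 - sqrt (1039414 / 1436435)) - (- 1.9014677891771)\<bar> \<le> 1 / 10 ^ 10" by simp
qed

text \<open>Both arguments are lower ends, for \<open>1 + 2 / sqrt 5\<close> and for the inverse
  square of the golden ratio; the next enclosure has the upper ends.\<close>

lemma wedge_bounds_10:
  "ennreal 0.3759088222 \<le> wedge_integral (sqrt (4827 / 2548)) (sqrt (2584 / 6765))"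
  "wedge_integral (sqrt (4827 / 2548)) (sqrt (2584 / 6765)) \<le> ennreal 0.3759093915"
proof -
  have l: "\<bar>ln (1 + sqrt (4827 / 2548 * (2584 / 6765))) - (0.6155373366649)\<bar> \<le> 1 / 10 ^ 10" using ln_sqrt_near_7(1) by simp
  have m: "\<bar>ln (1 - sqrt (4827 / 2548 * (2584 / 6765))) - (- 1.9014677891771)\<bar> \<le> 1 / 10 ^ 10" using ln_sqrt_near_7(2) by simp
  have t: "\<bar>sqrt (1 / (2584 / 6765)) - 1.618034009447\<bar> \<le> 1 / 10 ^ 10" and s: "\<bar>sqrt (4827 / 2548) - 1.376381851657\<bar> \<le> 1 / 10 ^ 10"
    by (rule sqrt_near; simp add: power2_eq_square)+
  have A: "\<bar>odd_horner 0 recip_poly_two (1 / (2584 / 6765)) - (0.628433383182)\<bar> \<le> 1 / 10 ^ 10"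
    by (simp add: recip_poly_two_def)
  have B: "\<bar>odd_horner 0 recip_poly_two (4827 / 2548) - 0.684750217034\<bar> \<le> 1 / 10 ^ 10"
    by (simp add: recip_poly_two_def)
  have C: "\<bar>log_horner 0 0 recip_poly_two (1 / (2584 / 6765)) (4827 / 2548 * (2584 / 6765)) - (- 0.193342595986)\<bar> \<le> 1 / 10 ^ 10"
    by (simp add: recip_poly_two_def power_divide)
  have v: "\<bar>wedge_value recip_poly_two (4827 / 2548) (2584 / 6765) - 0.375909106864\<bar> \<le> 105 * (1 / 10 ^ 10)"
    by (rule wedge_value_near[OF l m t s A B C]) simp_all
  have one: "\<bar>wedge_value [1] (4827 / 2548) (2584 / 6765) - 0.691840484894\<bar> \<le> 105 * (1 / 10 ^ 10)"
    by (rule wedge_value_near[OF l m t s, of "[1]" 1 1 0]) simp_all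
  note W = wedge_integral_approx[of "4827 / 2548" "2584 / 6765" recip_poly_two "1 / 3650401", OF _ _ _ _ recip_poly_two]
  have "ennreal 0.3759088222 \<le> ennreal (wedge_value recip_poly_two (4827 / 2548) (2584 / 6765) - 1 / 3650401)"
    using v unfolding abs_le_iff by (intro ennreal_leI) simp
  also have "\<dots> \<le> wedge_integral (sqrt (4827 / 2548)) (sqrt (2584 / 6765))"
    using one unfolding abs_le_iff by (intro W) simp_all
  finally show "ennreal 0.3759088222 \<le> wedge_integral (sqrt (4827 / 2548)) (sqrt (2584 / 6765))" .
  have "wedge_integral (sqrt (4827 / 2548)) (sqrt (2584 / 6765)) \<le> ennreal (wedge_value recip_poly_two (4827 / 2548) (2584 / 6765) + 1 / 3650401)"
    using one unfolding abs_le_iff by (intro W) simp_all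
  also have "\<dots> \<le> ennreal 0.3759093915"
    using v unfolding abs_le_iff by (intro ennreal_leI) simp
  finally show "wedge_integral (sqrt (4827 / 2548)) (sqrt (2584 / 6765)) \<le> ennreal 0.3759093915" .
qed

lemma ln_sqrt_near_8:
  "\<bar>ln (1 + sqrt (9772043 / 13504630)) - (0.6155373874195)\<bar> \<le> 1 / 10 ^ 10"
  "\<bar>ln (1 - sqrt (9772043 / 13504630)) - (- 1.9014684180990)\<bar> \<le> 1 / 10 ^ 10"
proof -
  have z: "\<bar>sqrt (9772043 / 13504630) - 379745 / 446417\<bar> \<le> 1 / 10 ^ 12"
    by (rule sqrt_near) (simp_all add: power2_eq_square)
  have "\<bar>ln (446417 / 413081) - (0.0776097931404 :: real)\<bar> \<le> 1 / 10 ^ 11"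
    by (rule ln_near[where y = "16668 / 429749" and n = 7]) (simp_all add: replicate_7 power_divide)
  then have "\<bar>ln (413081 / 446417) - (- 0.0776097931404 :: real)\<bar> \<le> 1 / 10 ^ 11"
    by (rule ln_inverse_near) simp_all
  from ln_mult_pow2_near[OF this ln_2_near, of "826162 / 446417" 0 1]
  have "\<bar>ln (826162 / 446417) - (0.6155373874195 :: real)\<bar> \<le> 5 / 10 ^ 11" by simp
  then have "\<bar>ln (1 + 379745 / 446417) - (0.6155373874195 :: real)\<bar> \<le> 5 / 10 ^ 11" by simp
  from ln_one_plus_sqrt_near[OF z _ _ this]
  show "\<bar>ln (1 + sqrt (9772043 / 13504630)) - (0.6155373874195)\<bar> \<le> 1 / 10 ^ 10" by simp
  have "\<bar>ln (533376 / 446417) - (0.1779731235807 :: real)\<bar> \<le> 1 / 10 ^ 11"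
    by (rule ln_near[where y = "86959 / 979793" and n = 7]) (simp_all add: replicate_7 power_divide)
  from ln_mult_pow2_near[OF this ln_2_near, of "66672 / 446417" 3 0]
  have "\<bar>ln (66672 / 446417) - (- 1.9014684180990 :: real)\<bar> \<le> 5 / 10 ^ 11" by simp
  then have "\<bar>ln (1 - 379745 / 446417) - (- 1.9014684180990 :: real)\<bar> \<le> 5 / 10 ^ 11" by simp
  from ln_one_minus_sqrt_near[OF z _ _ _ this, of "0.134"]
  show "\<bar>ln (1 - sqrt (9772043 / 13504630)) - (- 1.9014684180990)\<bar> \<le> 1 / 10 ^ 10" by simp
qed

lemma wedge_bounds_11:
  "ennreal 0.3759088849 \<le> wedge_integral (sqrt (6119 / 3230)) (sqrt (1597 / 4181))"
  "wedge_integral (sqrt (6119 / 3230)) (sqrt (1597 / 4181)) \<le> ennreal 0.3759094542"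
proof -
  have l: "\<bar>ln (1 + sqrt (6119 / 3230 * (1597 / 4181))) - (0.6155373874195)\<bar> \<le> 1 / 10 ^ 10" using ln_sqrt_near_8(1) by simp
  have m: "\<bar>ln (1 - sqrt (6119 / 3230 * (1597 / 4181))) - (- 1.9014684180990)\<bar> \<le> 1 / 10 ^ 10" using ln_sqrt_near_8(2) by simp
  have t: "\<bar>sqrt (1 / (1597 / 4181)) - 1.618033934564\<bar> \<le> 1 / 10 ^ 10" and s: "\<bar>sqrt (6119 / 3230) - 1.376381939936\<bar> \<le> 1 / 10 ^ 10"
    by (rule sqrt_near; simp add: power2_eq_square)+
  have A: "\<bar>odd_horner 0 recip_poly_two (1 / (1597 / 4181)) - (0.628433400069)\<bar> \<le> 1 / 10 ^ 10"
    by (simp add: recip_poly_two_def)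
  have B: "\<bar>odd_horner 0 recip_poly_two (6119 / 3230) - 0.684750195274\<bar> \<le> 1 / 10 ^ 10"
    by (simp add: recip_poly_two_def)
  have C: "\<bar>log_horner 0 0 recip_poly_two (1 / (1597 / 4181)) (6119 / 3230 * (1597 / 4181)) - (- 0.193342623134)\<bar> \<le> 1 / 10 ^ 10"
    by (simp add: recip_poly_two_def power_divide)
  have v: "\<bar>wedge_value recip_poly_two (6119 / 3230) (1597 / 4181) - 0.375909169555\<bar> \<le> 105 * (1 / 10 ^ 10)"
    by (rule wedge_value_near[OF l m t s A B C]) simp_all
  have one: "\<bar>wedge_value [1] (6119 / 3230) (1597 / 4181) - 0.691840644141\<bar> \<le> 105 * (1 / 10 ^ 10)"
    by (rule wedge_value_near[OF l m t s, of "[1]" 1 1 0]) simp_all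
  note W = wedge_integral_approx[of "6119 / 3230" "1597 / 4181" recip_poly_two "1 / 3650401", OF _ _ _ _ recip_poly_two]
  have "ennreal 0.3759088849 \<le> ennreal (wedge_value recip_poly_two (6119 / 3230) (1597 / 4181) - 1 / 3650401)"
    using v unfolding abs_le_iff by (intro ennreal_leI) simp
  also have "\<dots> \<le> wedge_integral (sqrt (6119 / 3230)) (sqrt (1597 / 4181))"
    using one unfolding abs_le_iff by (intro W) simp_all
  finally show "ennreal 0.3759088849 \<le> wedge_integral (sqrt (6119 / 3230)) (sqrt (1597 / 4181))" .
  have "wedge_integral (sqrt (6119 / 3230)) (sqrt (1597 / 4181)) \<le> ennreal (wedge_value recip_poly_two (6119 / 3230) (1597 / 4181) + 1 / 3650401)"
    using one unfolding abs_le_iff by (intro W) simp_all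
  also have "\<dots> \<le> ennreal 0.3759094542"
    using v unfolding abs_le_iff by (intro ennreal_leI) simp
  finally show "wedge_integral (sqrt (6119 / 3230)) (sqrt (1597 / 4181)) \<le> ennreal 0.3759094542" .
qed

lemma ln_sqrt_near_9:
  "\<bar>ln (1 + sqrt (1609 / 2548)) - (0.5848124867275)\<bar> \<le> 1 / 10 ^ 10"
  "\<bar>ln (1 - sqrt (1609 / 2548)) - (- 1.5830610242092)\<bar> \<le> 1 / 10 ^ 10"
proof -
  have z: "\<bar>sqrt (1609 / 2548) - 506295 / 637126\<bar> \<le> 1 / 10 ^ 12"
    by (rule sqrt_near) (simp_all add: power2_eq_square)
  have "\<bar>ln (1274252 / 1143421) - (0.1083346938324 :: real)\<bar> \<le> 1 / 10 ^ 11"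
    by (rule ln_near[where y = "130831 / 2417673" and n = 7]) (simp_all add: replicate_7 power_divide)
  then have "\<bar>ln (1143421 / 1274252) - (- 0.1083346938324 :: real)\<bar> \<le> 1 / 10 ^ 11"
    by (rule ln_inverse_near) simp_all
  from ln_mult_pow2_near[OF this ln_2_near, of "1143421 / 637126" 0 1]
  have "\<bar>ln (1143421 / 637126) - (0.5848124867275 :: real)\<bar> \<le> 5 / 10 ^ 11" by simp
  then have "\<bar>ln (1 + 506295 / 637126) - (0.5848124867275 :: real)\<bar> \<le> 5 / 10 ^ 11" by simp
  from ln_one_plus_sqrt_near[OF z _ _ this]
  show "\<bar>ln (1 + sqrt (1609 / 2548)) - (0.5848124867275)\<bar> \<le> 1 / 10 ^ 10" by simp
  have "\<bar>ln (318563 / 261662) - (0.1967666630894 :: real)\<bar> \<le> 1 / 10 ^ 11"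
    by (rule ln_near[where y = "56901 / 580225" and n = 7]) (simp_all add: replicate_7 power_divide)
  then have "\<bar>ln (261662 / 318563) - (- 0.1967666630894 :: real)\<bar> \<le> 1 / 10 ^ 11"
    by (rule ln_inverse_near) simp_all
  from ln_mult_pow2_near[OF this ln_2_near, of "130831 / 637126" 2 0]
  have "\<bar>ln (130831 / 637126) - (- 1.5830610242092 :: real)\<bar> \<le> 5 / 10 ^ 11" by simp
  then have "\<bar>ln (1 - 506295 / 637126) - (- 1.5830610242092 :: real)\<bar> \<le> 5 / 10 ^ 11" by simp
  from ln_one_minus_sqrt_near[OF z _ _ _ this, of "0.185"]
  show "\<bar>ln (1 - sqrt (1609 / 2548)) - (- 1.5830610242092)\<bar> \<le> 1 / 10 ^ 10" by simp
qed

lemma wedge_bounds_12: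
  "ennreal 0.3430030120 \<le> wedge_integral (sqrt (4827 / 2548)) (sqrt (1 / 3))"
  "wedge_integral (sqrt (4827 / 2548)) (sqrt (1 / 3)) \<le> ennreal 0.3430035813"
proof -
  have l: "\<bar>ln (1 + sqrt (4827 / 2548 * (1 / 3))) - (0.5848124867275)\<bar> \<le> 1 / 10 ^ 10" using ln_sqrt_near_9(1) by simp
  have m: "\<bar>ln (1 - sqrt (4827 / 2548 * (1 / 3))) - (- 1.5830610242092)\<bar> \<le> 1 / 10 ^ 10" using ln_sqrt_near_9(2) by simp
  have t: "\<bar>sqrt (1 / (1 / 3)) - 1.732050807569\<bar> \<le> 1 / 10 ^ 10" and s: "\<bar>sqrt (4827 / 2548) - 1.376381851657\<bar> \<le> 1 / 10 ^ 10"
    by (rule sqrt_near; simp add: power2_eq_square)+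
  have A: "\<bar>odd_horner 0 recip_poly_two (1 / (1 / 3)) - (0.598828423824)\<bar> \<le> 1 / 10 ^ 10"
    by (simp add: recip_poly_two_def)
  have B: "\<bar>odd_horner 0 recip_poly_two (4827 / 2548) - 0.684750217034\<bar> \<le> 1 / 10 ^ 10"
    by (simp add: recip_poly_two_def)
  have C: "\<bar>log_horner 0 0 recip_poly_two (1 / (1 / 3)) (4827 / 2548 * (1 / 3)) - (- 0.185780558628)\<bar> \<le> 1 / 10 ^ 10"
    by (simp add: recip_poly_two_def power_divide)
  have v: "\<bar>wedge_value recip_poly_two (4827 / 2548) (1 / 3) - 0.343003296617\<bar> \<le> 105 * (1 / 10 ^ 10)"
    by (rule wedge_value_near[OF l m t s A B C]) simp_all
  have one: "\<bar>wedge_value [1] (4827 / 2548) (1 / 3) - 0.627402285821\<bar> \<le> 105 * (1 / 10 ^ 10)"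
    by (rule wedge_value_near[OF l m t s, of "[1]" 1 1 0]) simp_all
  note W = wedge_integral_approx[of "4827 / 2548" "1 / 3" recip_poly_two "1 / 3650401", OF _ _ _ _ recip_poly_two]
  have "ennreal 0.3430030120 \<le> ennreal (wedge_value recip_poly_two (4827 / 2548) (1 / 3) - 1 / 3650401)"
    using v unfolding abs_le_iff by (intro ennreal_leI) simp
  also have "\<dots> \<le> wedge_integral (sqrt (4827 / 2548)) (sqrt (1 / 3))"
    using one unfolding abs_le_iff by (intro W) simp_all
  finally show "ennreal 0.3430030120 \<le> wedge_integral (sqrt (4827 / 2548)) (sqrt (1 / 3))" .
  have "wedge_integral (sqrt (4827 / 2548)) (sqrt (1 / 3)) \<le> ennreal (wedge_value recip_poly_two (4827 / 2548) (1 / 3) + 1 / 3650401)"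
    using one unfolding abs_le_iff by (intro W) simp_all
  also have "\<dots> \<le> ennreal 0.3430035813"
    using v unfolding abs_le_iff by (intro ennreal_leI) simp
  finally show "wedge_integral (sqrt (4827 / 2548)) (sqrt (1 / 3)) \<le> ennreal 0.3430035813" .
qed

lemma ln_sqrt_near_10:
  "\<bar>ln (1 + sqrt (6119 / 9690)) - (0.5848125151277)\<bar> \<le> 1 / 10 ^ 10"
  "\<bar>ln (1 - sqrt (6119 / 9690)) - (- 1.5830612724183)\<bar> \<le> 1 / 10 ^ 10"
proof -
  have z: "\<bar>sqrt (6119 / 9690) - 1106403 / 1392307\<bar> \<le> 1 / 10 ^ 12"
    by (rule sqrt_near) (simp_all add: power2_eq_square)
  have "\<bar>ln (1392307 / 1249355) - (0.1083346654322 :: real)\<bar> \<le> 1 / 10 ^ 11"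
    by (rule ln_near[where y = "71476 / 1320831" and n = 7]) (simp_all add: replicate_7 power_divide)
  then have "\<bar>ln (1249355 / 1392307) - (- 0.1083346654322 :: real)\<bar> \<le> 1 / 10 ^ 11"
    by (rule ln_inverse_near) simp_all
  from ln_mult_pow2_near[OF this ln_2_near, of "2498710 / 1392307" 0 1]
  have "\<bar>ln (2498710 / 1392307) - (0.5848125151277 :: real)\<bar> \<le> 5 / 10 ^ 11" by simp
  then have "\<bar>ln (1 + 1106403 / 1392307) - (0.5848125151277 :: real)\<bar> \<le> 5 / 10 ^ 11" by simp
  from ln_one_plus_sqrt_near[OF z _ _ this]
  show "\<bar>ln (1 + sqrt (6119 / 9690)) - (0.5848125151277)\<bar> \<le> 1 / 10 ^ 10" by simp
  have "\<bar>ln (1392307 / 1143616) - (0.1967669112985 :: real)\<bar> \<le> 1 / 10 ^ 11"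
    by (rule ln_near[where y = "248691 / 2535923" and n = 7]) (simp_all add: replicate_7 power_divide)
  then have "\<bar>ln (1143616 / 1392307) - (- 0.1967669112985 :: real)\<bar> \<le> 1 / 10 ^ 11"
    by (rule ln_inverse_near) simp_all
  from ln_mult_pow2_near[OF this ln_2_near, of "285904 / 1392307" 2 0]
  have "\<bar>ln (285904 / 1392307) - (- 1.5830612724183 :: real)\<bar> \<le> 5 / 10 ^ 11" by simp
  then have "\<bar>ln (1 - 1106403 / 1392307) - (- 1.5830612724183 :: real)\<bar> \<le> 5 / 10 ^ 11" by simp
  from ln_one_minus_sqrt_near[OF z _ _ _ this, of "0.185"]
  show "\<bar>ln (1 - sqrt (6119 / 9690)) - (- 1.5830612724183)\<bar> \<le> 1 / 10 ^ 10" by simp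
qed

lemma wedge_bounds_13:
  "ennreal 0.3430030450 \<le> wedge_integral (sqrt (6119 / 3230)) (sqrt (1 / 3))"
  "wedge_integral (sqrt (6119 / 3230)) (sqrt (1 / 3)) \<le> ennreal 0.3430036143"
proof -
  have l: "\<bar>ln (1 + sqrt (6119 / 3230 * (1 / 3))) - (0.5848125151277)\<bar> \<le> 1 / 10 ^ 10" using ln_sqrt_near_10(1) by simp
  have m: "\<bar>ln (1 - sqrt (6119 / 3230 * (1 / 3))) - (- 1.5830612724183)\<bar> \<le> 1 / 10 ^ 10" using ln_sqrt_near_10(2) by simp
  have t: "\<bar>sqrt (1 / (1 / 3)) - 1.732050807569\<bar> \<le> 1 / 10 ^ 10" and s: "\<bar>sqrt (6119 / 3230) - 1.376381939936\<bar> \<le> 1 / 10 ^ 10"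
    by (rule sqrt_near; simp add: power2_eq_square)+
  have A: "\<bar>odd_horner 0 recip_poly_two (1 / (1 / 3)) - (0.598828423824)\<bar> \<le> 1 / 10 ^ 10"
    by (simp add: recip_poly_two_def)
  have B: "\<bar>odd_horner 0 recip_poly_two (6119 / 3230) - 0.684750195274\<bar> \<le> 1 / 10 ^ 10"
    by (simp add: recip_poly_two_def)
  have C: "\<bar>log_horner 0 0 recip_poly_two (1 / (1 / 3)) (6119 / 3230 * (1 / 3)) - (- 0.185780577514)\<bar> \<le> 1 / 10 ^ 10"
    by (simp add: recip_poly_two_def power_divide)
  have v: "\<bar>wedge_value recip_poly_two (6119 / 3230) (1 / 3) - 0.343003329676\<bar> \<le> 105 * (1 / 10 ^ 10)"
    by (rule wedge_value_near[OF l m t s A B C]) simp_all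
  have one: "\<bar>wedge_value [1] (6119 / 3230) (1 / 3) - 0.627402381510\<bar> \<le> 105 * (1 / 10 ^ 10)"
    by (rule wedge_value_near[OF l m t s, of "[1]" 1 1 0]) simp_all
  note W = wedge_integral_approx[of "6119 / 3230" "1 / 3" recip_poly_two "1 / 3650401", OF _ _ _ _ recip_poly_two]
  have "ennreal 0.3430030450 \<le> ennreal (wedge_value recip_poly_two (6119 / 3230) (1 / 3) - 1 / 3650401)"
    using v unfolding abs_le_iff by (intro ennreal_leI) simp
  also have "\<dots> \<le> wedge_integral (sqrt (6119 / 3230)) (sqrt (1 / 3))"
    using one unfolding abs_le_iff by (intro W) simp_all
  finally show "ennreal 0.3430030450 \<le> wedge_integral (sqrt (6119 / 3230)) (sqrt (1 / 3))" .
  have "wedge_integral (sqrt (6119 / 3230)) (sqrt (1 / 3)) \<le> ennreal (wedge_value recip_poly_two (6119 / 3230) (1 / 3) + 1 / 3650401)"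
    using one unfolding abs_le_iff by (intro W) simp_all
  also have "\<dots> \<le> ennreal 0.3430036143"
    using v unfolding abs_le_iff by (intro ennreal_leI) simp
  finally show "wedge_integral (sqrt (6119 / 3230)) (sqrt (1 / 3)) \<le> ennreal 0.3430036143" .
qed

section \<open>The four densities\<close>

lemma cos_36: "cos (pi / 5) = (1 + sqrt 5) / 4"
proof -
  define c where "c = cos (pi / 5)"
  have "cos (2 * (pi / 5)) = - cos (3 * (pi / 5))"
  proof -
    have "cos (3 * (pi / 5)) = cos (pi - 2 * (pi / 5))" by (rule arg_cong[where f = cos]) simp
    then show ?thesis by (simp only: cos_pi_minus)
  qed
  then have "2 * c\<^sup>2 - 1 = - (4 * c ^ 3 - 3 * c)"
    unfolding c_def by (simp only: cos_double_cos cos_treble_cos)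
  \<comment> \<open>The root -1 is excluded by \<open>c > 0\<close>, and the quadratic factor has
    one root of each sign.\<close>
  then have "(c + 1) * (4 * c\<^sup>2 - 2 * c - 1) = 0" by (simp add: algebra_simps power2_eq_square power3_eq_cube)
  moreover have c0: "c > 0" unfolding c_def by (intro cos_gt_zero) auto
  ultimately have "4 * c\<^sup>2 - 2 * c - 1 = 0" by auto
  then have "(4 * c - 1)\<^sup>2 = 5" by (simp add: power2_eq_square algebra_simps)
  moreover have "1 / 4 \<le> c"
  proof -
    have "cos (pi / 3) \<le> c" unfolding c_def by (intro cos_monotone_0_pi_le) auto
    then show ?thesis by (simp add: cos_60)
  qed
  ultimately have "4 * c - 1 = sqrt 5" by (intro real_sqrt_unique[symmetric]) auto
  then show ?thesis by (simp add: c_def)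
qed

lemma quotient_near:
  fixes M V d \<epsilon> :: real
  assumes "Ml \<le> M" "M \<le> Mu" "0 < Vl" "Vl \<le> V" "V \<le> Vu" "(d - \<epsilon>) * Vu < Ml" "Mu < (d + \<epsilon>) * Vl" "0 \<le> d - \<epsilon>" "0 \<le> \<epsilon>"
  shows "\<bar>M / V - d\<bar> < \<epsilon>"
proof -
  have "(d - \<epsilon>) * V \<le> (d - \<epsilon>) * Vu" using assms by (intro mult_left_mono) auto
  then have 1: "(d - \<epsilon>) * V < M" using assms by linarith
  have "(d + \<epsilon>) * Vl \<le> (d + \<epsilon>) * V" using assms by (intro mult_left_mono) auto
  then have 2: "M < (d + \<epsilon>) * V" using assms by linarith
  have "V > 0" using assms by linarith
  then have "d - \<epsilon> < M / V" "M / V < d + \<epsilon>" using 1 2 by (simp_all add: pos_less_divide_eq pos_divide_less_eq)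
  then show ?thesis by (simp add: abs_less_iff)
qed

text \<open>For \<open>k = cos \<phi>\<close> the quotient is the cotangent of
  \<open>\<phi>\<close>. Squaring turns its brackets into inequalities that are linear in
  \<open>k\<^sup>2\<close>.\<close>

lemma sqrt_le_cot:
  assumes "0 < k" "k < 1"
  shows "x * (1 - k\<^sup>2) \<le> k\<^sup>2 \<Longrightarrow> sqrt x \<le> k / sqrt (1 - k\<^sup>2)"
    and "k\<^sup>2 \<le> x * (1 - k\<^sup>2) \<Longrightarrow> k / sqrt (1 - k\<^sup>2) \<le> sqrt x"
proof -
  have 1: "1 - k\<^sup>2 > 0" using assms by (simp add: abs_square_less_1)
  have 2: "k / sqrt (1 - k\<^sup>2) = sqrt (k\<^sup>2 / (1 - k\<^sup>2))" using assms by (simp add: real_sqrt_divide)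
  show "x * (1 - k\<^sup>2) \<le> k\<^sup>2 \<Longrightarrow> sqrt x \<le> k / sqrt (1 - k\<^sup>2)" "k\<^sup>2 \<le> x * (1 - k\<^sup>2) \<Longrightarrow> k / sqrt (1 - k\<^sup>2) \<le> sqrt x"
    unfolding 2 using 1 by (simp_all add: pos_le_divide_eq pos_divide_le_eq)
qed

lemma ennreal_half_sum:
  assumes "0 \<le> a" "0 \<le> b" "0 \<le> c" "0 \<le> d"
  shows "ennreal ((a + b + c + d) / 2) = ennreal (1 / 2) * ((ennreal a + ennreal b) + (ennreal c + ennreal d))"
proof -
  have "(a + b + c + d) / 2 = 1 / 2 * ((a + b) + (c + d))" by simp
  then show ?thesis
    using assms by (simp only: ennreal_mult' ennreal_plus add_nonneg_nonneg zero_le_divide_1_iff zero_le_numeral)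
qed

context cycle_simplex
begin

text \<open>Besides the two-sided bound, the upper estimates give the finiteness of the volume that
  \<open>coxeter_simplex\<close> demands.\<close>

lemma simplex_measure_bounds:
  assumes l: "0 \<le> l1" "0 \<le> l2" "0 \<le> l3" "0 \<le> l4"
    and W1: "ennreal l1 \<le> wedge_integral (s / c) (k / s)" "wedge_integral (s / c) (k / s) \<le> ennreal u1"
    and W2: "ennreal l2 \<le> wedge_integral (s / c) (c / s)" "wedge_integral (s / c) (c / s) \<le> ennreal u2"
    and W3: "ennreal l3 \<le> wedge_integral (k / sqrt (1 - k\<^sup>2)) (s / k)" "wedge_integral (k / sqrt (1 - k\<^sup>2)) (s / k) \<le> ennreal u3"
    and W4: "ennreal l4 \<le> wedge_integral (k / sqrt (1 - k\<^sup>2)) (s / c)" "wedge_integral (k / sqrt (1 - k\<^sup>2)) (s / c) \<le> ennreal u4"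
    and u: "0 \<le> u1" "0 \<le> u2" "0 \<le> u3" "0 \<le> u4"
  shows "emeasure hyp_vol (simplex_of v) < \<infinity>"
    and "(l1 + l2 + l3 + l4) / 2 \<le> measure hyp_vol (simplex_of v)"
    and "measure hyp_vol (simplex_of v) \<le> (u1 + u2 + u3 + u4) / 2"
proof -
  have "ennreal ((l1 + l2 + l3 + l4) / 2) = ennreal (1 / 2) * ((ennreal l1 + ennreal l2) + (ennreal l3 + ennreal l4))"
    by (rule ennreal_half_sum) (rule l)+
  also have "\<dots> \<le> emeasure hyp_vol (simplex_of v)"
    unfolding emeasure_simplex by (intro mult_left_mono add_mono W1 W2 W3 W4) simp
  finally have lo: "ennreal ((l1 + l2 + l3 + l4) / 2) \<le> emeasure hyp_vol (simplex_of v)" .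
  have "emeasure hyp_vol (simplex_of v) \<le> ennreal (1 / 2) * ((ennreal u1 + ennreal u2) + (ennreal u3 + ennreal u4))"
    unfolding emeasure_simplex by (intro mult_left_mono add_mono W1 W2 W3 W4) simp
  also have "\<dots> = ennreal ((u1 + u2 + u3 + u4) / 2)"
    by (rule ennreal_half_sum[symmetric]) (rule u)+
  finally have up: "emeasure hyp_vol (simplex_of v) \<le> ennreal ((u1 + u2 + u3 + u4) / 2)" .
  then show fin: "emeasure hyp_vol (simplex_of v) < \<infinity>" by (simp add: le_less_trans)
  then have m: "emeasure hyp_vol (simplex_of v) = ennreal (measure hyp_vol (simplex_of v))"
    by (intro emeasure_eq_ennreal_measure) simp
  show "(l1 + l2 + l3 + l4) / 2 \<le> measure hyp_vol (simplex_of v)"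
    using lo unfolding m by (simp add: ennreal_le_iff)
  show "measure hyp_vol (simplex_of v) \<le> (u1 + u2 + u3 + u4) / 2"
    using up u unfolding m by (simp add: ennreal_le_iff)
qed

end


lemma wedge_bounds_mono:
  assumes "ennreal lo \<le> wedge_integral (sqrt x) (sqrt t)" "wedge_integral (sqrt x') (sqrt t') \<le> ennreal hi"
    and "sqrt x \<le> S" "S \<le> sqrt x'" "sqrt t \<le> \<tau>" "\<tau> \<le> sqrt t'" "0 \<le> t" "0 \<le> t'" "0 \<le> x'" "x' * t' < 1"
  shows "ennreal lo \<le> wedge_integral S \<tau>" "wedge_integral S \<tau> \<le> ennreal hi"
proof -
  have m: "sqrt t' * sqrt x' < 1" using assms by (simp add: real_sqrt_mult[symmetric] mult.commute)
  have t: "0 \<le> sqrt t" using assms by simp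
  have "0 \<le> \<tau>" using assms(5) t by linarith
  show "wedge_integral S \<tau> \<le> ennreal hi"
    by (rule order_trans[OF wedge_integral_mono assms(2)]) (use assms m \<open>0 \<le> \<tau>\<close> in auto)
  have "\<tau> * S \<le> sqrt t' * sqrt x'"
    using assms \<open>0 \<le> \<tau>\<close> by (intro order_trans[OF mult_left_mono mult_right_mono]) auto
  then show "ennreal lo \<le> wedge_integral S \<tau>"
    by (intro order_trans[OF assms(1) wedge_integral_mono]) (use assms m t in auto)
qed

lemma sqrt_2_bounds: "1.414213562 \<le> sqrt 2" "sqrt 2 \<le> 1.414213563"
  by (rule real_le_rsqrt real_le_lsqrt; simp add: power2_eq_square)+

lemma sqrt_3_bounds: "1.732050807 \<le> sqrt 3" "sqrt 3 \<le> 1.732050808"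
  by (rule real_le_rsqrt real_le_lsqrt; simp add: power2_eq_square)+

lemma sqrt_5_bounds: "2.236067977 \<le> sqrt 5" "sqrt 5 \<le> 2.236067978"
  by (rule real_le_rsqrt real_le_lsqrt; simp add: power2_eq_square)+

lemma sqrt_15_bounds: "3.872983346 \<le> sqrt 15" "sqrt 15 \<le> 3.872983347"
  by (rule real_le_rsqrt real_le_lsqrt; simp add: power2_eq_square)+

lemma AV3_density:
  assumes "cycle_simplex v p a b h (1 / 2) (1 / 2) (sqrt 3 / 2)"
  shows "emeasure hyp_vol (simplex_of v) < \<infinity>"
    and "coxeter_system (outward_normal v) \<Longrightarrow> \<bar>delta_opt v - 0.838825\<bar> < 1 / 10 ^ 6"
proof -
  interpret cycle_simplex v p a b h "1 / 2" "1 / 2" "sqrt 3 / 2" by (rule assms)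
  have r: "1 / 2 / (sqrt 3 / 2) = sqrt (1 / 3)" "1 / 2 / (1 / 2) = sqrt 1" "sqrt 3 / 2 / (1 / 2) = sqrt 3"
    "1 / 2 / sqrt (1 - (1 / 2)\<^sup>2) = sqrt (1 / 3)"
    by (simp_all add: real_sqrt_divide power2_eq_square)
  \<comment> \<open>The four integrals in the order of \<open>emeasure_simplex\<close>; the first
    and the third coincide because \<open>k = s\<close>.\<close>
  note V = simplex_measure_bounds[unfolded r, OF _ _ _ _ wedge_bounds_1 wedge_bounds_2 wedge_bounds_1 wedge_bounds_3]
  show "emeasure hyp_vol (simplex_of v) < \<infinity>" by (rule V) simp_all
  assume "coxeter_system (outward_normal v)"
  then have "delta_opt v = ((1 / 2 + sqrt 3 / 2)\<^sup>2 + 1 / 4) * (1 / 2) / (4 * (sqrt 3 / 2)) / measure hyp_vol (simplex_of v)"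
    using sqrt_3_bounds by (intro delta_opt_eq) simp_all
  also have "((1 / 2 + sqrt 3 / 2)\<^sup>2 + 1 / 4) * (1 / 2) / (4 * (sqrt 3 / 2)) = 5 * sqrt 3 / 48 + 1 / 8"
    by (simp add: field_simps power2_eq_square)
  finally show "\<bar>delta_opt v - 0.838825\<bar> < 1 / 10 ^ 6"
    using V(2,3) sqrt_3_bounds
    \<comment> \<open>\<open>Vl\<close> and \<open>Vu\<close> enclose half the sum of the four
      enclosures, \<open>Ml\<close> and \<open>Mu\<close> the numerator in closed form.\<close>
    by (simp only:) (rule quotient_near[where Ml = "0.30542195" and Mu = "0.30542197"
        and Vl = "0.36410707" and Vu = "0.36410713"], simp_all)
qed

lemma BV3_density:
  assumes "cycle_simplex v p a b h (sqrt 2 / 2) (1 / 2) (sqrt 3 / 2)"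
  shows "emeasure hyp_vol (simplex_of v) < \<infinity>"
    and "coxeter_system (outward_normal v) \<Longrightarrow> \<bar>delta_opt v - 0.747914\<bar> < 1 / 10 ^ 6"
proof -
  interpret cycle_simplex v p a b h "sqrt 2 / 2" "1 / 2" "sqrt 3 / 2" by (rule assms)
  have r: "1 / 2 / (sqrt 3 / 2) = sqrt (1 / 3)" "sqrt 2 / 2 / (1 / 2) = sqrt 2" "sqrt 3 / 2 / (1 / 2) = sqrt 3"
    "sqrt 2 / 2 / sqrt (1 - (sqrt 2 / 2)\<^sup>2) = sqrt 1" "1 / 2 / (sqrt 2 / 2) = sqrt (1 / 2)"
    by (simp_all add: real_sqrt_divide power2_eq_square)
  note V = simplex_measure_bounds[unfolded r, OF _ _ _ _ wedge_bounds_4 wedge_bounds_2 wedge_bounds_7 wedge_bounds_8]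
  show "emeasure hyp_vol (simplex_of v) < \<infinity>" by (rule V) simp_all
  assume "coxeter_system (outward_normal v)"
  then have "delta_opt v = ((sqrt 2 / 2 + sqrt 3 / 2)\<^sup>2 + 1 / 4) * (1 / 2) / (4 * (sqrt 3 / 2)) / measure hyp_vol (simplex_of v)"
    using sqrt_3_bounds sqrt_2_bounds by (intro delta_opt_eq) simp_all
  also have "((sqrt 2 / 2 + sqrt 3 / 2)\<^sup>2 + 1 / 4) * (1 / 2) / (4 * (sqrt 3 / 2)) = (sqrt 3 + sqrt 2) / 8"
    by (simp add: field_simps power2_eq_square)
  finally show "\<bar>delta_opt v - 0.747914\<bar> < 1 / 10 ^ 6"
    using V(2,3) sqrt_3_bounds sqrt_2_bounds
    by (simp only:) (rule quotient_near[where Ml = "0.393283045" and Mu = "0.393283047"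
        and Vl = "0.5258399" and Vu = "0.5258406"], simp_all)
qed

text \<open>
  The interval ends are quotients of Fibonacci numbers approximating \<open>(2 * k)\<^sup>2\<close>, the square of the
  golden ratio, and rational approximations of \<open>k\<^sup>2 / (1 - k\<^sup>2) = 1 + 2 / sqrt 5\<close>.
\<close>

lemma HV3_density:
  assumes "cycle_simplex v p a b h ((1 + sqrt 5) / 4) (1 / 2) (sqrt 3 / 2)"
  shows "emeasure hyp_vol (simplex_of v) < \<infinity>"
    and "coxeter_system (outward_normal v) \<Longrightarrow> \<bar>delta_opt v - 0.655381\<bar> < 1 / 10 ^ 6"
proof -
  define k where "k = (1 + sqrt 5) / 4"
  interpret cycle_simplex v p a b h k "1 / 2" "sqrt 3 / 2" unfolding k_def by (rule assms)
  have kb: "0.80901699425 \<le> k" "k \<le> 0.8090169945" using sqrt_5_bounds unfolding k_def by simp_all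
  have k2: "k\<^sup>2 = (3 + sqrt 5) / 8" by (simp add: k_def power2_eq_square field_simps)
  have r: "1 / 2 / (sqrt 3 / 2) = sqrt (1 / 3)" "sqrt 3 / 2 / (1 / 2) = sqrt 3"
    by (simp_all add: real_sqrt_divide)
  have "(k / (1 / 2))\<^sup>2 = (3 + sqrt 5) / 2" by (simp add: power_mult_distrib k2)
  then have t1: "sqrt (4181 / 1597) \<le> k / (1 / 2)" "k / (1 / 2) \<le> sqrt (6765 / 2584)"
    using kb sqrt_5_bounds by (auto intro!: real_le_lsqrt real_le_rsqrt)
  have "1 / 2 / k = (sqrt 5 - 1) / 2"
    using sqrt_5_bounds by (simp add: k_def field_simps)
  then have "(1 / 2 / k)\<^sup>2 = (3 - sqrt 5) / 2"
    by (simp only:) (simp add: power2_eq_square field_simps)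
  then have t2: "sqrt (2584 / 6765) \<le> 1 / 2 / k" "1 / 2 / k \<le> sqrt (1597 / 4181)"
    using kb sqrt_5_bounds by (auto intro!: real_le_lsqrt real_le_rsqrt)
  have k1: "0 < k" "k < 1" using kb by auto
  have S': "4827 / 2548 * (1 - k\<^sup>2) \<le> k\<^sup>2" "k\<^sup>2 \<le> 6119 / 3230 * (1 - k\<^sup>2)"
    unfolding k2 using sqrt_5_bounds by (simp_all add: field_simps)
  have S: "sqrt (4827 / 2548) \<le> k / sqrt (1 - k\<^sup>2)" "k / sqrt (1 - k\<^sup>2) \<le> sqrt (6119 / 3230)"
    by (rule sqrt_le_cot[OF k1]; rule S')+
  note W1 = wedge_bounds_mono[OF wedge_bounds_5(1) wedge_bounds_6(2) order_refl order_refl t1]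
  note W3 = wedge_bounds_mono[OF wedge_bounds_10(1) wedge_bounds_11(2) S t2]
  note W4 = wedge_bounds_mono[OF wedge_bounds_12(1) wedge_bounds_13(2) S order_refl order_refl]
  have W: "ennreal 0.2887452443 \<le> wedge_integral (sqrt (1 / 3)) (k / (1 / 2))"
    "wedge_integral (sqrt (1 / 3)) (k / (1 / 2)) \<le> ennreal 0.2887452928"
    "ennreal 0.3759088222 \<le> wedge_integral (k / sqrt (1 - k\<^sup>2)) (1 / 2 / k)"
    "wedge_integral (k / sqrt (1 - k\<^sup>2)) (1 / 2 / k) \<le> ennreal 0.3759094542"
    "ennreal 0.3430030120 \<le> wedge_integral (k / sqrt (1 - k\<^sup>2)) (sqrt (1 / 3))"
    "wedge_integral (k / sqrt (1 - k\<^sup>2)) (sqrt (1 / 3)) \<le> ennreal 0.3430036143"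
    by (rule W1 W3 W4; simp)+
  note V = simplex_measure_bounds[unfolded r, OF _ _ _ _ W(1,2) wedge_bounds_2 W(3-6)]
  show "emeasure hyp_vol (simplex_of v) < \<infinity>" by (rule V) simp_all
  assume "coxeter_system (outward_normal v)"
  then have "delta_opt v = ((k + sqrt 3 / 2)\<^sup>2 + 1 / 4) * (1 / 2) / (4 * (sqrt 3 / 2)) / measure hyp_vol (simplex_of v)"
    using sqrt_3_bounds kb by (intro delta_opt_eq) simp_all
  \<comment> \<open>The numerator becomes a linear combination of \<open>sqrt 3\<close>,
    \<open>sqrt 5\<close> and \<open>sqrt 15\<close>, so that separate bounds on these roots
    suffice.\<close>
  also have "((k + sqrt 3 / 2)\<^sup>2 + 1 / 4) * (1 / 2) / (4 * (sqrt 3 / 2)) = (11 * sqrt 3 + sqrt 15 + 6 + 6 * sqrt 5) / 96"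
  proof -
    have "(k + sqrt 3 / 2)\<^sup>2 = k\<^sup>2 + sqrt 3 * k + 3 / 4" by (simp add: power2_eq_square algebra_simps)
    then have e: "((k + sqrt 3 / 2)\<^sup>2 + 1 / 4) = (11 + sqrt 5 + 2 * sqrt 3 * (1 + sqrt 5)) / 8"
      by (simp only: k2) (simp add: k_def field_simps)
    have f: "sqrt 15 = sqrt 3 * sqrt 5" by (simp add: real_sqrt_mult[symmetric])
    have "11 + f + 2 * q * (1 + f) = q * ((11 * q + q * f + 6 + 6 * f) / 3)" if q: "q * q = 3" for q f :: real
    proof -
      have "q * ((11 * q + q * f + 6 + 6 * f) / 3) = (11 * (q * q) + (q * q) * f + 6 * q + 6 * q * f) / 3"
        by (simp add: algebra_simps)
      then show ?thesis unfolding q by (simp add: field_simps)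
    qed
    from this[of "sqrt 3" "sqrt 5"]
    have "11 + sqrt 5 + 2 * sqrt 3 * (1 + sqrt 5) = sqrt 3 * ((11 * sqrt 3 + sqrt 3 * sqrt 5 + 6 + 6 * sqrt 5) / 3)"
      by simp
    then show ?thesis unfolding e f by (simp only:) simp
  qed
  finally show "\<bar>delta_opt v - 0.655381\<bar> < 1 / 10 ^ 6"
    using V(2,3) sqrt_3_bounds sqrt_5_bounds sqrt_15_bounds
    by (simp only:) (rule quotient_near[where Ml = "0.441061979" and Mu = "0.441061981"
        and Vl = "0.6729854" and Vu = "0.6729862"], simp_all)
qed

lemma CR3_density:
  assumes "cycle_simplex v p a b h (1 / 2) (sqrt 2 / 2) (sqrt 2 / 2)"
  shows "emeasure hyp_vol (simplex_of v) < \<infinity>"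
    and "coxeter_system (outward_normal v) \<Longrightarrow> \<bar>delta_opt v - 0.767195\<bar> < 1 / 10 ^ 6"
proof -
  interpret cycle_simplex v p a b h "1 / 2" "sqrt 2 / 2" "sqrt 2 / 2" by (rule assms)
  have r: "sqrt 2 / 2 / (sqrt 2 / 2) = sqrt 1" "1 / 2 / (sqrt 2 / 2) = sqrt (1 / 2)" "sqrt 2 / 2 / (1 / 2) = sqrt 2"
    "1 / 2 / sqrt (1 - (1 / 2)\<^sup>2) = sqrt (1 / 3)"
    by (simp_all add: real_sqrt_divide power2_eq_square)
  note V = simplex_measure_bounds[unfolded r, OF _ _ _ _ wedge_bounds_7 wedge_bounds_9 wedge_bounds_4 wedge_bounds_1]
  show "emeasure hyp_vol (simplex_of v) < \<infinity>" by (rule V) simp_all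
  assume "coxeter_system (outward_normal v)"
  then have "delta_opt v = ((1 / 2 + sqrt 2 / 2)\<^sup>2 + 1 / 4) * (sqrt 2 / 2) / (4 * (sqrt 2 / 2)) / measure hyp_vol (simplex_of v)"
    using sqrt_2_bounds by (intro delta_opt_eq) simp_all
  also have "((1 / 2 + sqrt 2 / 2)\<^sup>2 + 1 / 4) * (sqrt 2 / 2) / (4 * (sqrt 2 / 2)) = (1 + sqrt 2 / 2) / 4"
    by (simp add: field_simps power2_eq_square)
  finally show "\<bar>delta_opt v - 0.767195\<bar> < 1 / 10 ^ 6"
    using V(2,3) sqrt_2_bounds
    by (simp only:) (rule quotient_near[where Ml = "0.426776695" and Mu = "0.426776696"
        and Vl = "0.5562818" and Vu = "0.5562824"], simp_all)
qed

text \<open>From right to left the finite volume comes from \<open>AV3_density(1)\<close>.\<close>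

lemma AV3_iff: "coxeter_simplex AV3_diagram v \<longleftrightarrow> cycle_simplex v 1 2 0 3 (1 / 2) (1 / 2) (sqrt 3 / 2)"
  using coxeter_cycle_36[of 3 v] AV3_density(1)[of v 1 2 0 3] by (auto simp: AV3_diagram_def cos_60)

lemma BV3_iff: "coxeter_simplex BV3_diagram v \<longleftrightarrow> cycle_simplex v 1 2 0 3 (sqrt 2 / 2) (1 / 2) (sqrt 3 / 2)"
  using coxeter_cycle_36[of 4 v] BV3_density(1)[of v 1 2 0 3] by (auto simp: BV3_diagram_def cos_45)

lemma HV3_iff: "coxeter_simplex HV3_diagram v \<longleftrightarrow> cycle_simplex v 1 2 0 3 ((1 + sqrt 5) / 4) (1 / 2) (sqrt 3 / 2)"
  using coxeter_cycle_36[of 5 v] HV3_density(1)[of v 1 2 0 3] by (auto simp: HV3_diagram_def cos_36)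

lemma CR3_iff: "coxeter_simplex CR3_diagram v \<longleftrightarrow> cycle_simplex v 1 0 2 3 (1 / 2) (sqrt 2 / 2) (sqrt 2 / 2)"
  using coxeter_cycle_44[of v] CR3_density(1)[of v 1 0 2 3] by (auto simp: CR3_diagram_def)

theorem theorem4:
  shows "(\<exists>v. coxeter_simplex AV3_diagram v) \<and>
         (\<forall>v. coxeter_simplex AV3_diagram v \<longrightarrow> \<bar>delta_opt v - 0.838825\<bar> < 1 / 10 ^ 6) \<and>
         (\<exists>v. coxeter_simplex BV3_diagram v) \<and>
         (\<forall>v. coxeter_simplex BV3_diagram v \<longrightarrow> \<bar>delta_opt v - 0.747914\<bar> < 1 / 10 ^ 6) \<and>
         (\<exists>v. coxeter_simplex HV3_diagram v) \<and>
         (\<forall>v. coxeter_simplex HV3_diagram v \<longrightarrow> \<bar>delta_opt v - 0.655381\<bar> < 1 / 10 ^ 6) \<and>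
         (\<exists>v. coxeter_simplex CR3_diagram v) \<and>
         (\<forall>v. coxeter_simplex CR3_diagram v \<longrightarrow> \<bar>delta_opt v - 0.767195\<bar> < 1 / 10 ^ 6)"
proof -
  have d: "distinct [1 :: 4, 2, 0, 3]" "distinct [1 :: 4, 0, 2, 3]" by simp_all
  \<comment> \<open>The realisations from \<open>exists_cycle_simplex\<close> keep the four
    universal statements from being vacuous.\<close>
  have e: "\<exists>v. coxeter_simplex AV3_diagram v" "\<exists>v. coxeter_simplex BV3_diagram v"
    "\<exists>v. coxeter_simplex HV3_diagram v" "\<exists>v. coxeter_simplex CR3_diagram v"
    unfolding AV3_iff BV3_iff HV3_iff CR3_iff
    by (rule exists_cycle_simplex; (insert sqrt_3_bounds sqrt_5_bounds, simp add: d power2_eq_square))+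
  show ?thesis
    by (intro conjI allI impI e; (frule coxeter_simplex_system)?;
        simp only: AV3_iff BV3_iff HV3_iff CR3_iff AV3_density(2) BV3_density(2) HV3_density(2) CR3_density(2))
qed

end
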